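(* Let $(M,d,\mu)$ be a metric measure space satisfying $\mathrm{VD}$ and $\mathrm{RVD}$, and assume $(M,d)$ satisfies the $\rho$-chain condition for some scale function $\rho$ with $\beta_1(\rho)\ge 1$. Let $(\mathcal{E},\mathcal{F})$ be a regular strongly local Dirichlet form on $L^2(M,\mu)$ satisfying $\mathrm{PHI}(\psi_c)$ for a scale function $\psi_c$. Then the heat semigroup of $(\mathcal{E},\mathcal{F})$ admits a heat kernel $p_t(x,y)$, and there exist constants $C\ge1$, $c_1,c_2>0$ such that for all $x,y\in M$ and all $0<t<\psi_c(\mathrm{diam}(M,d))$, $$\frac{C^{-1}}{V(x,\psi_c^{-1}(t))}\exp\Big\{-c_1\sup_{r>0}\Big(\frac{\rho(d(x,y))}{\rho(r)}-\frac{t}{\psi_c(r)}\Big)\Big\}\le p_t(x,y)\le \frac{C}{V(x,\psi_c^{-1}(t))}\exp\Big\{-c_2\sup_{r>0}\Big(\frac{\rho(d(x,y))}{\rho(r)}-\frac{t}{\psi_c(r)}\Big)\Big\}.$$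
   Context: A metric measure space $(M,d,\mu)$: $(M,d)$ is a separable, locally compact, complete metric space in which every ball is precompact, and $\mu$ is a Radon measure of full support. $B(x,r)=\{y:d(x,y)<r\}$, $V(x,r)=\mu(B(x,r))$, $\overline R=\mathrm{diam}(M,d)\in(0,\infty]$. $\mathrm{VD}$: there are $C\ge1,\alpha_2>0$ with $V(x,R)/V(x,r)\le C(R/r)^{\alpha_2}$ for all $x\in M$, $0<r<R<\infty$. $\mathrm{RVD}$: there are $C\ge1,\alpha_1>0$ with $V(x,R)/V(x,r)\ge C^{-1}(R/r)^{\alpha_1}$ for all $x\in M$, $0<r\le R<\overline R$. A scale function is a continuous increasing $\phi:[0,\infty)\to[0,\infty)$ with $\phi(0)=0$, $\phi(r)\to\infty$ as $r\to\infty$, and constants $C(\phi)\ge1$, $0<\beta_1(\phi)\le\beta_2(\phi)$ with $C(\phi)^{-1}(t/s)^{\beta_1(\phi)}\le\phi(t)/\phi(s)\le C(\phi)(t/s)^{\beta_2(\phi)}$ for all $0<s\le t$. For $\varepsilon>0$, an $\varepsilon$-chain from $x$ to $y$ is a finite sequence $x=\xi_0,\xi_1,\dots,\xi_{N+1}=y$ in $M$ with $d(\xi_i,\xi_{i+1})<\varepsilon$ for all $i$; $d_\varepsilon(x,y)$ is the infimum of $\sum_{i=0}^N d(\xi_i,\xi_{i+1})$ over all $\varepsilon$-chains from $x$ to $y$ ($=\infty$ if none exists). The $\rho$-chain condition (for a scale function $\rho$): there is $C>0$ such that for all $x,y\in M$ and all $0<\varepsilon<d(x,y)$, $C^{-1}\rho(d(x,y))/\rho(\varepsilon)\le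 d_\varepsilon(x,y)/\varepsilon\le C\rho(d(x,y))/\rho(\varepsilon)$. For a regular Dirichlet form with heat semigroup $P_t$, a function $u:[0,\infty)\times M\to[0,\infty)$ is caloric on $(0,t]\times B$ if $\frac{d}{ds}(u(s,\cdot),\varphi)_{L^2}=-\mathcal{E}(u(s,\cdot),\varphi)$ for all $0<s\le t$ and $\varphi\in\mathcal{F}\cap C_0(B)$. $\mathrm{PHI}(\phi)$: there exist constants $0<C_1<C_2<C_3<C_4<\infty$, $C\ge1$, $c\in(0,1)$ such that for all $0<t<(C_4^{-1}\wedge1)\phi(\overline R)$, $x\in M$, and every nonnegative $u$ caloric on $(0,t]\times B(x,\phi^{-1}(t))$, $\sup_{(C_1t,C_2t]\times B(x,c\phi^{-1}(t))}u\le C\inf_{(C_3t,C_4t]\times B(x,c\phi^{-1}(t))}u$. *)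

theory Defs
  imports "HOL-Analysis.Analysis" "HOL-Probability.Probability"
begin

text \<open>The underlying metric space is a type of class heine_borel (a proper metric space:
  every bounded set is precompact; hence complete, locally compact and separable).
  The measure mu is a Borel measure on the whole type, finite and positive on balls
  (locally finite Borel measures on proper metric spaces are Radon; positivity on balls
  is full support).\<close>

definition mm_diam :: "'a::metric_space measure \<Rightarrow> ereal" where
  "mm_diam \<mu> = (SUP x\<in>space \<mu>. SUP y\<in>space \<mu>. ereal (dist x y))"

definition mm_space :: "'a::heine_borel measure \<Rightarrow> bool" where
  "mm_space \<mu> \<longleftrightarrow> sets \<mu> = sets borel \<and>
     (\<forall>x r. emeasure \<mu> (ball x r) < \<infinity>) \<and>
     (\<forall>x r. r > 0 \<longrightarrow> emeasure \<mu> (ball x r) > 0) \<and>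
     mm_diam \<mu> > 0"

definition V :: "'a::metric_space measure \<Rightarrow> 'a \<Rightarrow> real \<Rightarrow> real" where
  "V \<mu> x r = measure \<mu> (ball x r)"

definition VD :: "'a::metric_space measure \<Rightarrow> bool" where
  "VD \<mu> \<longleftrightarrow> (\<exists>C \<alpha>2. C \<ge> 1 \<and> \<alpha>2 > 0 \<and>
     (\<forall>x r R. 0 < r \<and> r < R \<longrightarrow> V \<mu> x R / V \<mu> x r \<le> C * (R / r) powr \<alpha>2))"

definition RVD :: "'a::metric_space measure \<Rightarrow> bool" where
  "RVD \<mu> \<longleftrightarrow> (\<exists>C \<alpha>1. C \<ge> 1 \<and> \<alpha>1 > 0 \<and>
     (\<forall>x r R. 0 < r \<and> r \<le> R \<and> ereal R < mm_diam \<mu> \<longrightarrow>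
        V \<mu> x R / V \<mu> x r \<ge> inverse C * (R / r) powr \<alpha>1))"

definition scale_function_with :: "(real \<Rightarrow> real) \<Rightarrow> real \<Rightarrow> real \<Rightarrow> real \<Rightarrow> bool" where
  "scale_function_with \<phi> C \<beta>1 \<beta>2 \<longleftrightarrow>
     continuous_on {0..} \<phi> \<and> strict_mono_on {0..} \<phi> \<and> \<phi> 0 = 0 \<and>
     (\<forall>r\<ge>0. \<phi> r \<ge> 0) \<and> filterlim \<phi> at_top at_top \<and>
     C \<ge> 1 \<and> 0 < \<beta>1 \<and> \<beta>1 \<le> \<beta>2 \<and>
     (\<forall>s t. 0 < s \<and> s \<le> t \<longrightarrow>
        inverse C * (t / s) powr \<beta>1 \<le> \<phi> t / \<phi> s \<and> \<phi> t / \<phi> s \<le> C * (t / s) powr \<beta>2)"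

definition scale_function :: "(real \<Rightarrow> real) \<Rightarrow> bool" where
  "scale_function \<phi> \<longleftrightarrow> (\<exists>C \<beta>1 \<beta>2. scale_function_with \<phi> C \<beta>1 \<beta>2)"

definition scale_inv :: "(real \<Rightarrow> real) \<Rightarrow> real \<Rightarrow> real" where
  "scale_inv \<phi> t = (THE r. 0 \<le> r \<and> \<phi> r = t)"

definition phi_bar :: "(real \<Rightarrow> real) \<Rightarrow> ereal \<Rightarrow> ereal" where
  "phi_bar \<phi> R = (case R of ereal r \<Rightarrow> ereal (\<phi> r) | _ \<Rightarrow> \<infinity>)"

definition eps_chain :: "real \<Rightarrow> 'a::metric_space \<Rightarrow> 'a \<Rightarrow> 'a list \<Rightarrow> bool" where
  "eps_chain \<epsilon> x y xs \<longleftrightarrow> length xs \<ge> 2 \<and> hd xs = x \<and> last xs = y \<and>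
     (\<forall>i. Suc i < length xs \<longrightarrow> dist (xs ! i) (xs ! Suc i) < \<epsilon>)"

definition chain_length :: "'a::metric_space list \<Rightarrow> real" where
  "chain_length xs = (\<Sum>i<length xs - 1. dist (xs ! i) (xs ! Suc i))"

text \<open>d_eps(x,y), equal to infinity when no eps-chain exists (Inf of the empty set).\<close>
definition d_eps :: "real \<Rightarrow> 'a::metric_space \<Rightarrow> 'a \<Rightarrow> ereal" where
  "d_eps \<epsilon> x y = (INF xs\<in>{xs. eps_chain \<epsilon> x y xs}. ereal (chain_length xs))"

definition chain_condition :: "(real \<Rightarrow> real) \<Rightarrow> 'a::metric_space itself \<Rightarrow> bool" where
  "chain_condition \<rho> _ \<longleftrightarrow> (\<exists>C>0. \<forall>(x::'a) y \<epsilon>. 0 < \<epsilon> \<and> \<epsilon> < dist x y \<longrightarrow>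
      ereal (inverse C * \<rho> (dist x y) / \<rho> \<epsilon>) \<le> d_eps \<epsilon> x y / ereal \<epsilon> \<and>
      d_eps \<epsilon> x y / ereal \<epsilon> \<le> ereal (C * \<rho> (dist x y) / \<rho> \<epsilon>))"

text \<open>Elements of L2 are represented by functions; everything respects a.e.-equality.\<close>
definition L2 :: "'a measure \<Rightarrow> ('a \<Rightarrow> real) set" where
  "L2 \<mu> = {f. f \<in> borel_measurable \<mu> \<and> integrable \<mu> (\<lambda>x. (f x)\<^sup>2)}"

definition l2inner :: "'a measure \<Rightarrow> ('a \<Rightarrow> real) \<Rightarrow> ('a \<Rightarrow> real) \<Rightarrow> real" where
  "l2inner \<mu> f g = (\<integral>x. f x * g x \<partial>\<mu>)"

definition l2norm :: "'a measure \<Rightarrow> ('a \<Rightarrow> real) \<Rightarrow> real" where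
  "l2norm \<mu> f = sqrt (l2inner \<mu> f f)"

definition E1norm :: "'a measure \<Rightarrow> (('a \<Rightarrow> real) \<Rightarrow> ('a \<Rightarrow> real) \<Rightarrow> real) \<Rightarrow> ('a \<Rightarrow> real) \<Rightarrow> real" where
  "E1norm \<mu> E f = sqrt (E f f + l2inner \<mu> f f)"

definition fsupp :: "('a::topological_space \<Rightarrow> real) \<Rightarrow> 'a set" where
  "fsupp f = closure {x. f x \<noteq> 0}"

definition Cc :: "('a::topological_space \<Rightarrow> real) set" where
  "Cc = {f. continuous_on UNIV f \<and> compact (fsupp f)}"

definition dirichlet_form ::
  "'a::heine_borel measure \<Rightarrow> (('a \<Rightarrow> real) \<Rightarrow> ('a \<Rightarrow> real) \<Rightarrow> real) \<Rightarrow> ('a \<Rightarrow> real) set \<Rightarrow> bool" where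
  "dirichlet_form \<mu> E F \<longleftrightarrow>
     F \<subseteq> L2 \<mu> \<and>
     (\<lambda>x. 0) \<in> F \<and>
     (\<forall>f\<in>F. \<forall>g\<in>F. (\<lambda>x. f x + g x) \<in> F) \<and>
     (\<forall>f\<in>F. \<forall>c. (\<lambda>x. c * f x) \<in> F) \<and>
     (\<forall>f\<in>F. \<forall>g\<in>L2 \<mu>. (AE x in \<mu>. f x = g x) \<longrightarrow> g \<in> F \<and> (\<forall>h\<in>F. E f h = E g h)) \<and>
     (\<forall>f\<in>F. \<forall>g\<in>F. E f g = E g f) \<and>
     (\<forall>f\<in>F. \<forall>g\<in>F. \<forall>h\<in>F. E (\<lambda>x. f x + g x) h = E f h + E g h) \<and>
     (\<forall>f\<in>F. \<forall>h\<in>F. \<forall>c. E (\<lambda>x. c * f x) h = c * E f h) \<and>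
     (\<forall>f\<in>F. E f f \<ge> 0) \<and>
     \<comment> \<open>densely defined\<close>
     (\<forall>f\<in>L2 \<mu>. \<forall>e>0. \<exists>g\<in>F. l2norm \<mu> (\<lambda>x. f x - g x) < e) \<and>
     \<comment> \<open>closed: (F, E_1) is complete\<close>
     (\<forall>u::nat \<Rightarrow> 'a \<Rightarrow> real. (\<forall>n. u n \<in> F) \<and>
        (\<forall>e>0. \<exists>N. \<forall>m\<ge>N. \<forall>n\<ge>N. E1norm \<mu> E (\<lambda>x. u m x - u n x) < e) \<longrightarrow>
        (\<exists>v\<in>F. (\<lambda>n. E1norm \<mu> E (\<lambda>x. u n x - v x)) \<longlonglongrightarrow> 0)) \<and>
     \<comment> \<open>Markovian (unit contraction)\<close>
     (\<forall>f\<in>F. (\<lambda>x. min 1 (max 0 (f x))) \<in> F \<and>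
        E (\<lambda>x. min 1 (max 0 (f x))) (\<lambda>x. min 1 (max 0 (f x))) \<le> E f f)"

definition regular_dirichlet_form ::
  "'a::heine_borel measure \<Rightarrow> (('a \<Rightarrow> real) \<Rightarrow> ('a \<Rightarrow> real) \<Rightarrow> real) \<Rightarrow> ('a \<Rightarrow> real) set \<Rightarrow> bool" where
  "regular_dirichlet_form \<mu> E F \<longleftrightarrow> dirichlet_form \<mu> E F \<and>
     (\<forall>f\<in>F. \<forall>e>0. \<exists>g\<in>F \<inter> Cc. E1norm \<mu> E (\<lambda>x. f x - g x) < e) \<and>
     (\<forall>f\<in>Cc. \<forall>e>0. \<exists>g\<in>F \<inter> Cc. \<forall>x. \<bar>f x - g x\<bar> < e)"

definition strongly_local ::
  "(('a::topological_space \<Rightarrow> real) \<Rightarrow> ('a \<Rightarrow> real) \<Rightarrow> real) \<Rightarrow> ('a \<Rightarrow> real) set \<Rightarrow> bool" where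
  "strongly_local E F \<longleftrightarrow> (\<forall>u\<in>F. \<forall>v\<in>F.
     compact (fsupp u) \<and> compact (fsupp v) \<and>
     (\<exists>U c. open U \<and> fsupp u \<subseteq> U \<and> (\<forall>x\<in>U. v x = c)) \<longrightarrow> E u v = 0)"

text \<open>P is the heat semigroup of (E,F): for every f in L2, t |-> P t f is the (unique) strong
  L2-solution of the heat equation associated with E with initial value f.\<close>
definition heat_semigroup ::
  "'a measure \<Rightarrow> (('a \<Rightarrow> real) \<Rightarrow> ('a \<Rightarrow> real) \<Rightarrow> real) \<Rightarrow> ('a \<Rightarrow> real) set \<Rightarrow>
   (real \<Rightarrow> ('a \<Rightarrow> real) \<Rightarrow> ('a \<Rightarrow> real)) \<Rightarrow> bool" where
  "heat_semigroup \<mu> E F P \<longleftrightarrow> (\<forall>f\<in>L2 \<mu>.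
     (\<forall>t\<ge>0. P t f \<in> L2 \<mu>) \<and>
     (AE x in \<mu>. P 0 f x = f x) \<and>
     ((\<lambda>t. l2norm \<mu> (\<lambda>x. P t f x - f x)) \<longlongrightarrow> 0) (at_right 0) \<and>
     (\<forall>t>0. P t f \<in> F \<and>
        (\<exists>w\<in>L2 \<mu>. ((\<lambda>h. l2norm \<mu> (\<lambda>x. (P (t + h) f x - P t f x) / h - w x)) \<longlongrightarrow> 0) (at 0) \<and>
           (\<forall>\<phi>\<in>F. l2inner \<mu> w \<phi> = - E (P t f) \<phi>))))"

definition heat_kernel ::
  "'a measure \<Rightarrow> (real \<Rightarrow> ('a \<Rightarrow> real) \<Rightarrow> ('a \<Rightarrow> real)) \<Rightarrow> (real \<Rightarrow> 'a \<Rightarrow> 'a \<Rightarrow> real) \<Rightarrow> bool" where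
  "heat_kernel \<mu> P p \<longleftrightarrow> (\<forall>t>0. (\<lambda>(x, y). p t x y) \<in> borel_measurable (\<mu> \<Otimes>\<^sub>M \<mu>) \<and>
     (\<forall>f\<in>L2 \<mu>. AE x in \<mu>. integrable \<mu> (\<lambda>y. p t x y * f y) \<and>
        P t f x = (\<integral>y. p t x y * f y \<partial>\<mu>)))"

definition caloric ::
  "'a::topological_space measure \<Rightarrow> (('a \<Rightarrow> real) \<Rightarrow> ('a \<Rightarrow> real) \<Rightarrow> real) \<Rightarrow> ('a \<Rightarrow> real) set \<Rightarrow>
   (real \<Rightarrow> 'a \<Rightarrow> real) \<Rightarrow> real \<Rightarrow> 'a set \<Rightarrow> bool" where
  "caloric \<mu> E F u t B \<longleftrightarrow> (\<forall>s\<in>{0<..t}. u s \<in> F \<and>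
     (\<forall>\<phi>\<in>F \<inter> Cc. fsupp \<phi> \<subseteq> B \<longrightarrow>
        ((\<lambda>s. l2inner \<mu> (u s) \<phi>) has_real_derivative (- E (u s) \<phi>)) (at s within {0<..t})))"

definition esssup_on :: "'a measure \<Rightarrow> 'a set \<Rightarrow> ('a \<Rightarrow> real) \<Rightarrow> ereal" where
  "esssup_on \<mu> B f = esssup (restrict_space \<mu> B) (\<lambda>x. ereal (f x))"

definition essinf_on :: "'a measure \<Rightarrow> 'a set \<Rightarrow> ('a \<Rightarrow> real) \<Rightarrow> ereal" where
  "essinf_on \<mu> B f = - esssup (restrict_space \<mu> B) (\<lambda>x. - ereal (f x))"

definition PHI ::
  "'a::heine_borel measure \<Rightarrow> (('a \<Rightarrow> real) \<Rightarrow> ('a \<Rightarrow> real) \<Rightarrow> real) \<Rightarrow> ('a \<Rightarrow> real) set \<Rightarrow>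
   (real \<Rightarrow> real) \<Rightarrow> bool" where
  "PHI \<mu> E F \<phi> \<longleftrightarrow> (\<exists>C1 C2 C3 C4 C c. 0 < C1 \<and> C1 < C2 \<and> C2 < C3 \<and> C3 < C4 \<and>
     C \<ge> 1 \<and> 0 < c \<and> c < 1 \<and>
     (\<forall>t x u. 0 < t \<and> ereal t < ereal (min (inverse C4) 1) * phi_bar \<phi> (mm_diam \<mu>) \<and>
        (\<forall>s y. u s y \<ge> 0) \<and> caloric \<mu> E F u t (ball x (scale_inv \<phi> t)) \<longrightarrow>
        (SUP s\<in>{C1 * t<..C2 * t}. esssup_on \<mu> (ball x (c * scale_inv \<phi> t)) (u s))
          \<le> ereal C * (INF s\<in>{C3 * t<..C4 * t}. essinf_on \<mu> (ball x (c * scale_inv \<phi> t)) (u s))))"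

definition Phi_exp :: "(real \<Rightarrow> real) \<Rightarrow> (real \<Rightarrow> real) \<Rightarrow> real \<Rightarrow> real \<Rightarrow> ereal" where
  "Phi_exp \<rho> \<psi> t d = (SUP r\<in>{0<..}. ereal (\<rho> d / \<rho> r - t / \<psi> r))"

definition exp_neg :: "real \<Rightarrow> ereal \<Rightarrow> real" where
  "exp_neg c s = (case s of ereal v \<Rightarrow> exp (- c * v) | PInfty \<Rightarrow> 0 | MInfty \<Rightarrow> 0)"

end

theory Submission
  imports Defs
begin

text \<open>Everything is derived from the semigroup \<open>P\<^sub>t\<close> on \<open>L\<^sup>2\<close>, whose linearity, symmetry and Markov
  property follow from the heat equation. Strong locality turns truncated data, constant in a ball
  of radius \<open>r\<close>, into caloric functions; the Harnack inequality then shows that \<open>P\<^sub>s 1\<^sub>A\<close> decays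
  geometrically in the number of steps of size \<open>r\<close> needed to leave \<open>A\<close>, for \<open>s \<le> a \<psi>(r)\<close>. The chain
  condition says that this number is comparable to \<open>\<rho>(d)/\<rho>(r)\<close>, so optimising over \<open>r\<close> yields the
  exponent. Lower bounds for cutoff functions, pushed forward in time by the Harnack inequality,
  give a near-diagonal lower bound, and chaining it gives the off-diagonal one. Testing the form
  with a truncated step-counting function shows \<open>(\<rho>(R)/\<rho>(r))\<^sup>2 \<le> G \<psi>(R)/\<psi>(r)\<close> for \<open>r \<le> R\<close>; this makes the supremum finite and
  insensitive to the constants in front of its two terms. The bounds are obtained for \<open>P\<^sub>t f\<close> with
  \<open>f\<close> supported in a small ball. The local bound \<open>P\<^sub>t f \<le> \<kappa>(x) \<integral>f\<close> provides a kernel by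
  Caratheodory extension and the Radon-Nikodym theorem, and the bounds for \<open>P\<^sub>t f\<close> on small balls
  pass to the kernel almost everywhere.\<close>

text \<open>The square in the comparison of the two scales is what makes it useful. With X =
  \<open>\<rho> r / \<rho> s\<close> the quantity
  \<open>\<rho> d / \<rho> s - \<psi> r / \<psi> s\<close> is at most
  \<open>D X - X\<^sup>2 / G\<close> when d is at most a multiple of r and s \<le> r, hence bounded;
  and enlarging s shrinks the second term by the square of the factor lost in the first, so the
  first can be made to dominate. The Harnack hypothesis dictates the form of the estimates. It wants
  functions that are nonnegative at every point and caloric for the whole time
  \<open>\<psi> r\<close>, and it compares essential bounds on single time slices. The functions fed
  into it are therefore positive parts, sometimes glued in time: a phase at rest, then the heat
  flow. Gluing is harmless only if the one-sided derivatives agree at the junction, which rests on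
  the convergence of \<open>P\<^sub>t f\<close> to f in energy, not merely in
  \<open>L\<^sup>2\<close>. All estimates hold almost everywhere at one fixed time on small balls
  and are assembled from countably many balls.\<close>

lemma quadratic_nonneg_discriminant:
  fixes a b c :: real
  assumes "\<And>l. a + 2 * l * b + l\<^sup>2 * c \<ge> 0" and "c \<ge> 0"
  shows "b\<^sup>2 \<le> a * c"
proof (cases "c = 0")
  case True
  have "b = 0"
  proof (rule ccontr)
    assume "b \<noteq> 0"
    then have "a + 2 * (- (a + 1) / (2 * b)) * b = -1" by (simp add: field_simps)
    with assms(1)[of "- (a + 1) / (2 * b)"] True show False by simp
  qed
  with True show ?thesis by simp
next
  case False
  with \<open>c \<ge> 0\<close> have c: "c > 0" by simp
  from assms(1)[of "- b / c"] c have "a - b\<^sup>2 / c \<ge> 0"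
    by (simp add: power2_eq_square field_simps)
  then show ?thesis using c by (simp add: field_simps)
qed

section \<open>Square integrable functions\<close>

lemma L2_measurable: "f \<in> L2 M \<Longrightarrow> f \<in> borel_measurable M"
  by (simp add: L2_def)

lemma L2_integrable_square: "f \<in> L2 M \<Longrightarrow> integrable M (\<lambda>x. (f x)\<^sup>2)"
  by (simp add: L2_def)

lemma L2_integrable_mult:
  assumes "f \<in> L2 M" "g \<in> L2 M"
  shows "integrable M (\<lambda>x. f x * g x)"
proof (rule Bochner_Integration.integrable_bound)
  show "integrable M (\<lambda>x. (f x)\<^sup>2 + (g x)\<^sup>2)"
    using assms by (auto intro: L2_integrable_square)
  show "(\<lambda>x. f x * g x) \<in> borel_measurable M"
    using assms[THEN L2_measurable] by measurable
  have "\<bar>a * b\<bar> \<le> \<bar>a\<^sup>2 + b\<^sup>2\<bar>" for a b :: real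
  proof -
    have "0 \<le> (\<bar>a\<bar> - \<bar>b\<bar>)\<^sup>2" by simp
    then have "2 * (\<bar>a\<bar> * \<bar>b\<bar>) \<le> a\<^sup>2 + b\<^sup>2" by (simp add: power2_diff)
    moreover have "0 \<le> \<bar>a\<bar> * \<bar>b\<bar>" by simp
    ultimately have "\<bar>a\<bar> * \<bar>b\<bar> \<le> a\<^sup>2 + b\<^sup>2" by linarith
    then show ?thesis by (simp add: abs_mult)
  qed
  then show "AE x in M. norm (f x * g x) \<le> norm ((f x)\<^sup>2 + (g x)\<^sup>2)"
    by (intro AE_I2) simp
qed

lemma L2_AE_bound:
  assumes "g \<in> L2 M" "f \<in> borel_measurable M" "AE x in M. \<bar>f x\<bar> \<le> \<bar>g x\<bar>"
  shows "f \<in> L2 M"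
proof -
  have "integrable M (\<lambda>x. (f x)\<^sup>2)"
    using assms by (intro Bochner_Integration.integrable_bound[OF L2_integrable_square[OF assms(1)]])
      (auto simp: abs_le_square_iff)
  then show ?thesis using assms by (simp add: L2_def)
qed

lemma L2_bound:
  "g \<in> L2 M \<Longrightarrow> f \<in> borel_measurable M \<Longrightarrow> (\<And>x. \<bar>f x\<bar> \<le> \<bar>g x\<bar>) \<Longrightarrow> f \<in> L2 M"
  by (rule L2_AE_bound) auto

lemma L2_AE_cong:
  "g \<in> L2 M \<Longrightarrow> f \<in> borel_measurable M \<Longrightarrow> AE x in M. f x = g x \<Longrightarrow> f \<in> L2 M"
  by (rule L2_AE_bound) (auto elim: eventually_mono)

lemma L2_scale: "f \<in> L2 M \<Longrightarrow> (\<lambda>x. c * f x) \<in> L2 M"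
  by (auto simp: L2_def power_mult_distrib)

lemma L2_add:
  assumes "f \<in> L2 M" "g \<in> L2 M"
  shows "(\<lambda>x. f x + g x) \<in> L2 M"
proof -
  have "integrable M (\<lambda>x. (f x)\<^sup>2 + (g x)\<^sup>2 + 2 * (f x * g x))"
    using assms by (intro Bochner_Integration.integrable_add integrable_mult_right L2_integrable_square L2_integrable_mult)
  moreover have "(\<lambda>x. (f x)\<^sup>2 + (g x)\<^sup>2 + 2 * (f x * g x)) = (\<lambda>x. (f x + g x)\<^sup>2)"
    by (auto simp: power2_sum)
  ultimately show ?thesis using assms by (auto simp: L2_def)
qed

lemma L2_minus: "f \<in> L2 M \<Longrightarrow> (\<lambda>x. - f x) \<in> L2 M"
  using L2_scale[of f M "-1"] by simp

lemma L2_diff: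
  "f \<in> L2 M \<Longrightarrow> g \<in> L2 M \<Longrightarrow> (\<lambda>x. f x - g x) \<in> L2 M"
  using L2_add[of f M "\<lambda>x. - g x"] L2_minus[of g M] by simp

lemma L2_zero: "(\<lambda>x. 0) \<in> L2 M"
  by (simp add: L2_def)

lemma L2_sum: "finite I \<Longrightarrow> (\<And>i. i \<in> I \<Longrightarrow> f i \<in> L2 M) \<Longrightarrow> (\<lambda>x. \<Sum>i\<in>I. f i x) \<in> L2 M"
  by (induction I rule: finite_induct) (auto intro: L2_add L2_zero)

lemma L2_divide: "f \<in> L2 M \<Longrightarrow> (\<lambda>x. f x / c) \<in> L2 M"
  using L2_scale[of f M "1 / c"] by simp

lemma L2_indicator:
  assumes "A \<in> sets M" "emeasure M A < \<infinity>"
  shows "indicat_real A \<in> L2 M"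
proof -
  have "(\<lambda>x. (indicat_real A x)\<^sup>2) = indicat_real A" by (auto simp: indicator_def)
  then show ?thesis using assms by (auto simp: L2_def)
qed

lemmas L2_intros = L2_add L2_scale L2_diff L2_minus L2_zero L2_divide

lemma l2inner_commute: "l2inner M f g = l2inner M g f"
  by (simp add: l2inner_def mult.commute)

lemma l2inner_add_left:
  "f \<in> L2 M \<Longrightarrow> g \<in> L2 M \<Longrightarrow> h \<in> L2 M \<Longrightarrow>
    l2inner M (\<lambda>x. f x + g x) h = l2inner M f h + l2inner M g h"
  by (simp add: l2inner_def distrib_right L2_integrable_mult)

lemma l2inner_diff_left:
  "f \<in> L2 M \<Longrightarrow> g \<in> L2 M \<Longrightarrow> h \<in> L2 M \<Longrightarrow>
    l2inner M (\<lambda>x. f x - g x) h = l2inner M f h - l2inner M g h"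
  by (simp add: l2inner_def left_diff_distrib L2_integrable_mult)

lemma l2inner_scale_left: "l2inner M (\<lambda>x. c * f x) h = c * l2inner M f h"
  by (simp add: l2inner_def mult.assoc)

lemma l2inner_divide_left: "l2inner M (\<lambda>x. f x / c) h = l2inner M f h / c"
  using l2inner_scale_left[of M "1 / c" f h] by simp

lemma l2inner_add_right:
  "f \<in> L2 M \<Longrightarrow> g \<in> L2 M \<Longrightarrow> h \<in> L2 M \<Longrightarrow>
    l2inner M h (\<lambda>x. f x + g x) = l2inner M h f + l2inner M h g"
  using l2inner_add_left[of f M g h] by (simp add: l2inner_commute)

lemma l2inner_diff_right:
  "f \<in> L2 M \<Longrightarrow> g \<in> L2 M \<Longrightarrow> h \<in> L2 M \<Longrightarrow>
    l2inner M h (\<lambda>x. f x - g x) = l2inner M h f - l2inner M h g"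
  using l2inner_diff_left[of f M g h] by (simp add: l2inner_commute)

lemma l2inner_scale_right: "l2inner M h (\<lambda>x. c * f x) = c * l2inner M h f"
  using l2inner_scale_left[of M c f h] by (simp add: l2inner_commute)

lemma l2inner_sum_left:
  "finite I \<Longrightarrow> (\<And>i. i \<in> I \<Longrightarrow> f i \<in> L2 M) \<Longrightarrow> h \<in> L2 M \<Longrightarrow>
    l2inner M (\<lambda>x. \<Sum>i\<in>I. f i x) h = (\<Sum>i\<in>I. l2inner M (f i) h)"
proof (induction I rule: finite_induct)
  case (insert i I)
  then have "l2inner M (\<lambda>x. f i x + (\<Sum>i\<in>I. f i x)) h = l2inner M (f i) h + l2inner M (\<lambda>x. \<Sum>i\<in>I. f i x) h"
    by (intro l2inner_add_left L2_sum) auto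
  with insert show ?case by simp
qed (simp add: l2inner_def)

lemma l2inner_sum_right:
  "finite I \<Longrightarrow> (\<And>i. i \<in> I \<Longrightarrow> f i \<in> L2 M) \<Longrightarrow> h \<in> L2 M \<Longrightarrow>
    l2inner M h (\<lambda>x. \<Sum>i\<in>I. f i x) = (\<Sum>i\<in>I. l2inner M h (f i))"
  using l2inner_sum_left[of I f M h] by (simp add: l2inner_commute)

lemma l2inner_self_nonneg: "l2inner M f f \<ge> 0"
  by (simp add: l2inner_def)

lemma l2inner_AE_cong:
  assumes "f \<in> borel_measurable M" "f' \<in> borel_measurable M" "g \<in> borel_measurable M" "g' \<in> borel_measurable M"
    "AE x in M. f x = f' x" "AE x in M. g x = g' x"
  shows "l2inner M f g = l2inner M f' g'"
  unfolding l2inner_def using assms by (intro integral_cong_AE) auto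

lemma l2inner_cauchy_schwarz_square:
  assumes "f \<in> L2 M" "g \<in> L2 M"
  shows "(l2inner M f g)\<^sup>2 \<le> l2inner M f f * l2inner M g g"
proof (rule quadratic_nonneg_discriminant)
  fix l
  have "0 \<le> l2inner M (\<lambda>x. f x + l * g x) (\<lambda>x. f x + l * g x)" by (rule l2inner_self_nonneg)
  also have "\<dots> = l2inner M f f + 2 * l * l2inner M f g + l\<^sup>2 * l2inner M g g"
    using assms by (simp add: l2inner_add_left l2inner_add_right L2_intros l2inner_scale_left
        l2inner_scale_right l2inner_commute[of M g f] power2_eq_square algebra_simps)
  finally show "0 \<le> l2inner M f f + 2 * l * l2inner M f g + l\<^sup>2 * l2inner M g g" .
qed (rule l2inner_self_nonneg)

lemma l2norm_nonneg: "0 \<le> l2norm M f"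
  by (simp add: l2norm_def l2inner_self_nonneg)

lemma l2norm_square: "(l2norm M f)\<^sup>2 = l2inner M f f"
  by (simp add: l2norm_def l2inner_self_nonneg)

lemma l2inner_cauchy_schwarz:
  assumes "f \<in> L2 M" "g \<in> L2 M"
  shows "\<bar>l2inner M f g\<bar> \<le> l2norm M f * l2norm M g"
proof -
  have "\<bar>l2inner M f g\<bar>\<^sup>2 \<le> (l2norm M f * l2norm M g)\<^sup>2"
    using l2inner_cauchy_schwarz_square[OF assms] by (simp add: power_mult_distrib l2norm_square)
  then show ?thesis by (rule power2_le_imp_le) (simp add: l2norm_nonneg)
qed

lemma l2norm_triangle:
  assumes "f \<in> L2 M" "g \<in> L2 M"
  shows "l2norm M (\<lambda>x. f x + g x) \<le> l2norm M f + l2norm M g"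
proof (rule power2_le_imp_le)
  have "(l2norm M (\<lambda>x. f x + g x))\<^sup>2 = l2inner M f f + 2 * l2inner M f g + l2inner M g g"
    using assms by (simp add: l2norm_square l2inner_add_left l2inner_add_right L2_intros l2inner_commute[of M g f])
  also have "\<dots> \<le> (l2norm M f)\<^sup>2 + 2 * (l2norm M f * l2norm M g) + (l2norm M g)\<^sup>2"
    using l2inner_cauchy_schwarz[OF assms] by (simp add: l2norm_square)
  also have "\<dots> = (l2norm M f + l2norm M g)\<^sup>2" by (simp add: power2_sum)
  finally show "(l2norm M (\<lambda>x. f x + g x))\<^sup>2 \<le> (l2norm M f + l2norm M g)\<^sup>2" .
qed (simp add: l2norm_nonneg)

lemma l2norm_scale: "l2norm M (\<lambda>x. c * f x) = \<bar>c\<bar> * l2norm M f"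
  by (simp add: l2norm_def l2inner_scale_left l2inner_scale_right real_sqrt_mult mult.assoc[symmetric])

lemma l2norm_minus: "l2norm M (\<lambda>x. - f x) = l2norm M f"
  using l2norm_scale[of M "-1" f] by simp

lemma l2norm_diff_commute: "l2norm M (\<lambda>x. f x - g x) = l2norm M (\<lambda>x. g x - f x)"
  using l2norm_minus[of M "\<lambda>x. f x - g x"] by simp

lemma l2norm_mono:
  assumes "g \<in> L2 M" "f \<in> borel_measurable M" "AE x in M. \<bar>f x\<bar> \<le> \<bar>g x\<bar>"
  shows "l2norm M f \<le> l2norm M g"
proof -
  have f: "f \<in> L2 M" using assms by (rule L2_AE_bound)
  have "(\<integral>x. f x * f x \<partial>M) \<le> (\<integral>x. g x * g x \<partial>M)"
    using assms(3) by (intro integral_mono_AE L2_integrable_mult f assms(1))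
      (auto simp: abs_le_square_iff power2_eq_square)
  then show ?thesis by (simp add: l2norm_def l2inner_def)
qed

lemma l2norm_AE_cong:
  assumes "f \<in> borel_measurable M" "g \<in> borel_measurable M" "AE x in M. f x = g x"
  shows "l2norm M f = l2norm M g"
  unfolding l2norm_def using l2inner_AE_cong[of f M g f g] assms by simp

lemma l2norm_zero_AE:
  assumes "f \<in> L2 M" "l2norm M f = 0"
  shows "AE x in M. f x = 0"
proof -
  have "(\<integral>x. f x * f x \<partial>M) = 0" using assms by (simp add: l2norm_def l2inner_def)
  then have "AE x in M. f x * f x = 0"
    using integral_nonneg_eq_0_iff_AE[of M "\<lambda>x. f x * f x"] L2_integrable_mult[OF assms(1,1)] by simp
  then show ?thesis by simp
qed

lemma L2_ext:
  assumes "f \<in> L2 M" "g \<in> L2 M" "\<And>h. h \<in> L2 M \<Longrightarrow> l2inner M f h = l2inner M g h"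
  shows "AE x in M. f x = g x"
proof -
  let ?d = "\<lambda>x. f x - g x"
  have d: "?d \<in> L2 M" using assms by (intro L2_intros)
  have "l2inner M ?d ?d = 0" using assms d by (simp add: l2inner_diff_left)
  then have "l2norm M ?d = 0" by (simp add: l2norm_def)
  from l2norm_zero_AE[OF d this] show ?thesis by simp
qed

lemma l2norm_tendsto_unique:
  assumes "G \<noteq> bot" "\<And>n. u n \<in> L2 M" "f \<in> L2 M" "g \<in> L2 M"
    "((\<lambda>n. l2norm M (\<lambda>x. u n x - f x)) \<longlongrightarrow> 0) G" "((\<lambda>n. l2norm M (\<lambda>x. u n x - g x)) \<longlongrightarrow> 0) G"
  shows "AE x in M. f x = g x"
proof -
  have d: "(\<lambda>x. f x - g x) \<in> L2 M" using assms by (intro L2_intros)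
  have "l2norm M (\<lambda>x. f x - g x) \<le> l2norm M (\<lambda>x. u n x - f x) + l2norm M (\<lambda>x. u n x - g x)" for n
    using l2norm_triangle[of "\<lambda>x. f x - u n x" M "\<lambda>x. u n x - g x"] assms
    by (simp add: L2_diff l2norm_diff_commute[of M f])
  moreover have "((\<lambda>n. l2norm M (\<lambda>x. u n x - f x) + l2norm M (\<lambda>x. u n x - g x)) \<longlongrightarrow> 0 + 0) G"
    by (intro tendsto_intros assms)
  ultimately have "l2norm M (\<lambda>x. f x - g x) \<le> 0 + 0"
    by (intro tendsto_lowerbound[OF _ _ assms(1)]) auto
  then have "l2norm M (\<lambda>x. f x - g x) = 0" using l2norm_nonneg[of M "\<lambda>x. f x - g x"] by simp
  from l2norm_zero_AE[OF d this] show ?thesis by simp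
qed

lemma l2inner_tendsto:
  assumes "\<forall>\<^sub>F n in G. u n \<in> L2 M" "\<forall>\<^sub>F n in G. v n \<in> L2 M" "f \<in> L2 M" "g \<in> L2 M"
    "((\<lambda>n. l2norm M (\<lambda>x. u n x - f x)) \<longlongrightarrow> 0) G" "((\<lambda>n. l2norm M (\<lambda>x. v n x - g x)) \<longlongrightarrow> 0) G"
  shows "((\<lambda>n. l2inner M (u n) (v n)) \<longlongrightarrow> l2inner M f g) G"
proof -
  let ?a = "\<lambda>n. l2norm M (\<lambda>x. u n x - f x)" and ?b = "\<lambda>n. l2norm M (\<lambda>x. v n x - g x)"
  have "\<forall>\<^sub>F n in G. norm (l2inner M (u n) (v n) - l2inner M f g) \<le> ?a n * (?b n + l2norm M g) + l2norm M f * ?b n"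
    using assms(1,2)
  proof eventually_elim
    case (elim n)
    have uf: "(\<lambda>x. u n x - f x) \<in> L2 M" and vg: "(\<lambda>x. v n x - g x) \<in> L2 M"
      using elim assms by (auto intro: L2_intros)
    have "l2inner M (u n) (v n) - l2inner M f g
      = l2inner M (\<lambda>x. u n x - f x) (v n) + l2inner M f (\<lambda>x. v n x - g x)"
      using elim assms by (simp add: l2inner_diff_left l2inner_diff_right)
    moreover have "\<bar>l2inner M (\<lambda>x. u n x - f x) (v n)\<bar> \<le> ?a n * l2norm M (v n)"
      using elim uf by (intro l2inner_cauchy_schwarz)
    moreover have "l2norm M (v n) \<le> ?b n + l2norm M g"
      using l2norm_triangle[OF vg assms(4)] by simp
    then have "?a n * l2norm M (v n) \<le> ?a n * (?b n + l2norm M g)"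
      by (intro mult_left_mono l2norm_nonneg)
    moreover have "\<bar>l2inner M f (\<lambda>x. v n x - g x)\<bar> \<le> l2norm M f * ?b n"
      using vg assms by (intro l2inner_cauchy_schwarz)
    ultimately show ?case by simp
  qed
  moreover have "((\<lambda>n. ?a n * (?b n + l2norm M g) + l2norm M f * ?b n) \<longlongrightarrow> 0) G"
    by (rule tendsto_eq_intros assms refl | simp)+
  ultimately have "((\<lambda>n. l2inner M (u n) (v n) - l2inner M f g) \<longlongrightarrow> 0) G"
    by (rule Lim_null_comparison)
  then show ?thesis by (rule LIM_zero_cancel)
qed

lemma l2inner_tendsto_left:
  assumes "\<forall>\<^sub>F n in G. u n \<in> L2 M" "f \<in> L2 M" "g \<in> L2 M"
    "((\<lambda>n. l2norm M (\<lambda>x. u n x - f x)) \<longlongrightarrow> 0) G"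
  shows "((\<lambda>n. l2inner M (u n) g) \<longlongrightarrow> l2inner M f g) G"
  using l2inner_tendsto[of u M G "\<lambda>_. g" f g] assms by (simp add: l2norm_def l2inner_def)

text \<open>The positive part of f - g lies below the absolute value of \<open>u n - f\<close> along
  the filter, so its norm vanishes. That positive part is square integrable even when g is
  not.\<close>

lemma AE_le_L2_limit:
  assumes "G \<noteq> bot" "\<forall>\<^sub>F n in G. u n \<in> L2 M" "f \<in> L2 M" "g \<in> borel_measurable M"
    "((\<lambda>n. l2norm M (\<lambda>x. u n x - f x)) \<longlongrightarrow> 0) G" "\<forall>\<^sub>F n in G. AE x in M. u n x \<le> g x"
  shows "AE x in M. f x \<le> g x"
proof -
  let ?d = "\<lambda>x. max 0 (f x - g x)"
  have [measurable]: "f \<in> borel_measurable M" "g \<in> borel_measurable M" using assms L2_measurable by auto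
  have "\<forall>\<^sub>F n in G. l2norm M ?d \<le> l2norm M (\<lambda>x. u n x - f x)"
    using assms(2,6)
  proof eventually_elim
    case (elim n)
    have "(\<lambda>x. u n x - f x) \<in> L2 M" using elim assms by (intro L2_intros)
    then show ?case
    proof (rule l2norm_mono)
      show "AE x in M. \<bar>?d x\<bar> \<le> \<bar>u n x - f x\<bar>" using elim(2) by eventually_elim auto
    qed auto
  qed
  then have le: "l2norm M ?d \<le> 0"
    by (rule tendsto_lowerbound[OF assms(5) _ assms(1)])
  obtain n where n: "u n \<in> L2 M" "AE x in M. u n x \<le> g x"
    using eventually_happens'[OF assms(1) eventually_conj[OF assms(2,6)]] by auto
  have "?d \<in> L2 M"
  proof (rule L2_AE_bound)
    show "(\<lambda>x. u n x - f x) \<in> L2 M" using n assms by (intro L2_intros)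
    show "AE x in M. \<bar>?d x\<bar> \<le> \<bar>u n x - f x\<bar>" using n(2) by eventually_elim auto
  qed auto
  from l2norm_zero_AE[OF this] le l2norm_nonneg[of M ?d] have "AE x in M. ?d x = 0" by simp
  then show ?thesis by eventually_elim (auto split: if_splits simp: max_def)
qed

section \<open>Dirichlet forms\<close>

locale dirichlet =
  fixes \<mu> :: "'a::heine_borel measure"
    and E :: "('a \<Rightarrow> real) \<Rightarrow> ('a \<Rightarrow> real) \<Rightarrow> real"
    and F :: "('a \<Rightarrow> real) set"
  assumes form: "dirichlet_form \<mu> E F"
begin

lemma F_L2: "f \<in> F \<Longrightarrow> f \<in> L2 \<mu>"
  using form by (auto simp: dirichlet_form_def)

lemma F_measurable: "f \<in> F \<Longrightarrow> f \<in> borel_measurable \<mu>"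
  using F_L2 L2_measurable by blast

lemma F_zero: "(\<lambda>x. 0) \<in> F"
  using form unfolding dirichlet_form_def by blast

lemma F_add: "f \<in> F \<Longrightarrow> g \<in> F \<Longrightarrow> (\<lambda>x. f x + g x) \<in> F"
  using form unfolding dirichlet_form_def by blast

lemma F_scale: "f \<in> F \<Longrightarrow> (\<lambda>x. c * f x) \<in> F"
  using form unfolding dirichlet_form_def by blast

lemma F_minus: "f \<in> F \<Longrightarrow> (\<lambda>x. - f x) \<in> F"
  using F_scale[of f "-1"] by simp

lemma F_diff: "f \<in> F \<Longrightarrow> g \<in> F \<Longrightarrow> (\<lambda>x. f x - g x) \<in> F"
  using F_add[of f "\<lambda>x. - g x"] F_minus[of g] by simp

lemma F_AE: "f \<in> F \<Longrightarrow> g \<in> L2 \<mu> \<Longrightarrow> AE x in \<mu>. f x = g x \<Longrightarrow> g \<in> F"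
  using form unfolding dirichlet_form_def by blast

lemma F_AE_measurable:
  "f \<in> F \<Longrightarrow> g \<in> borel_measurable \<mu> \<Longrightarrow> AE x in \<mu>. f x = g x \<Longrightarrow> g \<in> F"
  by (rule F_AE[of f]) (auto intro!: L2_AE_cong[of f \<mu> g] simp: F_L2 elim: eventually_mono)

lemma E_AE: "f \<in> F \<Longrightarrow> g \<in> L2 \<mu> \<Longrightarrow> AE x in \<mu>. f x = g x \<Longrightarrow> h \<in> F \<Longrightarrow> E f h = E g h"
  using form unfolding dirichlet_form_def by blast

lemma E_sym: "f \<in> F \<Longrightarrow> g \<in> F \<Longrightarrow> E f g = E g f"
  using form unfolding dirichlet_form_def by blast

lemma E_add_left: "f \<in> F \<Longrightarrow> g \<in> F \<Longrightarrow> h \<in> F \<Longrightarrow> E (\<lambda>x. f x + g x) h = E f h + E g h"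
  using form unfolding dirichlet_form_def by blast

lemma E_scale_left: "f \<in> F \<Longrightarrow> h \<in> F \<Longrightarrow> E (\<lambda>x. c * f x) h = c * E f h"
  using form unfolding dirichlet_form_def by blast

lemma E_minus_left: "f \<in> F \<Longrightarrow> h \<in> F \<Longrightarrow> E (\<lambda>x. - f x) h = - E f h"
  using E_scale_left[of f h "-1"] by simp

lemma E_diff_left: "f \<in> F \<Longrightarrow> g \<in> F \<Longrightarrow> h \<in> F \<Longrightarrow> E (\<lambda>x. f x - g x) h = E f h - E g h"
  using E_add_left[of f "\<lambda>x. - g x" h] by (simp add: F_minus E_minus_left)

lemma E_add_right:
  assumes "f \<in> F" "g \<in> F" "h \<in> F"
  shows "E h (\<lambda>x. f x + g x) = E h f + E h g"
  using E_add_left[OF assms] E_sym[OF assms(3) F_add[OF assms(1,2)]] E_sym[OF assms(3,1)] E_sym[OF assms(3,2)]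
  by linarith

lemma E_diff_right:
  assumes "f \<in> F" "g \<in> F" "h \<in> F"
  shows "E h (\<lambda>x. f x - g x) = E h f - E h g"
  using E_diff_left[OF assms] E_sym[OF assms(3) F_diff[OF assms(1,2)]] E_sym[OF assms(3,1)] E_sym[OF assms(3,2)]
  by linarith

lemma E_scale_right:
  assumes "f \<in> F" "h \<in> F"
  shows "E h (\<lambda>x. c * f x) = c * E h f"
  using E_scale_left[OF assms, of c] E_sym[OF assms(2) F_scale[OF assms(1)]] E_sym[OF assms(2,1)]
  by simp

lemma E_nonneg: "f \<in> F \<Longrightarrow> 0 \<le> E f f"
  using form unfolding dirichlet_form_def by blast

lemma E_diff_self:
  "f \<in> F \<Longrightarrow> g \<in> F \<Longrightarrow> E (\<lambda>x. f x - g x) (\<lambda>x. f x - g x) = E f f - 2 * E f g + E g g"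
  by (simp add: E_diff_left E_diff_right F_diff E_sym[of g f])

text \<open>Parallelogram identity, with the nonnegative energy of f + g dropped.\<close>

lemma E_diff_self_le:
  assumes "f \<in> F" "g \<in> F"
  shows "E (\<lambda>x. f x - g x) (\<lambda>x. f x - g x) \<le> 2 * E f f + 2 * E g g"
proof -
  have "0 \<le> E (\<lambda>x. f x + g x) (\<lambda>x. f x + g x)" using assms by (intro E_nonneg F_add)
  then show ?thesis using assms
    by (simp add: E_diff_self E_add_left E_add_right F_add E_sym[of g f])
qed

lemma E_add_scale_self:
  assumes "f \<in> F" "g \<in> F"
  shows "E (\<lambda>x. f x + l * g x) (\<lambda>x. f x + l * g x) = E f f + 2 * l * E f g + l\<^sup>2 * E g g"
proof -
  have "E (\<lambda>x. f x + l * g x) (\<lambda>x. f x + l * g x) = E f f + l * E f g + (l * E g f + l * (l * E g g))"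
    using assms by (simp add: E_add_left E_add_right F_add F_scale E_scale_left E_scale_right)
  then show ?thesis using E_sym[OF assms] by (simp add: power2_eq_square algebra_simps)
qed

lemma E_cauchy_schwarz_square:
  assumes "f \<in> F" "g \<in> F"
  shows "(E f g)\<^sup>2 \<le> E f f * E g g"
proof (rule quadratic_nonneg_discriminant)
  fix l
  have "0 \<le> E (\<lambda>x. f x + l * g x) (\<lambda>x. f x + l * g x)"
    using assms by (intro E_nonneg F_add F_scale)
  then show "0 \<le> E f f + 2 * l * E f g + l\<^sup>2 * E g g"
    by (simp add: E_add_scale_self assms)
qed (use assms in \<open>auto intro: E_nonneg\<close>)

lemma E_cauchy_schwarz:
  assumes "f \<in> F" "g \<in> F"
  shows "\<bar>E f g\<bar> \<le> sqrt (E f f) * sqrt (E g g)"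
  using real_sqrt_le_mono[OF E_cauchy_schwarz_square[OF assms]] by (simp add: real_sqrt_mult)

lemma F_closed:
  assumes "\<And>n. u n \<in> F" "\<And>e. e > 0 \<Longrightarrow> \<exists>N. \<forall>m\<ge>N. \<forall>n\<ge>N. E1norm \<mu> E (\<lambda>x. u m x - u n x) < e"
  obtains v where "v \<in> F" "(\<lambda>n::nat. E1norm \<mu> E (\<lambda>x. u n x - v x)) \<longlonglongrightarrow> 0"
proof -
  have "\<forall>u::nat \<Rightarrow> 'a \<Rightarrow> real. (\<forall>n. u n \<in> F) \<and>
        (\<forall>e>0. \<exists>N. \<forall>m\<ge>N. \<forall>n\<ge>N. E1norm \<mu> E (\<lambda>x. u m x - u n x) < e) \<longrightarrow>
        (\<exists>v\<in>F. (\<lambda>n. E1norm \<mu> E (\<lambda>x. u n x - v x)) \<longlonglongrightarrow> 0)"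
    using form unfolding dirichlet_form_def by (elim conjE)
  then have "\<exists>v\<in>F. (\<lambda>n. E1norm \<mu> E (\<lambda>x. u n x - v x)) \<longlonglongrightarrow> 0"
    using assms by (elim allE[of _ u] impE) auto
  then show ?thesis using that by blast
qed

definition clamp :: "real \<Rightarrow> ('a \<Rightarrow> real) \<Rightarrow> 'a \<Rightarrow> real" where
  "clamp K f = (\<lambda>x. min K (max 0 (f x)))"

lemma clamp1_F: "f \<in> F \<Longrightarrow> clamp 1 f \<in> F"
  and E_clamp1_le: "f \<in> F \<Longrightarrow> E (clamp 1 f) (clamp 1 f) \<le> E f f"
  using form unfolding dirichlet_form_def clamp_def by blast+

lemma clamp_scale: "K > 0 \<Longrightarrow> clamp K f = (\<lambda>x. K * clamp 1 (\<lambda>x. (1 / K) * f x) x)"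
  by (auto simp: clamp_def fun_eq_iff min_def max_def field_simps)

lemma clamp_F: "f \<in> F \<Longrightarrow> K > 0 \<Longrightarrow> clamp K f \<in> F"
  by (subst clamp_scale) (auto intro!: F_scale clamp1_F simp del: times_divide_eq_left mult_1_left)

lemma E_clamp_le:
  assumes "f \<in> F" "K > 0"
  shows "E (clamp K f) (clamp K f) \<le> E f f"
proof -
  let ?g = "\<lambda>x. (1 / K) * f x"
  have g: "?g \<in> F" using assms by (intro F_scale)
  have "E (clamp K f) (clamp K f) = K * (K * E (clamp 1 ?g) (clamp 1 ?g))"
    using assms g by (subst (1 2) clamp_scale) (simp_all add: E_scale_left E_scale_right clamp1_F F_scale)
  also have "\<dots> \<le> K * (K * E ?g ?g)"
    using assms E_clamp1_le[OF g] by (intro mult_left_mono) auto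
  also have "\<dots> = E f f"
    using assms by (simp add: E_scale_left[OF assms(1)] E_scale_right[OF assms(1)] F_scale g
        del: times_divide_eq_left mult_1_left)
  finally show ?thesis .
qed

text \<open>Perturbing a function that is already clamped by a multiple of the part that was cut off
  does not change its clamping, so the Markov property bounds the first variation.\<close>
lemma E_clamp_cross:
  assumes u: "u \<in> F"
  shows "0 \<le> E u (\<lambda>x. u x - clamp 1 u x)"
proof -
  let ?T = "clamp 1 u" and ?v = "\<lambda>x. u x - clamp 1 u x"
  have T: "?T \<in> F" and v: "?v \<in> F" using u by (auto intro: clamp1_F F_diff)
  have var: "0 \<le> 2 * E ?T ?v + l * E ?v ?v" if l: "0 < l" "l \<le> 1" for l
  proof -
    let ?w = "\<lambda>x. ?T x + l * ?v x"
    have w: "?w \<in> F" using T v by (intro F_add F_scale)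
    have "clamp 1 ?w x = ?T x" for x
    proof -
      consider "u x < 0" | "0 \<le> u x" "u x \<le> 1" | "u x > 1" by linarith
      then show ?thesis
        using l mult_pos_neg[of l "u x"] by cases (auto simp: clamp_def min_def max_def not_less)
    qed
    then have "clamp 1 ?w = ?T" by auto
    then have "E ?T ?T \<le> E ?w ?w" using E_clamp1_le[OF w] by simp
    also have "\<dots> = E ?T ?T + l * (2 * E ?T ?v + l * E ?v ?v)"
      unfolding E_add_scale_self[OF T v] by (simp add: power2_eq_square algebra_simps)
    finally show ?thesis using l by (simp add: zero_le_mult_iff)
  qed
  have "0 \<le> 2 * E ?T ?v"
  proof (rule ccontr)
    assume neg: "\<not> 0 \<le> 2 * E ?T ?v"
    have vv: "0 \<le> E ?v ?v" using v by (rule E_nonneg)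
    \<comment> \<open>Small enough that the quadratic term cannot outweigh the negative first
      variation; the + 1 guards against a vanishing energy of the part cut off.\<close>
    define l where "l = min 1 (- E ?T ?v / (E ?v ?v + 1))"
    have l: "0 < l" "l \<le> 1" using neg vv by (auto simp: l_def divide_neg_pos)
    have "l * E ?v ?v \<le> l * (E ?v ?v + 1)" using l by simp
    also have "\<dots> \<le> - E ?T ?v / (E ?v ?v + 1) * (E ?v ?v + 1)" using vv by (intro mult_right_mono) (auto simp: l_def)
    also have "\<dots> = - E ?T ?v" using vv by simp
    finally show False using var[OF l] neg by linarith
  qed
  moreover have "E u ?v = E (\<lambda>x. ?T x + ?v x) ?v" by simp
  then have "E u ?v = E ?T ?v + E ?v ?v" using E_add_left[OF T v v] by simp
  ultimately show ?thesis using E_nonneg[OF v] by simp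
qed

end

section \<open>The heat semigroup\<close>

locale heat = dirichlet \<mu> E F
  for \<mu> :: "'a::heine_borel measure" and E :: "('a \<Rightarrow> real) \<Rightarrow> ('a \<Rightarrow> real) \<Rightarrow> real" and F :: "('a \<Rightarrow> real) set" +
  fixes P :: "real \<Rightarrow> ('a \<Rightarrow> real) \<Rightarrow> ('a \<Rightarrow> real)"
  assumes heat: "heat_semigroup \<mu> E F P"
begin

abbreviation "ip \<equiv> l2inner \<mu>"
abbreviation "nrm \<equiv> l2norm \<mu>"

lemma P_L2: "f \<in> L2 \<mu> \<Longrightarrow> t \<ge> 0 \<Longrightarrow> P t f \<in> L2 \<mu>"
  using heat by (auto simp: heat_semigroup_def)

lemma P_measurable: "f \<in> L2 \<mu> \<Longrightarrow> t \<ge> 0 \<Longrightarrow> P t f \<in> borel_measurable \<mu>"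
  using P_L2 L2_measurable by blast

lemma P_F: "f \<in> L2 \<mu> \<Longrightarrow> t > 0 \<Longrightarrow> P t f \<in> F"
  using heat by (auto simp: heat_semigroup_def)

lemma P_0: "f \<in> L2 \<mu> \<Longrightarrow> AE x in \<mu>. P 0 f x = f x"
  using heat by (auto simp: heat_semigroup_def)

lemma P_tendsto_0: "f \<in> L2 \<mu> \<Longrightarrow> ((\<lambda>t. nrm (\<lambda>x. P t f x - f x)) \<longlongrightarrow> 0) (at_right 0)"
  using heat by (auto simp: heat_semigroup_def)

text \<open>Stands in for the generator applied to \<open>P t f\<close>: the strong time derivative
  of the orbit, of which \<open>heat_semigroup\<close> only asserts the existence.\<close>

definition W :: "real \<Rightarrow> ('a \<Rightarrow> real) \<Rightarrow> 'a \<Rightarrow> real" where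
  "W t f = (SOME w. w \<in> L2 \<mu> \<and> ((\<lambda>h. nrm (\<lambda>x. (P (t + h) f x - P t f x) / h - w x)) \<longlongrightarrow> 0) (at 0) \<and>
           (\<forall>\<phi>\<in>F. ip w \<phi> = - E (P t f) \<phi>))"

lemma W:
  assumes "f \<in> L2 \<mu>" "t > 0"
  shows W_L2: "W t f \<in> L2 \<mu>"
    and W_tendsto: "((\<lambda>h. nrm (\<lambda>x. (P (t + h) f x - P t f x) / h - W t f x)) \<longlongrightarrow> 0) (at 0)"
    and W_inner: "\<And>\<phi>. \<phi> \<in> F \<Longrightarrow> ip (W t f) \<phi> = - E (P t f) \<phi>"
proof -
  have "\<exists>w. w \<in> L2 \<mu> \<and> ((\<lambda>h. nrm (\<lambda>x. (P (t + h) f x - P t f x) / h - w x)) \<longlongrightarrow> 0) (at 0) \<and>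
           (\<forall>\<phi>\<in>F. ip w \<phi> = - E (P t f) \<phi>)"
    using heat assms unfolding heat_semigroup_def by blast
  from someI_ex[OF this, folded W_def]
  show "W t f \<in> L2 \<mu>"
    "((\<lambda>h. nrm (\<lambda>x. (P (t + h) f x - P t f x) / h - W t f x)) \<longlongrightarrow> 0) (at 0)"
    "\<And>\<phi>. \<phi> \<in> F \<Longrightarrow> ip (W t f) \<phi> = - E (P t f) \<phi>" by auto
qed

lemma quotient_L2:
  assumes "f \<in> L2 \<mu>" "t > 0"
  shows "\<forall>\<^sub>F h in at 0. (\<lambda>x. (P (t + h) f x - P t f x) / h) \<in> L2 \<mu>"
proof -
  have "\<forall>\<^sub>F h in at 0. t + h > 0"
    using assms(2) by (auto simp: eventually_at dist_real_def intro!: exI[of _ t])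
  then show ?thesis
    by eventually_elim (use assms in \<open>auto intro!: L2_divide L2_diff P_L2\<close>)
qed

lemma P_shift_L2:
  assumes "f \<in> L2 \<mu>" "t > 0"
  shows "\<forall>\<^sub>F h in at 0. P (t + h) f \<in> L2 \<mu>"
proof -
  have "\<forall>\<^sub>F h in at 0. t + h > 0"
    using assms(2) by (auto simp: eventually_at dist_real_def intro!: exI[of _ t])
  then show ?thesis
    by eventually_elim (use assms in \<open>auto intro!: P_L2\<close>)
qed

lemma P_tendsto:
  assumes "f \<in> L2 \<mu>" "t > 0"
  shows "((\<lambda>h. nrm (\<lambda>x. P (t + h) f x - P t f x)) \<longlongrightarrow> 0) (at 0)"
proof (rule Lim_null_comparison)
  let ?q = "\<lambda>h x. (P (t + h) f x - P t f x) / h"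
  show "\<forall>\<^sub>F h in at 0. norm (nrm (\<lambda>x. P (t + h) f x - P t f x))
      \<le> \<bar>h\<bar> * (nrm (\<lambda>x. ?q h x - W t f x) + nrm (W t f))"
    \<comment> \<open>The second fact serves only to exclude h = 0.\<close>
    using quotient_L2[OF assms] eventually_at_ball'[OF zero_less_one, of "0::real" UNIV]
  proof eventually_elim
    case (elim h)
    have "nrm (\<lambda>x. P (t + h) f x - P t f x) = nrm (\<lambda>x. h * ?q h x)" using elim by simp
    also have "\<dots> = \<bar>h\<bar> * nrm (\<lambda>x. (?q h x - W t f x) + W t f x)" by (subst l2norm_scale) simp
    also have "\<dots> \<le> \<bar>h\<bar> * (nrm (\<lambda>x. ?q h x - W t f x) + nrm (W t f))"
      using elim assms by (intro mult_left_mono l2norm_triangle L2_diff W_L2) auto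
    finally show ?case by (simp add: l2norm_nonneg)
  qed
  show "((\<lambda>h. \<bar>h\<bar> * (nrm (\<lambda>x. ?q h x - W t f x) + nrm (W t f))) \<longlongrightarrow> 0) (at 0)"
    by (rule tendsto_eq_intros W_tendsto[OF assms] refl | simp)+
qed

lemma ip_P_has_derivative:
  assumes "f \<in> L2 \<mu>" "g \<in> L2 \<mu>" "t > 0"
  shows "((\<lambda>s. ip (P s f) g) has_real_derivative ip (W t f) g) (at t)"
  unfolding DERIV_def
proof (rule Lim_transform_eventually)
  show "((\<lambda>h. ip (\<lambda>x. (P (t + h) f x - P t f x) / h) g) \<longlongrightarrow> ip (W t f) g) (at 0)"
    using assms by (intro l2inner_tendsto_left quotient_L2 W_L2 W_tendsto)
  show "\<forall>\<^sub>F h in at 0. ip (\<lambda>x. (P (t + h) f x - P t f x) / h) g = (ip (P (t + h) f) g - ip (P t f) g) / h"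
    using P_shift_L2[OF assms(1,3)]
    by eventually_elim (use assms in \<open>simp add: l2inner_divide_left l2inner_diff_left P_L2\<close>)
qed

text \<open>Product rule: the two factors contribute the energy of the pair with opposite signs, and
  these cancel because E is symmetric. Symmetry, the semigroup law and linearity of P all come from
  this cancellation.\<close>

lemma ip_P_P_has_derivative:
  assumes "f \<in> L2 \<mu>" "g \<in> L2 \<mu>" "0 < s" "s < T"
  shows "((\<lambda>s. ip (P s f) (P (T - s) g)) has_real_derivative 0) (at s)"
  unfolding DERIV_def
proof (rule Lim_transform_eventually)
  let ?q = "\<lambda>h x. (P (s + h) f x - P s f x) / h"
  let ?r = "\<lambda>h x. (P ((T - s) + h) g x - P (T - s) g x) / h"
  have T: "T - s > 0" using assms by simp
  \<comment> \<open>The second factor runs backwards in time, so its limits are taken along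
    -h.\<close>
  have neg: "filterlim uminus (at (0::real)) (at 0)"
    by (auto intro!: tendsto_eq_intros simp: filterlim_at eventually_at_filter)
  note c = filterlim_compose[OF _ neg] 
  have 1: "((\<lambda>h. ip (?q h) (P ((T - s) + - h) g)) \<longlongrightarrow> ip (W s f) (P (T - s) g)) (at 0)"
    using assms T
    by (intro l2inner_tendsto quotient_L2 W_L2 W_tendsto P_L2 c[OF P_tendsto[OF assms(2) T]])
      (use eventually_compose_filterlim[OF P_shift_L2[OF assms(2) T] neg] in auto)
  have 2: "((\<lambda>h. ip (?r (- h)) (P s f)) \<longlongrightarrow> ip (W (T - s) g) (P s f)) (at 0)"
    using assms T by (intro c[where g="\<lambda>h. ip (?r h) (P s f)", OF l2inner_tendsto_left] quotient_L2 W_L2 W_tendsto P_L2) auto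
  have "ip (W s f) (P (T - s) g) - ip (W (T - s) g) (P s f) = 0"
    using assms T by (simp add: W_inner P_F E_sym)
  with tendsto_diff[OF 1 2]
  show "((\<lambda>h. ip (?q h) (P ((T - s) + - h) g) - ip (?r (- h)) (P s f)) \<longlongrightarrow> 0) (at 0)" by simp
  show "\<forall>\<^sub>F h in at 0. ip (?q h) (P ((T - s) + - h) g) - ip (?r (- h)) (P s f)
     = (ip (P (s + h) f) (P (T - (s + h)) g) - ip (P s f) (P (T - s) g)) / h"
    using P_shift_L2[OF assms(1,3)] eventually_compose_filterlim[OF P_shift_L2[OF assms(2) T] neg]
      eventually_at_ball'[OF zero_less_one, of "0::real" UNIV]
  proof eventually_elim
    case (elim h)
    have e: "T - s + - h = T - (s + h)" by simp
    have m: "P (T - s) g \<in> L2 \<mu>" "P s f \<in> L2 \<mu>" using assms T by (auto intro: P_L2)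
    have 1: "ip (?q h) (P (T - (s + h)) g) = (ip (P (s + h) f) (P (T - (s + h)) g) - ip (P s f) (P (T - (s + h)) g)) / h"
      using elim m by (simp only: e l2inner_divide_left l2inner_diff_left)
    have 2: "ip (?r (- h)) (P s f) = (ip (P s f) (P (T - (s + h)) g) - ip (P s f) (P (T - s) g)) / (- h)"
      using elim m by (simp only: e l2inner_divide_left l2inner_diff_left l2inner_commute[of _ "P s f"])
    show ?case using elim unfolding 1[unfolded e[symmetric]] 2 by (simp add: e field_simps)
  qed
qed

lemma ip_P_P:
  assumes f: "f \<in> L2 \<mu>" and g: "g \<in> L2 \<mu>" and "0 < s" "s < T"
  shows "ip (P s f) (P (T - s) g) = ip f (P T g)"
proof -
  let ?a = "\<lambda>s. ip (P s f) (P (T - s) g)"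
  have T: "T > 0" using assms by simp
  have const: "?a r = ?a s" if r: "0 < r" "r < T" for r
  proof -
    have "\<exists>c. \<forall>x\<in>{0<..<T}. ?a x = c"
      using ip_P_P_has_derivative[OF f g] by (intro has_field_derivative_zero_constant)
        (auto intro: has_field_derivative_at_within)
    with r assms show ?thesis by auto
  qed
  have neg: "filterlim (\<lambda>h::real. - h) (at 0) (at_right 0)"
    by (auto intro!: tendsto_eq_intros simp: filterlim_at eventually_at_filter)
  have "(?a \<longlongrightarrow> ip f (P T g)) (at_right 0)"
  proof (rule l2inner_tendsto)
    show "\<forall>\<^sub>F s in at_right 0. P s f \<in> L2 \<mu>"
      using f by (auto simp: eventually_at_filter P_L2)
    show "\<forall>\<^sub>F s in at_right 0. P (T - s) g \<in> L2 \<mu>"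
      using eventually_compose_filterlim[OF P_shift_L2[OF g T] neg] by simp
    show "((\<lambda>n. nrm (\<lambda>x. P (T - n) g x - P T g x)) \<longlongrightarrow> 0) (at_right 0)"
      using filterlim_compose[OF P_tendsto[OF g T] neg] by simp
  qed (use assms in \<open>auto intro: P_L2 P_tendsto_0\<close>)
  moreover have "\<forall>\<^sub>F r in at_right 0. ?a r = ?a s"
    using const T by (auto simp: eventually_at_right_field intro!: exI[of _ T])
  ultimately have "((\<lambda>r. ?a s) \<longlongrightarrow> ip f (P T g)) (at_right (0::real))"
    by (rule Lim_transform_eventually)
  then show ?thesis by (simp add: tendsto_const_iff)
qed

text \<open>At the midpoint s = t/2 both factors in \<open>ip_P_P\<close> carry the same time, so
  exchanging f and g does not change the value.\<close>

lemma P_symmetric: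
  assumes f: "f \<in> L2 \<mu>" and g: "g \<in> L2 \<mu>" and t: "0 < t"
  shows "ip (P t f) g = ip f (P t g)"
proof -
  have "ip (P (t/2) f) (P (t - t/2) g) = ip f (P t g)" by (rule ip_P_P) (use assms in auto)
  moreover have "ip (P (t/2) g) (P (t - t/2) f) = ip g (P t f)" by (rule ip_P_P) (use assms in auto)
  moreover have "t - t/2 = t/2" by simp
  ultimately show ?thesis by (simp add: l2inner_commute)
qed

lemma P_semigroup:
  assumes f: "f \<in> L2 \<mu>" and "0 < s" "0 < t"
  shows "AE x in \<mu>. P s (P t f) x = P (s + t) f x"
proof (rule L2_ext)
  fix g assume g: "g \<in> L2 \<mu>"
  have "ip (P s (P t f)) g = ip (P t f) (P ((s + t) - t) g)"
    using assms g by (simp add: P_symmetric P_L2)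
  also have "\<dots> = ip (P (s + t) f) g"
    using ip_P_P[OF f g, of t "s + t"] assms g by (simp add: P_symmetric)
  finally show "ip (P s (P t f)) g = ip (P (s + t) f) g" .
qed (use assms in \<open>auto intro!: P_L2\<close>)

text \<open>Symmetry moves the operator onto the test function, where the inner product is linear;
  the heat equation does not provide linearity of P directly.\<close>

lemma P_add:
  assumes "f \<in> L2 \<mu>" "g \<in> L2 \<mu>" "0 < t"
  shows "AE x in \<mu>. P t (\<lambda>x. f x + g x) x = P t f x + P t g x"
proof (rule L2_ext)
  fix h assume "h \<in> L2 \<mu>"
  with assms show "ip (P t (\<lambda>x. f x + g x)) h = ip (\<lambda>x. P t f x + P t g x) h"
    by (simp add: P_symmetric L2_add l2inner_add_left P_L2)
qed (use assms in \<open>auto intro!: P_L2 L2_add\<close>)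

lemma P_scale:
  assumes "f \<in> L2 \<mu>" "0 < t"
  shows "AE x in \<mu>. P t (\<lambda>x. c * f x) x = c * P t f x"
proof (rule L2_ext)
  fix h assume "h \<in> L2 \<mu>"
  with assms show "ip (P t (\<lambda>x. c * f x)) h = ip (\<lambda>x. c * P t f x) h"
    by (simp add: P_symmetric L2_scale l2inner_scale_left P_L2)
qed (use assms in \<open>auto intro!: P_L2 L2_scale\<close>)

lemma P_diff:
  assumes "f \<in> L2 \<mu>" "g \<in> L2 \<mu>" "0 < t"
  shows "AE x in \<mu>. P t (\<lambda>x. f x - g x) x = P t f x - P t g x"
  using P_add[OF assms(1) L2_minus[OF assms(2)] assms(3)] P_scale[OF assms(2,3), of "-1"]
  by eventually_elim simp

lemma P_cong:
  assumes "f \<in> L2 \<mu>" "g \<in> L2 \<mu>" "AE x in \<mu>. f x = g x" "0 < t"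
  shows "AE x in \<mu>. P t f x = P t g x"
proof (rule L2_ext)
  fix h assume h: "h \<in> L2 \<mu>"
  have "ip f (P t h) = ip g (P t h)"
    using assms h by (intro l2inner_AE_cong) (auto simp: L2_measurable P_L2)
  with assms h show "ip (P t f) h = ip (P t g) h" by (simp add: P_symmetric)
qed (use assms in \<open>auto intro!: P_L2\<close>)

lemma P_sum:
  assumes "finite I" "\<And>i. i \<in> I \<Longrightarrow> f i \<in> L2 \<mu>" "0 < t"
  shows "AE x in \<mu>. P t (\<lambda>x. \<Sum>i\<in>I. f i x) x = (\<Sum>i\<in>I. P t (f i) x)"
  using assms(1,2)
proof (induction I rule: finite_induct)
  case empty
  show ?case using P_scale[OF L2_zero assms(3), of 0] by simp
next
  case (insert i I)
  have "AE x in \<mu>. P t (\<lambda>x. f i x + (\<Sum>i\<in>I. f i x)) x = P t (f i) x + P t (\<lambda>x. \<Sum>i\<in>I. f i x) x"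
    using insert assms by (intro P_add L2_sum) auto
  moreover have "AE x in \<mu>. P t (\<lambda>x. \<Sum>i\<in>I. f i x) x = (\<Sum>i\<in>I. P t (f i) x)"
    using insert by auto
  ultimately show ?case by eventually_elim (use insert in simp)
qed

end

section \<open>Markov property and contractivity of the semigroup\<close>

lemma square_dist_clamp_expansion:
  fixes a b :: real
  shows "\<bar>(a - min 1 (max 0 a))\<^sup>2 - (b - min 1 (max 0 b))\<^sup>2 - 2 * (b - min 1 (max 0 b)) * (a - b)\<bar> \<le> (a - b)\<^sup>2"
proof -
  define T where "T = (\<lambda>x::real. min 1 (max 0 x))"
  have "\<bar>(a - T a)\<^sup>2 - (b - T b)\<^sup>2 - 2 * (b - T b) * (a - b)\<bar> \<le> (a - b)\<^sup>2"
  proof (rule abs_leI)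
  \<comment> \<open>\<open>T a\<close> is the point of [0,1] nearest to a, and \<open>T b\<close> is
    a competitor.\<close>
  have "(a - T a)\<^sup>2 \<le> (a - T b)\<^sup>2"
    by (intro abs_le_square_iff[THEN iffD1]) (auto simp: T_def min_def max_def abs_if)
  then show "(a - T a)\<^sup>2 - (b - T b)\<^sup>2 - 2 * (b - T b) * (a - b) \<le> (a - b)\<^sup>2"
    by (simp add: power2_eq_square algebra_simps)
  have "(b - T b)\<^sup>2 + 2 * (b - T b) * (a - b) \<le> (a - T a)\<^sup>2"
  proof -
    have sq: "0 \<le> ((a - T a) - (b - T b))\<^sup>2" by simp
    \<comment> \<open>Variational inequality of the projection onto [0,1].\<close>
    have "0 \<le> (b - T b) * (T b - T a)"
    proof -
      have Ta: "0 \<le> T a" "T a \<le> 1" by (auto simp: T_def)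
      consider "b < 0" | "0 \<le> b" "b \<le> 1" | "b > 1" by linarith
      then show ?thesis
      proof cases
        case 1
        then have "T b = 0" by (simp add: T_def)
        with 1 Ta show ?thesis by (auto intro: mult_nonpos_nonneg)
      next
        case 2
        then have "T b = b" by (simp add: T_def)
        then show ?thesis by simp
      next
        case 3
        then have "T b = 1" by (simp add: T_def)
        with 3 Ta show ?thesis by (auto intro: mult_nonneg_nonneg)
      qed
    qed
    with sq show ?thesis by (simp add: power2_eq_square algebra_simps)
  qed
  then show "- ((a - T a)\<^sup>2 - (b - T b)\<^sup>2 - 2 * (b - T b) * (a - b)) \<le> (a - b)\<^sup>2"
    using zero_le_power2[of "a - b"] by linarith
  qed
  then show ?thesis by (simp only: T_def)
qed

lemma difference_quotient_bound:
  fixes h :: real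
  assumes "\<bar>N' - N - 2 * a\<bar> \<le> d" "h \<noteq> 0"
  shows "\<bar>(N' - N) / h - 2 * (a / h)\<bar> \<le> \<bar>h\<bar> * (d / h / h)"
proof -
  have "\<bar>(N' - N) / h - 2 * (a / h)\<bar> = \<bar>N' - N - 2 * a\<bar> / \<bar>h\<bar>"
    by (simp add: diff_divide_distrib flip: abs_divide)
  also have "\<dots> \<le> d / \<bar>h\<bar>" using assms by (intro divide_right_mono) auto
  also have "\<dots> = \<bar>h\<bar> * (d / h / h)" using assms by (simp add: field_simps)
  finally show ?thesis .
qed

lemma l2inner_divide_right: "l2inner M h (\<lambda>x. f x / c) = l2inner M h f / c"
  using l2inner_divide_left[of M f c h] by (simp add: l2inner_commute)

lemma nonincreasing_from_derivative:
  fixes f :: "real \<Rightarrow> real"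
  assumes "\<And>t. t > 0 \<Longrightarrow> (f has_real_derivative f' t) (at t)" "\<And>t. t > 0 \<Longrightarrow> f' t \<le> 0" "0 < s" "s \<le> t"
  shows "f t \<le> f s"
proof (rule DERIV_nonpos_imp_nonincreasing[OF assms(4)])
  fix x assume "s \<le> x"
  then have "x > 0" using assms(3) by simp
  from assms(1,2)[OF this] show "\<exists>y. (f has_real_derivative y) (at x) \<and> y \<le> 0" by blast
qed

context heat
begin

text \<open>Pointwise the signed distance to the interval [0,1]; its norm measures how far f is from
  satisfying 0 \<le> f \<le> 1.\<close>

definition residue :: "('a \<Rightarrow> real) \<Rightarrow> 'a \<Rightarrow> real" where
  "residue f = (\<lambda>x. f x - clamp 1 f x)"

lemma residue_L2: "f \<in> L2 \<mu> \<Longrightarrow> residue f \<in> L2 \<mu>"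
  by (rule L2_bound[of f]) (auto simp: residue_def clamp_def dest: L2_measurable)

text \<open>The squared distance of a real number to [0,1] has the derivative 2(b - T b) with a
  quadratic remainder. Integrated, the remainder is the squared norm of the increment of the orbit,
  which is of order \<open>h\<^sup>2\<close> because the difference quotients converge.\<close>

lemma residue_norm_has_derivative:
  assumes f: "f \<in> L2 \<mu>" and t: "t > 0"
  shows "((\<lambda>s. ip (residue (P s f)) (residue (P s f))) has_real_derivative
    2 * ip (W t f) (residue (P t f))) (at t)"
  unfolding DERIV_def
proof -
  let ?N = "\<lambda>s. ip (residue (P s f)) (residue (P s f))"
  let ?q = "\<lambda>h x. (P (t + h) f x - P t f x) / h"
  have u: "P t f \<in> L2 \<mu>" and ru: "residue (P t f) \<in> L2 \<mu>" using f t by (auto intro!: P_L2 residue_L2)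
  have lim: "((\<lambda>h. 2 * ip (?q h) (residue (P t f))) \<longlongrightarrow> 2 * ip (W t f) (residue (P t f))) (at 0)"
    using assms ru by (intro tendsto_mult tendsto_const l2inner_tendsto_left quotient_L2 W_L2 W_tendsto)
  have "((\<lambda>h. (?N (t + h) - ?N t) / h - 2 * ip (?q h) (residue (P t f))) \<longlongrightarrow> 0) (at 0)"
  proof (rule Lim_null_comparison)
    show "\<forall>\<^sub>F h in at 0. norm ((?N (t + h) - ?N t) / h - 2 * ip (?q h) (residue (P t f))) \<le> \<bar>h\<bar> * ip (?q h) (?q h)"
      using quotient_L2[OF assms] P_shift_L2[OF assms] eventually_at_ball'[OF zero_less_one, of "0::real" UNIV]
    proof eventually_elim
      case (elim h)
      let ?v = "P (t + h) f" and ?u = "P t f"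
      have h: "h \<noteq> 0" using elim by simp
      have rv: "residue ?v \<in> L2 \<mu>" using elim by (intro residue_L2)
      have d: "(\<lambda>x. ?v x - ?u x) \<in> L2 \<mu>" using elim u by (intro L2_diff)
      have eq: "?N (t + h) - ?N t - 2 * ip (\<lambda>x. ?v x - ?u x) (residue ?u)
        = (\<integral>x. (residue ?v x)\<^sup>2 - (residue ?u x)\<^sup>2 - 2 * residue ?u x * (?v x - ?u x) \<partial>\<mu>)"
        using L2_integrable_mult[OF rv rv] L2_integrable_mult[OF ru ru] L2_integrable_mult[OF ru d]
        by (simp add: l2inner_def power2_eq_square mult.commute mult.assoc mult.left_commute)
      define k where "k x = (residue ?v x)\<^sup>2 - (residue ?u x)\<^sup>2 - 2 * residue ?u x * (?v x - ?u x)" for x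
      have k: "integrable \<mu> k"
        using L2_integrable_mult[OF rv rv] L2_integrable_mult[OF ru ru] L2_integrable_mult[OF ru d]
        unfolding k_def by (simp add: power2_eq_square mult.assoc)
      have kle: "\<bar>k x\<bar> \<le> (?v x - ?u x) * (?v x - ?u x)" for x
        unfolding k_def residue_def clamp_def power2_eq_square[of "?v x - ?u x", symmetric]
        by (rule square_dist_clamp_expansion)
      have "\<bar>integral\<^sup>L \<mu> k\<bar> \<le> (\<integral>x. \<bar>k x\<bar> \<partial>\<mu>)"
        by (rule integral_norm_bound[of \<mu> k, unfolded real_norm_def])
      also have "\<dots> \<le> (\<integral>x. (?v x - ?u x) * (?v x - ?u x) \<partial>\<mu>)"
        using kle by (intro integral_mono integrable_abs k L2_integrable_mult d) auto
      finally have "\<bar>?N (t + h) - ?N t - 2 * ip (\<lambda>x. ?v x - ?u x) (residue ?u)\<bar>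
          \<le> ip (\<lambda>x. ?v x - ?u x) (\<lambda>x. ?v x - ?u x)"
        unfolding eq k_def[symmetric] l2inner_def[of _ "\<lambda>x. ?v x - ?u x" "\<lambda>x. ?v x - ?u x"] .
      then show ?case
        unfolding real_norm_def l2inner_divide_left l2inner_divide_right
        by (rule difference_quotient_bound) (rule h)
    qed
    have "((\<lambda>h. ip (?q h) (?q h)) \<longlongrightarrow> ip (W t f) (W t f)) (at 0)"
      using assms by (intro l2inner_tendsto quotient_L2 W_L2 W_tendsto)
    from tendsto_mult[OF tendsto_rabs_zero[OF tendsto_ident_at] this]
    show "((\<lambda>h. \<bar>h\<bar> * ip (?q h) (?q h)) \<longlongrightarrow> 0) (at 0)" by simp
  qed
  from tendsto_add[OF this lim]
  show "((\<lambda>h. (?N (t + h) - ?N t) / h) \<longlongrightarrow> 2 * ip (W t f) (residue (P t f))) (at 0)" by simp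
qed

text \<open>The norm of the residue cannot increase: its derivative is a negative multiple of the
  cross term in \<open>E_clamp_cross\<close>. It tends to 0 at time 0, since there it is dominated
  by the distance between \<open>P s f\<close> and f, whose values already lie in [0,1].\<close>

lemma P_unit_interval:
  assumes f: "f \<in> L2 \<mu>" and f01: "AE x in \<mu>. 0 \<le> f x \<and> f x \<le> 1" and t: "t > 0"
  shows "AE x in \<mu>. 0 \<le> P t f x \<and> P t f x \<le> 1"
proof -
  let ?N = "\<lambda>s. nrm (residue (P s f))"
  have mono: "?N t \<le> ?N s" if s: "0 < s" "s \<le> t" for s
  proof -
    have "ip (residue (P t f)) (residue (P t f)) \<le> ip (residue (P s f)) (residue (P s f))"
    proof (rule nonincreasing_from_derivative[OF residue_norm_has_derivative[OF f]])
      fix r :: real assume r: "r > 0"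
      have u: "P r f \<in> F" using f r by (rule P_F)
      then have "residue (P r f) \<in> F" unfolding residue_def by (intro F_diff clamp1_F)
      then have "ip (W r f) (residue (P r f)) = - E (P r f) (residue (P r f))" by (rule W_inner[OF f r])
      also have "\<dots> \<le> 0" using E_clamp_cross[OF u] by (simp add: residue_def)
      finally show "2 * ip (W r f) (residue (P r f)) \<le> 0" by simp
    qed (use s in auto)
    then show ?thesis by (simp add: l2norm_def)
  qed
  have le: "?N s \<le> nrm (\<lambda>x. P s f x - f x)" if "s > 0" for s
  proof (rule l2norm_mono)
    show "(\<lambda>x. P s f x - f x) \<in> L2 \<mu>" "residue (P s f) \<in> borel_measurable \<mu>"
      using f that by (auto intro!: L2_diff P_L2 residue_L2 L2_measurable)
    show "AE x in \<mu>. \<bar>residue (P s f) x\<bar> \<le> \<bar>P s f x - f x\<bar>"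
      using f01 by eventually_elim (auto simp: residue_def clamp_def)
  qed
  have "?N t \<le> 0"
  proof (rule tendsto_lowerbound[OF P_tendsto_0[OF f]])
    show "\<forall>\<^sub>F s in at_right 0. ?N t \<le> nrm (\<lambda>x. P s f x - f x)"
      unfolding eventually_at_right_field using t by (intro exI[of _ t]) (auto intro!: order_trans[OF mono le])
  qed simp
  then have "?N t = 0" using l2norm_nonneg[of \<mu> "residue (P t f)"] by simp
  then have "AE x in \<mu>. residue (P t f) x = 0"
    by (intro l2norm_zero_AE residue_L2 P_L2 f) (use t in auto)
  then show ?thesis by eventually_elim (auto simp: residue_def clamp_def min_def max_def split: if_splits)
qed

lemma P_bounded:
  assumes f: "f \<in> L2 \<mu>" and fK: "AE x in \<mu>. 0 \<le> f x \<and> f x \<le> K" and t: "t > 0"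
  shows "AE x in \<mu>. 0 \<le> P t f x \<and> P t f x \<le> K"
proof (cases "K > 0")
  case True
  have "AE x in \<mu>. 0 \<le> P t (\<lambda>x. (1 / K) * f x) x \<and> P t (\<lambda>x. (1 / K) * f x) x \<le> 1"
  proof (rule P_unit_interval)
    show "AE x in \<mu>. 0 \<le> (1 / K) * f x \<and> (1 / K) * f x \<le> 1"
      using fK by eventually_elim (use True in \<open>auto simp: field_simps\<close>)
  qed (use f t in \<open>auto intro: L2_divide\<close>)
  moreover have "AE x in \<mu>. P t (\<lambda>x. (1 / K) * f x) x = (1 / K) * P t f x"
    using f t by (rule P_scale)
  ultimately show ?thesis
  proof eventually_elim
    case (elim x)
    from elim(1)[unfolded elim(2)] True show ?case by (auto simp: field_simps zero_le_divide_iff)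
  qed
next
  case False
  \<comment> \<open>For K \<le> 0 the bounds force f = 0 almost everywhere; for K < 0 they are
    contradictory, so that every property holds almost everywhere.\<close>
  have "AE x in \<mu>. f x = 0 * f x" using fK by eventually_elim (use False in auto)
  from P_cong[OF f L2_scale[OF f] this t] P_scale[OF f t, of 0] have z: "AE x in \<mu>. P t f x = 0"
    by eventually_elim simp
  show ?thesis
  proof (cases "K = 0")
    case True
    then show ?thesis using z by auto
  next
    case nz: False
    have "AE x in \<mu>. False" using fK by eventually_elim (use nz False in auto)
    then show ?thesis by (auto elim: eventually_mono)
  qed
qed

lemma P_contraction:
  assumes f: "f \<in> L2 \<mu>" and s: "0 < s"
  shows "nrm (P s f) \<le> nrm f"
proof -
  have der: "((\<lambda>r. ip (P r f) (P r f)) has_real_derivative - 2 * E (P t f) (P t f)) (at t)" if t: "t > 0" for t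
    unfolding DERIV_def
  proof (rule Lim_transform_eventually)
    let ?q = "\<lambda>h x. (P (t + h) f x - P t f x) / h"
    have u: "P t f \<in> L2 \<mu>" using f t by (auto intro: P_L2)
    \<comment> \<open>Difference of squares: the increment of the squared norm is the increment of
      the orbit paired with the sum of its two values.\<close>
    have 1: "((\<lambda>h. ip (?q h) (P (t + h) f)) \<longlongrightarrow> ip (W t f) (P t f)) (at 0)"
      using f t u by (intro l2inner_tendsto quotient_L2 W_L2 W_tendsto P_shift_L2 P_tendsto)
    have 2: "((\<lambda>h. ip (?q h) (P t f)) \<longlongrightarrow> ip (W t f) (P t f)) (at 0)"
      using f t u by (intro l2inner_tendsto_left quotient_L2 W_L2 W_tendsto)
    show "((\<lambda>h. ip (?q h) (P (t + h) f) + ip (?q h) (P t f)) \<longlongrightarrow> - 2 * E (P t f) (P t f)) (at 0)"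
      by (rule tendsto_eq_rhs[OF tendsto_add[OF 1 2]]) (simp add: W_inner f t P_F)
    show "\<forall>\<^sub>F h in at 0. ip (?q h) (P (t + h) f) + ip (?q h) (P t f)
       = (ip (P (t + h) f) (P (t + h) f) - ip (P t f) (P t f)) / h"
      using P_shift_L2[OF f t] eventually_at_ball'[OF zero_less_one, of "0::real" UNIV]
    proof eventually_elim
      case (elim h)
      with u show ?case using l2inner_commute[of \<mu> "P t f" "P (t + h) f"]
        by (simp only: l2inner_divide_left l2inner_diff_left) (simp add: diff_divide_distrib)
    qed
  qed
  have mono: "ip (P s f) (P s f) \<le> ip (P r f) (P r f)" if "0 < r" "r \<le> s" for r
    by (rule nonincreasing_from_derivative[OF der]) (use that f in \<open>auto intro: E_nonneg P_F\<close>)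
  have "((\<lambda>r. ip (P r f) (P r f)) \<longlongrightarrow> ip f f) (at_right 0)"
    using f by (intro l2inner_tendsto P_tendsto_0) (auto simp: eventually_at_filter P_L2)
  then have "ip (P s f) (P s f) \<le> ip f f"
    by (rule tendsto_lowerbound) (use mono s in \<open>auto simp: eventually_at_right_field intro!: exI[of _ s]\<close>)
  then show ?thesis by (simp add: l2norm_def)
qed

text \<open>\<open>P_bounded\<close> needs a bounded function. The truncations of f at height n
  converge to f in norm, and contractivity carries this over to their images.\<close>

lemma P_nonneg:
  assumes f: "f \<in> L2 \<mu>" and f0: "AE x in \<mu>. 0 \<le> f x" and t: "t > 0"
  shows "AE x in \<mu>. 0 \<le> P t f x"
proof -
  have [measurable]: "f \<in> borel_measurable \<mu>" using f by (rule L2_measurable)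
  define g where "g = (\<lambda>n x. min (f x) (real n))"
  have [measurable]: "g n \<in> borel_measurable \<mu>" for n unfolding g_def by measurable
  have g: "g n \<in> L2 \<mu>" for n
    by (rule L2_AE_bound[OF f]) (use f0 in \<open>auto simp: g_def elim: eventually_mono\<close>)
  have lim: "(\<lambda>n. ip (\<lambda>x. g n x - f x) (\<lambda>x. g n x - f x)) \<longlonglongrightarrow> ip (\<lambda>x. 0) (\<lambda>x. 0)"
    unfolding l2inner_def
  proof (rule integral_dominated_convergence[where w="\<lambda>x. f x * f x"])
    show "AE x in \<mu>. (\<lambda>n. (g n x - f x) * (g n x - f x)) \<longlonglongrightarrow> 0 * 0"
    proof (rule AE_I2, rule tendsto_eventually)
      fix x
      have "\<forall>\<^sub>F n in sequentially. f x \<le> real n"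
        using filterlim_real_sequentially by (auto simp: filterlim_at_top)
      then show "\<forall>\<^sub>F n in sequentially. (g n x - f x) * (g n x - f x) = 0 * 0"
        by eventually_elim (simp add: g_def)
    qed
    show "AE x in \<mu>. norm ((g n x - f x) * (g n x - f x)) \<le> f x * f x" for n
      using f0 by eventually_elim (auto simp: g_def min_def abs_mult intro!: mult_mono)
  qed (use f g in \<open>auto intro: L2_integrable_mult simp: L2_measurable\<close>)
  then have "(\<lambda>n. sqrt (ip (\<lambda>x. g n x - f x) (\<lambda>x. g n x - f x))) \<longlonglongrightarrow> sqrt (ip (\<lambda>x. 0) (\<lambda>x. 0))"
    by (rule tendsto_real_sqrt)
  then have gf: "(\<lambda>n. nrm (\<lambda>x. g n x - f x)) \<longlonglongrightarrow> 0"
    by (simp add: l2norm_def l2inner_def)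
  have "(\<lambda>n. nrm (\<lambda>x. P t (g n) x - P t f x)) \<longlonglongrightarrow> 0"
  proof (rule Lim_null_comparison[OF _ gf], rule always_eventually, rule allI)
    fix n
    have "nrm (\<lambda>x. P t (g n) x - P t f x) = nrm (P t (\<lambda>x. g n x - f x))"
    proof (rule l2norm_AE_cong)
      show "AE x in \<mu>. P t (g n) x - P t f x = P t (\<lambda>x. g n x - f x) x"
        using P_diff[OF g[of n] f t] by eventually_elim simp
    qed (use g f t in \<open>auto intro!: L2_measurable L2_diff P_L2\<close>)
    also have "\<dots> \<le> nrm (\<lambda>x. g n x - f x)"
      using g f t by (intro P_contraction L2_diff)
    finally show "norm (nrm (\<lambda>x. P t (g n) x - P t f x)) \<le> nrm (\<lambda>x. g n x - f x)"
      by (simp add: l2norm_nonneg)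
  qed
  then have "(\<lambda>n. nrm (\<lambda>x. - P t (g n) x - - P t f x)) \<longlonglongrightarrow> 0"
    using l2norm_minus[of \<mu> "\<lambda>x. P t (g _) x - P t f x"] by simp
  then have "AE x in \<mu>. - P t f x \<le> 0"
  proof (rule AE_le_L2_limit[rotated 4])
    show "\<forall>\<^sub>F n in sequentially. AE x in \<mu>. - P t (g n) x \<le> 0"
    proof (rule always_eventually, rule allI)
      fix n
      have "AE x in \<mu>. 0 \<le> P t (g n) x \<and> P t (g n) x \<le> real n"
        by (rule P_bounded[OF g _ t]) (use f0 in \<open>auto simp: g_def elim: eventually_mono\<close>)
      then show "AE x in \<mu>. - P t (g n) x \<le> 0" by eventually_elim simp
    qed
    show "\<forall>\<^sub>F n in sequentially. (\<lambda>x. - P t (g n) x) \<in> L2 \<mu>"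
      using g t by (intro always_eventually allI L2_minus P_L2) auto
  qed (use f t in \<open>auto intro!: L2_minus P_L2\<close>)
  then show ?thesis by eventually_elim simp
qed

lemma P_mono:
  assumes "f \<in> L2 \<mu>" "g \<in> L2 \<mu>" "AE x in \<mu>. f x \<le> g x" "t > 0"
  shows "AE x in \<mu>. P t f x \<le> P t g x"
proof -
  have "AE x in \<mu>. 0 \<le> P t (\<lambda>x. g x - f x) x"
    using assms by (intro P_nonneg L2_diff) (auto elim: eventually_mono)
  with P_diff[OF assms(2,1,4)] show ?thesis by eventually_elim simp
qed

end

section \<open>Energy along the semigroup and its limit at time zero\<close>

context heat
begin

lemma ip_P_P_add:
  assumes "f \<in> L2 \<mu>" "0 < s" "0 < r"
  shows "ip (P s f) (P r f) = ip (P (s + r) f) f"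
  using ip_P_P[OF assms(1,1,2), of "s + r"] assms P_symmetric[OF assms(1,1), of "s + r"] by simp

text \<open>Minus the derivative of \<open>ip (P t f) f\<close>. By \<open>E_P_P\<close> it is also
  the energy of \<open>P (t/2) f\<close>; in spectral terms, the integral of \<lambda>
  exp(-\<lambda> t).\<close>

definition decay :: "('a \<Rightarrow> real) \<Rightarrow> real \<Rightarrow> real" where
  "decay f t = - ip (W t f) f"

text \<open>One function of the first time is differentiated twice: by the heat equation, and after
  both times have been collected in a single P.\<close>

lemma E_P_P:
  assumes f: "f \<in> L2 \<mu>" and s: "0 < s" and r: "0 < r"
  shows "E (P s f) (P r f) = decay f (s + r)"
proof -
  have 1: "((\<lambda>x. ip (P x f) (P r f)) has_real_derivative ip (W s f) (P r f)) (at s)"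
    using f r s by (intro ip_P_has_derivative P_L2) auto
  have "((\<lambda>x. ip (P x f) f) has_real_derivative ip (W (s + r) f) f) (at (s + r))"
    using f r s by (intro ip_P_has_derivative) auto
  then have 2: "((\<lambda>x. ip (P (x + r) f) f) has_real_derivative ip (W (s + r) f) f) (at s)"
    by (simp add: DERIV_shift)
  have "((\<lambda>x. ip (P x f) (P r f)) has_real_derivative ip (W (s + r) f) f) (at s)"
    by (rule has_field_derivative_transform_within_open[OF 2, of "{0<..}"])
      (use s r f in \<open>auto simp: ip_P_P_add\<close>)
  from DERIV_unique[OF 1 this] W_inner[OF f s P_F[OF f r]] show ?thesis
    by (simp add: decay_def)
qed

lemma E_P_self: "f \<in> F \<Longrightarrow> 0 < s \<Longrightarrow> E (P s f) f = decay f s"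
  using W_inner[of f s f] by (simp add: decay_def F_L2)

text \<open>Midpoint convexity of \<open>ip (P t f) f\<close>: the second difference is the squared
  norm of the difference of the orbit at two half times.\<close>

lemma second_difference:
  assumes f: "f \<in> L2 \<mu>" and s: "0 < s" and h: "0 < h"
  shows "2 * ip (P (s + h) f) f \<le> ip (P s f) f + ip (P (s + 2 * h) f) f"
proof -
  let ?u = "P (s/2) f" and ?v = "P (s/2 + h) f"
  have u: "?u \<in> L2 \<mu>" and v: "?v \<in> L2 \<mu>" using f s h by (auto intro: P_L2)
  have e: "s/2 + s/2 = s" "s/2 + (s/2 + h) = s + h" "(s/2 + h) + (s/2 + h) = s + 2 * h" by (auto simp: field_simps)
  have "0 \<le> ip (\<lambda>x. ?u x - ?v x) (\<lambda>x. ?u x - ?v x)" by (rule l2inner_self_nonneg)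
  also have "\<dots> = ip ?u ?u - 2 * ip ?u ?v + ip ?v ?v"
    using u v l2inner_commute[of \<mu> ?v ?u] by (simp add: l2inner_diff_left l2inner_diff_right L2_diff)
  also have "ip ?u ?u = ip (P s f) f" using ip_P_P_add[OF f, of "s/2" "s/2"] s e by simp
  also have "ip ?u ?v = ip (P (s + h) f) f" using ip_P_P_add[OF f, of "s/2" "s/2 + h"] s h unfolding e by simp
  also have "ip ?v ?v = ip (P (s + 2 * h) f) f" using ip_P_P_add[OF f, of "s/2 + h" "s/2 + h"] s h unfolding e by simp
  finally show ?thesis by simp
qed

text \<open>In a convex sequence the first decrement is the largest. This is what compares
  increments at the times \<open>\<psi> e\<close> and \<open>\<psi> R\<close> in
  \<open>scale_gain\<close>.\<close>

lemma ip_P_decrement_le: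
  assumes g: "g \<in> L2 \<mu>" and s: "0 < s" and n: "n \<ge> 1"
  shows "ip g g - ip (P (real n * s) g) g \<le> real n * (ip g g - ip (P s g) g)"
proof -
  define b where "b k = (if k = 0 then ip g g else ip (P (real k * s) g) g)" for k :: nat
  have conv: "2 * b (Suc k) \<le> b k + b (Suc (Suc k))" for k
  proof (cases "k = 0")
    case True
    have u: "P s g \<in> L2 \<mu>" using g s by (auto intro: P_L2)
    have "0 \<le> ip (\<lambda>x. g x - P s g x) (\<lambda>x. g x - P s g x)" by (rule l2inner_self_nonneg)
    also have "\<dots> = ip g g - 2 * ip (P s g) g + ip (P s g) (P s g)"
      using u g l2inner_commute[of \<mu> g "P s g"] by (simp add: l2inner_diff_left l2inner_diff_right L2_diff)
    also have "ip (P s g) (P s g) = ip (P (2 * s) g) g" using ip_P_P_add[OF g s s] by simp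
    finally show ?thesis using True by (simp add: b_def)
  next
    case False
    with s have "0 < real k * s" by simp
    from second_difference[OF g this s] False show ?thesis by (simp add: b_def algebra_simps)
  qed
  have dec: "b k - b (Suc k) \<le> b 0 - b (Suc 0)" for k
  proof (induction k)
    case (Suc k)
    then show ?case using conv[of k] by simp
  qed simp
  have "b 0 - b k \<le> real k * (b 0 - b (Suc 0))" for k
  proof (induction k)
    case (Suc k)
    then show ?case using dec[of k] by (simp add: algebra_simps)
  qed simp
  from this[of n] n show ?thesis by (simp add: b_def)
qed

lemma decay_nonneg: "f \<in> L2 \<mu> \<Longrightarrow> 0 < t \<Longrightarrow> 0 \<le> decay f t"
  using E_P_P[of f "t/2" "t/2"] E_nonneg[OF P_F[of f "t/2"]] by simp

text \<open>The derivative of a convex function increases, and \<open>decay\<close> is minus such a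
  derivative.\<close>

lemma decay_antimono:
  assumes f: "f \<in> L2 \<mu>" and "0 < s" "s < t"
  shows "decay f t \<le> decay f s"
proof -
  define a where "a r = ip (P r f) f" for r
  have der: "((\<lambda>h. (a (r + h) - a r) / h) \<longlongrightarrow> - decay f r) (at 0)" if "r > 0" for r
    using ip_P_has_derivative[OF f f that] by (simp add: DERIV_def a_def decay_def)
  \<comment> \<open>Steps of this size lead from s to t in a whole number, so second differences can
    be telescoped between the two times.\<close>
  define h where "h n = (t - s) / real (Suc n)" for n
  have h_pos: "h n > 0" for n using assms by (simp add: h_def)
  have h_lim: "filterlim h (at 0) sequentially"
    unfolding filterlim_at
  proof
    have "(\<lambda>n. (t - s) * inverse (real (Suc n))) \<longlonglongrightarrow> (t - s) * 0"
      by (intro tendsto_intros LIMSEQ_inverse_real_of_nat)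
    then show "h \<longlonglongrightarrow> 0" by (simp add: h_def[abs_def] divide_inverse)
    show "\<forall>\<^sub>F n in sequentially. h n \<in> UNIV \<and> h n \<noteq> 0"
      by (intro always_eventually allI conjI UNIV_I) (metis h_pos less_irrefl)
  qed
  have step: "a (s + h n) - a s \<le> a (t + h n) - a t" for n
  proof -
    have "a (s + h n) - a s \<le> a (s + real k * h n + h n) - a (s + real k * h n)" for k
    proof (induction k)
      case (Suc k)
      have "0 < s + real k * h n" using assms h_pos[of n] by (simp add: add_pos_nonneg less_imp_le)
      from second_difference[OF f this h_pos[of n]] Suc show ?case
        by (simp add: a_def algebra_simps)
    qed simp
    from this[of "Suc n"] show ?thesis by (simp add: h_def del: of_nat_Suc)
  qed
  have "- decay f s \<le> - decay f t"
  proof (rule LIMSEQ_le)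
    show "(\<lambda>n. (a (s + h n) - a s) / h n) \<longlonglongrightarrow> - decay f s"
      using filterlim_compose[OF der h_lim, of s] assms by simp
    show "(\<lambda>n. (a (t + h n) - a t) / h n) \<longlonglongrightarrow> - decay f t"
      using filterlim_compose[OF der h_lim, of t] assms by simp
    show "\<exists>N. \<forall>n\<ge>N. (a (s + h n) - a s) / h n \<le> (a (t + h n) - a t) / h n"
      by (intro exI[of _ 0] allI impI divide_right_mono step less_imp_le[OF h_pos])
  qed
  then show ?thesis by simp
qed

text \<open>Cauchy-Schwarz bounds the square of \<open>decay f s\<close> by
  \<open>decay f (2 * s)\<close> times the energy of f, and monotonicity lets one factor be
  cancelled.\<close>

lemma decay_le_energy:
  assumes f: "f \<in> F" and s: "0 < s"
  shows "decay f s \<le> E f f"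
proof (cases "decay f s = 0")
  case True
  then show ?thesis using E_nonneg[OF f] by simp
next
  case False
  have fL: "f \<in> L2 \<mu>" using f by (rule F_L2)
  have pos: "0 < decay f s" using decay_nonneg[OF fL s] False by simp
  have "(decay f s)\<^sup>2 \<le> E (P s f) (P s f) * E f f"
    using E_cauchy_schwarz_square[OF P_F[OF fL s] f] E_P_self[OF f s] by simp
  also have "E (P s f) (P s f) = decay f (2 * s)" using E_P_P[OF fL s s] by simp
  also have "decay f (2 * s) * E f f \<le> decay f s * E f f"
    using decay_antimono[OF fL s, of "2 * s"] s E_nonneg[OF f] by (intro mult_right_mono) auto
  finally show ?thesis using pos by (simp add: power2_eq_square)
qed

lemma E_P_diff:
  assumes f: "f \<in> L2 \<mu>" and "0 < s" "0 < r"
  shows "E (\<lambda>x. P s f x - P r f x) (\<lambda>x. P s f x - P r f x) = decay f (2 * s) - 2 * decay f (s + r) + decay f (2 * r)"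
  using assms by (simp add: E_diff_self P_F E_P_P)

lemma nrm_le_E1norm: "f \<in> F \<Longrightarrow> nrm f \<le> E1norm \<mu> E f"
  using E_nonneg[of f] by (simp add: E1norm_def l2norm_def)

text \<open>Being monotone and bounded, \<open>decay f\<close> has a limit l at 0. Energies of
  differences of the orbit are second differences of \<open>decay\<close>, so the orbit is Cauchy in
  energy; closedness yields a limit, which must agree with f almost everywhere, and this forces l to
  be the energy of f.\<close>

lemma energy_tendsto_0:
  assumes f: "f \<in> F"
  shows "((\<lambda>s. E (\<lambda>x. P s f x - f x) (\<lambda>x. P s f x - f x)) \<longlongrightarrow> 0) (at_right 0)"
proof -
  have fL: "f \<in> L2 \<mu>" using f by (rule F_L2)
  define l where "l = (SUP s\<in>{0<..}. decay f s)"
  have bdd: "bdd_above (decay f ` {0<..})"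
    using decay_le_energy[OF f] by (intro bdd_aboveI[of _ "E f f"]) auto
  have ub: "decay f s \<le> l" if "s > 0" for s
    unfolding l_def using bdd that by (intro cSUP_upper) auto
  have near: "\<exists>d>0. \<forall>s. 0 < s \<and> s < d \<longrightarrow> l - e < decay f s" if e: "e > 0" for e
  proof -
    have "l - e < (SUP s\<in>{0<..}. decay f s)" using e by (simp add: l_def)
    then obtain d where d: "d > 0" "l - e < decay f d"
      using bdd by (subst (asm) less_cSUP_iff) auto
    then show ?thesis using decay_antimono[OF fL] by (intro exI[of _ d]) (auto intro: less_le_trans)
  qed
  have clim: "(decay f \<longlongrightarrow> l) (at_right 0)"
  proof (rule tendstoI)
    fix e :: real assume "e > 0"
    from near[OF this] obtain d where d: "d > 0" "\<And>s. 0 < s \<Longrightarrow> s < d \<Longrightarrow> l - e < decay f s" by blast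
    show "\<forall>\<^sub>F s in at_right 0. dist (decay f s) l < e"
      unfolding eventually_at_right_field
    proof (intro exI[of _ d] conjI allI impI d(1))
      fix y assume "0 < y" "y < d"
      then show "dist (decay f y) l < e" using d(2)[of y] ub[of y] by (simp add: dist_real_def)
    qed
  qed
  define e where "e s = E (\<lambda>x. P s f x - f x) (\<lambda>x. P s f x - f x)" for s
  have e_eq: "e s = decay f (2 * s) - 2 * decay f s + E f f" if "s > 0" for s
    unfolding e_def using that f fL by (simp add: E_diff_self P_F E_P_P E_P_self)
  have dbl: "filterlim (\<lambda>s::real. 2 * s) (at_right 0) (at_right 0)"
    by (auto simp: filterlim_at eventually_at_filter intro!: tendsto_eq_intros)
  have "((\<lambda>s. decay f (2 * s) - 2 * decay f s + E f f) \<longlongrightarrow> l - 2 * l + E f f) (at_right 0)"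
    by (intro tendsto_intros clim filterlim_compose[OF clim dbl])
  then have elim: "(e \<longlongrightarrow> E f f - l) (at_right 0)"
    by (rule Lim_transform_eventually[OF tendsto_eq_rhs]) (auto simp: e_eq eventually_at_filter)
  define s where "s n = 1 / real (Suc n)" for n
  have s_pos: "s n > 0" for n by (simp add: s_def)
  have s_lim0: "s \<longlonglongrightarrow> 0" unfolding s_def using LIMSEQ_inverse_real_of_nat by (simp add: divide_inverse)
  have s_lim: "filterlim s (at_right 0) sequentially"
    unfolding filterlim_at using s_lim0 s_pos by (auto simp: less_le s_def)
  have nlim: "(\<lambda>n. nrm (\<lambda>x. P (s n) f x - f x)) \<longlonglongrightarrow> 0"
    using filterlim_compose[OF P_tendsto_0[OF fL] s_lim] .
  have cauchy: "\<exists>N. \<forall>m\<ge>N. \<forall>n\<ge>N. E1norm \<mu> E (\<lambda>x. P (s m) f x - P (s n) f x) < r" if r: "r > 0" for r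
  proof -
    from near[of "r\<^sup>2 / 4"] r obtain d where d: "d > 0" "\<And>s. 0 < s \<Longrightarrow> s < d \<Longrightarrow> l - r\<^sup>2/4 < decay f s" by auto
    have "\<forall>\<^sub>F n in sequentially. s n < d / 2" using order_tendstoD(2)[OF s_lim0, of "d/2"] d by simp
    moreover have "\<forall>\<^sub>F n in sequentially. nrm (\<lambda>x. P (s n) f x - f x) < r / 4"
      using order_tendstoD(2)[OF nlim, of "r/4"] r by simp
    ultimately have "\<forall>\<^sub>F n in sequentially. s n < d / 2 \<and> nrm (\<lambda>x. P (s n) f x - f x) < r / 4"
      by (rule eventually_conj)
    then obtain N where N: "\<And>n. n \<ge> N \<Longrightarrow> s n < d / 2 \<and> nrm (\<lambda>x. P (s n) f x - f x) < r / 4"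
      by (auto simp: eventually_sequentially)
    show ?thesis
    proof (intro exI[of _ N] allI impI)
      fix m n assume mn: "m \<ge> N" "n \<ge> N"
      let ?g = "\<lambda>x. P (s m) f x - P (s n) f x"
      have "E ?g ?g = decay f (2 * s m) - 2 * decay f (s m + s n) + decay f (2 * s n)"
        by (rule E_P_diff[OF fL s_pos s_pos])
      also have "\<dots> < r\<^sup>2 / 2"
        using ub[of "2 * s m"] ub[of "2 * s n"] s_pos[of m] s_pos[of n] d(2)[of "s m + s n"] N[OF mn(1)] N[OF mn(2)] by simp
      finally have E: "E ?g ?g < r\<^sup>2 / 2" .
      have pl: "P (s k) f \<in> L2 \<mu>" for k using fL s_pos[of k] by (auto intro: P_L2)
      have "nrm ?g \<le> nrm (\<lambda>x. P (s m) f x - f x) + nrm (\<lambda>x. P (s n) f x - f x)"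
        using l2norm_triangle[OF L2_diff[OF pl fL] L2_diff[OF fL pl], of m n] l2norm_diff_commute[of \<mu> f]
        by simp
      also have "\<dots> < r / 2" using N[OF mn(1)] N[OF mn(2)] by simp
      finally have "(nrm ?g)\<^sup>2 < (r / 2)\<^sup>2" by (intro power_strict_mono) (auto simp: l2norm_nonneg)
      then have "E ?g ?g + ip ?g ?g < r\<^sup>2 / 2 + r\<^sup>2 / 4" using E by (simp add: l2norm_square power_divide)
      also have "\<dots> \<le> r\<^sup>2" using zero_le_power2[of r] by linarith
      finally have "sqrt (E ?g ?g + ip ?g ?g) < sqrt (r\<^sup>2)" by (rule real_sqrt_less_mono)
      then show "E1norm \<mu> E ?g < r" using r by (simp add: E1norm_def)
    qed
  qed
  have PF: "P (s n) f \<in> F" for n using fL s_pos by (rule P_F)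
  obtain v where v: "v \<in> F" "(\<lambda>n. E1norm \<mu> E (\<lambda>x. P (s n) f x - v x)) \<longlonglongrightarrow> 0"
    by (rule F_closed[of "\<lambda>n. P (s n) f", OF PF cauchy])
  have "(\<lambda>n. nrm (\<lambda>x. P (s n) f x - v x)) \<longlonglongrightarrow> 0"
    by (rule Lim_null_comparison[OF _ v(2)])
      (intro always_eventually allI, simp add: l2norm_nonneg nrm_le_E1norm PF v F_diff)
  then have vf: "AE x in \<mu>. v x = f x"
    using PF v(1) fL nlim by (intro l2norm_tendsto_unique[where G=sequentially and u="\<lambda>n. P (s n) f"]) (auto intro: F_L2)
  have "e (s n) \<le> (E1norm \<mu> E (\<lambda>x. P (s n) f x - v x))\<^sup>2" for n
  proof -
    let ?g = "\<lambda>x. P (s n) f x - v x" and ?h = "\<lambda>x. P (s n) f x - f x"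
    have g: "?g \<in> F" and h: "?h \<in> F" using PF v f by (auto intro: F_diff)
    have gh: "AE x in \<mu>. ?g x = ?h x" using vf by eventually_elim simp
    have "E ?g ?g = E ?h ?h"
      using E_AE[OF g F_L2[OF h] gh g] E_AE[OF g F_L2[OF h] gh h] E_sym[OF g h] by simp
    then show ?thesis using E_nonneg[OF g] l2inner_self_nonneg[of \<mu> ?g]
      by (simp add: e_def E1norm_def)
  qed
  moreover have "(\<lambda>n. (E1norm \<mu> E (\<lambda>x. P (s n) f x - v x))\<^sup>2) \<longlonglongrightarrow> 0"
    using tendsto_power[OF v(2), of 2] by simp
  moreover have "0 \<le> e (s n)" for n unfolding e_def using PF f by (intro E_nonneg F_diff)
  ultimately have "(\<lambda>n. e (s n)) \<longlonglongrightarrow> 0"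
    by (intro Lim_null_comparison[of "\<lambda>n. e (s n)" "\<lambda>n. (E1norm \<mu> E (\<lambda>x. P (s n) f x - v x))\<^sup>2"]) auto
  moreover have "(\<lambda>n. e (s n)) \<longlonglongrightarrow> E f f - l" by (rule filterlim_compose[OF elim s_lim])
  ultimately have "E f f - l = 0" by (metis LIMSEQ_unique)
  with elim show ?thesis by (simp add: e_def[abs_def])
qed

lemma E_P_tendsto:
  assumes f: "f \<in> F" and g: "g \<in> F"
  shows "((\<lambda>s. E (P s f) g) \<longlongrightarrow> E f g) (at_right 0)"
proof -
  let ?d = "\<lambda>s x. P s f x - f x"
  have "((\<lambda>s. E (?d s) g) \<longlongrightarrow> 0) (at_right 0)"
  proof (rule Lim_null_comparison)
    show "\<forall>\<^sub>F s in at_right 0. norm (E (?d s) g) \<le> sqrt (E (?d s) (?d s)) * sqrt (E g g)"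
      using f g by (auto simp: eventually_at_filter intro!: always_eventually E_cauchy_schwarz F_diff P_F F_L2)
    show "((\<lambda>s. sqrt (E (?d s) (?d s)) * sqrt (E g g)) \<longlongrightarrow> 0) (at_right 0)"
      using tendsto_mult_right[OF tendsto_real_sqrt[OF energy_tendsto_0[OF f]], of "sqrt (E g g)"] by simp
  qed
  then have "((\<lambda>s. E (P s f) g - E f g) \<longlongrightarrow> 0) (at_right 0)"
    by (rule Lim_transform_eventually) (use f g in \<open>auto simp: eventually_at_filter E_diff_left P_F F_L2\<close>)
  then show ?thesis by (rule LIM_zero_cancel)
qed

text \<open>The derivative at the junction when a resting function is continued by the heat flow.
  The mean value theorem reduces it to the continuity of \<open>E (P s f) g\<close> at time
  0.\<close>

lemma ip_P_right_derivative:
  assumes f: "f \<in> F" and g: "g \<in> F"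
  shows "((\<lambda>s. (ip (P s f) g - ip f g) / s) \<longlongrightarrow> - E f g) (at_right 0)"
proof (rule tendstoI)
  fix e :: real assume e: "e > 0"
  have fL: "f \<in> L2 \<mu>" and gL: "g \<in> L2 \<mu>" using f g by (auto intro: F_L2)
  from tendstoD[OF E_P_tendsto[OF f g] e] obtain d where d: "d > 0" "\<And>s. 0 < s \<Longrightarrow> s < d \<Longrightarrow> dist (E (P s f) g) (E f g) < e"
    by (auto simp: eventually_at_right_field)
  have P0: "ip (P 0 f) g = ip f g"
    using P_0[OF fL] fL gL by (intro l2inner_AE_cong) (auto simp: L2_measurable P_L2)
  show "\<forall>\<^sub>F s in at_right 0. dist ((ip (P s f) g - ip f g) / s) (- E f g) < e"
    unfolding eventually_at_right_field
  proof (intro exI[of _ d] conjI allI impI d(1))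
    fix s assume s: "0 < s" "s < d"
    have der: "((\<lambda>r. ip (P r f) g) has_real_derivative ip (W x f) g) (at x)" if "x > 0" for x
      by (rule ip_P_has_derivative[OF fL gL that])
    have "\<exists>l z. 0 < z \<and> z < s \<and> ((\<lambda>r. ip (P r f) g) has_real_derivative l) (at z) \<and> ip (P s f) g - ip (P 0 f) g = (s - 0) * l"
    proof (rule MVT[OF s(1)])
      have "((\<lambda>r. ip (P r f) g) \<longlongrightarrow> ip f g) (at_right 0)"
        using fL gL by (intro l2inner_tendsto_left P_tendsto_0) (auto simp: eventually_at_filter P_L2)
      then have "((\<lambda>r. ip (P r f) g) \<longlongrightarrow> ip (P 0 f) g) (at 0 within {0..s})"
        unfolding P0 using s by (simp add: at_within_Icc_at_right)
      then have "continuous (at x within {0..s}) (\<lambda>r. ip (P r f) g)" if "x \<in> {0..s}" for x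
      proof (cases "x = 0")
        case True
        with \<open>((\<lambda>r. ip (P r f) g) \<longlongrightarrow> ip (P 0 f) g) (at 0 within {0..s})\<close> show ?thesis
          by (simp add: continuous_within)
      next
        case False
        with that have "x > 0" by simp
        from DERIV_isCont[OF der[OF this]] show ?thesis by (rule continuous_at_imp_continuous_at_within)
      qed
      then show "continuous_on {0..s} (\<lambda>r. ip (P r f) g)" by (simp add: continuous_on_eq_continuous_within)
      show "\<And>x. 0 < x \<Longrightarrow> x < s \<Longrightarrow> (\<lambda>r. ip (P r f) g) differentiable at x"
        using der real_differentiable_def by blast
    qed
    then obtain l z where z: "0 < z" "z < s" "((\<lambda>r. ip (P r f) g) has_real_derivative l) (at z)"
      "ip (P s f) g - ip f g = s * l" unfolding P0 by auto
    have "l = ip (W z f) g" using DERIV_unique[OF z(3) der[OF z(1)]] .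
    also have "\<dots> = - E (P z f) g" by (rule W_inner[OF fL z(1) g])
    finally have "(ip (P s f) g - ip f g) / s = - E (P z f) g" using z(4) s by simp
    then show "dist ((ip (P s f) g - ip f g) / s) (- E f g) < e"
      using d(2)[of z] z s by (simp add: dist_real_def)
  qed
qed

text \<open>Smoothing g to \<open>P t g\<close> turns the energy pairing into an inner product with
  \<open>W t g\<close>, for which norm convergence suffices. The error of smoothing is uniformly
  small because the energies are bounded.\<close>

lemma E_weak_limit:
  assumes z: "\<And>n. z n \<in> F" and y: "y \<in> F" and g: "g \<in> F"
    and lim: "(\<lambda>n. nrm (\<lambda>x. z n x - y x)) \<longlonglongrightarrow> 0" and B: "\<And>n::nat. E (z n) (z n) \<le> B"
  shows "(\<lambda>n. E (z n) g) \<longlonglongrightarrow> E y g"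
proof (rule LIMSEQ_I)
  fix e :: real assume e: "e > 0"
  let ?d = "\<lambda>n x. z n x - y x"
  have gL: "g \<in> L2 \<mu>" using g by (rule F_L2)
  define K where "K = 2 * B + 2 * E y y"
  have dF: "?d n \<in> F" for n using z y by (intro F_diff)
  have K: "E (?d n) (?d n) \<le> K" for n
    using E_diff_self_le[OF z y, of n] B[of n] by (simp add: K_def)
  have K0: "0 \<le> K" using K[of 0] E_nonneg[OF dF, of 0] by simp
  have "((\<lambda>s. sqrt K * sqrt (E (\<lambda>x. P s g x - g x) (\<lambda>x. P s g x - g x))) \<longlongrightarrow> sqrt K * sqrt 0) (at_right 0)"
    by (intro tendsto_intros energy_tendsto_0 g)
  then have "\<forall>\<^sub>F s in at_right 0. sqrt K * sqrt (E (\<lambda>x. P s g x - g x) (\<lambda>x. P s g x - g x)) < e / 2"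
    using e by (intro order_tendstoD) auto
  then obtain b where b: "b > 0" "\<And>t. 0 < t \<Longrightarrow> t < b \<Longrightarrow> sqrt K * sqrt (E (\<lambda>x. P t g x - g x) (\<lambda>x. P t g x - g x)) < e / 2"
    by (auto simp: eventually_at_right_field)
  define t where "t = b / 2"
  have t: "t > 0" "sqrt K * sqrt (E (\<lambda>x. P t g x - g x) (\<lambda>x. P t g x - g x)) < e / 2"
    using b by (auto simp: t_def)
  have PF: "P t g \<in> F" using gL t by (intro P_F)
  have "(\<lambda>n. nrm (W t g) * nrm (?d n)) \<longlonglongrightarrow> nrm (W t g) * 0" by (intro tendsto_intros lim)
  then have "\<forall>\<^sub>F n in sequentially. nrm (W t g) * nrm (?d n) < e / 2"
    using e by (intro order_tendstoD) auto
  then obtain N where N: "\<And>n. n \<ge> N \<Longrightarrow> nrm (W t g) * nrm (?d n) < e / 2"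
    by (auto simp: eventually_sequentially)
  show "\<exists>N. \<forall>n\<ge>N. norm (E (z n) g - E y g) < e"
  proof (intro exI[of _ N] allI impI)
    fix n assume n: "n \<ge> N"
    have "E (?d n) (P t g) = - ip (W t g) (?d n)"
      using E_sym[OF dF PF] W_inner[OF gL t(1) dF] by simp
    then have 1: "\<bar>E (?d n) (P t g)\<bar> \<le> nrm (W t g) * nrm (?d n)"
      using l2inner_cauchy_schwarz[OF W_L2[OF gL t(1)] F_L2[OF dF]] by simp
    have "\<bar>E (?d n) (\<lambda>x. P t g x - g x)\<bar> \<le> sqrt (E (?d n) (?d n)) * sqrt (E (\<lambda>x. P t g x - g x) (\<lambda>x. P t g x - g x))"
      by (intro E_cauchy_schwarz dF F_diff PF g)
    also have "\<dots> \<le> sqrt K * sqrt (E (\<lambda>x. P t g x - g x) (\<lambda>x. P t g x - g x))"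
      using K by (intro mult_right_mono real_sqrt_le_mono real_sqrt_ge_zero E_nonneg F_diff PF g) auto
    finally have 2: "\<bar>E (?d n) (\<lambda>x. P t g x - g x)\<bar> < e / 2" using t(2) by simp
    have "E (?d n) g = E (?d n) (P t g) - E (?d n) (\<lambda>x. P t g x - g x)"
      using dF PF g by (simp add: E_diff_right)
    then have "\<bar>E (?d n) g\<bar> < e" using 1 2 N[OF n] by linarith
    then show "norm (E (z n) g - E y g) < e" using z y g by (simp add: E_diff_left)
  qed
qed

text \<open>Mass does not grow: by symmetry f is paired with the image of an indicator, which stays
  below 1.\<close>

lemma ip_P_indicator_le:
  assumes f: "f \<in> L2 \<mu>" "integrable \<mu> f" "AE x in \<mu>. 0 \<le> f x" and A: "A \<in> sets \<mu>" "emeasure \<mu> A < \<infinity>" and t: "0 < t"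
  shows "ip (P t f) (indicat_real A) \<le> (\<integral>x. f x \<partial>\<mu>)"
proof -
  have A2: "indicat_real A \<in> L2 \<mu>" using A by (rule L2_indicator)
  have b: "AE x in \<mu>. 0 \<le> P t (indicat_real A) x \<and> P t (indicat_real A) x \<le> 1"
    by (rule P_unit_interval[OF A2 _ t]) (auto simp: indicator_def)
  have "ip (P t f) (indicat_real A) = (\<integral>x. f x * P t (indicat_real A) x \<partial>\<mu>)"
    using P_symmetric[OF f(1) A2 t] by (simp add: l2inner_def)
  also have "\<dots> \<le> (\<integral>x. f x \<partial>\<mu>)"
  proof (rule integral_mono_AE[OF L2_integrable_mult[OF f(1)] f(2)])
    show "P t (indicat_real A) \<in> L2 \<mu>" using A2 t by (auto intro: P_L2)
    show "AE x in \<mu>. f x * P t (indicat_real A) x \<le> f x"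
      using b f(3) by eventually_elim (auto intro: mult_left_le)
  qed
  finally show ?thesis .
qed

end

section \<open>Proper metric measure spaces\<close>

lemma proper_countable_dense:
  obtains D :: "'a::heine_borel set" where "countable D" "\<And>x e. e > 0 \<Longrightarrow> \<exists>d\<in>D. dist x d < e"
proof -
  fix a :: 'a
  have "\<exists>k. finite k \<and> cball a (real n) \<subseteq> (\<Union>x\<in>k. ball x (1 / real (Suc m)))" for n m :: nat
    using compact_cball[of a "real n"] unfolding compact_eq_totally_bounded
    by (metis of_nat_0_less_iff zero_less_Suc zero_less_divide_1_iff)
  then obtain k where k: "\<And>n m. finite (k n m)" "\<And>n m. cball a (real n) \<subseteq> (\<Union>x\<in>k n m. ball x (1 / real (Suc m)))"
    by metis
  show thesis
  proof
    show "countable (\<Union>n m. k n m)" by (intro countable_UN countableI_type countable_finite[OF k(1)])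
    fix x and e :: real assume "e > 0"
    then obtain m where m: "1 / real (Suc m) < e" using nat_approx_posE by blast
    obtain n :: nat where "dist a x \<le> real n" using real_arch_simple by blast
    then have "x \<in> cball a (real n)" by simp
    then obtain d where "d \<in> k n m" "dist d x < 1 / real (Suc m)" using k(2)[of n m] by auto
    with m show "\<exists>d\<in>(\<Union>n m. k n m). dist x d < e"
      by (intro bexI[of _ d]) (auto simp: dist_commute)
  qed
qed

locale proper_mm_space =
  fixes \<mu> :: "'a::heine_borel measure"
  assumes mm: "mm_space \<mu>"
begin

lemma sets_mu [simp, measurable_cong]: "sets \<mu> = sets borel"
  using mm by (simp add: mm_space_def)

lemma space_mu [simp]: "space \<mu> = UNIV"
  using sets_eq_imp_space_eq[OF sets_mu] by simp

lemma ball_finite: "emeasure \<mu> (ball x r) < \<infinity>"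
  using mm by (auto simp: mm_space_def)

lemma ball_pos: "r > 0 \<Longrightarrow> 0 < emeasure \<mu> (ball x r)"
  using mm by (auto simp: mm_space_def)

lemma diam_pos: "0 < mm_diam \<mu>"
  using mm by (auto simp: mm_space_def)

lemma emeasure_ball: "emeasure \<mu> (ball x r) = ennreal (V \<mu> x r)"
  using ball_finite[of x r] by (simp add: V_def emeasure_eq_ennreal_measure)

lemma V_pos: "r > 0 \<Longrightarrow> 0 < V \<mu> x r"
  using ball_pos[of r x] by (simp add: emeasure_ball)

lemma bounded_subset_ball: "bounded (A::'a set) \<Longrightarrow> \<exists>r>0. A \<subseteq> ball x r"
proof -
  assume "bounded A"
  then obtain e where e: "\<And>y. y \<in> A \<Longrightarrow> dist x y \<le> e" by (meson bounded_any_center)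
  show ?thesis
    by (intro exI[of _ "\<bar>e\<bar> + 1"]) (use e in force)
qed

lemma bounded_finite: "bounded A \<Longrightarrow> emeasure \<mu> A < \<infinity>"
proof -
  assume "bounded A"
  then obtain r where "A \<subseteq> ball undefined r" using bounded_subset_ball by blast
  then have "emeasure \<mu> A \<le> emeasure \<mu> (ball undefined r)" by (intro emeasure_mono) auto
  then show ?thesis by (rule le_less_trans[OF _ ball_finite])
qed

lemma measure_mono_bounded:
  "A \<subseteq> B \<Longrightarrow> A \<in> sets borel \<Longrightarrow> B \<in> sets borel \<Longrightarrow> bounded B \<Longrightarrow> measure \<mu> A \<le> measure \<mu> B"
  using bounded_finite[of B] by (intro measure_mono_fmeasurable) (auto simp: fmeasurable_def)

lemma V_mono: "r \<le> s \<Longrightarrow> V \<mu> x r \<le> V \<mu> x s"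
  unfolding V_def by (rule measure_mono_bounded) auto

lemma V_subset: "ball x r \<subseteq> ball y s \<Longrightarrow> V \<mu> x r \<le> V \<mu> y s"
  unfolding V_def by (rule measure_mono_bounded) auto

lemma indicator_L2: "bounded A \<Longrightarrow> A \<in> sets borel \<Longrightarrow> indicat_real A \<in> L2 \<mu>"
  using bounded_finite[of A] by (intro L2_indicator) auto

sublocale sigma_finite_measure \<mu>
proof
  fix a :: 'a
  show "\<exists>A. countable A \<and> A \<subseteq> sets \<mu> \<and> \<Union> A = space \<mu> \<and> (\<forall>a\<in>A. emeasure \<mu> a \<noteq> \<infinity>)"
  proof (intro exI[of _ "range (\<lambda>n::nat. ball a (real n))"] conjI ballI)
    have "\<exists>n. dist a x < real n" for x by (rule reals_Archimedean2)
    then show "\<Union> (range (\<lambda>n::nat. ball a (real n))) = space \<mu>" by auto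
    fix A assume "A \<in> range (\<lambda>n::nat. ball a (real n))"
    then obtain n where A: "A = ball a (real n)" by auto
    show "emeasure \<mu> A \<noteq> \<infinity>" using ball_finite[of a "real n"] unfolding A by simp
  qed auto
qed

text \<open>Lindeloef argument: every good ball contains a good ball with centre in a countable
  dense set and rational radius, and of these there are countably many.\<close>

lemma AE_local:
  assumes "\<And>x. x \<in> S \<Longrightarrow> \<exists>r>0. AE y in \<mu>. y \<in> ball x r \<longrightarrow> Q y"
  shows "AE y in \<mu>. y \<in> S \<longrightarrow> Q y"
proof -
  obtain D :: "'a set" where D: "countable D" "\<And>x e. e > 0 \<Longrightarrow> \<exists>d\<in>D. dist x d < e"
    using proper_countable_dense[where 'a='a] by metis
  let ?G = "{p \<in> D \<times> \<rat>. AE y in \<mu>. y \<in> ball (fst p) (snd p) \<longrightarrow> Q y}"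
  have "countable ?G" using D(1) countable_rat by (intro countable_subset[of ?G "D \<times> \<rat>"]) auto
  then have "AE y in \<mu>. \<forall>p\<in>?G. y \<in> ball (fst p) (snd p) \<longrightarrow> Q y"
    by (subst AE_ball_countable) auto
  then show ?thesis
  proof eventually_elim
    case (elim y)
    show ?case
    proof
      assume "y \<in> S"
      from assms[OF this] obtain r where r: "r > 0" "AE z in \<mu>. z \<in> ball y r \<longrightarrow> Q z" by blast
      obtain d where d: "d \<in> D" "dist y d < r / 3" using D(2)[of "r/3" y] r by auto
      obtain q where q: "q \<in> \<rat>" "r / 3 < q" "q < r / 2" using Rats_dense_in_real[of "r/3" "r/2"] r by auto
      have "ball d q \<subseteq> ball y r"
      proof
        fix z assume "z \<in> ball d q"
        then have "dist y z < r" using dist_triangle[of y z d] d(2) q by simp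
        then show "z \<in> ball y r" by simp
      qed
      with r(2) have "AE z in \<mu>. z \<in> ball d q \<longrightarrow> Q z" by (auto elim!: eventually_mono)
      then have "(d, q) \<in> ?G" using d q by simp
      with elim show "Q y" using d q by (force simp: dist_commute)
    qed
  qed
qed

text \<open>Balls have positive measure, so an almost everywhere statement on one yields a witness.
  This is how inequalities between constants are read off from essential bounds.\<close>

lemma AE_not_False_on_ball: "r > 0 \<Longrightarrow> AE y in \<mu>. y \<in> ball x r \<longrightarrow> Q y \<Longrightarrow> \<exists>y\<in>ball x r. Q y"
proof (rule ccontr)
  assume r: "r > 0" and ae: "AE y in \<mu>. y \<in> ball x r \<longrightarrow> Q y" and "\<not> (\<exists>y\<in>ball x r. Q y)"
  then have "AE y in \<mu>. y \<notin> ball x r" by (auto elim!: eventually_mono)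
  then have "ball x r \<in> null_sets \<mu>"
    by (subst AE_iff_null_sets) auto
  then have "emeasure \<mu> (ball x r) = 0" by auto
  with ball_pos[OF r, of x] show False by simp
qed

end

lemma in_fsupp: "f x \<noteq> 0 \<Longrightarrow> x \<in> fsupp f"
  unfolding fsupp_def by (rule closure_subset[THEN subsetD]) simp

section \<open>Locality, cutoff functions and caloric functions\<close>

locale local_form = heat \<mu> E F P + proper_mm_space \<mu>
  for \<mu> :: "'a::heine_borel measure" and E :: "('a \<Rightarrow> real) \<Rightarrow> ('a \<Rightarrow> real) \<Rightarrow> real"
    and F :: "('a \<Rightarrow> real) set" and P +
  assumes regular: "regular_dirichlet_form \<mu> E F" and strongly_local: "strongly_local E F"
begin

lemma Cc_bounded: "f \<in> Cc \<Longrightarrow> \<exists>K>0. \<forall>x. \<bar>f x\<bar> \<le> K"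
proof -
  assume f: "f \<in> Cc"
  have "compact (f ` fsupp f)"
    using f by (intro compact_continuous_image) (auto simp: Cc_def intro: continuous_on_subset)
  then have "bounded (f ` fsupp f)" by (rule compact_imp_bounded)
  then obtain K where K: "\<And>y. y \<in> f ` fsupp f \<Longrightarrow> norm y \<le> K"
    by (auto simp: bounded_iff)
  have "\<bar>f x\<bar> \<le> \<bar>K\<bar> + 1" for x
  proof (cases "f x = 0")
    case False
    then have "x \<in> fsupp f" by (intro in_fsupp)
    then have "\<bar>f x\<bar> \<le> K" using K by auto
    then show ?thesis by simp
  qed simp
  then show ?thesis by (intro exI[of _ "\<bar>K\<bar> + 1"]) auto
qed

lemma regular_approx_energy: "f \<in> F \<Longrightarrow> e > 0 \<Longrightarrow> \<exists>g\<in>F \<inter> Cc. E1norm \<mu> E (\<lambda>x. f x - g x) < e"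
  and regular_approx_uniform: "f \<in> Cc \<Longrightarrow> e > 0 \<Longrightarrow> \<exists>g\<in>F \<inter> Cc. \<forall>x. \<bar>f x - g x\<bar> < e"
  using regular unfolding regular_dirichlet_form_def by blast+

lemma cutoff:
  assumes K: "compact K" and U: "open U" "bounded U" "K \<subseteq> U"
  obtains f where "f \<in> F" "f \<in> Cc" "\<And>x. 0 \<le> f x" "\<And>x. f x \<le> 1" "\<And>x. x \<in> K \<Longrightarrow> f x = 1" "\<And>x. x \<notin> U \<Longrightarrow> f x = 0"
proof (cases "K = {}")
  case True
  have "(\<lambda>x. 0) \<in> Cc" by (simp add: Cc_def fsupp_def)
  then show ?thesis using that[of "\<lambda>x. 0"] True F_zero by auto
next
  case False
  obtain d where d: "d > 0" "(\<Union>x\<in>K. ball x d) \<subseteq> U"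
    using compact_subset_open_imp_ball_epsilon_subset[OF K U(1,3)] by blast
  \<comment> \<open>The height 3/2 leaves room for an approximation error of 1/2: an approximation
    still exceeds 1 on K and stays below 1/2 outside U.\<close>
  define h where "h x = 3/2 * max 0 (1 - infdist x K / d)" for x
  have h0: "h x = 0" if "x \<notin> U" for x
  proof -
    have "d \<le> infdist x K"
    proof (rule ccontr)
      assume lt: "\<not> d \<le> infdist x K"
      obtain y where y: "y \<in> K" "infdist x K = dist x y"
        using infdist_attains_inf[OF compact_imp_closed[OF K] False] by metis
      with lt have "x \<in> ball y d" by (simp add: dist_commute)
      with y(1) d(2) have "x \<in> U" by blast
      with that show False by simp
    qed
    then show ?thesis using d(1) by (simp add: h_def)
  qed
  have cont: "continuous_on UNIV h" unfolding h_def by (intro continuous_intros) (use d in auto)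
  have cl: "compact (closure U)" using U(2) by (simp add: compact_closure)
  have supp: "compact (fsupp g)" if "\<And>x. x \<notin> U \<Longrightarrow> g x = 0" for g :: "'a \<Rightarrow> real"
  proof -
    have "fsupp g \<subseteq> closure U" unfolding fsupp_def by (rule closure_mono) (use that in auto)
    then have "fsupp g = closure U \<inter> fsupp g" by auto
    moreover have "closed (fsupp g)" by (simp add: fsupp_def)
    ultimately show ?thesis using cl compact_Int_closed by metis
  qed
  have "h \<in> Cc" using cont supp[OF h0] by (simp add: Cc_def)
  from regular_approx_uniform[OF this, of "1/2"]
  obtain g where g: "g \<in> F" "g \<in> Cc" "\<And>x. \<bar>h x - g x\<bar> < 1/2" by auto
  \<comment> \<open>The slice of g between the heights 1/2 and 1, stretched to [0,1].\<close>
  define f where "f x = 2 * (clamp 1 g x - clamp (1/2) g x)" for x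
  have f0: "f x = 0" if "x \<notin> U" for x
    using h0[OF that] g(3)[of x] by (auto simp: f_def clamp_def)
  show ?thesis
  proof (rule that[of f])
    show "f \<in> F" unfolding f_def using g(1) by (intro F_scale F_diff clamp_F) auto
    have "continuous_on UNIV g" using g(2) by (simp add: Cc_def)
    then have "continuous_on UNIV f" unfolding f_def clamp_def by (intro continuous_intros)
    then show "f \<in> Cc" using supp[OF f0] by (simp add: Cc_def)
    show "0 \<le> f x" "f x \<le> 1" for x by (auto simp: f_def clamp_def)
    show "f x = 1" if "x \<in> K" for x
    proof -
      have "h x = 3/2" using that d(1) by (simp add: h_def)
      with g(3)[of x] have "1 < g x" by linarith
      then show ?thesis by (simp add: f_def clamp_def)
    qed
  qed (rule f0)
qed

lemma E_separated:
  assumes "u \<in> F" "v \<in> F" "compact (fsupp u)" "compact (fsupp v)" "open U" "fsupp u \<subseteq> U" "\<And>x. x \<in> U \<Longrightarrow> v x = c"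
  shows "E u v = 0"
proof -
  have "\<exists>U c. open U \<and> fsupp u \<subseteq> U \<and> (\<forall>x\<in>U. v x = c)"
    by (rule exI[of _ U], rule exI[of _ c]) (simp add: assms)
  with assms(3,4) show ?thesis
    by (intro strongly_local[unfolded strongly_local_def, rule_format, OF assms(1,2)] conjI)
qed

lemma E_locally_constant:
  assumes "f \<in> F" "f \<in> Cc" "\<phi> \<in> F" "\<phi> \<in> Cc" "open B" "fsupp \<phi> \<subseteq> B" "\<And>x. x \<in> B \<Longrightarrow> f x = c"
  shows "E f \<phi> = 0"
proof -
  have "compact (fsupp \<phi>)" "compact (fsupp f)" using assms by (auto simp: Cc_def)
  then have "E \<phi> f = 0" by (rule E_separated[OF assms(3,1) _ _ assms(5,6,7)])
  then show ?thesis using E_sym[OF assms(1,3)] by simp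
qed

text \<open>Strong locality is only assumed for compactly supported functions; a bounded \<open>v \<ge> 0\<close> vanishing
  on \<open>B\<close> is the weak limit of the compactly supported \<open>(v \<and> g\<^sub>n)\<^sup>+\<close>, where \<open>g\<^sub>n \<rightarrow> v\<close> in energy.\<close>
lemma E_vanishing:
  assumes v: "v \<in> F" "\<And>x. 0 \<le> v x" "\<And>x. v x \<le> K" "\<And>x. x \<in> B \<Longrightarrow> v x = 0"
    and \<phi>: "\<phi> \<in> F" "\<phi> \<in> Cc" and B: "open B" "fsupp \<phi> \<subseteq> B"
  shows "E v \<phi> = 0"
proof -
  have "\<exists>g. g \<in> F \<and> g \<in> Cc \<and> E1norm \<mu> E (\<lambda>x. v x - g x) < 1 / real (Suc n)" for n
    using regular_approx_energy[OF v(1), of "1 / real (Suc n)"] by auto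
  then obtain g where g: "\<And>n. g n \<in> F" "\<And>n. g n \<in> Cc" "\<And>n. E1norm \<mu> E (\<lambda>x. v x - g n x) < 1 / real (Suc n)"
    by metis
  \<comment> \<open>Since v and \<open>g n\<close> are bounded, \<open>k n\<close> and
    \<open>z n\<close> are clamps, so the Markov property bounds the energy of \<open>z n\<close>,
    the positive part of the minimum of v and \<open>g n\<close>.\<close>
  define k where "k n = (\<lambda>x. max 0 (v x - g n x))" for n
  define z where "z n = (\<lambda>x. max 0 (v x - k n x))" for n
  have K0: "0 \<le> K" using v(2,3) order_trans by blast
  have d: "(\<lambda>x. v x - g n x) \<in> F" for n using v(1) g(1) by (rule F_diff)
  have k_clamp: "\<exists>L>0. k n = clamp L (\<lambda>x. v x - g n x)" for n
  proof -
    obtain L where L: "L > 0" "\<And>x. \<bar>g n x\<bar> \<le> L" using Cc_bounded[OF g(2)[of n]] by auto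
    have "k n = clamp (K + L) (\<lambda>x. v x - g n x)"
    proof
      fix x show "k n x = clamp (K + L) (\<lambda>x. v x - g n x) x"
        using v(3)[of x] L(2)[of x] K0 L(1) by (auto simp: k_def clamp_def min_def)
    qed
    then show ?thesis using L K0 by (intro exI[of _ "K + L"]) auto
  qed
  have kF: "k n \<in> F" and kE: "E (k n) (k n) \<le> E (\<lambda>x. v x - g n x) (\<lambda>x. v x - g n x)" for n
    using k_clamp[of n] clamp_F[OF d[of n]] E_clamp_le[OF d[of n]] by auto
  have vk: "(\<lambda>x. v x - k n x) \<in> F" for n using v(1) kF by (rule F_diff)
  have z_clamp: "z n = clamp (K + 1) (\<lambda>x. v x - k n x)" for n
  proof
    fix x show "z n x = clamp (K + 1) (\<lambda>x. v x - k n x) x"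
      using v(3)[of x] K0 by (auto simp: z_def clamp_def k_def min_def max_def)
  qed
  have zF: "z n \<in> F" and zE: "E (z n) (z n) \<le> E (\<lambda>x. v x - k n x) (\<lambda>x. v x - k n x)" for n
    using clamp_F[OF vk[of n], of "K + 1"] E_clamp_le[OF vk[of n], of "K + 1"] K0 z_clamp[of n] by auto
  have dE: "E (\<lambda>x. v x - g n x) (\<lambda>x. v x - g n x) \<le> 1" for n
  proof -
    have "1 / real (Suc n) \<le> 1" by simp
    with g(3)[of n] have "sqrt (E (\<lambda>x. v x - g n x) (\<lambda>x. v x - g n x) + ip (\<lambda>x. v x - g n x) (\<lambda>x. v x - g n x)) \<le> 1"
      unfolding E1norm_def by linarith
    then show ?thesis using l2inner_self_nonneg[of \<mu> "\<lambda>x. v x - g n x"] by simp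
  qed
  have "(\<lambda>n. E (z n) \<phi>) \<longlonglongrightarrow> E v \<phi>"
  proof (rule E_weak_limit[OF zF v(1) \<phi>(1)])
    fix n show "E (z n) (z n) \<le> 2 * E v v + 2"
      using zE[of n] E_diff_self_le[OF v(1) kF[of n]] kE[of n] dE[of n] by linarith
  next
    show "(\<lambda>n. nrm (\<lambda>x. z n x - v x)) \<longlonglongrightarrow> 0"
    proof (rule Lim_null_comparison)
      show "\<forall>\<^sub>F n in sequentially. norm (nrm (\<lambda>x. z n x - v x)) \<le> inverse (real (Suc n))"
      proof (rule always_eventually, rule allI)
        fix n
        have "nrm (\<lambda>x. z n x - v x) \<le> nrm (\<lambda>x. v x - g n x)"
          using v(2) by (intro l2norm_mono F_L2[OF d] F_measurable[OF F_diff[OF zF v(1)]] AE_I2) (auto simp: z_def k_def)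
        also have "\<dots> \<le> inverse (real (Suc n))"
          using nrm_le_E1norm[OF d[of n]] g(3)[of n] by (simp add: divide_inverse)
        finally show "norm (nrm (\<lambda>x. z n x - v x)) \<le> inverse (real (Suc n))" by (simp add: l2norm_nonneg)
      qed
    qed (rule LIMSEQ_inverse_real_of_nat)
  qed
  moreover have "E (z n) \<phi> = 0" for n
  proof -
    have "fsupp (z n) \<subseteq> fsupp (g n)"
      unfolding fsupp_def by (rule closure_mono) (use v(2) in \<open>auto simp: z_def k_def max_def split: if_splits\<close>)
    then have "fsupp (z n) = fsupp (g n) \<inter> fsupp (z n)" by auto
    moreover have "closed (fsupp (z n))" by (simp add: fsupp_def)
    moreover have "compact (fsupp (g n))" using g(2)[of n] by (simp add: Cc_def)
    ultimately have "compact (fsupp (z n))" using compact_Int_closed by metis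
    moreover have "z n x = 0" if "x \<in> B" for x using v(4)[OF that] by (simp add: z_def k_def)
    ultimately have "E \<phi> (z n) = 0"
      using E_separated[OF \<phi>(1) zF[of n] _ _ B, of 0] \<phi>(2) by (simp add: Cc_def)
    then show ?thesis using E_sym[OF zF \<phi>(1)] by simp
  qed
  ultimately show ?thesis using LIMSEQ_unique by (simp add: LIMSEQ_const_iff)
qed

text \<open>The negative part of y vanishes on B, so by locality test functions supported in B do
  not see it. This makes y nonnegative everywhere, as the Harnack inequality demands, without
  disturbing the heat equation in B.\<close>

lemma positive_part_local:
  assumes y: "y \<in> F" and K: "K > 0" "AE x in \<mu>. \<bar>y x\<bar> \<le> K"
    and pos: "AE x in \<mu>. x \<in> B \<longrightarrow> 0 \<le> y x" and B: "open B"
  shows "(\<lambda>x. max 0 (y x)) \<in> F"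
    and "\<And>\<phi>. \<phi> \<in> F \<Longrightarrow> \<phi> \<in> Cc \<Longrightarrow> fsupp \<phi> \<subseteq> B \<Longrightarrow> E (\<lambda>x. max 0 (y x)) \<phi> = E y \<phi>"
    and "\<And>\<phi>. \<phi> \<in> F \<Longrightarrow> \<phi> \<in> Cc \<Longrightarrow> fsupp \<phi> \<subseteq> B \<Longrightarrow> ip (\<lambda>x. max 0 (y x)) \<phi> = ip y \<phi>"
proof -
  have ym [measurable]: "y \<in> borel_measurable \<mu>" using y by (rule F_measurable)
  have Bm [measurable]: "B \<in> sets borel" using B by simp
  show posF: "(\<lambda>x. max 0 (y x)) \<in> F"
    by (rule F_AE_measurable[OF clamp_F[OF y K(1)]])
      (use K in \<open>auto simp: clamp_def elim!: eventually_mono\<close>)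
  \<comment> \<open>Set to 0 on B by hand: \<open>E_vanishing\<close> asks for zeros at every point
    of B, while y is nonnegative there only almost everywhere.\<close>
  define v where "v = (\<lambda>x. if x \<in> B then 0 else min K (max 0 (- y x)))"
  have vm: "v \<in> borel_measurable \<mu>" unfolding v_def by measurable
  have split: "AE x in \<mu>. max 0 (y x) = y x + v x"
    using K(2) pos by eventually_elim (auto simp: v_def)
  have vF: "v \<in> F"
    by (rule F_AE_measurable[OF clamp_F[OF F_minus[OF y] K(1)] vm])
      (use pos K(1) in \<open>auto simp: v_def clamp_def min_def max_def elim!: eventually_mono\<close>)
  fix \<phi> assume \<phi>: "\<phi> \<in> F" "\<phi> \<in> Cc" "fsupp \<phi> \<subseteq> B"
  have "E v \<phi> = 0"
    by (rule E_vanishing[OF vF _ _ _ \<phi>(1,2) B \<phi>(3), of K]) (use K in \<open>auto simp: v_def\<close>)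
  moreover have "E (\<lambda>x. max 0 (y x)) \<phi> = E (\<lambda>x. y x + v x) \<phi>"
    using E_AE[OF posF F_L2[OF F_add[OF y vF]] split \<phi>(1)] .
  ultimately show "E (\<lambda>x. max 0 (y x)) \<phi> = E y \<phi>" using y vF \<phi> by (simp add: E_add_left)
  have "ip v \<phi> = 0"
  proof -
    have "v x * \<phi> x = 0" for x
    proof (cases "\<phi> x = 0")
      case False
      then have "x \<in> fsupp \<phi>" by (intro in_fsupp)
      with \<phi>(3) show ?thesis by (auto simp: v_def)
    qed simp
    then have "(\<lambda>x. v x * \<phi> x) = (\<lambda>x. 0)" by (rule ext)
    then show ?thesis by (simp add: l2inner_def)
  qed
  moreover have "ip (\<lambda>x. max 0 (y x)) \<phi> = ip (\<lambda>x. y x + v x) \<phi>"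
    using split F_measurable[OF \<phi>(1)] vm by (intro l2inner_AE_cong) auto
  ultimately show "ip (\<lambda>x. max 0 (y x)) \<phi> = ip y \<phi>" using y vF \<phi> by (simp add: l2inner_add_left F_L2)
qed

abbreviation "cal \<equiv> caloric \<mu> E F"

lemma caloric_F: "cal u t B \<Longrightarrow> 0 < s \<Longrightarrow> s \<le> t \<Longrightarrow> u s \<in> F"
  by (simp add: caloric_def)

text \<open>Only the time T1 matters. The derivative from the left belongs to u1; the assumption on
  u2 provides the derivative from the right with the same value.\<close>

lemma caloric_glue:
  assumes c1: "cal u1 T1 B" and c2: "cal u2 (T2 - T1) B" and T: "0 < T1" "T1 < T2"
    and start: "\<And>\<phi>. \<phi> \<in> F \<Longrightarrow> \<phi> \<in> Cc \<Longrightarrow> fsupp \<phi> \<subseteq> B \<Longrightarrow>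
      ((\<lambda>s. (ip (u2 s) \<phi> - ip (u1 T1) \<phi>) / s) \<longlongrightarrow> - E (u1 T1) \<phi>) (at_right 0)"
  shows "cal (\<lambda>h. if h \<le> T1 then u1 h else u2 (h - T1)) T2 B"
  unfolding caloric_def
proof (intro ballI conjI impI)
  fix a assume a: "a \<in> {0<..T2}"
  let ?u = "\<lambda>h. if h \<le> T1 then u1 h else u2 (h - T1)"
  show uF: "?u a \<in> F" using a caloric_F[OF c1, of a] caloric_F[OF c2, of "a - T1"] by auto
  fix \<phi> assume "\<phi> \<in> F \<inter> Cc" and supp: "fsupp \<phi> \<subseteq> B"
  then have \<phi>: "\<phi> \<in> F" "\<phi> \<in> Cc" by auto
  let ?D = "- E (?u a) \<phi>"
  let ?g = "\<lambda>h. ip (?u h) \<phi>"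
  let ?q = "\<lambda>y. (?g y - ?g a) / (y - a)"
  have "(?q \<longlongrightarrow> ?D) (at a within {0<..T1})"
  proof (cases "a \<le> T1")
    case True
    then have "((\<lambda>s. ip (u1 s) \<phi>) has_real_derivative - E (u1 a) \<phi>) (at a within {0<..T1})"
      using c1 a \<phi> supp unfolding caloric_def by auto
    then have "((\<lambda>y. (ip (u1 y) \<phi> - ip (u1 a) \<phi>) / (y - a)) \<longlongrightarrow> - E (u1 a) \<phi>) (at a within {0<..T1})"
      by (simp add: has_field_derivative_iff)
    then have "(?q \<longlongrightarrow> - E (u1 a) \<phi>) (at a within {0<..T1})"
      by (rule Lim_transform_eventually) (use True in \<open>auto simp: eventually_at_filter\<close>)
    then show ?thesis using True by simp
  next
    case False
    \<comment> \<open>a is at positive distance from this interval, so the filter is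
      trivial.\<close>
    then have "\<forall>\<^sub>F y in at a within {0<..T1}. ?q y = ?D"
      by (auto simp: eventually_at dist_real_def intro!: exI[of _ "a - T1"])
    then show ?thesis by (rule tendsto_eventually)
  qed
  moreover have "(?q \<longlongrightarrow> ?D) (at a within {T1<..T2})"
  proof (cases "T1 \<le> a")
    case True
    define w where "w = (if a = T1 then u1 T1 else u2 (a - T1))"
    have w: "?u a = w" using True by (auto simp: w_def)
    have "((\<lambda>s. (ip (u2 s) \<phi> - ip w \<phi>) / (s - (a - T1))) \<longlongrightarrow> - E w \<phi>) (at (a - T1) within {0<..T2 - T1})"
    proof (cases "a = T1")
      case True
      have "at (0::real) within {0<..T2 - T1} = at_right 0" 
        by (rule at_within_nhd[of _ "{..<T2 - T1}"]) (use T in auto)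
      then show ?thesis using start[OF \<phi> supp] True by (simp add: w_def)
    next
      case False
      with True have "((\<lambda>s. ip (u2 s) \<phi>) has_real_derivative - E (u2 (a - T1)) \<phi>) (at (a - T1) within {0<..T2 - T1})"
        using c2 a \<phi> supp unfolding caloric_def by auto
      then show ?thesis using False by (simp add: has_field_derivative_iff w_def)
    qed
    moreover have "filterlim (\<lambda>h. h - T1) (at (a - T1) within {0<..T2 - T1}) (at a within {T1<..T2})"
      unfolding filterlim_at by (auto simp: eventually_at_filter intro!: tendsto_eq_intros)
    ultimately have "((\<lambda>h. (ip (u2 (h - T1)) \<phi> - ip w \<phi>) / ((h - T1) - (a - T1))) \<longlongrightarrow> - E w \<phi>) (at a within {T1<..T2})"
      by (rule filterlim_compose)
    then have "(?q \<longlongrightarrow> - E w \<phi>) (at a within {T1<..T2})"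
      by (rule Lim_transform_eventually) (use w in \<open>auto simp: eventually_at_filter\<close>)
    then show ?thesis using w by simp
  next
    case False
    then have "\<forall>\<^sub>F y in at a within {T1<..T2}. ?q y = ?D"
      by (auto simp: eventually_at dist_real_def intro!: exI[of _ "T1 - a"])
    then show ?thesis by (rule tendsto_eventually)
  qed
  ultimately have "(?q \<longlongrightarrow> ?D) (at a within ({0<..T1} \<union> {T1<..T2}))"
    by (simp only: Lim_within_Un)
  moreover have "{0<..T1} \<union> {T1<..T2} = {0<..T2}" using T by auto
  ultimately show "(?g has_real_derivative ?D) (at a within {0<..T2})"
    by (simp only: has_field_derivative_iff)
qed

lemma caloric_const:
  assumes "w \<in> F" "\<And>\<phi>. \<phi> \<in> F \<Longrightarrow> \<phi> \<in> Cc \<Longrightarrow> fsupp \<phi> \<subseteq> B \<Longrightarrow> E w \<phi> = 0"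
  shows "cal (\<lambda>h. w) t B"
  using assms unfolding caloric_def by simp

text \<open>Modification on a null set: it trades nonnegativity almost everywhere for nonnegativity
  at every point.\<close>

lemma nonneg_part_F:
  assumes "y \<in> F" "AE x in \<mu>. 0 \<le> y x"
  shows "(\<lambda>x. max 0 (y x)) \<in> F" "\<And>\<phi>. \<phi> \<in> F \<Longrightarrow> E (\<lambda>x. max 0 (y x)) \<phi> = E y \<phi>"
    "\<And>\<phi>. \<phi> \<in> F \<Longrightarrow> ip (\<lambda>x. max 0 (y x)) \<phi> = ip y \<phi>"
proof -
  have ym [measurable]: "y \<in> borel_measurable \<mu>" using assms(1) by (rule F_measurable)
  have ae: "AE x in \<mu>. y x = max 0 (y x)" using assms(2) by eventually_elim auto
  show f: "(\<lambda>x. max 0 (y x)) \<in> F" by (rule F_AE_measurable[OF assms(1) _ ae]) measurable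
  fix \<phi> assume \<phi>: "\<phi> \<in> F"
  show "E (\<lambda>x. max 0 (y x)) \<phi> = E y \<phi>" using E_AE[OF assms(1) F_L2[OF f] ae \<phi>] by simp
  show "ip (\<lambda>x. max 0 (y x)) \<phi> = ip y \<phi>"
    by (rule l2inner_AE_cong) (use ae F_measurable[OF \<phi>] in \<open>auto elim: eventually_mono\<close>)
qed

lemma caloric_semigroup:
  assumes f: "f \<in> L2 \<mu>" "AE x in \<mu>. 0 \<le> f x" and s: "0 \<le> s"
  shows "cal (\<lambda>h x. max 0 (P (s + h) f x)) t B"
  unfolding caloric_def
proof (intro ballI conjI impI)
  fix h assume "h \<in> {0<..t}"
  then have h: "0 < s + h" using s by simp
  note np = nonneg_part_F[OF P_F[OF f(1)] P_nonneg[OF f]]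
  show "(\<lambda>x. max 0 (P (s + h) f x)) \<in> F" using np(1) h by blast
  fix \<phi> assume "\<phi> \<in> F \<inter> Cc"
  then have \<phi>: "\<phi> \<in> F" by simp
  have "((\<lambda>h. ip (P (s + h) f) \<phi>) has_real_derivative ip (W (s + h) f) \<phi>) (at h)"
    using ip_P_has_derivative[OF f(1) F_L2[OF \<phi>] h]
      DERIV_shift[of "\<lambda>h. ip (P h f) \<phi>" "ip (W (s + h) f) \<phi>" h s] by (simp add: add.commute)
  moreover have "ip (W (s + h) f) \<phi> = - E (\<lambda>x. max 0 (P (s + h) f x)) \<phi>"
    using W_inner[OF f(1) h \<phi>] np(2)[OF h h \<phi>] by simp
  ultimately have "((\<lambda>h. ip (P (s + h) f) \<phi>) has_real_derivative - E (\<lambda>x. max 0 (P (s + h) f x)) \<phi>) (at h)" by simp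
  then have "((\<lambda>h. ip (\<lambda>x. max 0 (P (s + h) f x)) \<phi>) has_real_derivative - E (\<lambda>x. max 0 (P (s + h) f x)) \<phi>) (at h)"
    by (rule has_field_derivative_transform_within_open[of _ _ _ "{- s<..}"])
      (use h np(3)[OF _ _ \<phi>] in auto)
  then show "((\<lambda>h. ip (\<lambda>x. max 0 (P (s + h) f x)) \<phi>) has_real_derivative - E (\<lambda>x. max 0 (P (s + h) f x)) \<phi>) (at h within {0<..t})"
    by (rule has_field_derivative_at_within)
qed

end

section \<open>Scale functions\<close>

locale scale =
  fixes \<phi> :: "real \<Rightarrow> real" and K \<beta> \<beta>' :: real
  assumes scale: "scale_function_with \<phi> K \<beta> \<beta>'"
begin

lemma K_ge_1: "K \<ge> 1" and beta_pos: "0 < \<beta>" and beta_le: "\<beta> \<le> \<beta>'" and at_0: "\<phi> 0 = 0"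
  and cont: "continuous_on {0..} \<phi>" and unbounded: "filterlim \<phi> at_top at_top"
  using scale by (auto simp: scale_function_with_def)

lemma K_pos: "K > 0" and beta'_pos: "0 < \<beta>'"
  using K_ge_1 beta_pos beta_le by auto

lemma strict: "0 \<le> r \<Longrightarrow> r < s \<Longrightarrow> \<phi> r < \<phi> s"
  using scale by (auto simp: scale_function_with_def strict_mono_on_def)

lemma mono: "0 \<le> r \<Longrightarrow> r \<le> s \<Longrightarrow> \<phi> r \<le> \<phi> s"
  using strict[of r s] by (cases "r = s") auto

lemma pos: "0 < r \<Longrightarrow> 0 < \<phi> r"
  using strict[of 0 r] by (simp add: at_0)

lemma less_iff: "0 \<le> r \<Longrightarrow> 0 \<le> s \<Longrightarrow> \<phi> r < \<phi> s \<longleftrightarrow> r < s"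
  using strict[of r s] mono[of s r] by (cases "r < s") auto

lemma le_iff: "0 \<le> r \<Longrightarrow> 0 \<le> s \<Longrightarrow> \<phi> r \<le> \<phi> s \<longleftrightarrow> r \<le> s"
  using less_iff[of s r] by auto

lemma ratio_le: "0 < s \<Longrightarrow> s \<le> t \<Longrightarrow> \<phi> t \<le> K * (t / s) powr \<beta>' * \<phi> s"
  using scale pos[of s] unfolding scale_function_with_def by (simp add: divide_le_eq)

lemma ratio_ge: 
  assumes "0 < s" "s \<le> t"
  shows "(t / s) powr \<beta> * \<phi> s \<le> K * \<phi> t"
proof -
  have "inverse K * (t / s) powr \<beta> \<le> \<phi> t / \<phi> s"
    using scale assms unfolding scale_function_with_def by blast
  then show ?thesis using pos[OF assms(1)] K_pos by (simp add: field_simps)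
qed

lemma scale_inv: "0 \<le> r \<Longrightarrow> scale_inv \<phi> (\<phi> r) = r"
  unfolding scale_inv_def
proof (rule the_equality)
  fix s assume r: "0 \<le> r" and s: "0 \<le> s \<and> \<phi> s = \<phi> r"
  then show "s = r" using less_iff[of r s] less_iff[of s r] by auto
qed simp

lemma surj: 
  assumes "0 \<le> t"
  obtains r where "0 \<le> r" "\<phi> r = t"
proof -
  obtain R where R: "R \<ge> 0" "t \<le> \<phi> R"
    using unbounded unfolding filterlim_at_top eventually_at_top_linorder
    by (metis linorder_le_cases order_refl)
  have "\<exists>x\<ge>0. x \<le> R \<and> \<phi> x = t"
    using R assms at_0 continuous_on_subset[OF cont, of "{0..R}"] by (intro IVT') auto
  then show ?thesis using that by blast
qed

lemma inv_pos:
  assumes "0 < t"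
  shows "0 < scale_inv \<phi> t" "\<phi> (scale_inv \<phi> t) = t"
proof -
  obtain r where "0 \<le> r" "\<phi> r = t" using surj[of t] assms by auto
  then show "\<phi> (scale_inv \<phi> t) = t" "0 < scale_inv \<phi> t" using scale_inv[of r] assms at_0 by (auto simp: less_le)
qed

lemma small: 
  assumes "e > 0"
  obtains r where "r > 0" "\<phi> r < e"
proof -
  obtain r where r: "0 \<le> r" "\<phi> r = e / 2" using surj[of "e/2"] assms by auto
  then show ?thesis using that[of r] assms at_0 by (cases "r = 0") auto
qed

lemma phi_bar_mono:
  assumes "0 \<le> r" "ereal r < R"
  shows "ereal (\<phi> r) < phi_bar \<phi> R"
  using assms strict[of r] by (cases R) (auto simp: phi_bar_def)

lemma phi_bar_inv:
  assumes "0 < t" "ereal t < phi_bar \<phi> R" "0 \<le> R"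
  shows "ereal (scale_inv \<phi> t) < R"
proof (cases R)
  case (real D)
  then have "\<phi> (scale_inv \<phi> t) < \<phi> D" using assms inv_pos[OF assms(1)] by (simp add: phi_bar_def)
  then show ?thesis using real assms inv_pos[OF assms(1)] less_iff[of "scale_inv \<phi> t" D] by auto
qed (use assms in auto)

end

section \<open>Consequences of the parabolic Harnack inequality\<close>

lemma esssup_on_le_imp_AE:
  fixes f :: "'a::heine_borel \<Rightarrow> real"
  assumes "mm_space \<mu>" "esssup_on \<mu> (ball x r) f \<le> ereal a"
  shows "AE y in \<mu>. y \<in> ball x r \<longrightarrow> f y \<le> a"
proof -
  interpret proper_mm_space \<mu> by (rule proper_mm_space.intro[OF assms(1)])
  have "AE y in restrict_space \<mu> (ball x r). ereal (f y) \<le> esssup_on \<mu> (ball x r) f"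
    unfolding esssup_on_def by (rule esssup_AE)
  then have "AE y in \<mu>. y \<in> ball x r \<longrightarrow> ereal (f y) \<le> esssup_on \<mu> (ball x r) f"
    by (subst (asm) AE_restrict_space_iff) auto
  then show ?thesis
  proof eventually_elim
    case (elim y)
    then show ?case using assms(2) order_trans[of "ereal (f y)" _ "ereal a"] by auto
  qed
qed

lemma essinf_on_ge_imp_AE:
  fixes f :: "'a::heine_borel \<Rightarrow> real"
  assumes "mm_space \<mu>" "ereal a \<le> essinf_on \<mu> (ball x r) f"
  shows "AE y in \<mu>. y \<in> ball x r \<longrightarrow> a \<le> f y"
proof -
  have "esssup_on \<mu> (ball x r) (\<lambda>y. - f y) = - essinf_on \<mu> (ball x r) f"
    by (simp add: esssup_on_def essinf_on_def)
  then have "esssup_on \<mu> (ball x r) (\<lambda>y. - f y) \<le> ereal (- a)"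
    using assms(2) by (metis ereal_minus_le_minus uminus_ereal.simps(1))
  from esssup_on_le_imp_AE[OF assms(1) this] show ?thesis by simp
qed

locale harnack = local_form \<mu> E F P + psi: scale \<psi> K \<beta> \<beta>'
  for \<mu> :: "'a::heine_borel measure" and E :: "('a \<Rightarrow> real) \<Rightarrow> ('a \<Rightarrow> real) \<Rightarrow> real"
    and F :: "('a \<Rightarrow> real) set" and P and \<psi> K \<beta> \<beta>' +
  fixes C1 C2 C3 C4 C c :: real
  assumes params: "0 < C1" "C1 < C2" "C2 < C3" "C3 < C4" "C \<ge> 1" "0 < c" "c < 1"
    and harnack: "\<And>t x u. 0 < t \<Longrightarrow> ereal t < ereal (min (inverse C4) 1) * phi_bar \<psi> (mm_diam \<mu>) \<Longrightarrow>
        (\<And>s y. u s y \<ge> 0) \<Longrightarrow> caloric \<mu> E F u t (ball x (scale_inv \<psi> t)) \<Longrightarrow>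
        (SUP s\<in>{C1 * t<..C2 * t}. esssup_on \<mu> (ball x (c * scale_inv \<psi> t)) (u s))
          \<le> ereal C * (INF s\<in>{C3 * t<..C4 * t}. essinf_on \<mu> (ball x (c * scale_inv \<psi> t)) (u s))"
begin

lemma ball_c_subset: "r > 0 \<Longrightarrow> ball x (c * r) \<subseteq> ball x r"
  using params by (intro subset_ball) (simp add: mult_le_cancel_right1)

lemma caloric_cong:
  assumes "cal u t B" "\<And>s. 0 < s \<Longrightarrow> s \<le> t \<Longrightarrow> v s = u s"
  shows "cal v t B"
  unfolding caloric_def
proof (intro ballI conjI impI)
  fix s assume s: "s \<in> {0<..t}"
  then have vs: "v s = u s" using assms(2) by auto
  show "v s \<in> F" using s assms(1) vs by (simp add: caloric_def)
  fix \<phi> assume \<phi>: "\<phi> \<in> F \<inter> Cc" "fsupp \<phi> \<subseteq> B"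
  have "((\<lambda>s. ip (u s) \<phi>) has_real_derivative - E (u s) \<phi>) (at s within {0<..t})"
    using assms(1) s \<phi> by (auto simp: caloric_def)
  then have "((\<lambda>y. (ip (u y) \<phi> - ip (u s) \<phi>) / (y - s)) \<longlongrightarrow> - E (u s) \<phi>) (at s within {0<..t})"
    by (simp add: has_field_derivative_iff)
  then have "((\<lambda>y. (ip (v y) \<phi> - ip (v s) \<phi>) / (y - s)) \<longlongrightarrow> - E (u s) \<phi>) (at s within {0<..t})"
    by (rule Lim_transform_eventually) (auto simp: eventually_at_filter assms(2) vs)
  then show "((\<lambda>s. ip (v s) \<phi>) has_real_derivative - E (v s) \<phi>) (at s within {0<..t})"
    by (simp add: has_field_derivative_iff vs)
qed

lemma exists_cutoff_ball:
  assumes "r > 0" "r < R"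
  obtains cut where "cut \<in> F" "cut \<in> Cc" "\<And>y. 0 \<le> cut y" "\<And>y. cut y \<le> 1" "\<And>y. y \<in> cball x r \<Longrightarrow> cut y = 1" "\<And>y. y \<notin> ball x R \<Longrightarrow> cut y = 0"
  by (rule cutoff[of "cball x r" "ball x R"]) (use assms in auto)

text \<open>For \<open>C4 > 1\<close> the Harnack inequality would involve times at which a caloric function is not
  constrained at all: truncate a locally constant function to 0 just before time \<open>C4 t\<close>.\<close>
lemma C4_le_1: "C4 \<le> 1"
proof (rule ccontr)
  assume "\<not> C4 \<le> 1"
  then have C4: "C4 > 1" by simp
  have diam: "0 < mm_diam \<mu>" by (rule diam_pos)
  have "\<exists>r>0. ereal (\<psi> r) < ereal (inverse C4) * phi_bar \<psi> (mm_diam \<mu>)"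
  proof (cases "mm_diam \<mu>")
    case (real D)
    then have "D > 0" using diam by simp
    then obtain r where "r > 0" "\<psi> r < inverse C4 * \<psi> D" using psi.small[of "inverse C4 * \<psi> D"] psi.pos[of D] C4 by auto
    then show ?thesis using real by (auto simp: phi_bar_def)
  next
    case PInf
    then show ?thesis using C4 by (auto simp: phi_bar_def intro!: exI[of _ 1])
  qed (use diam in auto)
  then obtain r where r: "r > 0" "ereal (\<psi> r) < ereal (inverse C4) * phi_bar \<psi> (mm_diam \<mu>)" by blast
  define t where "t = \<psi> r"
  have t: "t > 0" and rt: "scale_inv \<psi> t = r" using r psi.pos[of r] psi.scale_inv[of r] by (auto simp: t_def)
  fix x :: 'a
  obtain cut where cut: "cut \<in> F" "cut \<in> Cc" "\<And>y. 0 \<le> cut y" "\<And>y. y \<in> cball x r \<Longrightarrow> cut y = 1"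
    using exists_cutoff_ball[of r "r + 1" x] r by (metis less_add_one)
  \<comment> \<open>The switch to 0 comes after t, so that u stays caloric, and after C2 t, so that
    u is still 1 on the ball at the end of the early window.\<close>
  define u where "u s = (if s \<le> max t (C2 * t) then cut else (\<lambda>y. 0))" for s
  have "cal (\<lambda>s. cut) t (ball x r)"
    by (rule caloric_const[OF cut(1)], rule E_locally_constant[OF cut(1,2), of _ "ball x r" 1]) (auto simp: cut(4))
  then have cu: "cal u t (ball x r)" by (rule caloric_cong) (auto simp: u_def)
  have "(SUP s\<in>{C1 * t<..C2 * t}. esssup_on \<mu> (ball x (c * r)) (u s))
          \<le> ereal C * (INF s\<in>{C3 * t<..C4 * t}. essinf_on \<mu> (ball x (c * r)) (u s))"
    using harnack[of t u x] t r(2) C4 cu rt cut(3) by (simp add: t_def[symmetric] u_def min_def inverse_le_1_iff)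
  also have "\<dots> \<le> ereal C * 0"
  proof (rule ereal_mult_left_mono)
    have "essinf_on \<mu> (ball x (c * r)) (u (C4 * t)) \<le> 0"
    proof (rule ccontr)
      assume "\<not> essinf_on \<mu> (ball x (c * r)) (u (C4 * t)) \<le> 0"
      then have "0 < essinf_on \<mu> (ball x (c * r)) (u (C4 * t))" by simp
      then obtain e where e: "0 < ereal e" "ereal e < essinf_on \<mu> (ball x (c * r)) (u (C4 * t))"
        using ereal_dense2 by blast
      have "AE y in \<mu>. y \<in> ball x (c * r) \<longrightarrow> e \<le> u (C4 * t) y"
        using e(2) by (intro essinf_on_ge_imp_AE[OF mm]) simp
      from AE_not_False_on_ball[OF _ this] obtain y where "e \<le> u (C4 * t) y" using r params by auto
      moreover have "u (C4 * t) = (\<lambda>y. 0)"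
      proof -
        have "t < C4 * t" "C2 * t < C4 * t" using C4 params t by auto
        then have "\<not> C4 * t \<le> max t (C2 * t)" by linarith
        then show ?thesis by (simp add: u_def)
      qed
      ultimately show False using e by simp
    qed
    then show "(INF s\<in>{C3 * t<..C4 * t}. essinf_on \<mu> (ball x (c * r)) (u s)) \<le> 0"
      by (rule INF_lower2[rotated]) (use params t in auto)
  qed (use params in auto)
  finally have le0: "(SUP s\<in>{C1 * t<..C2 * t}. esssup_on \<mu> (ball x (c * r)) (u s)) \<le> 0" by simp
  have "esssup_on \<mu> (ball x (c * r)) (u (C2 * t)) \<le> (SUP s\<in>{C1 * t<..C2 * t}. esssup_on \<mu> (ball x (c * r)) (u s))"
    by (rule SUP_upper) (use params t in auto)
  also note le0
  finally have "esssup_on \<mu> (ball x (c * r)) (u (C2 * t)) \<le> ereal 0" by (simp add: zero_ereal_def)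
  then have "AE y in \<mu>. y \<in> ball x (c * r) \<longrightarrow> u (C2 * t) y \<le> 0" by (rule esssup_on_le_imp_AE[OF mm])
  from AE_not_False_on_ball[OF _ this] obtain y where y: "y \<in> ball x (c * r)" "u (C2 * t) y \<le> 0" using r params by auto
  have "y \<in> cball x r" using y(1) ball_c_subset[OF r(1), of x] by auto
  with y(2) cut(4) show False by (simp add: u_def)
qed

text \<open>Beyond time \<open>C4 \<psi>(r)\<close> a caloric function may be continued by the heat semigroup.\<close>
lemma parabolic_harnack:
  assumes r: "r > 0" "ereal r < mm_diam \<mu>" and nonneg: "\<And>s y. u s y \<ge> 0"
    and cal: "cal u (C4 * \<psi> r) (ball x r)"
  shows "\<exists>m\<ge>0.
    (\<forall>s. C1 * \<psi> r < s \<and> s \<le> C2 * \<psi> r \<longrightarrow> (AE y in \<mu>. y \<in> ball x (c * r) \<longrightarrow> u s y \<le> C * m)) \<and>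
    (\<forall>s. C3 * \<psi> r < s \<and> s \<le> C4 * \<psi> r \<longrightarrow> (AE y in \<mu>. y \<in> ball x (c * r) \<longrightarrow> m \<le> u s y))"
proof -
  define t where "t = \<psi> r"
  have t: "t > 0" and rt: "scale_inv \<psi> t = r" using r psi.pos[of r] psi.scale_inv[of r] by (auto simp: t_def)
  have C4t: "C4 * t \<le> t" "0 < C4 * t" using C4_le_1 params t by auto
  define w where "w = u (C4 * t)"
  define v where "v s = (if s \<le> C4 * t then u s else (\<lambda>y. max 0 (P (0 + (s - C4 * t)) w y)))" for s
  have wF: "w \<in> F" using caloric_F[OF cal] C4t by (simp add: w_def t_def)
  have w0: "AE y in \<mu>. 0 \<le> w y" using nonneg by (simp add: w_def)
  have calv: "cal v t (ball x r)"
  proof (cases "C4 * t < t")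
    case True
    show ?thesis unfolding v_def
    proof (rule caloric_glue)
      show "cal u (C4 * t) (ball x r)" using cal by (simp add: t_def)
      show "cal (\<lambda>h y. max 0 (P (0 + h) w y)) (t - C4 * t) (ball x r)"
        by (rule caloric_semigroup[OF F_L2[OF wF] w0]) simp
      fix \<phi> assume \<phi>: "\<phi> \<in> F"
      have "((\<lambda>s. (ip (P s w) \<phi> - ip w \<phi>) / s) \<longlongrightarrow> - E w \<phi>) (at_right 0)"
        by (rule ip_P_right_derivative[OF wF \<phi>])
      then show "((\<lambda>s. (ip (\<lambda>y. max 0 (P (0 + s) w y)) \<phi> - ip (u (C4 * t)) \<phi>) / s) \<longlongrightarrow> - E (u (C4 * t)) \<phi>) (at_right 0)"
        unfolding w_def[symmetric]
      proof (rule Lim_transform_eventually)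
        have "ip (P s w) \<phi> = ip (\<lambda>y. max 0 (P (0 + s) w y)) \<phi>" if "s > 0" for s
          using nonneg_part_F(3)[OF P_F[OF F_L2[OF wF] that] P_nonneg[OF F_L2[OF wF] w0 that] \<phi>] by simp
        then show "\<forall>\<^sub>F s in at_right 0. (ip (P s w) \<phi> - ip w \<phi>) / s = (ip (\<lambda>y. max 0 (P (0 + s) w y)) \<phi> - ip w \<phi>) / s"
          by (auto simp: eventually_at_filter)
      qed
    qed (use True C4t in auto)
  next
    case False
    with C4t have e: "C4 * t = t" by simp
    have "cal u t (ball x r)" using cal unfolding t_def[symmetric] e .
    then show ?thesis by (rule caloric_cong) (simp add: v_def e)
  qed
  define L where "L = (INF s\<in>{C3 * t<..C4 * t}. essinf_on \<mu> (ball x (c * r)) (v s))"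
  have v_eq: "v s = u s" if "s \<le> C4 * t" for s using that by (simp add: v_def)
  have harn: "(SUP s\<in>{C1 * t<..C2 * t}. esssup_on \<mu> (ball x (c * r)) (v s)) \<le> ereal C * L"
  proof -
    \<comment> \<open>The factor in front of \<open>phi_bar\<close> is therefore 1, and every radius
      below the diameter is admissible.\<close>
    have "1 \<le> inverse C4" using C4_le_1 params by (intro one_le_inverse) auto
    then have "min (inverse C4) 1 = 1" by simp
    then have "ereal t < ereal (min (inverse C4) 1) * phi_bar \<psi> (mm_diam \<mu>)"
      using psi.phi_bar_mono[OF _ r(2)] r by (simp add: t_def one_ereal_def[symmetric])
    moreover have "0 \<le> v s y" for s y using nonneg by (simp add: v_def)
    ultimately show ?thesis unfolding L_def using harnack[of t v x] t calv unfolding rt by blast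
  qed
  have L0: "0 \<le> L" unfolding L_def
  proof (rule INF_greatest)
    fix s assume s: "s \<in> {C3 * t<..C4 * t}"
    have s0: "0 < s" using s params t by (auto intro: less_trans[of 0 "C3 * t"])
    have "u s \<in> F" using caloric_F[OF cal, of s] s s0 by (simp add: t_def)
    then have um [measurable]: "u s \<in> borel_measurable \<mu>" by (rule F_measurable)
    have "esssup_on \<mu> (ball x (c * r)) (\<lambda>y. - u s y) \<le> 0"
      unfolding esssup_on_def
      by (rule esssup_I) (use nonneg in \<open>auto intro!: measurable_restrict_space1\<close>)
    then show "0 \<le> essinf_on \<mu> (ball x (c * r)) (v s)"
      using s by (simp add: v_eq essinf_on_def esssup_on_def ereal_0_le_uminus_iff)
  qed
  have "L < \<infinity>"
  proof -
    \<comment> \<open>An infinite bound would give a point of the ball at which a real-valued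
      function exceeds every natural number.\<close>
    have "essinf_on \<mu> (ball x (c * r)) (v (C4 * t)) \<noteq> \<infinity>"
    proof
      assume inf: "essinf_on \<mu> (ball x (c * r)) (v (C4 * t)) = \<infinity>"
      have "AE y in \<mu>. y \<in> ball x (c * r) \<longrightarrow> real n \<le> v (C4 * t) y" for n
        by (rule essinf_on_ge_imp_AE[OF mm]) (simp add: inf)
      then have "AE y in \<mu>. \<forall>n. y \<in> ball x (c * r) \<longrightarrow> real n \<le> v (C4 * t) y"
        by (rule AE_all_countable[THEN iffD2, OF allI])
      then have "AE y in \<mu>. y \<in> ball x (c * r) \<longrightarrow> (\<forall>n. real n \<le> v (C4 * t) y)" by eventually_elim auto
      from AE_not_False_on_ball[OF _ this] obtain y where "\<forall>n. real n \<le> v (C4 * t) y" using r params by auto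
      then show False using reals_Archimedean2[of "v (C4 * t) y"] by (meson not_le)
    qed
    moreover have "L \<le> essinf_on \<mu> (ball x (c * r)) (v (C4 * t))"
      unfolding L_def by (rule INF_lower) (use params t in auto)
    ultimately show ?thesis by (metis ereal_infty_less(1) order.strict_trans1 less_ereal.simps(2))
  qed
  with L0 obtain m where m: "L = ereal m" "m \<ge> 0" by (cases L) auto
  show ?thesis
  proof (intro exI[of _ m] conjI allI impI m(2))
    fix s assume s: "C1 * \<psi> r < s \<and> s \<le> C2 * \<psi> r"
    have "s \<le> C2 * t" using s by (simp add: t_def)
    also have "\<dots> \<le> C4 * t" using params t by (intro mult_right_mono) auto
    finally have vs: "v s = u s" by (rule v_eq)
    have "esssup_on \<mu> (ball x (c * r)) (v s) \<le> (SUP s\<in>{C1 * t<..C2 * t}. esssup_on \<mu> (ball x (c * r)) (v s))"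
      by (rule SUP_upper) (use s in \<open>auto simp: t_def\<close>)
    also have "\<dots> \<le> ereal (C * m)" using harn m by simp
    finally show "AE y in \<mu>. y \<in> ball x (c * r) \<longrightarrow> u s y \<le> C * m"
      unfolding vs by (rule esssup_on_le_imp_AE[OF mm])
  next
    fix s assume s: "C3 * \<psi> r < s \<and> s \<le> C4 * \<psi> r"
    then have vs: "v s = u s" by (intro v_eq) (simp add: t_def)
    have "ereal m \<le> essinf_on \<mu> (ball x (c * r)) (v s)"
      unfolding m(1)[symmetric] L_def by (rule INF_lower) (use s in \<open>auto simp: t_def\<close>)
    then show "AE y in \<mu>. y \<in> ball x (c * r) \<longrightarrow> m \<le> u s y"
      unfolding vs by (rule essinf_on_ge_imp_AE[OF mm])
  qed
qed

lemma P_abs_bounded: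
  assumes f: "f \<in> L2 \<mu>" "AE x in \<mu>. \<bar>f x\<bar> \<le> B" and t: "t > 0"
  shows "AE x in \<mu>. \<bar>P t f x\<bar> \<le> B"
proof -
  have fm [measurable]: "f \<in> borel_measurable \<mu>" using f(1) by (rule L2_measurable)
  have a: "(\<lambda>x. \<bar>f x\<bar>) \<in> L2 \<mu>" by (rule L2_bound[OF f(1)]) auto
  have "AE x in \<mu>. 0 \<le> P t (\<lambda>x. \<bar>f x\<bar>) x \<and> P t (\<lambda>x. \<bar>f x\<bar>) x \<le> B"
    by (rule P_bounded[OF a _ t]) (use f in auto)
  moreover have "AE x in \<mu>. P t f x \<le> P t (\<lambda>x. \<bar>f x\<bar>) x"
    by (rule P_mono[OF f(1) a _ t]) auto
  moreover have "AE x in \<mu>. P t (\<lambda>x. - 1 * f x) x \<le> P t (\<lambda>x. \<bar>f x\<bar>) x"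
    by (rule P_mono[OF L2_scale[OF f(1)] a _ t]) auto
  moreover have "AE x in \<mu>. P t (\<lambda>x. - 1 * f x) x = - 1 * P t f x" by (rule P_scale[OF f(1) t])
  ultimately show ?thesis by eventually_elim auto
qed

text \<open>Half of the time between the beginning of the early and the end of the late Harnack
  window: a flow lasting at most \<open>a0 * \<psi> r\<close> and ending with the late window starts
  after the early window has begun.\<close>

definition a0 :: real where "a0 = (C4 - C1) / 2"
text \<open>One Harnack step recovers the fraction 1/C of a gap; this fraction remains.\<close>

definition \<theta> :: real where "\<theta> = 1 - 1 / C"

lemma a0_pos: "a0 > 0" using params by (simp add: a0_def)
lemma theta: "0 \<le> \<theta>" "\<theta> < 1" using params by (auto simp: \<theta>_def)

text \<open>The flow is restarted at s - C2 \<psi>(r), so that the early window ends at s and the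
  late one at s + (C4 - C2) \<psi>(r). The supremum at s is then at most C times an infimum at the
  later time, and an infimum is at most an average.\<close>

lemma harnack_average:
  assumes r: "0 < r" "ereal r < mm_diam \<mu>" and f: "f \<in> L2 \<mu>" "\<And>y. 0 \<le> f y" and s: "C2 * \<psi> r \<le> s"
  shows "AE y in \<mu>. y \<in> ball z (c * r) \<longrightarrow>
    P s f y \<le> C / V \<mu> z (c * r) * ip (P (s + (C4 - C2) * \<psi> r) f) (indicat_real (ball z (c * r)))"
proof -
  have p: "0 < \<psi> r" using r by (intro psi.pos)
  have cr: "0 < c * r" using r params by simp
  have \<sigma>: "0 \<le> s - C2 * \<psi> r" using s by simp
  let ?t = "s + (C4 - C2) * \<psi> r" and ?I = "indicat_real (ball z (c * r))"
  have t_eq: "s - C2 * \<psi> r + C4 * \<psi> r = ?t" by (simp add: algebra_simps)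
  have t: "0 < ?t" unfolding t_eq[symmetric] using \<sigma> params p by (intro add_nonneg_pos) auto
  have IL: "?I \<in> L2 \<mu>" by (intro indicator_L2) auto
  obtain m where m: "m \<ge> 0"
    "\<And>h. C1 * \<psi> r < h \<Longrightarrow> h \<le> C2 * \<psi> r \<Longrightarrow> AE y in \<mu>. y \<in> ball z (c * r) \<longrightarrow> max 0 (P ((s - C2 * \<psi> r) + h) f y) \<le> C * m"
    "\<And>h. C3 * \<psi> r < h \<Longrightarrow> h \<le> C4 * \<psi> r \<Longrightarrow> AE y in \<mu>. y \<in> ball z (c * r) \<longrightarrow> m \<le> max 0 (P ((s - C2 * \<psi> r) + h) f y)"
    using parabolic_harnack[OF r _ caloric_semigroup[OF f(1) _ \<sigma>], of z] f(2) by auto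
  have up: "AE y in \<mu>. y \<in> ball z (c * r) \<longrightarrow> max 0 (P s f y) \<le> C * m"
    using m(2)[of "C2 * \<psi> r"] params p by simp
  have low: "AE y in \<mu>. y \<in> ball z (c * r) \<longrightarrow> m \<le> max 0 (P ?t f y)"
    using m(3)[of "C4 * \<psi> r"] params p unfolding t_eq by simp
  have Pf0: "AE y in \<mu>. 0 \<le> P ?t f y" using f by (intro P_nonneg t) auto
  have "m * V \<mu> z (c * r) = (\<integral>y. m * ?I y \<partial>\<mu>)" by (simp add: V_def)
  also have "\<dots> \<le> ip (P ?t f) ?I"
    unfolding l2inner_def
  proof (rule integral_mono_AE)
    show "integrable \<mu> (\<lambda>y. m * ?I y)" using ball_finite by (intro integrable_mult_right integrable_real_indicator) auto
    show "integrable \<mu> (\<lambda>y. P ?t f y * ?I y)" using f IL t by (intro L2_integrable_mult P_L2) auto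
    show "AE y in \<mu>. m * ?I y \<le> P ?t f y * ?I y" using low Pf0 by eventually_elim (auto simp: indicator_def)
  qed
  finally have mle: "m * V \<mu> z (c * r) \<le> ip (P ?t f) ?I" .
  have "C * m \<le> C / V \<mu> z (c * r) * ip (P ?t f) ?I"
    using mult_left_mono[OF mle, of C] params V_pos[OF cr, of z] by (simp add: field_simps)
  with up show ?thesis by (auto elim!: eventually_mono)
qed

text \<open>The difference to the lower bound, started as a constant in \<open>ball x r\<close>, is a nonnegative
  caloric function there, by strong locality.\<close>
lemma contraction:
  assumes r: "r > 0" "ereal r < mm_diam \<mu>" and f: "f \<in> F" "f \<in> Cc" "\<And>y. y \<in> ball x r \<Longrightarrow> f y = b"
    and M: "M \<ge> 0" and s: "0 < s" "s \<le> a0 * \<psi> r"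
    and lower: "\<And>h. 0 < h \<Longrightarrow> h \<le> s \<Longrightarrow> AE y in \<mu>. y \<in> ball x r \<longrightarrow> b - M \<le> P h f y"
  shows "AE y in \<mu>. y \<in> ball x (c * r) \<longrightarrow> b - \<theta> * M \<le> P s f y"
proof (cases "M = 0")
  case True
  then show ?thesis using lower[OF s(1) order_refl] ball_c_subset[OF r(1), of x] by (auto elim!: eventually_mono)
next
  case False
  with M have M: "M > 0" by simp
  have psi: "\<psi> r > 0" using r by (intro psi.pos)
  have fL: "f \<in> L2 \<mu>" using f by (intro F_L2)
  obtain cut where cut: "cut \<in> F" "cut \<in> Cc" "\<And>y. 0 \<le> cut y" "\<And>y. cut y \<le> 1" "\<And>y. y \<in> cball x r \<Longrightarrow> cut y = 1"
    using exists_cutoff_ball[of r "r + 1" x] r by (metis less_add_one)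
  obtain B where B: "B > 0" "\<And>y. \<bar>f y\<bar> \<le> B" using Cc_bounded[OF f(2)] by auto
  define B' where "B' = B + \<bar>b - M\<bar>"
  have B': "B' > 0" using B by (simp add: B'_def)
  have cut_abs: "\<bar>(b - M) * cut y\<bar> \<le> \<bar>b - M\<bar>" for y
    using cut(3,4)[of y] by (simp add: abs_mult mult_left_le)
  \<comment> \<open>For h \<le> 0 this is the initial value minus the lower bound; it equals M on
    \<open>ball x r\<close> and is used both for the resting phase and as start of the flow.\<close>
  define y where "y h = (\<lambda>z. (if h \<le> 0 then f z else P h f z) - (b - M) * cut z)" for h
  have cut2: "(\<lambda>z. (b - M) * cut z) \<in> F" using cut(1) by (rule F_scale)
  have yF: "y h \<in> F" for h
    unfolding y_def using F_diff[OF f(1) cut2] F_diff[OF P_F[OF fL] cut2] by (cases "h \<le> 0") auto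
  have y_bdd: "AE z in \<mu>. \<bar>y h z\<bar> \<le> B'" for h
  proof (cases "h \<le> 0")
    case True
    then show ?thesis using B(2) cut_abs by (auto simp: y_def B'_def intro!: AE_I2 order_trans[OF abs_triangle_ineq4] add_mono)
  next
    case False
    then have "AE z in \<mu>. \<bar>P h f z\<bar> \<le> B" using B by (intro P_abs_bounded fL) auto
    then show ?thesis
    proof eventually_elim
      case (elim z)
      then show ?case using False cut_abs[of z] by (auto simp: y_def B'_def intro!: order_trans[OF abs_triangle_ineq4] add_mono)
    qed
  qed
  have y_pos: "AE z in \<mu>. z \<in> ball x r \<longrightarrow> 0 \<le> y h z" if "h \<le> s" for h
  proof (cases "h \<le> 0")
    case True
    then show ?thesis using f(3) cut(5) M by (auto simp: y_def intro!: AE_I2)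
  next
    case False
    then show ?thesis using lower[of h] that cut(5) by (auto simp: y_def elim!: eventually_mono)
  qed
  note pp = positive_part_local[OF yF B' y_bdd y_pos open_ball]
  have Ecut: "E cut \<phi> = 0" and Ef: "E f \<phi> = 0" if "\<phi> \<in> F" "\<phi> \<in> Cc" "fsupp \<phi> \<subseteq> ball x r" for \<phi>
    using E_locally_constant[OF cut(1,2) that(1,2) open_ball that(3), of 1]
      E_locally_constant[OF f(1,2) that(1,2) open_ball that(3), of b] cut(5) f(3) by auto
  have Ey0: "E (y 0) \<phi> = 0" if "\<phi> \<in> F" "\<phi> \<in> Cc" "fsupp \<phi> \<subseteq> ball x r" for \<phi>
    using that Ecut[OF that] Ef[OF that] f cut cut2 by (simp add: y_def E_diff_left E_scale_left)
  have Ey: "E (y h) \<phi> = E (P h f) \<phi>" if "\<phi> \<in> F" "\<phi> \<in> Cc" "fsupp \<phi> \<subseteq> ball x r" "0 < h" for \<phi> h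
    using that Ecut[OF that(1-3)] fL cut cut2 by (simp add: y_def E_diff_left E_scale_left P_F)
  have ipy: "ip (y h) \<phi> = ip (P h f) \<phi> - (b - M) * ip cut \<phi>" if "\<phi> \<in> F" "0 < h" for \<phi> h
    using that fL cut cut2 by (simp add: y_def l2inner_diff_left l2inner_scale_left P_L2 F_L2)
  have ipy0: "ip (y 0) \<phi> = ip f \<phi> - (b - M) * ip cut \<phi>" if "\<phi> \<in> F" for \<phi>
    using that fL cut cut2 by (simp add: y_def l2inner_diff_left l2inner_scale_left F_L2)
  let ?w = "\<lambda>z. max 0 (y 0 z)" and ?u2 = "\<lambda>h z. max 0 (y h z)"
  have c1: "cal (\<lambda>h. ?w) T (ball x r)" for T
    using s pp(1)[of 0] pp(2)[of 0] Ey0 by (intro caloric_const) auto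
  have c2: "cal ?u2 s (ball x r)"
    unfolding caloric_def
  proof (intro ballI conjI impI)
    fix h assume h: "h \<in> {0<..s}"
    show "?u2 h \<in> F" using pp(1)[of h] h by auto
    fix \<phi> assume "\<phi> \<in> F \<inter> Cc" and supp: "fsupp \<phi> \<subseteq> ball x r"
    then have \<phi>: "\<phi> \<in> F" "\<phi> \<in> Cc" by auto
    have "((\<lambda>h. ip (P h f) \<phi> - (b - M) * ip cut \<phi>) has_real_derivative ip (W h f) \<phi> - 0) (at h within {0<..s})"
      by (intro DERIV_diff DERIV_const has_field_derivative_at_within[OF ip_P_has_derivative] fL F_L2 \<phi>) (use h in auto)
    moreover have "ip (W h f) \<phi> = - E (?u2 h) \<phi>"
      using h W_inner[OF fL _ \<phi>(1), of h] pp(2)[OF _ \<phi> supp, of h] Ey[OF \<phi> supp, of h] by simp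
    ultimately have "((\<lambda>k. (ip (P k f) \<phi> - (b - M) * ip cut \<phi> - (ip (P h f) \<phi> - (b - M) * ip cut \<phi>)) / (k - h)) \<longlongrightarrow> - E (?u2 h) \<phi>) (at h within {0<..s})"
      by (simp only: has_field_derivative_iff) simp
    then have "((\<lambda>k. (ip (?u2 k) \<phi> - ip (?u2 h) \<phi>) / (k - h)) \<longlongrightarrow> - E (?u2 h) \<phi>) (at h within {0<..s})"
      by (rule Lim_transform_eventually)
        (use h pp(3)[OF _ \<phi> supp] ipy[OF \<phi>(1)] in \<open>auto simp: eventually_at_filter\<close>)
    then show "((\<lambda>h. ip (?u2 h) \<phi>) has_real_derivative - E (?u2 h) \<phi>) (at h within {0<..s})"
      by (simp only: has_field_derivative_iff)
  qed
  \<comment> \<open>Length of the resting phase, chosen so that the flow has run for exactly s at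
    the end of the late window. By the choice of \<open>a0\<close> it exceeds C1 \<psi>(r).\<close>
  define t0 where "t0 = C4 * \<psi> r - s"
  have a0le: "a0 * \<psi> r < (C4 - C1) * \<psi> r" using psi params by (simp add: a0_def)
  have t0: "C1 * \<psi> r < t0" using s a0le by (simp add: t0_def algebra_simps)
  have "0 < C1 * \<psi> r" using params psi by simp
  then have t0_pos: "0 < t0" "t0 < C4 * \<psi> r" "C4 * \<psi> r - t0 = s" using t0 s
    unfolding t0_def by linarith+
  define u where "u h = (if h \<le> t0 then ?w else ?u2 (h - t0))" for h
  have cu: "cal u (C4 * \<psi> r) (ball x r)"
    unfolding u_def
  proof (rule caloric_glue)
    show "cal (\<lambda>h. ?w) t0 (ball x r)" by (rule c1)
    show "cal ?u2 (C4 * \<psi> r - t0) (ball x r)" using c2 t0_pos by simp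
    fix \<phi> assume \<phi>: "\<phi> \<in> F" "\<phi> \<in> Cc" "fsupp \<phi> \<subseteq> ball x r"
    have Ew: "E ?w \<phi> = 0" using pp(2)[OF _ \<phi>, of 0] Ey0[OF \<phi>] s by simp
    have "((\<lambda>h. (ip (P h f) \<phi> - ip f \<phi>) / h) \<longlongrightarrow> - E ?w \<phi>) (at_right 0)"
      using ip_P_right_derivative[OF f(1) \<phi>(1)] Ew Ef[OF \<phi>] by simp
    then show "((\<lambda>h. (ip (?u2 h) \<phi> - ip ?w \<phi>) / h) \<longlongrightarrow> - E ?w \<phi>) (at_right 0)"
    proof (rule Lim_transform_eventually)
      have "\<forall>\<^sub>F h in at_right 0. 0 < h \<and> h \<le> s"
        using s(1) by (auto simp: eventually_at_right_field intro!: exI[of _ s])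
      then show "\<forall>\<^sub>F h in at_right 0. (ip (P h f) \<phi> - ip f \<phi>) / h = (ip (?u2 h) \<phi> - ip ?w \<phi>) / h"
        by eventually_elim (use s pp(3)[OF _ \<phi>] ipy[OF \<phi>(1)] ipy0[OF \<phi>(1)] in simp)
    qed
  qed (use t0_pos in auto)
  have u0: "0 \<le> u h z" for h z by (simp add: u_def)
  obtain m where m: "m \<ge> 0"
    "\<And>h. C1 * \<psi> r < h \<Longrightarrow> h \<le> C2 * \<psi> r \<Longrightarrow> AE z in \<mu>. z \<in> ball x (c * r) \<longrightarrow> u h z \<le> C * m"
    "\<And>h. C3 * \<psi> r < h \<Longrightarrow> h \<le> C4 * \<psi> r \<Longrightarrow> AE z in \<mu>. z \<in> ball x (c * r) \<longrightarrow> m \<le> u h z"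
    using parabolic_harnack[OF r u0 cu] by blast
  have cr: "0 < c * r" using r params by simp
  have "M \<le> C * m"
  proof -
    \<comment> \<open>At this time, inside the early window, u is still at rest with value M on the
      ball, so M is at most C m.\<close>
    have "C1 * \<psi> r < min t0 (C2 * \<psi> r)" using t0 params psi by simp
    from AE_not_False_on_ball[OF cr m(2)[OF this]] obtain z
      where z: "z \<in> ball x (c * r)" "u (min t0 (C2 * \<psi> r)) z \<le> C * m" by auto
    then have "z \<in> ball x r" using ball_c_subset[OF r(1)] by blast
    then have "y 0 z = M" using f(3)[of z] cut(5)[of z] by (simp add: y_def)
    with z M show ?thesis by (simp add: u_def)
  qed
  then have mM: "M / C \<le> m" using params by (simp add: divide_le_eq mult.commute)
  then have mpos: "0 < m" using M params by (smt (verit) divide_pos_pos)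
  have "AE z in \<mu>. z \<in> ball x (c * r) \<longrightarrow> m \<le> u (C4 * \<psi> r) z"
    using m(3) params psi by simp
  then show ?thesis
  proof eventually_elim
    case (elim z)
    show ?case
    proof
      assume z: "z \<in> ball x (c * r)"
      then have z': "z \<in> ball x r" using ball_c_subset[OF r(1)] by blast
      have "m \<le> max 0 (y s z)" using elim z t0_pos s by (simp add: u_def)
      then have "m \<le> y s z" using mpos by auto
      then have "m \<le> P s f z - (b - M)" using s z' cut(5)[of z] by (simp add: y_def)
      then have "b - M + M / C \<le> P s f z" using mM by simp
      then show "b - \<theta> * M \<le> P s f z" by (simp add: \<theta>_def algebra_simps)
    qed
  qed
qed

end

section \<open>Chain neighbourhoods\<close>

text \<open>Counts steps instead of measuring length: a point belongs to it if j steps shorter than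
  r lead there from A. For j > 0 it is open whatever A is.\<close>

primrec nbh :: "real \<Rightarrow> 'a::metric_space set \<Rightarrow> nat \<Rightarrow> 'a set" where
  "nbh r A 0 = A"
| "nbh r A (Suc j) = (\<Union>a\<in>nbh r A j. ball a r)"

lemma nbh_add: "nbh r A (i + j) = nbh r (nbh r A i) j"
  by (induction j) auto

lemma nbh_mono_set: "A \<subseteq> B \<Longrightarrow> nbh r A j \<subseteq> nbh r B j"
  by (induction j) auto

lemma nbh_mono_radius: "r \<le> s \<Longrightarrow> nbh r A j \<subseteq> nbh s A j"
proof (induction j)
  case (Suc j)
  then have "nbh r A j \<subseteq> nbh s A j" by simp
  then show ?case unfolding nbh.simps by (rule UN_mono) (rule subset_ball[OF Suc.prems])
qed simp

lemma nbh_Suc: "r > 0 \<Longrightarrow> nbh r A j \<subseteq> nbh r A (Suc j)"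
  by auto

lemma nbh_mono: "r > 0 \<Longrightarrow> i \<le> j \<Longrightarrow> nbh r A i \<subseteq> nbh r A j"
  by (rule lift_Suc_mono_le[of "nbh r A"]) (auto simp del: nbh.simps simp: nbh_Suc)

lemma nbh_Union: "nbh r A j = (\<Union>a\<in>A. nbh r {a} j)"
  by (induction j) auto

lemma nbh_sym: "y \<in> nbh r {x} j \<longleftrightarrow> x \<in> nbh r {y} j"
proof -
  have "x \<in> nbh r {y} j" if "y \<in> nbh r {x} j" for x y
    using that
  proof (induction j arbitrary: y)
    case (Suc j)
    then obtain a where a: "a \<in> nbh r {x} j" "y \<in> ball a r" by auto
    have "x \<in> nbh r {a} j" using Suc.IH a(1) .
    moreover have "{a} \<subseteq> nbh r {y} (Suc 0)" using a(2) by (auto simp: dist_commute)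
    ultimately have "x \<in> nbh r (nbh r {y} (Suc 0)) j" using nbh_mono_set by blast
    then show ?case using nbh_add[of r "{y}" "Suc 0" j] by simp
  qed simp
  then show ?thesis by blast
qed

lemma nbh_disjoint_iff: "y \<notin> nbh r A j \<longleftrightarrow> nbh r {y} j \<inter> A = {}"
  using nbh_sym[of y r _ j] nbh_Union[of r A j] by blast

lemma open_nbh: "open A \<or> j > 0 \<Longrightarrow> open (nbh r A j)"
  by (cases j) auto

lemma nbh_borel: "A \<in> sets borel \<Longrightarrow> nbh r A j \<in> sets borel"
  by (cases j) (auto intro!: borel_open)

lemma bounded_nbh: "bounded A \<Longrightarrow> bounded (nbh r A j)"
proof (induction j)
  case (Suc j)
  then obtain x e where e: "\<And>a. a \<in> nbh r A j \<Longrightarrow> dist x a \<le> e" unfolding bounded_def by auto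
  have "dist x y \<le> e + r" if y: "y \<in> nbh r A (Suc j)" for y
  proof -
    obtain a where "a \<in> nbh r A j" "dist a y < r" using y by auto
    then show ?thesis using e[of a] dist_triangle[of x y a] by simp
  qed
  then show ?case unfolding bounded_def by blast
qed simp

lemma closure_nbh: "r > 0 \<Longrightarrow> closure (nbh r A j) \<subseteq> nbh r A (Suc j)"
  unfolding closure_approachable nbh.simps by (auto simp: closure_approachable)

lemma nbh_obtain_chain:
  assumes "z \<in> nbh e {x} (Suc j)"
  shows "\<exists>xs. eps_chain e x z xs \<and> chain_length xs \<le> real (Suc j) * e"
  using assms
proof (induction j arbitrary: z)
  case 0
  then have "dist x z < e" by simp
  then have "eps_chain e x z [x, z] \<and> chain_length [x, z] \<le> real (Suc 0) * e"
    by (auto simp: eps_chain_def chain_length_def less_Suc_eq)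
  then show ?case by blast
next
  case (Suc j)
  obtain a where a: "a \<in> nbh e {x} (Suc j)" "dist a z < e"
    using Suc.prems unfolding nbh.simps(2)[of e "{x}" "Suc j"] by (auto simp del: nbh.simps)
  from Suc.IH[OF a(1)] obtain xs where xs: "eps_chain e x a xs" "chain_length xs \<le> real (Suc j) * e" by blast
  have ne: "xs \<noteq> []" "length xs \<ge> 2" using xs(1) by (auto simp: eps_chain_def)
  have last: "xs ! (length xs - 1) = a" using xs(1) ne by (simp add: eps_chain_def last_conv_nth)
  have "eps_chain e x z (xs @ [z])"
    unfolding eps_chain_def
  proof (intro conjI allI impI)
    fix i assume i: "Suc i < length (xs @ [z])"
    show "dist ((xs @ [z]) ! i) ((xs @ [z]) ! Suc i) < e"
    proof (cases "Suc i < length xs")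
      case True
      then show ?thesis using xs(1) by (simp add: eps_chain_def nth_append)
    next
      case False
      then have "i = length xs - 1" using i by simp
      then show ?thesis using a(2) last ne by (simp add: nth_append)
    qed
  qed (use xs(1) ne in \<open>auto simp: eps_chain_def\<close>)
  moreover have "chain_length (xs @ [z]) \<le> real (Suc (Suc j)) * e"
  proof -
    have "chain_length (xs @ [z]) = (\<Sum>i<Suc (length xs - 1). dist ((xs @ [z]) ! i) ((xs @ [z]) ! Suc i))"
      using ne by (simp add: chain_length_def)
    also have "\<dots> = (\<Sum>i<length xs - 1. dist ((xs @ [z]) ! i) ((xs @ [z]) ! Suc i)) + dist a z"
    proof -
      have "dist ((xs @ [z]) ! (length xs - 1)) ((xs @ [z]) ! Suc (length xs - 1)) = dist a z"
        using ne last by (simp add: nth_append)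
      then show ?thesis by (simp only: sum.lessThan_Suc)
    qed
    also have "(\<Sum>i<length xs - 1. dist ((xs @ [z]) ! i) ((xs @ [z]) ! Suc i)) = chain_length xs"
      unfolding chain_length_def by (rule sum.cong) (auto simp: nth_append)
    finally show ?thesis using xs(2) a(2) by (simp add: algebra_simps)
  qed
  ultimately show ?case by blast
qed

text \<open>Greedily merging consecutive steps leaves at most \<open>2 L / e\<close> of them, since two neighbouring
  merged steps cannot both be short.\<close>
lemma chain_to_nbh:
  assumes xs: "eps_chain e x z xs" and e: "e > 0"
  shows "\<exists>n. real n * e \<le> 2 * chain_length xs \<and> z \<in> nbh e {x} (Suc n)"
proof -
  define L where "L i = (\<Sum>k<i. dist (xs ! k) (xs ! Suc k))" for i
  \<comment> \<open>n merged steps end at p, and l bounds a pending step from p to the current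
    vertex. If extending the pending step would make it too long, it is closed at the current
    vertex: then l + d is at least e, and the factor 2 pays for the new step.\<close>
  have inv: "\<exists>n p l. p \<in> nbh e {x} n \<and> dist p (xs ! i) \<le> l \<and> dist p (xs ! i) < e \<and> real n * e + l \<le> 2 * L i"
    if "i < length xs" for i
    using that
  proof (induction i)
    case 0
    have "xs \<noteq> []" using xs by (auto simp: eps_chain_def)
    then have "xs ! 0 = x" using xs hd_conv_nth[of xs] by (simp add: eps_chain_def)
    then show ?case using e by (intro exI[of _ 0] exI[of _ x]) (auto simp: L_def)
  next
    case (Suc i)
    then obtain n p l where p: "p \<in> nbh e {x} n" "dist p (xs ! i) \<le> l" "dist p (xs ! i) < e" "real n * e + l \<le> 2 * L i"
      by auto
    define d where "d = dist (xs ! i) (xs ! Suc i)"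
    have d: "0 \<le> d" "d < e" using xs Suc.prems by (auto simp: d_def eps_chain_def)
    have LS: "L (Suc i) = L i + d" by (simp add: L_def d_def)
    have tri: "dist p (xs ! Suc i) \<le> l + d" using p(2) dist_triangle[of p "xs ! Suc i" "xs ! i"] by (simp add: d_def)
    show ?case
    proof (cases "dist p (xs ! Suc i) < e")
      case True
      then show ?thesis using p tri d LS by (intro exI[of _ n] exI[of _ p] exI[of _ "l + d"]) auto
    next
      case False
      have "xs ! i \<in> nbh e {x} (Suc n)" using p by auto
      then show ?thesis using False p tri d LS
        by (intro exI[of _ "Suc n"] exI[of _ "xs ! i"] exI[of _ d]) (auto simp: d_def algebra_simps)
    qed
  qed
  have ne: "length xs - 1 < length xs" using xs by (auto simp: eps_chain_def)
  have "xs \<noteq> []" using ne by auto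
  then have last: "xs ! (length xs - 1) = z" using xs last_conv_nth[of xs] by (simp add: eps_chain_def)
  from inv[OF ne] obtain n p l where p: "p \<in> nbh e {x} n" "dist p z \<le> l" "dist p z < e" "real n * e + l \<le> 2 * L (length xs - 1)"
    unfolding last by blast
  have "chain_length xs = L (length xs - 1)" by (simp only: chain_length_def L_def)
  then have "real n * e \<le> 2 * chain_length xs" using p(2,4) zero_le_dist[of p z] by linarith
  moreover have "z \<in> nbh e {x} (Suc n)" using p by auto
  ultimately show ?thesis by blast
qed

text \<open>Total length over \<epsilon> and number of steps agree up to a factor: steps are shorter
  than \<epsilon>, and short consecutive steps can be merged. From here on the chain condition is
  used only as a statement about the number of steps.\<close>

lemma chain_condition_nbh:
  assumes sc: "scale_function_with \<rho> K \<beta> \<beta>'" and ch: "chain_condition \<rho> TYPE('a::metric_space)"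
  obtains \<kappa> where "\<kappa> \<ge> 1"
    "\<And>e (x::'a) z j. e > 0 \<Longrightarrow> j \<ge> 1 \<Longrightarrow> z \<in> nbh e {x} j \<Longrightarrow> \<rho> (dist x z) \<le> \<kappa> * real j * \<rho> e"
    "\<And>e (x::'a) z j. e > 0 \<Longrightarrow> \<kappa> * (\<rho> (dist x z) / \<rho> e + 1) \<le> real j \<Longrightarrow> z \<in> nbh e {x} j"
proof -
  interpret rho: scale \<rho> K \<beta> \<beta>' by (rule scale.intro[OF sc])
  obtain L where L: "L > 0" "\<And>(x::'a) y e. 0 < e \<Longrightarrow> e < dist x y \<Longrightarrow>
      ereal (inverse L * \<rho> (dist x y) / \<rho> e) \<le> d_eps e x y / ereal e \<and>
      d_eps e x y / ereal e \<le> ereal (L * \<rho> (dist x y) / \<rho> e)"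
    using ch unfolding chain_condition_def by blast
  define H where "H = K * 2 powr \<beta>'"
  have H: "H \<ge> 1" unfolding H_def using rho.K_ge_1 rho.beta'_pos ge_one_powr_ge_zero[of 2 \<beta>']
    by (metis less_imp_le mult_mono' mult_1 one_le_numeral zero_le_one)
  \<comment> \<open>L serves the first claim. In the second, 2 L H pays for merging steps and for
    halving e, and 3 absorbs the additive errors.\<close>
  define \<kappa> where "\<kappa> = max (max L 3) (2 * L * H)"
  have \<kappa>: "\<kappa> \<ge> 3" "\<kappa> \<ge> L" "\<kappa> \<ge> 2 * L * H" by (auto simp: \<kappa>_def)
  show thesis
  proof (rule that[of \<kappa>])
    show "1 \<le> \<kappa>" using \<kappa> by simp
  next
    fix e :: real and x z :: 'a and j :: nat assume e: "e > 0" and j: "j \<ge> 1" and z: "z \<in> nbh e {x} j"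
    have re: "\<rho> e > 0" using e by (rule rho.pos)
    have j1: "1 \<le> \<kappa> * real j" using \<kappa>(1) j mult_mono[of 1 \<kappa> 1 "real j"] by simp
    show "\<rho> (dist x z) \<le> \<kappa> * real j * \<rho> e"
    proof (cases "dist x z \<le> e")
      case True
      then have "\<rho> (dist x z) \<le> 1 * \<rho> e" using rho.mono[of "dist x z" e] by simp
      also have "\<dots> \<le> \<kappa> * real j * \<rho> e" using j1 re by (intro mult_right_mono) auto
      finally show ?thesis .
    next
      case False
      obtain i where i: "j = Suc i" using j by (cases j) auto
      obtain xs where xs: "eps_chain e x z xs" "chain_length xs \<le> real (Suc i) * e"
        using nbh_obtain_chain[of z e x i] z i by auto
      have "d_eps e x z \<le> ereal (chain_length xs)"
        unfolding d_eps_def by (rule INF_lower) (use xs in simp)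
      also have "\<dots> \<le> ereal (real j * e)" using xs i by simp
      finally have "d_eps e x z \<le> ereal (real j * e)" .
      then have "d_eps e x z / ereal e \<le> ereal (real j * e) / ereal e"
        by (rule ereal_divide_right_mono) (use e in simp)
      moreover have "ereal (inverse L * \<rho> (dist x z) / \<rho> e) \<le> d_eps e x z / ereal e"
        using L(2)[of e x z] e False by linarith
      ultimately have "ereal (inverse L * \<rho> (dist x z) / \<rho> e) \<le> ereal (real j * e) / ereal e"
        by (metis order_trans)
      then have "inverse L * \<rho> (dist x z) / \<rho> e \<le> real j" using e by simp
      then have "\<rho> (dist x z) \<le> L * (real j * \<rho> e)" using L(1) re by (simp add: field_simps)
      also have "\<dots> \<le> \<kappa> * (real j * \<rho> e)" using \<kappa>(2) re by (intro mult_right_mono) auto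
      finally show ?thesis by (simp add: mult.assoc)
    qed
  next
    fix e :: real and x z :: 'a and j :: nat assume e: "e > 0" and j: "\<kappa> * (\<rho> (dist x z) / \<rho> e + 1) \<le> real j"
    have re: "\<rho> e > 0" "\<rho> (e/2) > 0" using e rho.pos by auto
    have rd: "\<rho> (dist x z) \<ge> 0" using rho.mono[of 0 "dist x z"] rho.at_0 by simp
    have q0: "0 \<le> \<rho> (dist x z) / \<rho> e" using rd re by simp
    have j': "\<kappa> * (\<rho> (dist x z) / \<rho> e) + 3 \<le> real j" using j \<kappa>(1) by (simp add: algebra_simps)
    show "z \<in> nbh e {x} j"
    proof (cases "dist x z < e")
      case True
      have "0 \<le> \<kappa> * (\<rho> (dist x z) / \<rho> e)" using \<kappa>(1) q0 by (intro mult_nonneg_nonneg) auto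
      then have "1 \<le> j" using j' by linarith
      have "z \<in> nbh e {x} 1" using True by simp
      with nbh_mono[OF e \<open>1 \<le> j\<close>] show ?thesis by blast
    next
      case False
      \<comment> \<open>The chain condition requires a mesh strictly below the distance; half of e
        is safe also when the distance equals e.\<close>
      have "e / 2 < dist x z" using False e by simp
      with L(2)[of "e/2" x z] e have "d_eps (e/2) x z / ereal (e/2) \<le> ereal (L * \<rho> (dist x z) / \<rho> (e/2))" by simp
      then have "d_eps (e/2) x z \<le> ereal (L * \<rho> (dist x z) / \<rho> (e/2)) * ereal (e/2)"
        using e by (subst (asm) ereal_divide_le_pos) (auto simp: mult.commute)
      \<comment> \<open>The extra 1 makes the inequality strict, so that the infimum yields an
        actual chain.\<close>
      also have "\<dots> < ereal ((L * \<rho> (dist x z) / \<rho> (e/2) + 1) * (e/2))" using e by (simp add: distrib_right)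
      finally obtain xs where xs: "eps_chain (e/2) x z xs" "chain_length xs < (L * \<rho> (dist x z) / \<rho> (e/2) + 1) * (e/2)"
        unfolding d_eps_def INF_less_iff by auto
      from chain_to_nbh[OF xs(1)] e obtain n where n: "real n * (e/2) \<le> 2 * chain_length xs" "z \<in> nbh (e/2) {x} (Suc n)" by auto
      define X where "X = L * \<rho> (dist x z) / \<rho> (e/2) + 1"
      have "real n * (e/2) \<le> (2 * X) * (e/2)" using n(1) xs(2) unfolding X_def[symmetric] by linarith
      then have "real n \<le> 2 * X" using e by simp
      then have n2: "real n \<le> 2 * (L * \<rho> (dist x z) / \<rho> (e/2) + 1)" by (simp only: X_def)
      have "\<rho> e \<le> H * \<rho> (e/2)" using rho.ratio_le[of "e/2" e] e by (simp add: H_def)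
      then have "\<rho> (dist x z) / \<rho> (e/2) \<le> H * (\<rho> (dist x z) / \<rho> e)"
        using re rd mult_right_mono[of "\<rho> e" "H * \<rho> (e/2)" "\<rho> (dist x z)"] by (simp add: field_simps)
      then have "2 * L * (\<rho> (dist x z) / \<rho> (e/2)) \<le> 2 * L * (H * (\<rho> (dist x z) / \<rho> e))" using L(1) by (intro mult_left_mono) auto
      also have "\<dots> = (2 * L * H) * (\<rho> (dist x z) / \<rho> e)" by simp
      also have "\<dots> \<le> \<kappa> * (\<rho> (dist x z) / \<rho> e)" using \<kappa>(3) q0 by (intro mult_right_mono) auto
      finally have "real (Suc n) \<le> real j" using n2 j' by simp
      then have "Suc n \<le> j" by simp
      have "e / 2 \<le> e" using e by simp
      then have "z \<in> nbh e {x} (Suc n)" by (rule subsetD[OF nbh_mono_radius n(2)])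
      with nbh_mono[OF e \<open>Suc n \<le> j\<close>] show ?thesis by blast
    qed
  qed
qed

section \<open>Off-diagonal decay of the semigroup\<close>

context harnack
begin

lemma cutoff_ex:
  assumes "compact A" "open U" "bounded U" "A \<subseteq> U"
  shows "\<exists>f. f \<in> F \<and> f \<in> Cc \<and> (\<forall>x. 0 \<le> f x) \<and> (\<forall>x. f x \<le> 1) \<and> (\<forall>x. x \<in> A \<longrightarrow> f x = 1) \<and> (\<forall>x. x \<notin> U \<longrightarrow> f x = 0)"
  by (rule cutoff[OF assms]) blast

text \<open>Each layer of thickness r between y and the complement of A gains one factor \<theta>:
  if j + 1 steps from x stay in A, then j steps from any point of \<open>ball x r\<close> do, which
  is the hypothesis of \<open>contraction\<close> with the smaller gap.\<close>

lemma contraction_iterated: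
  assumes r: "r > 0" "ereal r < mm_diam \<mu>" and f: "f \<in> F" "f \<in> Cc" "\<And>y. y \<in> A \<Longrightarrow> f y = b"
    and M: "M \<ge> 0" and T: "T \<le> a0 * \<psi> r"
    and lower: "\<And>h. 0 < h \<Longrightarrow> h \<le> T \<Longrightarrow> AE y in \<mu>. b - M \<le> P h f y"
    and s: "0 < s" "s \<le> T"
  shows "AE y in \<mu>. nbh r {y} j \<subseteq> A \<longrightarrow> b - \<theta> ^ j * M \<le> P s f y"
  using s
proof (induction j arbitrary: s)
  case 0
  from lower[OF 0] show ?case by eventually_elim simp
next
  case (Suc j)
  have "AE y in \<mu>. y \<in> {y. nbh r {y} (Suc j) \<subseteq> A} \<longrightarrow> b - \<theta> ^ Suc j * M \<le> P s f y"
  proof (rule AE_local)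
    fix x assume "x \<in> {y. nbh r {y} (Suc j) \<subseteq> A}"
    then have x: "nbh r {x} (Suc j) \<subseteq> A" by blast
    have near: "nbh r {y} j \<subseteq> A" if "y \<in> ball x r" for y
    proof -
      have "nbh r {y} j \<subseteq> nbh r (nbh r {x} (Suc 0)) j" using that by (intro nbh_mono_set) auto
      also have "\<dots> = nbh r {x} (Suc j)" using nbh_add[of r "{x}" "Suc 0" j] by simp
      finally show ?thesis using x by simp
    qed
    have "y \<in> A" if "y \<in> ball x r" for y
      using near[OF that] nbh_mono[of r 0 j "{y}"] r by auto
    then have fb: "f y = b" if "y \<in> ball x r" for y using f(3) that by blast
    have "AE y in \<mu>. y \<in> ball x (c * r) \<longrightarrow> b - \<theta> * (\<theta> ^ j * M) \<le> P s f y"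
    proof (rule contraction[OF r f(1,2) fb])
      show "0 \<le> \<theta> ^ j * M" using theta M by simp
      show "0 < s" "s \<le> a0 * \<psi> r" using Suc.prems T by auto
      fix h assume "0 < h" "h \<le> s"
      then have "AE y in \<mu>. nbh r {y} j \<subseteq> A \<longrightarrow> b - \<theta> ^ j * M \<le> P h f y" using Suc.IH Suc.prems by simp
      then show "AE y in \<mu>. y \<in> ball x r \<longrightarrow> b - \<theta> ^ j * M \<le> P h f y"
        by eventually_elim (use near in blast)
    qed
    then show "\<exists>q>0. AE y in \<mu>. y \<in> ball x q \<longrightarrow> b - \<theta> ^ Suc j * M \<le> P s f y"
      using r params by (intro exI[of _ "c * r"]) (simp add: mult.assoc)
  qed
  then show ?case by simp
qed

lemma P_indicator_bounds:
  "bounded A \<Longrightarrow> A \<in> sets borel \<Longrightarrow> t > 0 \<Longrightarrow> AE y in \<mu>. 0 \<le> P t (indicat_real A) y \<and> P t (indicat_real A) y \<le> 1"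
  by (rule P_unit_interval[OF indicator_L2]) (auto simp: indicator_def)

text \<open>The iterated contraction is applied to -f, where f is a cutoff equal to 1 on A and
  supported within one step of it; -f is constantly 0 further out. The layer used by the cutoff
  accounts for \<open>Suc j\<close> against the exponent j.\<close>

lemma tail_small_time:
  assumes A: "bounded A" "A \<in> sets borel" and r: "r > 0" "ereal r < mm_diam \<mu>" and s: "0 < s" "s \<le> a0 * \<psi> r"
  shows "AE y in \<mu>. y \<notin> nbh r A (Suc j) \<longrightarrow> P s (indicat_real A) y \<le> \<theta> ^ j"
proof -
  let ?U = "nbh r A (Suc 0)"
  have clA: "closure A \<subseteq> ?U" using closure_nbh[OF r(1), of A 0] by simp
  have cpt: "compact (closure A)" using A(1) by (simp add: compact_closure)
  obtain f where f: "f \<in> F" "f \<in> Cc" "\<And>x. 0 \<le> f x" "\<And>x. f x \<le> 1" "\<And>x. x \<in> closure A \<Longrightarrow> f x = 1" "\<And>x. x \<notin> ?U \<Longrightarrow> f x = 0"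
    using cutoff_ex[OF cpt open_nbh[OF disjI2[OF zero_less_Suc]] bounded_nbh[OF A(1)] clA] by blast
  have fL: "f \<in> L2 \<mu>" using f by (intro F_L2)
  let ?g = "\<lambda>x. - 1 * f x"
  have g: "?g \<in> F" "?g \<in> Cc"
  proof -
    show "?g \<in> F" by (intro F_scale f)
    have "{x. - 1 * f x \<noteq> 0} = {x. f x \<noteq> 0}" by auto
    then show "?g \<in> Cc" using f(2) by (auto simp: Cc_def fsupp_def intro: continuous_intros)
  qed
  have Pg: "AE y in \<mu>. P h ?g y = - 1 * P h f y" if "0 < h" for h using P_scale[OF fL that] .
  have "AE y in \<mu>. nbh r {y} j \<subseteq> - ?U \<longrightarrow> 0 - \<theta> ^ j * 1 \<le> P s ?g y"
  proof (rule contraction_iterated[OF r g])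
    show "?g y = 0" if "y \<in> - ?U" for y using f(6) that by simp
    fix h assume h: "0 < h" "h \<le> s"
    have "AE y in \<mu>. 0 \<le> P h f y \<and> P h f y \<le> 1" by (rule P_unit_interval[OF fL _ h(1)]) (use f in auto)
    with Pg[OF h(1)] show "AE y in \<mu>. 0 - 1 \<le> P h ?g y" by eventually_elim auto
  qed (use s in auto)
  moreover have "AE y in \<mu>. P s (indicat_real A) y \<le> P s f y"
  proof (rule P_mono[OF indicator_L2[OF A] fL AE_I2 s(1)])
    show "indicat_real A x \<le> f x" for x
      using f(3)[of x] f(5)[of x] closure_subset[of A] by (auto simp: indicator_def)
  qed
  ultimately show ?thesis using Pg[OF s(1)]
  proof eventually_elim
    case (elim y)
    show ?case
    proof
      assume y: "y \<notin> nbh r A (Suc j)"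
      have "nbh r A (Suc j) = nbh r ?U j" using nbh_add[of r A "Suc 0" j] by (simp only: add_Suc add_0)
      with y have "y \<notin> nbh r ?U j" by blast
      then have "nbh r {y} j \<subseteq> - ?U" using nbh_disjoint_iff[of y r ?U j] by blast
      with elim show "P s (indicat_real A) y \<le> \<theta> ^ j" by simp
    qed
  qed
qed

text \<open>Same argument for a cutoff inside A that is 1 wherever a ball of radius r fits into A;
  again one layer is spent on the cutoff.\<close>

lemma survival_small_time:
  assumes A: "bounded A" "A \<in> sets borel" and r: "r > 0" "ereal r < mm_diam \<mu>" and s: "0 < s" "s \<le> a0 * \<psi> r" and U: "open A"
  shows "AE y in \<mu>. nbh r {y} (Suc j) \<subseteq> A \<longrightarrow> 1 - \<theta> ^ j \<le> P s (indicat_real A) y"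
proof -
  let ?B = "{y. ball y r \<subseteq> A}"
  have "?B \<subseteq> A" using r by auto
  have clB: "closure ?B \<subseteq> A"
  proof
    fix y assume "y \<in> closure ?B"
    then obtain z where "z \<in> ?B" "dist z y < r" using r by (meson closure_approachable)
    then show "y \<in> A" by auto
  qed
  have cpt: "compact (closure ?B)" using bounded_subset[OF A(1) \<open>?B \<subseteq> A\<close>] by (simp add: compact_closure)
  obtain f where f: "f \<in> F" "f \<in> Cc" "\<And>x. 0 \<le> f x" "\<And>x. f x \<le> 1" "\<And>x. x \<in> closure ?B \<Longrightarrow> f x = 1" "\<And>x. x \<notin> A \<Longrightarrow> f x = 0"
    using cutoff_ex[OF cpt U A(1) clB] by blast
  have fL: "f \<in> L2 \<mu>" using f by (intro F_L2)
  have "AE y in \<mu>. nbh r {y} j \<subseteq> closure ?B \<longrightarrow> 1 - \<theta> ^ j * 1 \<le> P s f y"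
  proof (rule contraction_iterated[OF r f(1,2,5)])
    fix h assume h: "0 < h" "h \<le> s"
    show "AE y in \<mu>. 1 - 1 \<le> P h f y" using P_nonneg[OF fL _ h(1)] f by simp
  qed (use s in auto)
  moreover have "AE y in \<mu>. P s f y \<le> P s (indicat_real A) y"
    by (rule P_mono[OF fL indicator_L2[OF A] _ s(1)])
      (use f in \<open>auto simp: indicator_def\<close>)
  ultimately show ?thesis
  proof eventually_elim
    case (elim y)
    show ?case
    proof
      assume "nbh r {y} (Suc j) \<subseteq> A"
      then have "nbh r {y} j \<subseteq> ?B" by auto
      then have "nbh r {y} j \<subseteq> closure ?B" using closure_subset by blast
      with elim show "1 - \<theta> ^ j \<le> P s (indicat_real A) y" by simp
    qed
  qed
qed

text \<open>A square root of \<theta>, so that one of two factors \<eta> can be sacrificed to sum a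
  geometric series; the 1/2 keeps it positive when \<theta> = 0.\<close>

definition \<eta> :: real where "\<eta> = sqrt (max \<theta> (1/2))"
text \<open>The price of one time step in \<open>decay_propagates\<close>: 1 for the remainder, the
  rest for the geometric series over the levels.\<close>

definition K1 :: real where "K1 = 1 + inverse \<eta> ^ 3 / (1 - \<eta>)"

lemma eta: "0 < \<eta>" "\<eta> < 1" "\<theta> \<le> \<eta>\<^sup>2"
  using theta by (auto simp: \<eta>_def)

lemma K1_ge_1: "K1 \<ge> 1"
  using eta by (simp add: K1_def)

lemma theta_power_le: "\<theta> ^ j \<le> inverse \<eta> ^ 2 * \<eta> ^ (2 * Suc j)"
proof -
  have "\<theta> ^ j \<le> (\<eta>\<^sup>2) ^ j" using eta theta by (intro power_mono) auto
  also have "\<dots> = inverse \<eta> ^ 2 * \<eta> ^ (2 * Suc j)"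
  proof -
    have "\<eta> ^ (2 * Suc j) = \<eta>\<^sup>2 * (\<eta>\<^sup>2) ^ j" by (simp only: power_mult power_Suc)
    moreover have "inverse \<eta> ^ 2 * \<eta>\<^sup>2 = 1" using eta by (simp add: power_inverse)
    ultimately show ?thesis by (metis mult.assoc mult_1)
  qed
  finally show ?thesis .
qed

lemma tail_small_time':
  assumes A: "bounded A" "A \<in> sets borel" and r: "r > 0" "ereal r < mm_diam \<mu>" and s: "0 < s" "s \<le> a0 * \<psi> r"
  shows "AE y in \<mu>. y \<notin> nbh r A j \<longrightarrow> P s (indicat_real A) y \<le> inverse \<eta> ^ 2 * \<eta> ^ (2 * j)"
proof (cases j)
  case 0
  have one: "1 \<le> inverse \<eta> ^ 2" using eta by (intro one_le_power) (simp add: one_le_inverse)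
  from P_indicator_bounds[OF A s(1)] show ?thesis unfolding 0
    by eventually_elim (use one in auto)
next
  case (Suc i)
  from tail_small_time[OF assms, of i] show ?thesis
    unfolding Suc
  proof eventually_elim
    case (elim y)
    then show ?case using theta_power_le[of i] by (auto intro: order_trans)
  qed
qed

text \<open>g is split into indicators of the levels i < J with weights
  \<open>B * \<eta> ^ i\<close> and a remainder below \<open>B * \<eta> ^ J\<close>. The indicator
  of level i + 1 has J - i - 1 steps to go, which costs \<eta> to twice that power; half of the
  power completes \<open>\<eta> ^ J\<close>, the other half sums up.\<close>

lemma decay_propagates:
  assumes A: "bounded A" "A \<in> sets borel" and r: "r > 0" "ereal r < mm_diam \<mu>" and s: "0 < s" "s \<le> a0 * \<psi> r"
    and g: "g \<in> L2 \<mu>" "AE y in \<mu>. 0 \<le> g y" "AE y in \<mu>. g y \<le> B" and B: "B \<ge> 0"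
    and decay: "\<And>i. AE y in \<mu>. y \<notin> nbh r A i \<longrightarrow> g y \<le> B * \<eta> ^ i"
  shows "AE y in \<mu>. y \<notin> nbh r A J \<longrightarrow> P s g y \<le> (B * K1) * \<eta> ^ J"
proof -
  have gm [measurable]: "g \<in> borel_measurable \<mu>" using g by (intro L2_measurable)
  let ?N = "\<lambda>i. nbh r A (Suc i)"
  have NL: "indicat_real (?N i) \<in> L2 \<mu>" for i
    using A by (intro indicator_L2 bounded_nbh nbh_borel)
  define h where "h x = (\<Sum>i<J. (B * \<eta> ^ i) * indicat_real (?N i) x)" for x
  have hL: "h \<in> L2 \<mu>" unfolding h_def by (rule L2_sum) (auto intro!: L2_scale NL simp del: nbh.simps)
  then have hm [measurable]: "h \<in> borel_measurable \<mu>" by (rule L2_measurable)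
  have h0: "0 \<le> h x" for x using B eta by (auto simp: h_def intro!: sum_nonneg mult_nonneg_nonneg)
  have hterm: "B * \<eta> ^ i \<le> h x" if "i < J" "x \<in> ?N i" for i x
  proof -
    have "(B * \<eta> ^ i) * indicat_real (?N i) x \<le> h x"
      unfolding h_def using that B eta
      by (intro member_le_sum) (auto intro!: mult_nonneg_nonneg)
    with that show ?thesis by simp
  qed
  define g2 where "g2 x = max 0 (g x - h x)" for x
  have g2m [measurable]: "g2 \<in> borel_measurable \<mu>" unfolding g2_def by measurable
  have g2L: "g2 \<in> L2 \<mu>"
  proof (rule L2_AE_bound[OF g(1) g2m])
    show "AE x in \<mu>. \<bar>g2 x\<bar> \<le> \<bar>g x\<bar>" using g(2)
    proof eventually_elim
      case (elim x) then show ?case using h0[of x] by (simp add: g2_def)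
    qed
  qed
  have "AE y in \<mu>. \<forall>i. y \<notin> nbh r A i \<longrightarrow> g y \<le> B * \<eta> ^ i"
    using decay by (simp add: AE_all_countable del: nbh.simps)
  then have "AE y in \<mu>. 0 \<le> g2 y \<and> g2 y \<le> B * \<eta> ^ J"
    using g(3)
  proof eventually_elim
    case (elim y)
    have BJ: "0 \<le> B * \<eta> ^ J" using B eta by simp
    have "g y \<le> h y + B * \<eta> ^ J"
    proof (cases "y \<in> nbh r A J")
      case False
      then show ?thesis using elim(1)[rule_format, of J] h0[of y] by linarith
    next
      case True
      \<comment> \<open>y misses the level before its first one, so g y is at most the weight
        attached to the first level containing y. Level 0 has no predecessor, and there the plain
        bound B is used.\<close>
      define i where "i = (LEAST i. y \<in> nbh r A i)"
      have i: "y \<in> nbh r A i" "i \<le> J" unfolding i_def using True by (auto intro: LeastI Least_le)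
      show ?thesis
      proof (cases i)
        case 0
        show ?thesis
        proof (cases "J = 0")
          case True
          then show ?thesis using elim(2) h0[of y] by simp
        next
          case False
          have "y \<in> ?N 0" using i(1)[unfolded 0] nbh_Suc[OF r(1), of A 0] by blast
          then have "B * \<eta> ^ 0 \<le> h y" using False by (intro hterm) auto
          then show ?thesis using elim(2) BJ by simp
        qed
      next
        case (Suc k)
        have "y \<notin> nbh r A k" using not_less_Least[of k "\<lambda>i. y \<in> nbh r A i"] Suc by (simp add: i_def del: nbh.simps)
        then have "g y \<le> B * \<eta> ^ k" using elim(1) by blast
        also have "\<dots> \<le> h y" using i Suc by (intro hterm) (auto simp del: nbh.simps)
        finally show ?thesis using BJ by simp
      qed
    qed
    then show ?case using BJ by (simp add: g2_def)
  qed
  from P_bounded[OF g2L this s(1)] have b2: "AE y in \<mu>. P s g2 y \<le> B * \<eta> ^ J" by eventually_elim simp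
  have "AE y in \<mu>. P s g y \<le> P s (\<lambda>x. h x + g2 x) y"
    by (rule P_mono[OF g(1) L2_add[OF hL g2L] _ s(1)]) (simp add: g2_def)
  moreover have "AE y in \<mu>. P s (\<lambda>x. h x + g2 x) y = P s h y + P s g2 y" by (rule P_add[OF hL g2L s(1)])
  moreover have "AE y in \<mu>. P s h y = (\<Sum>i<J. P s (\<lambda>x. (B * \<eta> ^ i) * indicat_real (?N i) x) y)"
    unfolding h_def by (rule P_sum) (auto intro!: L2_scale NL s simp del: nbh.simps)
  moreover have "AE y in \<mu>. \<forall>i. P s (\<lambda>x. (B * \<eta> ^ i) * indicat_real (?N i) x) y = (B * \<eta> ^ i) * P s (indicat_real (?N i)) y"
    unfolding AE_all_countable by (intro allI P_scale NL s)
  moreover have "AE y in \<mu>. \<forall>i. i < J \<longrightarrow> y \<notin> nbh r A J \<longrightarrow> P s (indicat_real (?N i)) y \<le> inverse \<eta> ^ 2 * \<eta> ^ (2 * (J - Suc i))"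
    unfolding AE_all_countable
  proof (intro allI)
    fix i
    have b: "bounded (?N i)" "?N i \<in> sets borel" using A by (auto intro: bounded_nbh nbh_borel simp del: nbh.simps)
    from tail_small_time'[OF b r s, of "J - Suc i"]
    show "AE y in \<mu>. i < J \<longrightarrow> y \<notin> nbh r A J \<longrightarrow> P s (indicat_real (?N i)) y \<le> inverse \<eta> ^ 2 * \<eta> ^ (2 * (J - Suc i))"
    proof eventually_elim
      case (elim y)
      have "nbh r (?N i) (J - Suc i) = nbh r A J" if "i < J" using nbh_add[of r A "Suc i" "J - Suc i"] that by simp
      with elim show ?case by simp
    qed
  qed
  ultimately show ?thesis using b2
  proof eventually_elim
    case (elim y)
    show ?case
    proof
      assume y: "y \<notin> nbh r A J"
      have "P s h y = (\<Sum>i<J. (B * \<eta> ^ i) * P s (indicat_real (?N i)) y)" using elim by simp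
      also have "\<dots> \<le> (\<Sum>i<J. (B * \<eta> ^ i) * (inverse \<eta> ^ 2 * \<eta> ^ (2 * (J - Suc i))))"
        using elim(5) y B eta by (intro sum_mono mult_left_mono) auto
      also have "\<dots> = (\<Sum>i<J. (B * inverse \<eta> ^ 3 * \<eta> ^ J) * \<eta> ^ (J - Suc i))"
      proof (rule sum.cong)
        fix i assume "i \<in> {..<J}"
        then obtain d where d: "J = Suc i + d" by (auto dest: less_imp_Suc_add)
        show "(B * \<eta> ^ i) * (inverse \<eta> ^ 2 * \<eta> ^ (2 * (J - Suc i))) = (B * inverse \<eta> ^ 3 * \<eta> ^ J) * \<eta> ^ (J - Suc i)"
          using eta(1) unfolding d by (simp add: power_add power_mult power2_eq_square power3_eq_cube field_simps)
      qed simp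
      also have "\<dots> = (B * inverse \<eta> ^ 3 * \<eta> ^ J) * (\<Sum>i<J. \<eta> ^ i)"
        by (simp only: sum_distrib_left[symmetric] sum.nat_diff_reindex)
      also have "\<dots> \<le> (B * inverse \<eta> ^ 3 * \<eta> ^ J) * (1 / (1 - \<eta>))"
      proof (rule mult_left_mono)
        show "(\<Sum>i<J. \<eta> ^ i) \<le> 1 / (1 - \<eta>)"
          using eta by (subst sum_gp_strict) (auto simp: divide_right_mono)
      qed (use B eta in auto)
      finally have "P s h y \<le> (B * inverse \<eta> ^ 3 * \<eta> ^ J) * (1 / (1 - \<eta>))" .
      then show "P s g y \<le> (B * K1) * \<eta> ^ J" using elim(1,2,6) by (simp add: K1_def algebra_simps)
    qed
  qed
qed

lemma tail_iterated:
  assumes A: "bounded A" "A \<in> sets borel" and r: "r > 0" "ereal r < mm_diam \<mu>" and s: "0 < s" "s \<le> a0 * \<psi> r"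
  shows "AE y in \<mu>. y \<notin> nbh r A j \<longrightarrow> P (real (Suc k) * s) (indicat_real A) y \<le> K1 ^ Suc k * \<eta> ^ j"
proof (induction k arbitrary: j)
  case 0
  have "AE y in \<mu>. y \<notin> nbh r A j \<longrightarrow> P s (indicat_real A) y \<le> (1 * K1) * \<eta> ^ j"
  proof (rule decay_propagates[OF A r s indicator_L2[OF A]])
    fix i
    have "A \<subseteq> nbh r A i" using nbh_mono[OF r(1), of 0 i A] by simp
    then show "AE y in \<mu>. y \<notin> nbh r A i \<longrightarrow> indicat_real A y \<le> 1 * \<eta> ^ i" using eta by (auto simp: indicator_def)
  qed (auto simp: indicator_def)
  then show ?case by simp
next
  case (Suc k)
  let ?t = "real (Suc k) * s"
  have t: "0 < ?t" using s by simp
  let ?g = "P ?t (indicat_real A)"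
  have level_indicator_L2: "indicat_real A \<in> L2 \<mu>" by (rule indicator_L2[OF A])
  have K: "1 \<le> K1 ^ Suc k" using K1_ge_1 by (rule one_le_power)
  have gb: "AE y in \<mu>. 0 \<le> ?g y \<and> ?g y \<le> 1" by (rule P_indicator_bounds[OF A t])
  have "AE y in \<mu>. y \<notin> nbh r A j \<longrightarrow> P s ?g y \<le> (K1 ^ Suc k * K1) * \<eta> ^ j"
  proof (rule decay_propagates[OF A r s])
    show "?g \<in> L2 \<mu>" using level_indicator_L2 t by (auto intro: P_L2)
    show "AE y in \<mu>. 0 \<le> ?g y" using gb by eventually_elim simp
    show "AE y in \<mu>. ?g y \<le> K1 ^ Suc k" using gb by eventually_elim (use K in simp)
    show "0 \<le> K1 ^ Suc k" using K by simp
  qed (rule Suc.IH)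
  moreover have "AE y in \<mu>. P s ?g y = P (s + ?t) (indicat_real A) y" by (rule P_semigroup[OF level_indicator_L2 s(1) t])
  moreover have "s + ?t = real (Suc (Suc k)) * s" by (simp add: algebra_simps)
  ultimately show ?case by (auto simp del: nbh.simps of_nat_Suc simp: mult.commute elim: eventually_elim2)
qed

text \<open>A time t takes at most 1 + t / (a0 \<psi>(r)) steps, each costing a factor
  \<open>K1\<close>; the maximum covers the coefficient of both summands.\<close>

definition kap1 :: real where "kap1 = max (ln K1) (ln K1 / a0)"
definition lam1 :: real where "lam1 = - ln \<eta>"

lemma kappa1: "0 \<le> kap1" and lambda1: "0 < lam1"
  using K1_ge_1 eta by (auto simp: kap1_def lam1_def le_max_iff_disj)

lemma tail:
  assumes A: "bounded A" "A \<in> sets borel" and r: "r > 0" "ereal r < mm_diam \<mu>" and t: "0 < t"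
  shows "AE y in \<mu>. y \<notin> nbh r A j \<longrightarrow> P t (indicat_real A) y \<le> exp (kap1 * (1 + t / \<psi> r) - lam1 * real j)"
proof -
  have p: "0 < a0 * \<psi> r" using a0_pos psi.pos r by simp
  \<comment> \<open>k + 1 equal steps are the fewest obtained by rounding for which each is no
    longer than \<open>a0 * \<psi> r\<close>.\<close>
  define k where "k = nat \<lfloor>t / (a0 * \<psi> r)\<rfloor>"
  have q0: "0 \<le> t / (a0 * \<psi> r)" using p t by simp
  have k: "real k \<le> t / (a0 * \<psi> r)" "t / (a0 * \<psi> r) < real (Suc k)"
  proof -
    have "real k = of_int \<lfloor>t / (a0 * \<psi> r)\<rfloor>" using q0 by (simp add: k_def)
    then show "real k \<le> t / (a0 * \<psi> r)" "t / (a0 * \<psi> r) < real (Suc k)" by linarith+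
  qed
  define s where "s = t / real (Suc k)"
  have s: "0 < s" "s \<le> a0 * \<psi> r" "real (Suc k) * s = t"
    using t k(2) p by (auto simp: s_def field_simps)
  have "K1 ^ Suc k * \<eta> ^ j = exp (real (Suc k) * ln K1 - lam1 * real j)"
  proof -
    have "exp (real (Suc k) * ln K1) = K1 ^ Suc k"
      using K1_ge_1 by (simp only: exp_of_nat_mult exp_ln[of K1])
    moreover have "exp (real j * ln \<eta>) = \<eta> ^ j"
      using eta by (simp only: exp_of_nat_mult exp_ln[of \<eta>])
    moreover have "real (Suc k) * ln K1 - lam1 * real j = real (Suc k) * ln K1 + real j * ln \<eta>"
      by (simp add: lam1_def)
    ultimately show ?thesis by (simp only: exp_add)
  qed
  also have "\<dots> \<le> exp (kap1 * (1 + t / \<psi> r) - lam1 * real j)"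
  proof -
    have lnK: "0 \<le> ln K1" using K1_ge_1 by simp
    have "real k * ln K1 \<le> (t / (a0 * \<psi> r)) * ln K1" using k(1) lnK by (intro mult_right_mono) auto
    also have "\<dots> = (ln K1 / a0) * (t / \<psi> r)" by simp
    also have "\<dots> \<le> kap1 * (t / \<psi> r)" using t psi.pos[OF r(1)] by (intro mult_right_mono) (auto simp: kap1_def)
    finally have "real k * ln K1 \<le> kap1 * (t / \<psi> r)" .
    moreover have "ln K1 \<le> kap1" by (simp add: kap1_def)
    ultimately show ?thesis by (simp add: algebra_simps)
  qed
  finally have le: "K1 ^ Suc k * \<eta> ^ j \<le> exp (kap1 * (1 + t / \<psi> r) - lam1 * real j)" .
  from tail_iterated[OF A r s(1,2), of j k] show ?thesis
    unfolding s(3) by eventually_elim (use le in auto)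
qed

end

context scale
begin

lemma ratio_small:
  assumes "e > 0"
  obtains d where "0 < d" "d < 1" "\<And>r. 0 < r \<Longrightarrow> \<phi> (d * r) \<le> e * \<phi> r"
proof -
  define d where "d = min (1/2) ((e / K) powr (1 / \<beta>))"
  have eK: "e / K > 0" using assms K_pos by simp
  have d: "0 < d" "d < 1" using eK by (auto simp: d_def)
  have "d powr \<beta> \<le> ((e / K) powr (1 / \<beta>)) powr \<beta>"
    using d beta_pos by (intro powr_mono2) (auto simp: d_def)
  also have "\<dots> = e / K" using assms K_pos beta_pos by (simp add: powr_powr)
  finally have dK: "K * d powr \<beta> \<le> e" using K_pos by (simp add: field_simps)
  have "\<phi> (d * r) \<le> e * \<phi> r" if r: "0 < r" for r
  proof -
    have "(r / (d * r)) powr \<beta> * \<phi> (d * r) \<le> K * \<phi> r" using d r by (intro ratio_ge) auto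
    then have "(1 / d) powr \<beta> * \<phi> (d * r) \<le> K * \<phi> r" using r by simp
    then have "\<phi> (d * r) \<le> (K * d powr \<beta>) * \<phi> r"
      using d by (simp add: powr_divide field_simps)
    also have "\<dots> \<le> e * \<phi> r" using dK pos[OF r] by (intro mult_right_mono) auto
    finally show ?thesis .
  qed
  with d that show ?thesis by blast
qed

end

section \<open>Near-diagonal lower bound\<close>

locale heat_kernel_setting = harnack \<mu> E F P \<psi> K \<beta> \<beta>' C1 C2 C3 C4 C c + rho: scale \<rho> K\<rho> \<gamma> \<gamma>'
  for \<mu> :: "'a::heine_borel measure" and E :: "('a \<Rightarrow> real) \<Rightarrow> ('a \<Rightarrow> real) \<Rightarrow> real"
    and F :: "('a \<Rightarrow> real) set" and P and \<psi> K \<beta> \<beta>' C1 C2 C3 C4 C c and \<rho> K\<rho> \<gamma> \<gamma>' +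
  fixes \<kappa> Cv \<alpha> :: real
  assumes kappa: "\<kappa> \<ge> 1"
    and nbh_lower: "\<And>e (x::'a) z j. e > 0 \<Longrightarrow> j \<ge> 1 \<Longrightarrow> z \<in> nbh e {x} j \<Longrightarrow> \<rho> (dist x z) \<le> \<kappa> * real j * \<rho> e"
    and nbh_upper: "\<And>e (x::'a) z j. e > 0 \<Longrightarrow> \<kappa> * (\<rho> (dist x z) / \<rho> e + 1) \<le> real j \<Longrightarrow> z \<in> nbh e {x} j"
    and Cv: "Cv \<ge> 1" and alpha: "\<alpha> > 0"
    and VD: "\<And>x r R. 0 < r \<Longrightarrow> r < R \<Longrightarrow> V \<mu> x R / V \<mu> x r \<le> Cv * (R / r) powr \<alpha>"
begin

lemma doubling:
  assumes "0 < r" "r \<le> R"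
  shows "V \<mu> x R \<le> Cv * (R / r) powr \<alpha> * V \<mu> x r"
proof (cases "r = R")
  case True
  then show ?thesis using Cv V_pos[of r x] assms by simp
next
  case False
  with assms VD[of r R x] V_pos[of r x] show ?thesis by (simp add: divide_le_eq)
qed

lemma doubling_shift:
  assumes "0 < r" "r \<le> R + dist x y"
  shows "V \<mu> x R \<le> Cv * ((R + dist x y) / r) powr \<alpha> * V \<mu> y r"
proof -
  have "ball x R \<subseteq> ball y (R + dist x y)"
  proof
    fix z assume "z \<in> ball x R"
    then show "z \<in> ball y (R + dist x y)" using dist_triangle[of y z x] by (simp add: dist_commute)
  qed
  then have "V \<mu> x R \<le> V \<mu> y (R + dist x y)" by (rule V_subset)
  also have "\<dots> \<le> Cv * ((R + dist x y) / r) powr \<alpha> * V \<mu> y r" using assms by (rule doubling)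
  finally show ?thesis .
qed

lemma ereal_less_diam_mono: "ereal r < mm_diam \<mu> \<Longrightarrow> s \<le> r \<Longrightarrow> ereal s < mm_diam \<mu>"
  by (meson ereal_less_eq(3) order_le_less_trans)

text \<open>The Harnack inequality on a ball of fixed small radius pushes a lower bound forward in time,
  at the price of a factor \<open>C\<close> per step.\<close>
lemma mass_forward:
  assumes r1: "r1 > 0" "ereal r1 < mm_diam \<mu>" and r2: "0 < r2" "r2 \<le> r1" "C4 * \<psi> r2 \<le> a0 * \<psi> r1"
    and f: "f \<in> F" "f \<in> Cc" "\<And>y. 0 \<le> f y" "\<And>y. y \<in> ball x r1 \<Longrightarrow> f y = 1"
    and s: "0 < s" "s \<le> a0 * \<psi> r1 + real n * ((C4 - C2) * \<psi> r2)"
  shows "AE y in \<mu>. y \<in> ball x (c * r2) \<longrightarrow> inverse C ^ Suc n \<le> P s f y"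
  using s
proof (induction n arbitrary: s)
  case 0
  have fL: "f \<in> L2 \<mu>" using f by (intro F_L2)
  have "AE y in \<mu>. y \<in> ball x (c * r1) \<longrightarrow> 1 - \<theta> * 1 \<le> P s f y"
  proof (rule contraction[OF r1 f(1,2,4)])
    show "s \<le> a0 * \<psi> r1" using 0 by simp
    fix h assume "0 < h" "h \<le> s"
    then show "AE y in \<mu>. y \<in> ball x r1 \<longrightarrow> 1 - 1 \<le> P h f y" using P_nonneg[OF fL _ \<open>0 < h\<close>] f(3) by auto
  qed (use 0 in auto)
  moreover have "ball x (c * r2) \<subseteq> ball x (c * r1)" using r2 params by (intro subset_ball mult_left_mono) auto
  ultimately show ?case by (auto simp: \<theta>_def inverse_eq_divide elim!: eventually_mono)
next
  case (Suc n)
  have fL: "f \<in> L2 \<mu>" using f by (intro F_L2)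
  have invC: "0 < inverse C" "inverse C \<le> 1" using params by (auto simp: inverse_le_1_iff)
  show ?case
  proof (cases "s \<le> a0 * \<psi> r1 + real n * ((C4 - C2) * \<psi> r2)")
    case True
    have "inverse C ^ Suc (Suc n) \<le> inverse C ^ Suc n" using invC by (intro power_decreasing) auto
    with Suc.IH[OF Suc.prems(1) True] show ?thesis by (auto elim!: eventually_mono)
  next
    case False
    have p2: "\<psi> r2 > 0" using r2 by (intro psi.pos)
    have "0 \<le> real n * ((C4 - C2) * \<psi> r2)" using params p2 by simp
    then have sC: "C4 * \<psi> r2 < s" using False r2 by linarith
    \<comment> \<open>The late window then ends at s, while the early one ends (C4 - C2) \<psi>(r2)
      before s, at a time covered by the induction hypothesis.\<close>
    define \<sigma> where "\<sigma> = s - C4 * \<psi> r2"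
    have \<sigma>: "0 \<le> \<sigma>" using sC by (simp add: \<sigma>_def)
    have d2: "ereal r2 < mm_diam \<mu>" using ereal_less_diam_mono[OF r1(2) r2(2)] .
    obtain m where m: "m \<ge> 0"
      "\<And>h. C1 * \<psi> r2 < h \<Longrightarrow> h \<le> C2 * \<psi> r2 \<Longrightarrow> AE z in \<mu>. z \<in> ball x (c * r2) \<longrightarrow> max 0 (P (\<sigma> + h) f z) \<le> C * m"
      "\<And>h. C3 * \<psi> r2 < h \<Longrightarrow> h \<le> C4 * \<psi> r2 \<Longrightarrow> AE z in \<mu>. z \<in> ball x (c * r2) \<longrightarrow> m \<le> max 0 (P (\<sigma> + h) f z)"
      using parabolic_harnack[OF r2(1) d2 _ caloric_semigroup[OF fL _ \<sigma>], of x] f(3) by auto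
    have cr: "0 < c * r2" using r2 params by simp
    have e: "\<sigma> + C2 * \<psi> r2 = s - (C4 - C2) * \<psi> r2" "\<sigma> + C4 * \<psi> r2 = s" by (auto simp: \<sigma>_def algebra_simps)
    have "0 < \<sigma> + C2 * \<psi> r2" using \<sigma> params p2 by (intro add_nonneg_pos) auto
    moreover have "\<sigma> + C2 * \<psi> r2 \<le> a0 * \<psi> r1 + real n * ((C4 - C2) * \<psi> r2)"
      using Suc.prems unfolding e(1) by (simp add: algebra_simps)
    ultimately have "AE y in \<mu>. y \<in> ball x (c * r2) \<longrightarrow> inverse C ^ Suc n \<le> P (\<sigma> + C2 * \<psi> r2) f y"
      by (rule Suc.IH)
    moreover have "AE z in \<mu>. z \<in> ball x (c * r2) \<longrightarrow> max 0 (P (\<sigma> + C2 * \<psi> r2) f z) \<le> C * m"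
      using params p2 by (intro m(2)) auto
    ultimately have "AE z in \<mu>. z \<in> ball x (c * r2) \<longrightarrow> inverse C ^ Suc n \<le> C * m" by eventually_elim auto
    from AE_not_False_on_ball[OF cr this] have "inverse C ^ Suc n \<le> C * m" by blast
    then have le: "inverse C * inverse C ^ Suc n \<le> inverse C * (C * m)" using invC by (intro mult_left_mono) auto
    have "inverse C * (C * m) = m" using params by simp
    with le have mle: "inverse C ^ Suc (Suc n) \<le> m" by (simp only: power_Suc)
    have pos: "0 < inverse C ^ Suc (Suc n)" using invC by simp
    have "AE z in \<mu>. z \<in> ball x (c * r2) \<longrightarrow> m \<le> max 0 (P s f z)"
      using m(3)[of "C4 * \<psi> r2"] params p2 unfolding e(2) by simp
    then show ?thesis using mle pos by (auto elim!: eventually_mono)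
  qed
qed

lemma L2_bounded_support_integrable:
  assumes f: "f \<in> L2 \<mu>" and A: "bounded A" "A \<in> sets borel" "\<And>y. y \<notin> A \<Longrightarrow> f y = 0"
  shows "integrable \<mu> f"
proof -
  have "integrable \<mu> (\<lambda>y. f y * indicat_real A y)" by (rule L2_integrable_mult[OF f indicator_L2[OF A(1,2)]])
  moreover have "(\<lambda>y. f y * indicat_real A y) = f" using A(3) by (auto simp: indicator_def fun_eq_iff)
  ultimately show ?thesis by simp
qed

text \<open>Duality: a lower bound for the image of a cutoff on the support of f becomes, by
  symmetry, a lower bound for the mass of \<open>P T f\<close> near x. The essential supremum of
  \<open>P T f\<close> is at least its average, and one Harnack step makes this a pointwise lower
  bound at the later time \<open>\<psi> r\<close>.\<close>

lemma near_diagonal: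
  obtains q k where "0 < q" "q < 1" "0 < k"
    "\<And>x r f. 0 < r \<Longrightarrow> ereal r < mm_diam \<mu> \<Longrightarrow> f \<in> L2 \<mu> \<Longrightarrow> (\<And>y. 0 \<le> f y) \<Longrightarrow> (\<And>y. y \<notin> ball x (q * r) \<Longrightarrow> f y = 0) \<Longrightarrow>
       AE y in \<mu>. y \<in> ball x (q * r) \<longrightarrow> k / V \<mu> x r * (\<integral>z. f z \<partial>\<mu>) \<le> P (\<psi> r) f y"
proof -
  obtain d where d: "0 < d" "d < 1" "\<And>r. 0 < r \<Longrightarrow> \<psi> (d * r) \<le> (a0 / C4) * \<psi> r"
    using psi.ratio_small[of "a0 / C4"] a0_pos params by auto
  \<comment> \<open>With r1 = c r / 4 and r2 = d r1 this gives c r2 = q r, the radius on which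
    \<open>mass_forward\<close> provides its bound.\<close>
  define q where "q = c * (d * (c / 4))"
  have "d * (c / 4) < 1 * 1" using d params by (intro mult_strict_mono) auto
  then have q: "0 < q" "q < 1" unfolding q_def using d params
    by (auto intro!: mult_pos_pos) (use mult_strict_mono[of c 1 "d * (c/4)" 1] in auto)
  \<comment> \<open>Number of Harnack steps of duration (C4 - C2) \<psi>(r2) that cover a time up to
    \<psi>(r); it does not depend on r.\<close>
  define n where "n = nat \<lceil>K * (4 / (d * c)) powr \<beta>' / (C4 - C2)\<rceil>"
  define k where "k = inverse C ^ Suc n / C"
  have k: "0 < k" using params by (simp add: k_def)
  show thesis
  proof (rule that[OF q k])
    fix x :: 'a and r :: real and f
    assume r: "0 < r" "ereal r < mm_diam \<mu>" and f: "f \<in> L2 \<mu>" "\<And>y. 0 \<le> f y" "\<And>y. y \<notin> ball x (q * r) \<Longrightarrow> f y = 0"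
    define r1 where "r1 = c / 4 * r"
    define r2 where "r2 = d * r1"
    have r1: "0 < r1" "r1 \<le> r" "2 * r1 \<le> c * r" using r params by (auto simp: r1_def)
    have r2: "0 < r2" "r2 \<le> r1" "c * r2 = q * r"
      using r1 d mult_right_mono[of d 1 r1] by (auto simp: r2_def r1_def q_def)
    have d1: "ereal r1 < mm_diam \<mu>" using ereal_less_diam_mono[OF r(2) r1(2)] .
    have p: "0 < \<psi> r" "0 < \<psi> r2" using r r2 psi.pos by auto
    have C4r2: "C4 * \<psi> r2 \<le> a0 * \<psi> r1" using d(3)[OF r1(1)] params by (simp add: r2_def field_simps)
    obtain cut where cut: "cut \<in> F" "cut \<in> Cc" "\<And>y. 0 \<le> cut y" "\<And>y. cut y \<le> 1" "\<And>y. y \<in> cball x r1 \<longrightarrow> cut y = 1"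
      "\<And>y. y \<notin> ball x (2 * r1) \<longrightarrow> cut y = 0"
      using cutoff_ex[of "cball x r1" "ball x (2 * r1)"] r1 by (auto simp: subset_iff)
    have cutL: "cut \<in> L2 \<mu>" using cut by (intro F_L2)
    \<comment> \<open>End of the early window of the Harnack inequality whose late window ends at
      \<open>\<psi> r\<close>.\<close>
    define T where "T = \<psi> r - C4 * \<psi> r + C2 * \<psi> r"
    have \<sigma>: "0 \<le> \<psi> r - C4 * \<psi> r" using C4_le_1 p by simp
    have T0: "0 < T" unfolding T_def using \<sigma> params p by (intro add_nonneg_pos) auto
    have "T \<le> \<psi> r" using params p by (simp add: T_def)
    also have "\<dots> \<le> K * (r / r2) powr \<beta>' * \<psi> r2" using r1 r2 by (intro psi.ratio_le) auto
    also have "r / r2 = 4 / (d * c)" using r params d by (simp add: r2_def r1_def)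
    also have "K * (4 / (d * c)) powr \<beta>' * \<psi> r2 = (K * (4 / (d * c)) powr \<beta>' / (C4 - C2)) * ((C4 - C2) * \<psi> r2)"
      using params by simp
    also have "\<dots> \<le> real n * ((C4 - C2) * \<psi> r2)"
      using params p by (intro mult_right_mono) (auto simp: n_def intro: real_nat_ceiling_ge)
    also have "\<dots> \<le> a0 * \<psi> r1 + real n * ((C4 - C2) * \<psi> r2)" using a0_pos psi.pos[OF r1(1)] by simp
    finally have Tn: "T \<le> a0 * \<psi> r1 + real n * ((C4 - C2) * \<psi> r2)" .
    have mass: "AE y in \<mu>. y \<in> ball x (q * r) \<longrightarrow> inverse C ^ Suc n \<le> P T cut y"
      unfolding r2(3)[symmetric] by (rule mass_forward[OF r1(1) d1 r2(1,2) C4r2 cut(1-3) _ T0 Tn]) (use cut(5) in auto)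
    have fint: "integrable \<mu> f" by (rule L2_bounded_support_integrable[OF f(1), of "ball x (q * r)"]) (use f(3) in auto)
    have PT: "P T cut \<in> L2 \<mu>" "P T f \<in> L2 \<mu>" using cutL f T0 by (auto intro: P_L2)
    have "inverse C ^ Suc n * (\<integral>z. f z \<partial>\<mu>) = (\<integral>z. inverse C ^ Suc n * f z \<partial>\<mu>)" by simp
    also have "\<dots> \<le> ip (P T cut) f"
      unfolding l2inner_def
    proof (rule integral_mono_AE)
      show "integrable \<mu> (\<lambda>z. inverse C ^ Suc n * f z)" using fint by simp
      show "integrable \<mu> (\<lambda>z. P T cut z * f z)" using PT f by (intro L2_integrable_mult)
      show "AE z in \<mu>. inverse C ^ Suc n * f z \<le> P T cut z * f z" using mass
      proof eventually_elim
        case (elim z)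
        show ?case
        proof (cases "z \<in> ball x (q * r)")
          case True
          then show ?thesis using elim f(2) by (intro mult_right_mono) auto
        qed (use f(3) in simp)
      qed
    qed
    also have "\<dots> = ip cut (P T f)" by (rule P_symmetric[OF cutL f(1) T0])
    finally have lower: "inverse C ^ Suc n * (\<integral>z. f z \<partial>\<mu>) \<le> ip cut (P T f)" .
    obtain m where m: "m \<ge> 0"
      "\<And>h. C1 * \<psi> r < h \<Longrightarrow> h \<le> C2 * \<psi> r \<Longrightarrow> AE z in \<mu>. z \<in> ball x (c * r) \<longrightarrow> max 0 (P ((\<psi> r - C4 * \<psi> r) + h) f z) \<le> C * m"
      "\<And>h. C3 * \<psi> r < h \<Longrightarrow> h \<le> C4 * \<psi> r \<Longrightarrow> AE z in \<mu>. z \<in> ball x (c * r) \<longrightarrow> m \<le> max 0 (P ((\<psi> r - C4 * \<psi> r) + h) f z)"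
      using parabolic_harnack[OF r _ caloric_semigroup[OF f(1) _ \<sigma>], of x] f(2) by auto
    have up: "AE z in \<mu>. z \<in> ball x (c * r) \<longrightarrow> max 0 (P T f z) \<le> C * m"
      unfolding T_def using params p by (intro m(2)) auto
    have ballL: "indicat_real (ball x (c * r)) \<in> L2 \<mu>" by (intro indicator_L2) auto
    have "ip cut (P T f) \<le> (\<integral>z. (C * m) * indicat_real (ball x (c * r)) z \<partial>\<mu>)"
      unfolding l2inner_def
    proof (rule integral_mono_AE)
      show "integrable \<mu> (\<lambda>z. cut z * P T f z)" using PT cutL by (intro L2_integrable_mult)
      show "integrable \<mu> (\<lambda>z. (C * m) * indicat_real (ball x (c * r)) z)"
        using ball_finite[of x "c * r"] by (intro integrable_mult_right integrable_real_indicator) auto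
      show "AE z in \<mu>. cut z * P T f z \<le> (C * m) * indicat_real (ball x (c * r)) z" using up
      proof eventually_elim
        case (elim z)
        show ?case
        proof (cases "z \<in> ball x (c * r)")
          case True
          have "cut z * P T f z \<le> cut z * max 0 (P T f z)" using cut(3) by (intro mult_left_mono) auto
          also have "\<dots> \<le> 1 * max 0 (P T f z)" using cut(4) by (intro mult_right_mono) auto
          also have "\<dots> \<le> C * m" using True elim by simp
          finally show ?thesis using True by simp
        next
          case False
          then have "z \<notin> ball x (2 * r1)" using r1(3) by auto
          then have "cut z = 0" using cut(6) by blast
          then show ?thesis using False by simp
        qed
      qed
    qed
    also have "\<dots> = C * m * V \<mu> x (c * r)" by (simp add: V_def)
    also have "\<dots> \<le> C * m * V \<mu> x r"
    proof (intro mult_left_mono V_mono)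
      show "c * r \<le> r" using r params by simp
      show "0 \<le> C * m" using params m(1) by simp
    qed
    finally have "inverse C ^ Suc n * (\<integral>z. f z \<partial>\<mu>) \<le> C * m * V \<mu> x r" using lower by simp
    then have km: "k / V \<mu> x r * (\<integral>z. f z \<partial>\<mu>) \<le> m"
      using V_pos[OF r(1), of x] params by (simp add: k_def field_simps del: power_Suc)
    have late: "AE z in \<mu>. z \<in> ball x (c * r) \<longrightarrow> m \<le> max 0 (P (\<psi> r) f z)"
      using m(3)[of "C4 * \<psi> r"] params p by simp
    have sub: "ball x (q * r) \<subseteq> ball x (c * r)"
    proof (rule subset_ball)
      have "q \<le> c * 1" unfolding q_def using \<open>d * (c / 4) < 1 * 1\<close> params by (intro mult_left_mono) auto
      then show "q * r \<le> c * r" using r by (intro mult_right_mono) auto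
    qed
    have "AE y in \<mu>. 0 \<le> P (\<psi> r) f y" using P_nonneg[OF f(1) _ p(1)] f(2) by simp
    with late show "AE y in \<mu>. y \<in> ball x (q * r) \<longrightarrow> k / V \<mu> x r * (\<integral>z. f z \<partial>\<mu>) \<le> P (\<psi> r) f y"
    proof eventually_elim
      case (elim y)
      show ?case
      proof
        assume "y \<in> ball x (q * r)"
        then have "y \<in> ball x (c * r)" using sub by blast
        then show "k / V \<mu> x r * (\<integral>z. f z \<partial>\<mu>) \<le> P (\<psi> r) f y" using elim km by auto
      qed
    qed
  qed
qed

section \<open>Comparison of the two scale functions\<close>

text \<open>The space need not be connected, but steps of length p/2 lead from x to some point at
  distance at least p/2. The first vertex with that property overshoots by less than p/2.\<close>

lemma exists_at_distance:
  fixes x :: 'a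
  assumes p: "0 < p" "p \<le> R / 2" and R: "ereal R < mm_diam \<mu>"
  obtains y where "p / 2 \<le> dist x y" "dist x y < p"
proof -
  have "\<exists>a b. R < dist a (b::'a)"
    using R unfolding mm_diam_def less_SUP_iff by auto
  then obtain a b :: 'a where "R < dist a b" by blast
  then have "R / 2 < dist x a \<or> R / 2 < dist x b" using dist_triangle[of a b x] dist_commute[of x a] by linarith
  then have "p / 2 \<le> dist x a \<or> p / 2 \<le> dist x b" using p by linarith
  then obtain z where z: "p / 2 \<le> dist x z" by blast
  obtain j :: nat where "\<kappa> * (\<rho> (dist x z) / \<rho> (p/2) + 1) \<le> real j" using real_arch_simple by blast
  then have "z \<in> nbh (p/2) {x} j" using p by (intro nbh_upper) auto
  then have ex: "\<exists>j y. y \<in> nbh (p/2) {x} j \<and> p / 2 \<le> dist x y" using z by blast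
  define i where "i = (LEAST j. \<exists>y. y \<in> nbh (p/2) {x} j \<and> p / 2 \<le> dist x y)"
  obtain y where y: "y \<in> nbh (p/2) {x} i" "p / 2 \<le> dist x y"
    using LeastI_ex[OF ex] unfolding i_def by blast
  have "i \<noteq> 0" using y p by (intro notI) auto
  then obtain k where k: "i = Suc k" by (cases i) auto
  obtain w where w: "w \<in> nbh (p/2) {x} k" "dist w y < p / 2" using y(1) k by auto
  have "k < i" using k by simp
  from not_less_Least[OF this[unfolded i_def]] w(1) have "\<not> p / 2 \<le> dist x w" by blast
  then have "dist x y < p" using w(2) dist_triangle[of x y w] by simp
  with y(2) that show ?thesis by blast
qed

context
  fixes A :: "nat \<Rightarrow> 'a set" and t :: real
  assumes bA: "\<And>i. bounded (A i)" and mA: "\<And>i. A i \<in> sets borel" and incA: "\<And>i j. i \<le> j \<Longrightarrow> A i \<subseteq> A j" and t: "t > 0"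
begin

text \<open>For nested sets, the heat that starts in the smaller of two of them and is lost from the
  larger by time t. Its integral is the bilinear term in \<open>defect_integral\<close>, with the
  advantage of being nonnegative.\<close>

definition defect :: "nat \<Rightarrow> nat \<Rightarrow> 'a \<Rightarrow> real" where
  "defect i k y = indicat_real (A (min i k)) y * (1 - P t (indicat_real (A (max i k))) y)"

lemma level_indicator_L2: "indicat_real (A i) \<in> L2 \<mu>"
  by (rule indicator_L2[OF bA mA])

lemma defect_integrable: "integrable \<mu> (defect i k)"
proof -
  have "integrable \<mu> (indicat_real (A (min i k)))"
    using bounded_finite[OF bA] mA by (intro integrable_real_indicator) auto
  moreover have "integrable \<mu> (\<lambda>y. indicat_real (A (min i k)) y * P t (indicat_real (A (max i k))) y)"
    using t by (intro L2_integrable_mult level_indicator_L2 P_L2) auto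
  ultimately have "integrable \<mu> (\<lambda>y. indicat_real (A (min i k)) y - indicat_real (A (min i k)) y * P t (indicat_real (A (max i k))) y)"
    by (rule Bochner_Integration.integrable_diff)
  then show ?thesis by (simp add: defect_def[abs_def] right_diff_distrib)
qed

lemma defect_integral:
  "(\<integral>y. defect i k y \<partial>\<mu>) = ip (indicat_real (A i)) (indicat_real (A k)) - ip (P t (indicat_real (A i))) (indicat_real (A k))"
proof -
  let ?a = "indicat_real (A (min i k))" and ?b = "indicat_real (A (max i k))"
  have "integrable \<mu> ?a" using bounded_finite[OF bA] mA by (intro integrable_real_indicator) auto
  then have "(\<integral>y. defect i k y \<partial>\<mu>) = (\<integral>y. ?a y \<partial>\<mu>) - ip ?a (P t ?b)"
    using L2_integrable_mult[OF level_indicator_L2 P_L2[OF level_indicator_L2], of t "min i k" "max i k"] t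
    by (simp add: defect_def[abs_def] right_diff_distrib l2inner_def)
  moreover have "(\<integral>y. ?a y \<partial>\<mu>) = ip ?a ?b"
  proof -
    have "min i k \<le> max i k" by linarith
    then have "?a y * ?b y = ?a y" for y using incA[of "min i k" "max i k"] by (auto simp: indicator_def)
    then have "(\<lambda>y. ?a y * ?b y) = ?a" by (rule ext)
    then show ?thesis by (simp only: l2inner_def)
  qed
  moreover have "ip ?a ?b = ip (indicat_real (A i)) (indicat_real (A k))"
    by (cases "i \<le> k") (auto simp: min_def max_def l2inner_def mult.commute)
  moreover have "ip ?a (P t ?b) = ip (P t (indicat_real (A i))) (indicat_real (A k))"
    using P_symmetric[OF level_indicator_L2 level_indicator_L2 t, of i k] P_symmetric[OF level_indicator_L2 level_indicator_L2 t, of k i]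
    by (cases "i \<le> k") (auto simp: min_def max_def l2inner_def mult.commute)
  ultimately show ?thesis by simp
qed

text \<open>g is a layer sum: on the last set it equals H + 1 minus the first index whose set
  contains the point. Expanding bilinearly turns its increment into a double sum of nonnegative
  defects.\<close>

lemma increment_eq_defect:
  fixes H :: nat
  defines "g \<equiv> \<lambda>y. \<Sum>i\<le>H. indicat_real (A i) y"
  shows "g \<in> L2 \<mu>" "ip g g - ip (P t g) g = (\<Sum>i\<le>H. \<Sum>k\<le>H. \<integral>y. defect i k y \<partial>\<mu>)"
proof -
  show gL: "g \<in> L2 \<mu>" unfolding g_def by (intro L2_sum level_indicator_L2) auto
  have PL: "P t (indicat_real (A i)) \<in> L2 \<mu>" for i using t by (auto intro: P_L2 level_indicator_L2)
  have 1: "ip g g = (\<Sum>i\<le>H. \<Sum>k\<le>H. ip (indicat_real (A i)) (indicat_real (A k)))"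
  proof -
    have "ip g g = (\<Sum>i\<le>H. ip (indicat_real (A i)) g)"
      using gL unfolding g_def by (intro l2inner_sum_left level_indicator_L2) auto
    also have "\<dots> = (\<Sum>i\<le>H. \<Sum>k\<le>H. ip (indicat_real (A i)) (indicat_real (A k)))"
      unfolding g_def by (intro sum.cong refl l2inner_sum_right level_indicator_L2) auto
    finally show ?thesis .
  qed
  have "AE y in \<mu>. P t g y = (\<Sum>i\<le>H. P t (indicat_real (A i)) y)"
    unfolding g_def by (rule P_sum) (auto intro: level_indicator_L2 t)
  then have "ip (P t g) g = ip (\<lambda>y. \<Sum>i\<le>H. P t (indicat_real (A i)) y) g"
    using gL t by (intro l2inner_AE_cong) (auto intro!: L2_measurable P_L2 L2_sum PL)
  also have "\<dots> = (\<Sum>i\<le>H. ip (P t (indicat_real (A i))) g)"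
    by (rule l2inner_sum_left) (auto intro: PL gL)
  also have "\<dots> = (\<Sum>i\<le>H. \<Sum>k\<le>H. ip (P t (indicat_real (A i))) (indicat_real (A k)))"
    unfolding g_def by (intro sum.cong refl l2inner_sum_right level_indicator_L2 PL) auto
  finally have 2: "ip (P t g) g = (\<Sum>i\<le>H. \<Sum>k\<le>H. ip (P t (indicat_real (A i))) (indicat_real (A k)))" .
  show "ip g g - ip (P t g) g = (\<Sum>i\<le>H. \<Sum>k\<le>H. \<integral>y. defect i k y \<partial>\<mu>)"
    unfolding 1 2 defect_integral by (simp only: sum_subtractf)
qed

lemma defect_AE: "AE y in \<mu>. 0 \<le> P t (indicat_real (A i)) y \<and> P t (indicat_real (A i)) y \<le> 1"
  by (rule P_indicator_bounds[OF bA mA t])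

lemma defect_integral_nonneg: "0 \<le> (\<integral>y. defect i k y \<partial>\<mu>)"
proof (rule integral_nonneg_AE)
  show "AE y in \<mu>. 0 \<le> defect i k y"
    using defect_AE[of "max i k"] by eventually_elim (auto simp: defect_def intro!: mult_nonneg_nonneg)
qed

end

lemma sum_powers_from_le:
  assumes "(0::real) \<le> a" "a < 1"
  shows "(\<Sum>i\<le>H. if l \<le> i then a ^ (i - l) else 0) \<le> 1 / (1 - a)"
proof -
  have "(\<Sum>i\<le>H. if l \<le> i then a ^ (i - l) else 0) = (\<Sum>i\<in>{l..H}. a ^ (i - l))"
    by (rule sum.mono_neutral_cong_right) auto
  also have "\<dots> = (\<Sum>i<Suc H - l. a ^ i)"
    by (rule sum.reindex_bij_witness[of _ "\<lambda>i. i + l" "\<lambda>i. i - l"]) auto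
  also have "\<dots> \<le> 1 / (1 - a)" using assms by (subst sum_gp_strict) (auto simp: divide_right_mono)
  finally show ?thesis .
qed

text \<open>At a point whose first level is l, losing heat from level max(i,k) costs a power of
  \<theta> growing with max(i,k) - l. Hence the double sum is bounded by a product of two geometric
  series, independently of H.\<close>

lemma increment_upper:
  fixes x :: 'a and H :: nat and e :: real
  defines "A \<equiv> nbh e {x}"
  defines "g \<equiv> \<lambda>y. \<Sum>i\<le>H. indicat_real (A i) y"
  assumes e: "e > 0" "ereal e < mm_diam \<mu>" and s: "0 < s" "s \<le> a0 * \<psi> e"
  shows "ip g g - ip (P s g) g \<le> (inverse \<eta> ^ 2 / (1 - \<eta>)\<^sup>2) * measure \<mu> (A H)"
proof -
  have bA: "bounded (A i)" and mA: "A i \<in> sets borel" for i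
    unfolding A_def by (auto intro: bounded_nbh nbh_borel)
  have incA: "i \<le> j \<Longrightarrow> A i \<subseteq> A j" for i j unfolding A_def using e(1) by (rule nbh_mono)
  let ?D = "defect A s"
  let ?B = "inverse \<eta> ^ 2"
  have B1: "1 \<le> ?B" using eta by (intro one_le_power) (simp add: one_le_inverse)
  have surv: "AE y in \<mu>. \<forall>l j. y \<in> A l \<longrightarrow> 1 - \<theta> ^ j \<le> P s (indicat_real (A (l + Suc j))) y"
    unfolding AE_all_countable
  proof (intro allI)
    fix l j
    have op: "open (A (l + Suc j))" unfolding A_def by (rule open_nbh) simp
    from survival_small_time[OF bA mA e s op, of j]
    show "AE y in \<mu>. y \<in> A l \<longrightarrow> 1 - \<theta> ^ j \<le> P s (indicat_real (A (l + Suc j))) y"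
    proof eventually_elim
      case (elim y)
      show ?case
      proof
        assume "y \<in> A l"
        then have "nbh e {y} (Suc j) \<subseteq> nbh e (A l) (Suc j)" by (intro nbh_mono_set) auto
        also have "\<dots> = A (l + Suc j)" unfolding A_def by (rule nbh_add[symmetric])
        finally show "1 - \<theta> ^ j \<le> P s (indicat_real (A (l + Suc j))) y" using elim by blast
      qed
    qed
  qed
  have bnd: "AE y in \<mu>. \<forall>i. 0 \<le> P s (indicat_real (A i)) y \<and> P s (indicat_real (A i)) y \<le> 1"
    unfolding AE_all_countable by (intro allI P_indicator_bounds[OF bA mA s(1)])
  have pw: "AE y in \<mu>. (\<Sum>i\<le>H. \<Sum>k\<le>H. ?D i k y) \<le> (?B / (1 - \<eta>)\<^sup>2) * indicat_real (A H) y"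
    using surv bnd
  proof eventually_elim
    case (elim y)
    show ?case
    proof (cases "y \<in> A H")
      case False
      have "?D i k y = 0" if "i \<le> H" "k \<le> H" for i k
      proof -
        have "min i k \<le> H" using that by simp
        then have "y \<notin> A (min i k)" using False incA by blast
        then show ?thesis by (simp add: defect_def[OF bA mA incA s(1)])
      qed
      then show ?thesis using False by simp
    next
      case True
      define l where "l = (LEAST i. y \<in> A i)"
      have l: "y \<in> A l" unfolding l_def using True by (rule LeastI)
      have notl: "y \<notin> A i" if "i < l" for i using not_less_Least that unfolding l_def by blast
      define w where "w i = (if l \<le> i then \<eta> ^ (i - l) else 0)" for i
      have w0: "0 \<le> w i" for i using eta by (simp add: w_def)
      have Dle: "?D i k y \<le> ?B * (w i * w k)" for i k
      proof (cases "l \<le> min i k")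
        case False
        then have "min i k < l" by linarith
        then have "y \<notin> A (min i k)" by (rule notl)
        then show ?thesis using w0 B1 by (simp add: defect_def[OF bA mA incA s(1)])
      next
        case True
        then have li: "l \<le> i" "l \<le> k" by auto
        let ?m = "max i k"
        \<comment> \<open>Twice the larger distance dominates the sum of both; this separates i from
          k.\<close>
        have pow: "\<eta> ^ (2 * (?m - l)) \<le> w i * w k"
        proof -
          have "(i - l) + (k - l) \<le> 2 * (?m - l)" by auto
          then have "\<eta> ^ (2 * (?m - l)) \<le> \<eta> ^ ((i - l) + (k - l))" using eta by (intro power_decreasing) auto
          then show ?thesis by (simp only: w_def li if_True power_add)
        qed
        have "1 - P s (indicat_real (A ?m)) y \<le> ?B * \<eta> ^ (2 * (?m - l))"
        proof (cases "?m = l")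
          case True
          have "1 - P s (indicat_real (A ?m)) y \<le> 1" using elim(2) by simp
          then show ?thesis using True B1 by simp
        next
          case False
          then have "l < ?m" using li by linarith
          then obtain j where "?m = Suc (l + j)" using less_imp_Suc_add by blast
          then have j: "?m = l + Suc j" by simp
          have "1 - P s (indicat_real (A ?m)) y \<le> \<theta> ^ j" using elim(1)[rule_format, OF l, of j] unfolding j by linarith
          also have "\<dots> \<le> ?B * \<eta> ^ (2 * Suc j)" by (rule theta_power_le)
          finally show ?thesis using j by simp
        qed
        also have "\<dots> \<le> ?B * (w i * w k)" using pow B1 by (intro mult_left_mono) auto
        finally have le: "1 - P s (indicat_real (A ?m)) y \<le> ?B * (w i * w k)" .
        have "0 \<le> ?B * (w i * w k)" using w0 B1 by (intro mult_nonneg_nonneg) auto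
        with le show ?thesis by (auto simp: defect_def[OF bA mA incA s(1)] indicator_def)
      qed
      have W: "(\<Sum>i\<le>H. w i) \<le> 1 / (1 - \<eta>)" unfolding w_def using eta by (intro sum_powers_from_le) auto
      have W0: "0 \<le> (\<Sum>i\<le>H. w i)" using w0 by (intro sum_nonneg) auto
      have "(\<Sum>i\<le>H. \<Sum>k\<le>H. ?D i k y) \<le> (\<Sum>i\<le>H. \<Sum>k\<le>H. ?B * (w i * w k))"
        using Dle by (intro sum_mono)
      also have "\<dots> = ?B * ((\<Sum>i\<le>H. w i) * (\<Sum>k\<le>H. w k))"
        by (subst sum_product) (simp only: sum_distrib_left)
      also have "\<dots> \<le> ?B * ((1 / (1 - \<eta>)) * (1 / (1 - \<eta>)))"
        using W W0 B1 eta by (intro mult_left_mono mult_mono) auto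
      also have "\<dots> = (?B / (1 - \<eta>)\<^sup>2) * indicat_real (A H) y" using True by (simp add: power2_eq_square)
      finally show ?thesis .
    qed
  qed
  have "ip g g - ip (P s g) g = (\<Sum>i\<le>H. \<Sum>k\<le>H. \<integral>y. ?D i k y \<partial>\<mu>)"
    unfolding g_def by (rule increment_eq_defect(2)[OF bA mA incA s(1)])
  also have "\<dots> = (\<integral>y. (\<Sum>i\<le>H. \<Sum>k\<le>H. ?D i k y) \<partial>\<mu>)"
    using defect_integrable[OF bA mA incA s(1)] by simp
  also have "\<dots> \<le> (\<integral>y. (?B / (1 - \<eta>)\<^sup>2) * indicat_real (A H) y \<partial>\<mu>)"
  proof (rule integral_mono_AE[OF _ _ pw])
    show "integrable \<mu> (\<lambda>y. \<Sum>i\<le>H. \<Sum>k\<le>H. ?D i k y)"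
      using defect_integrable[OF bA mA incA s(1)] by (intro Bochner_Integration.integrable_sum) auto
    show "integrable \<mu> (\<lambda>y. (?B / (1 - \<eta>)\<^sup>2) * indicat_real (A H) y)"
      using bounded_finite[OF bA] mA by (intro integrable_mult_right integrable_real_indicator) auto
  qed
  finally show ?thesis by simp
qed

text \<open>Test function: the truncated number of steps of size \<open>e\<close> needed to reach a point from \<open>x\<close>.
  Its increments \<open>(g - P\<^sub>s g, g)\<close> are at most of order \<open>V(x,R)\<close> at time \<open>s \<approx> \<psi>(e)\<close>, and by
  the near-diagonal bound at least of order \<open>(\<rho>(R)/\<rho>(e))\<^sup>2 V(x,R)\<close> at time \<open>\<psi>(R)\<close>; they grow at most
  linearly in time.\<close>
lemma scale_gain:
  obtains G where "G \<ge> 1" "\<And>e R. 0 < e \<Longrightarrow> e \<le> R \<Longrightarrow> ereal R < mm_diam \<mu> \<Longrightarrow> (\<rho> R / \<rho> e)\<^sup>2 \<le> G * (\<psi> R / \<psi> e)"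
proof -
  obtain q k where q: "0 < q" "q < 1" and k: "0 < k" and ndl:
    "\<And>x r f. 0 < r \<Longrightarrow> ereal r < mm_diam \<mu> \<Longrightarrow> f \<in> L2 \<mu> \<Longrightarrow> (\<And>y. 0 \<le> f y) \<Longrightarrow> (\<And>y. y \<notin> ball x (q * r) \<Longrightarrow> f y = 0) \<Longrightarrow>
       AE y in \<mu>. y \<in> ball x (q * r) \<longrightarrow> k / V \<mu> x r * (\<integral>z. f z \<partial>\<mu>) \<le> P (\<psi> r) f y"
    using near_diagonal by blast
  \<comment> \<open>Chosen so that \<open>b * \<rho> R \<le> \<rho> (q * R / 8)\<close>.\<close>
  define b where "b = inverse (K\<rho> * (8 / q) powr \<gamma>')"
  have b: "b > 0" using rho.K_pos q by (simp add: b_def)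
  obtain d where d: "0 < d" "d < 1" "\<And>r. 0 < r \<Longrightarrow> \<rho> (d * r) \<le> (b / (4 * \<kappa>\<^sup>2)) * \<rho> r"
    using rho.ratio_small[of "b / (4 * \<kappa>\<^sup>2)"] b kappa by auto
  \<comment> \<open>At most d, so that the ball of radius \<delta> R about x is filled at about half
    of the last level used; at most q/8, so that the two balls below stay apart and inside
    \<open>ball x (q * R)\<close>.\<close>
  define \<delta> where "\<delta> = min d (q / 8)"
  have \<delta>: "0 < \<delta>" "\<delta> \<le> d" "\<delta> \<le> q / 8" "\<delta> < 1" using d q by (auto simp: \<delta>_def)
  define v where "v = inverse (Cv * (2 / \<delta>) powr \<alpha>)"
  have v: "v > 0" using Cv \<delta> by (simp add: v_def)
  define M where "M = inverse \<eta> ^ 2 / (1 - \<eta>)\<^sup>2"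
  have M: "M > 0" using eta by (simp add: M_def)
  \<comment> \<open>Beyond this value the rounding errors, at most \<kappa> + 2 in total, leave b X
    / (8 \<kappa>) levels between H1 and H2. Below it the claim is trivial.\<close>
  define X0 where "X0 = 8 * \<kappa> * (\<kappa> + 2) / b"
  define G1 where "G1 = (1 / a0 + 1) * M / (k * v\<^sup>2 * (b / (8 * \<kappa>))\<^sup>2)"
  have G1: "0 < G1" unfolding G1_def using a0_pos M k v b kappa by (intro divide_pos_pos mult_pos_pos) (auto simp: add_pos_pos)
  show thesis
  proof (rule that[of "G1 + X0\<^sup>2 + 1"])
    show "1 \<le> G1 + X0\<^sup>2 + 1" using G1 by (simp add: less_imp_le)
    fix e R assume e: "0 < e" and R: "e \<le> R" "ereal R < mm_diam \<mu>"
    have R0: "0 < R" using e R by simp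
    have re: "0 < \<rho> e" "0 < \<rho> R" "0 < \<psi> e" "0 < \<psi> R" using e R0 rho.pos psi.pos by auto
    define X where "X = \<rho> R / \<rho> e"
    define Y where "Y = \<psi> R / \<psi> e"
    have X: "0 < X" using re by (simp add: X_def)
    have Y: "1 \<le> Y" using psi.mono[of e R] e R re by (simp add: Y_def)
    show "(\<rho> R / \<rho> e)\<^sup>2 \<le> (G1 + X0\<^sup>2 + 1) * (\<psi> R / \<psi> e)"
      unfolding X_def[symmetric] Y_def[symmetric]
    proof (cases "X \<le> X0")
      case True
      then have "X\<^sup>2 \<le> X0\<^sup>2 * 1" using X by (simp add: power_mono)
      also have "\<dots> \<le> (G1 + X0\<^sup>2 + 1) * Y" using Y G1 by (intro mult_mono) auto
      finally show "X\<^sup>2 \<le> (G1 + X0\<^sup>2 + 1) * Y" .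
    next
      case False
      have bX: "8 * \<kappa> * (\<kappa> + 2) < b * X" using False b by (simp add: X0_def field_simps)
      have ed: "ereal e < mm_diam \<mu>" using ereal_less_diam_mono[OF R(2,1)] .
      fix x :: 'a
      define A where "A = nbh e {x}"
      have bA: "bounded (A i)" and mA: "A i \<in> sets borel" for i
        unfolding A_def by (auto intro: bounded_nbh nbh_borel)
      have incA: "i \<le> j \<Longrightarrow> A i \<subseteq> A j" for i j unfolding A_def using e by (rule nbh_mono)
      have ereal_qR: "q * R / 2 \<le> R / 2" using q R0 mult_right_mono[of q 1 R] by simp
      \<comment> \<open>Far enough from x to avoid the levels up to H2, near enough for the
        near-diagonal bound to carry heat from around y0 to x.\<close>
      obtain y0 where y0: "q * R / 2 / 2 \<le> dist x y0" "dist x y0 < q * R / 2"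
        using exists_at_distance[OF _ ereal_qR R(2), of x] q R0 by auto
      let ?Z = "ball y0 (\<delta> * R)" and ?U = "ball x (\<delta> * R)"
      have dR: "0 < \<delta> * R" "\<delta> * R \<le> q * R / 8" "q * R \<le> R" using \<delta> q R0 mult_right_mono[of \<delta> "q/8" R] mult_right_mono[of q 1 R] by auto
      \<comment> \<open>From level H1 on the ball \<open>?U\<close> about x is contained in the
        level sets; up to level H2 they are disjoint from the ball \<open>?Z\<close> about
        y0.\<close>
      define H1 where "H1 = nat \<lceil>\<kappa> * (\<rho> (\<delta> * R) / \<rho> e + 1)\<rceil>"
      define H2 where "H2 = nat \<lfloor>b * X / (2 * \<kappa>)\<rfloor>"
      have \<rho>\<delta>: "\<rho> (\<delta> * R) \<le> (b / (4 * \<kappa>\<^sup>2)) * \<rho> R"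
        using rho.mono[of "\<delta> * R" "d * R"] d(3)[OF R0] \<delta> R0 dR(1) by (auto intro: order_trans)
      then have "\<rho> (\<delta> * R) / \<rho> e \<le> (b / (4 * \<kappa>\<^sup>2)) * X" using divide_right_mono[of _ _ "\<rho> e"] re by (fastforce simp: X_def)
      then have "\<kappa> * (\<rho> (\<delta> * R) / \<rho> e + 1) \<le> \<kappa> * ((b / (4 * \<kappa>\<^sup>2)) * X + 1)" using kappa by (intro mult_left_mono) auto
      also have "\<dots> = b * X / (4 * \<kappa>) + \<kappa>" using kappa by (simp add: power2_eq_square field_simps)
      finally have H1a: "\<kappa> * (\<rho> (\<delta> * R) / \<rho> e + 1) \<le> b * X / (4 * \<kappa>) + \<kappa>" .
      have \<rho>\<delta>0: "0 \<le> \<rho> (\<delta> * R) / \<rho> e" using rho.pos[OF dR(1)] re by simp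
      have H1pos: "0 \<le> \<kappa> * (\<rho> (\<delta> * R) / \<rho> e + 1)" using kappa \<rho>\<delta>0 by simp
      have H1: "\<kappa> * (\<rho> (\<delta> * R) / \<rho> e + 1) \<le> real H1" "real H1 \<le> b * X / (4 * \<kappa>) + \<kappa> + 1"
      proof -
        have "real H1 = of_int \<lceil>\<kappa> * (\<rho> (\<delta> * R) / \<rho> e + 1)\<rceil>" using H1pos by (simp add: H1_def)
        then show "\<kappa> * (\<rho> (\<delta> * R) / \<rho> e + 1) \<le> real H1" "real H1 \<le> b * X / (4 * \<kappa>) + \<kappa> + 1"
          using H1a by linarith+
      qed
      have H2: "real H2 \<le> b * X / (2 * \<kappa>)" "b * X / (2 * \<kappa>) - 1 \<le> real H2"
      proof -
        have "0 \<le> b * X / (2 * \<kappa>)" using b X kappa by simp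
        then have "real H2 = of_int \<lfloor>b * X / (2 * \<kappa>)\<rfloor>" by (simp add: H2_def)
        then show "real H2 \<le> b * X / (2 * \<kappa>)" "b * X / (2 * \<kappa>) - 1 \<le> real H2" by linarith+
      qed
      have big: "\<kappa> + 2 < b * X / (8 * \<kappa>)" using bX kappa by (simp add: field_simps)
      have "b * X / (2 * \<kappa>) = 4 * (b * X / (8 * \<kappa>))" "b * X / (4 * \<kappa>) = 2 * (b * X / (8 * \<kappa>))" by auto
      then have N: "b * X / (8 * \<kappa>) \<le> real H2 - real H1" and H2_1: "1 \<le> real H2"
        using H1(2) H2(2) big kappa by linarith+
      have \<rho>q: "b * \<rho> R \<le> \<rho> (q * R / 8)"
      proof -
        have "\<rho> R \<le> K\<rho> * (R / (q * R / 8)) powr \<gamma>' * \<rho> (q * R / 8)" using q R0 by (intro rho.ratio_le) auto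
        then have "\<rho> R \<le> (K\<rho> * (8 / q) powr \<gamma>') * \<rho> (q * R / 8)" using R0 by simp
        then show ?thesis using rho.K_pos q by (simp add: b_def field_simps)
      qed
      have far: "dist x y < q * R / 8" if "y \<in> A j" "j \<le> H2" for y j
      proof -
        have "y \<in> A H2" using incA that by blast
        moreover have "1 \<le> H2" using H2_1 by simp
        ultimately have "\<rho> (dist x y) \<le> \<kappa> * real H2 * \<rho> e" unfolding A_def using e by (intro nbh_lower) auto
        also have "\<dots> \<le> \<kappa> * (b * X / (2 * \<kappa>)) * \<rho> e" using H2(1) kappa re by (intro mult_right_mono mult_left_mono) auto
        also have "\<dots> = b * \<rho> R / 2" using kappa re by (simp add: X_def)
        also have "\<dots> < b * \<rho> R" using b re by simp
        also have "\<dots> \<le> \<rho> (q * R / 8)" by (rule \<rho>q)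
        finally show ?thesis using rho.less_iff[of "dist x y" "q * R / 8"] q R0 by simp
      qed
      have ZA: "?Z \<inter> A j = {}" if "j \<le> H2" for j
      proof -
        have False if "y \<in> ?Z" "y \<in> A j" for y
          using far[OF that(2) \<open>j \<le> H2\<close>] that(1) y0(1) dR(2) dist_triangle[of x y0 y] by (simp add: dist_commute)
        then show ?thesis by blast
      qed
      have UA: "?U \<subseteq> A i" if "H1 \<le> i" for i
      proof
        fix y assume "y \<in> ?U"
        then have "\<rho> (dist x y) \<le> \<rho> (\<delta> * R)" by (intro rho.mono) auto
        then have "\<kappa> * (\<rho> (dist x y) / \<rho> e + 1) \<le> \<kappa> * (\<rho> (\<delta> * R) / \<rho> e + 1)"
          using kappa re by (intro mult_left_mono add_right_mono divide_right_mono) auto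
        also have "\<dots> \<le> real i" using H1(1) that by simp
        finally show "y \<in> A i" unfolding A_def using e by (intro nbh_upper) auto
      qed
      have ZW: "?Z \<subseteq> ball x (q * R)" and UW: "?U \<subseteq> ball x (q * R)"
      proof -
        show "?Z \<subseteq> ball x (q * R)"
        proof
          fix y assume "y \<in> ?Z"
          then show "y \<in> ball x (q * R)" using dist_triangle[of x y y0] y0(2) dR by simp
        qed
        show "?U \<subseteq> ball x (q * R)" using dR q R0 by (intro subset_ball) simp
      qed
      have VZ: "v * V \<mu> x R \<le> V \<mu> y0 (\<delta> * R)" and VU: "v * V \<mu> x R \<le> V \<mu> x (\<delta> * R)"
      proof -
        have "V \<mu> x R \<le> Cv * ((R + dist x y) / (\<delta> * R)) powr \<alpha> * V \<mu> y (\<delta> * R)" if "dist x y < R" for y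
          using dR \<delta> R0 q that by (intro doubling_shift) (auto intro: order_trans[of _ "R"] simp: add_increasing2)
        moreover have "((R + dist x y) / (\<delta> * R)) powr \<alpha> \<le> (2 / \<delta>) powr \<alpha>" if "dist x y < R" for y
          using that \<delta> R0 alpha by (intro powr_mono2) (auto simp: field_simps)
        ultimately have "V \<mu> x R \<le> (Cv * (2 / \<delta>) powr \<alpha>) * V \<mu> y (\<delta> * R)" if "dist x y < R" for y
          using that Cv V_pos[OF dR(1), of y] by (smt (verit) mult_left_mono mult_right_mono)
        then have "v * V \<mu> x R \<le> V \<mu> y (\<delta> * R)" if "dist x y < R" for y
          using that Cv \<delta> by (simp add: v_def field_simps)
        note all = this
        show "v * V \<mu> x R \<le> V \<mu> y0 (\<delta> * R)" "v * V \<mu> x R \<le> V \<mu> x (\<delta> * R)"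
        proof -
          have "dist x y0 < R" using y0(2) dR(3) R0 by linarith
          moreover have "dist x x < R" using R0 by simp
          ultimately show "v * V \<mu> x R \<le> V \<mu> y0 (\<delta> * R)" "v * V \<mu> x R \<le> V \<mu> x (\<delta> * R)"
            using all by blast+
        qed
      qed
      have VR: "0 < V \<mu> x R" using R0 by (rule V_pos)
      define T where "T = \<psi> R"
      have T: "0 < T" using re by (simp add: T_def)
      have ZL: "indicat_real ?Z \<in> L2 \<mu>" and UL: "indicat_real ?U \<in> L2 \<mu>" by (auto intro!: indicator_L2)
      have PZ: "AE y in \<mu>. y \<in> ball x (q * R) \<longrightarrow> k / V \<mu> x R * V \<mu> y0 (\<delta> * R) \<le> P T (indicat_real ?Z) y"
      proof -
        have "AE y in \<mu>. y \<in> ball x (q * R) \<longrightarrow> k / V \<mu> x R * (\<integral>z. indicat_real ?Z z \<partial>\<mu>) \<le> P (\<psi> R) (indicat_real ?Z) y"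
          by (rule ndl[OF R0 R(2) ZL]) (use ZW in \<open>auto simp: indicator_def\<close>)
        moreover have "(\<integral>z. indicat_real ?Z z \<partial>\<mu>) = V \<mu> y0 (\<delta> * R)" by (simp add: V_def)
        ultimately show ?thesis by (simp only: T_def)
      qed
      note dA = bA mA incA T
      have Dlow: "k * v\<^sup>2 * V \<mu> x R \<le> (\<integral>y. defect A T i j y \<partial>\<mu>)" if ij: "i \<in> {H1..H2}" "j \<in> {H1..H2}" for i j
      proof -
        let ?m = "max i j"
        have mH: "?m \<le> H2" "H1 \<le> min i j" using ij by auto
        have AmL: "indicat_real (A ?m) \<in> L2 \<mu>" by (rule indicator_L2[OF bA mA])
        \<comment> \<open>The level set and \<open>?Z\<close> are disjoint, so their indicators add
          up to at most 1: heat arriving from \<open>?Z\<close> is missing from the level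
          set.\<close>
        have "AE y in \<mu>. 0 \<le> P T (\<lambda>y. indicat_real (A ?m) y + indicat_real ?Z y) y \<and> P T (\<lambda>y. indicat_real (A ?m) y + indicat_real ?Z y) y \<le> 1"
        proof (intro P_unit_interval L2_add AmL ZL T AE_I2)
          fix y show "0 \<le> indicat_real (A ?m) y + indicat_real ?Z y \<and> indicat_real (A ?m) y + indicat_real ?Z y \<le> 1"
            using ZA[OF mH(1)] by (cases "y \<in> ?Z"; cases "y \<in> A ?m") (auto simp: indicator_def simp del: mem_ball)
        qed
        with P_add[OF AmL ZL T] have sub: "AE y in \<mu>. P T (indicat_real ?Z) y \<le> 1 - P T (indicat_real (A ?m)) y"
          by eventually_elim auto
        define z where "z = k / V \<mu> x R * V \<mu> y0 (\<delta> * R)"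
        have z: "k * v \<le> z" unfolding z_def using VZ k VR by (simp add: field_simps)
        have "(\<integral>y. z * indicat_real ?U y \<partial>\<mu>) \<le> (\<integral>y. defect A T i j y \<partial>\<mu>)"
        proof (rule integral_mono_AE[OF _ defect_integrable[OF dA]])
          show "integrable \<mu> (\<lambda>y. z * indicat_real ?U y)"
            using ball_finite by (intro integrable_mult_right integrable_real_indicator) auto
          show "AE y in \<mu>. z * indicat_real ?U y \<le> defect A T i j y"
            using PZ sub P_indicator_bounds[OF bA mA T, of ?m]
          proof eventually_elim
            case (elim y)
            show ?case
            proof (cases "y \<in> ?U")
              case True
              then have "y \<in> A (min i j)" "y \<in> ball x (q * R)" using UA[OF mH(2)] UW by auto
              then show ?thesis using elim True by (auto simp: defect_def[OF dA] z_def)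
            next
              case False
              then show ?thesis using elim by (auto simp: defect_def[OF dA] indicator_def)
            qed
          qed
        qed
        then have "z * V \<mu> x (\<delta> * R) \<le> (\<integral>y. defect A T i j y \<partial>\<mu>)" by (simp add: V_def)
        moreover have "(k * v) * (v * V \<mu> x R) \<le> z * V \<mu> x (\<delta> * R)"
          using z VU k v VR by (intro mult_mono) (auto intro: order_trans[of 0 "k * v"])
        ultimately show ?thesis by (simp add: power2_eq_square mult.assoc)
      qed
      define g where "g y = (\<Sum>i\<le>H2. indicat_real (A i) y)" for y
      have g: "g \<in> L2 \<mu>" "ip g g - ip (P T g) g = (\<Sum>i\<le>H2. \<Sum>j\<le>H2. \<integral>y. defect A T i j y \<partial>\<mu>)"
        unfolding g_def[abs_def] using increment_eq_defect[OF dA, where H = H2] by auto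
      \<comment> \<open>The number of pairs of levels between H1 and H2 supplies the square; each
        pair contributes the same lower bound.\<close>
      have "(b * X / (8 * \<kappa>))\<^sup>2 * (k * v\<^sup>2 * V \<mu> x R) \<le> (real (card {H1..H2}))\<^sup>2 * (k * v\<^sup>2 * V \<mu> x R)"
      proof (intro mult_right_mono power_mono)
        have "0 \<le> b * X / (8 * \<kappa>)" using b X kappa by simp
        then have "H1 \<le> H2" using N by linarith
        then show "b * X / (8 * \<kappa>) \<le> real (card {H1..H2})" using N by simp
      qed (use b X kappa k VR in auto)
      also have "\<dots> = (\<Sum>i\<in>{H1..H2}. \<Sum>j\<in>{H1..H2}. k * v\<^sup>2 * V \<mu> x R)"
        by (simp only: sum_constant power2_eq_square mult.assoc)
      also have "\<dots> \<le> (\<Sum>i\<in>{H1..H2}. \<Sum>j\<in>{H1..H2}. \<integral>y. defect A T i j y \<partial>\<mu>)"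
        by (intro sum_mono Dlow)
      also have "\<dots> \<le> (\<Sum>i\<in>{H1..H2}. \<Sum>j\<le>H2. \<integral>y. defect A T i j y \<partial>\<mu>)"
        by (intro sum_mono sum_mono2) (auto intro: defect_integral_nonneg[OF dA])
      also have "\<dots> \<le> (\<Sum>i\<le>H2. \<Sum>j\<le>H2. \<integral>y. defect A T i j y \<partial>\<mu>)"
        by (intro sum_mono2 sum_nonneg) (auto intro: defect_integral_nonneg[OF dA])
      also have "\<dots> = ip g g - ip (P T g) g" using g by simp
      finally have lower: "(b * X / (8 * \<kappa>))\<^sup>2 * (k * v\<^sup>2 * V \<mu> x R) \<le> ip g g - ip (P T g) g" .
      \<comment> \<open>The time \<psi>(R) is divided into steps short enough for
        \<open>increment_upper\<close>; their number is at most a constant times Y.\<close>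
      define n where "n = nat \<lceil>T / (a0 * \<psi> e)\<rceil>"
      have p: "0 < T / (a0 * \<psi> e)" using T a0_pos re by simp
      have n: "T / (a0 * \<psi> e) \<le> real n" "real n \<le> T / (a0 * \<psi> e) + 1" "1 \<le> n"
      proof -
        have "real n = of_int \<lceil>T / (a0 * \<psi> e)\<rceil>" using p by (simp add: n_def)
        then show "T / (a0 * \<psi> e) \<le> real n" "real n \<le> T / (a0 * \<psi> e) + 1" by linarith+
        then show "1 \<le> n" using p by (cases n) auto
      qed
      define s where "s = T / real n"
      have s: "0 < s" "s \<le> a0 * \<psi> e" "real n * s = T"
        using n T a0_pos re by (auto simp: s_def field_simps)
      have "ip g g - ip (P T g) g \<le> real n * (ip g g - ip (P s g) g)"
        using ip_P_decrement_le[OF g(1) s(1) n(3)] unfolding s(3) .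
      also have "\<dots> \<le> real n * (M * measure \<mu> (A H2))"
        unfolding M_def g_def[abs_def] A_def by (intro mult_left_mono increment_upper e ed s) auto
      also have "\<dots> \<le> real n * (M * V \<mu> x R)"
      proof -
        have "A H2 \<subseteq> ball x R"
        proof
          fix y assume "y \<in> A H2"
          then have "dist x y < q * R / 8" by (rule far) simp
          then have "dist x y < R" using dR(3) R0 by linarith
          then show "y \<in> ball x R" by simp
        qed
        then have "measure \<mu> (A H2) \<le> V \<mu> x R" unfolding V_def by (intro measure_mono_bounded mA) auto
        then show ?thesis using M by (intro mult_left_mono) auto
      qed
      also have "\<dots> \<le> ((1 / a0 + 1) * Y) * (M * V \<mu> x R)"
      proof (rule mult_right_mono)
        have "real n \<le> (1 / a0) * Y + 1" using n(2) by (simp add: T_def Y_def)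
        also have "\<dots> \<le> (1 / a0) * Y + Y" using Y by simp
        finally show "real n \<le> (1 / a0 + 1) * Y" by (simp add: algebra_simps)
        show "0 \<le> M * V \<mu> x R" using M VR by simp
      qed
      finally have "(b * X / (8 * \<kappa>))\<^sup>2 * (k * v\<^sup>2 * V \<mu> x R) \<le> ((1 / a0 + 1) * Y) * (M * V \<mu> x R)" using lower by simp
      then have "((b * X / (8 * \<kappa>))\<^sup>2 * (k * v\<^sup>2)) * V \<mu> x R \<le> (((1 / a0 + 1) * Y) * M) * V \<mu> x R" by (simp only: mult.assoc)
      then have "(b * X / (8 * \<kappa>))\<^sup>2 * (k * v\<^sup>2) \<le> ((1 / a0 + 1) * Y) * M" using VR by (simp only: mult_le_cancel_right_pos)
      moreover have "(b * X / (8 * \<kappa>))\<^sup>2 * (k * v\<^sup>2) = X\<^sup>2 * (k * v\<^sup>2 * (b / (8 * \<kappa>))\<^sup>2)"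
        by (simp add: power_mult_distrib power_divide)
      moreover have "0 < k * v\<^sup>2 * (b / (8 * \<kappa>))\<^sup>2" using k v b kappa by simp
      ultimately have "X\<^sup>2 \<le> ((1 / a0 + 1) * Y) * M / (k * v\<^sup>2 * (b / (8 * \<kappa>))\<^sup>2)"
        by (simp only: pos_le_divide_eq)
      also have "\<dots> = G1 * Y" by (simp add: G1_def)
      also have "\<dots> \<le> (G1 + X0\<^sup>2 + 1) * Y" using Y by (intro mult_right_mono) auto
      finally show "X\<^sup>2 \<le> (G1 + X0\<^sup>2 + 1) * Y" .
    qed
  qed
qed

end

section \<open>The exponent\<close>

locale scale_comparison = heat_kernel_setting +
  fixes G q k :: real
  assumes G: "G \<ge> 1"
    and gain: "\<And>e R. 0 < e \<Longrightarrow> e \<le> R \<Longrightarrow> ereal R < mm_diam \<mu> \<Longrightarrow> (\<rho> R / \<rho> e)\<^sup>2 \<le> G * (\<psi> R / \<psi> e)"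
    and q: "0 < q" "q < 1" and k: "0 < k"
    and ndl: "\<And>x r f. 0 < r \<Longrightarrow> ereal r < mm_diam \<mu> \<Longrightarrow> f \<in> L2 \<mu> \<Longrightarrow> (\<And>y. 0 \<le> f y) \<Longrightarrow> (\<And>y. y \<notin> ball x (q * r) \<Longrightarrow> f y = 0) \<Longrightarrow>
       AE y in \<mu>. y \<in> ball x (q * r) \<longrightarrow> k / V \<mu> x r * (\<integral>z. f z \<partial>\<mu>) \<le> P (\<psi> r) f y"
begin

definition \<phi> :: "real \<Rightarrow> real \<Rightarrow> real \<Rightarrow> real" where
  "\<phi> t d s = \<rho> d / \<rho> s - t / \<psi> s"

text \<open>Real-valued form of \<open>Phi_exp\<close>. It is a genuine supremum once
  \<open>phi_bdd\<close> bounds the family above, which rests on \<open>gain\<close>.\<close>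

definition S :: "real \<Rightarrow> real \<Rightarrow> real" where
  "S t d = (SUP s\<in>{0<..}. \<phi> t d s)"

lemma rho_nonneg: "0 \<le> d \<Longrightarrow> 0 \<le> \<rho> d"
  using rho.mono[of 0 d] by (simp add: rho.at_0)

lemma rho_ratio_bound:
  assumes "0 \<le> d" "d \<le> B * s" "0 < s" "B \<ge> 1"
  shows "\<rho> d / \<rho> s \<le> K\<rho> * B powr \<gamma>'"
proof -
  have "\<rho> d \<le> \<rho> (B * s)" using assms by (intro rho.mono) auto
  also have "\<dots> \<le> K\<rho> * (B * s / s) powr \<gamma>' * \<rho> s" using assms by (intro rho.ratio_le) (auto simp: mult_le_cancel_right1)
  finally have "\<rho> d \<le> K\<rho> * B powr \<gamma>' * \<rho> s" using assms by simp
  then show ?thesis using rho.pos[OF assms(3)] by (simp add: divide_le_eq)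
qed

text \<open>For s \<le> r, \<open>gain\<close> replaces the time term by
  \<open>X\<^sup>2 / G\<close>, and completing the square bounds \<open>D X - X\<^sup>2 / G\<close>.
  For s > r the time term is dropped and \<rho> is monotone.\<close>

lemma phi_le:
  assumes r: "0 < r" "ereal r < mm_diam \<mu>" and d: "0 \<le> d" "d \<le> B * r" and B: "B \<ge> 1" and s: "0 < s"
  shows "\<phi> (\<psi> r) d s \<le> K\<rho> * B powr \<gamma>' + (K\<rho> * B powr \<gamma>')\<^sup>2 * G"
proof -
  define D where "D = K\<rho> * B powr \<gamma>'"
  have D0: "0 \<le> D" using rho.K_pos by (simp add: D_def)
  have pos: "0 < \<rho> s" "0 < \<psi> s" "0 < \<rho> r" "0 < \<psi> r" using s r rho.pos psi.pos by auto
  have Dr: "\<rho> d / \<rho> r \<le> D" unfolding D_def by (rule rho_ratio_bound[OF d r(1) B])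
  show ?thesis
  proof (cases "s \<le> r")
    case True
    define X where "X = \<rho> r / \<rho> s"
    have X0: "0 \<le> X" using pos by (simp add: X_def)
    have "X\<^sup>2 \<le> G * (\<psi> r / \<psi> s)" unfolding X_def using s True r by (intro gain) auto
    then have 1: "X\<^sup>2 / G \<le> \<psi> r / \<psi> s" using G by (simp add: field_simps)
    have "\<rho> d / \<rho> s = (\<rho> d / \<rho> r) * X" using pos by (simp add: X_def)
    also have "\<dots> \<le> D * X" using Dr X0 by (rule mult_right_mono)
    finally have "\<phi> (\<psi> r) d s \<le> D * X - X\<^sup>2 / G" using 1 by (simp add: \<phi>_def)
    also have "\<dots> \<le> D\<^sup>2 * G"
    proof -
      have "0 \<le> (X - D * G / 2)\<^sup>2 / G" using G by simp
      also have "\<dots> = X\<^sup>2 / G - D * X + D\<^sup>2 * G / 4" using G by (simp add: power2_eq_square field_simps)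
      finally have "D * X - X\<^sup>2 / G \<le> D\<^sup>2 * G / 4" by simp
      also have "\<dots> \<le> D\<^sup>2 * G" using G by simp
      finally show ?thesis .
    qed
    finally show ?thesis using D0 by (simp add: D_def[symmetric])
  next
    case False
    have "0 \<le> \<psi> r / \<psi> s" using pos by simp
    then have "\<phi> (\<psi> r) d s \<le> \<rho> d / \<rho> s" by (simp add: \<phi>_def)
    also have "\<dots> \<le> \<rho> d / \<rho> r" using rho.mono[of r s] False r pos rho_nonneg[OF d(1)] by (intro divide_left_mono) auto
    also have "\<dots> \<le> D" by (rule Dr)
    also have "\<dots> \<le> D + D\<^sup>2 * G" using G by simp
    finally show ?thesis by (simp add: D_def)
  qed
qed

lemma phi_bdd:
  assumes r: "0 < r" "ereal r < mm_diam \<mu>" and d: "0 \<le> d"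
  shows "bdd_above (\<phi> (\<psi> r) d ` {0<..})"
proof -
  have "d \<le> (d / r + 1) * r" using r by (simp add: field_simps)
  moreover have "d / r + 1 \<ge> 1" using d r by simp
  ultimately show ?thesis using phi_le[OF r d]
    by (intro bdd_aboveI2[of _ _ "K\<rho> * (d / r + 1) powr \<gamma>' + (K\<rho> * (d / r + 1) powr \<gamma>')\<^sup>2 * G"]) auto
qed

lemma phi_le_S: "0 < r \<Longrightarrow> ereal r < mm_diam \<mu> \<Longrightarrow> 0 \<le> d \<Longrightarrow> 0 < s \<Longrightarrow> \<phi> (\<psi> r) d s \<le> S (\<psi> r) d"
  unfolding S_def using phi_bdd by (intro cSUP_upper) auto

lemma S_le:
  assumes "0 < r" "ereal r < mm_diam \<mu>" "0 \<le> d" "d \<le> B * r" "B \<ge> 1"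
  shows "S (\<psi> r) d \<le> K\<rho> * B powr \<gamma>' + (K\<rho> * B powr \<gamma>')\<^sup>2 * G"
  unfolding S_def using phi_le[OF assms] by (intro cSUP_least) auto

lemma S_nonneg:
  assumes r: "0 < r" "ereal r < mm_diam \<mu>" and d: "0 \<le> d"
  shows "0 \<le> S (\<psi> r) d"
proof (rule field_le_epsilon)
  fix e :: real assume e: "0 < e"
  have p: "0 < \<psi> r" using r by (intro psi.pos)
  \<comment> \<open>At a radius this large the time term is exactly e; the distance term is
    nonnegative.\<close>
  obtain s where s: "0 \<le> s" "\<psi> s = \<psi> r / e" using psi.surj[of "\<psi> r / e"] p e by auto
  have s0: "0 < s" using s p e psi.at_0 by (cases "s = 0") auto
  have "0 \<le> \<rho> d / \<rho> s" using rho_nonneg[OF d] rho.pos[OF s0] by simp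
  then have "- e \<le> \<phi> (\<psi> r) d s" using s p e by (simp add: \<phi>_def)
  also have "\<dots> \<le> S (\<psi> r) d" by (rule phi_le_S[OF r d s0])
  finally show "0 \<le> S (\<psi> r) d + e" by simp
qed

lemma Phi_exp_eq:
  assumes r: "0 < r" "ereal r < mm_diam \<mu>" and d: "0 \<le> d"
  shows "Phi_exp \<rho> \<psi> (\<psi> r) d = ereal (S (\<psi> r) d)"
proof -
  have "ereal (S (\<psi> r) d) = (SUP s\<in>{0<..}. ereal (\<phi> (\<psi> r) d s))"
    unfolding S_def
  proof (rule ereal_SUP)
    have "(SUP s\<in>{0<..}. ereal (\<phi> (\<psi> r) d s)) \<le> ereal (S (\<psi> r) d)"
      using phi_le_S[OF r d] by (intro SUP_least) auto
    moreover have "ereal (\<phi> (\<psi> r) d 1) \<le> (SUP s\<in>{0<..}. ereal (\<phi> (\<psi> r) d s))"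
      by (intro SUP_upper) auto
    ultimately show "\<bar>SUP s\<in>{0<..}. ereal (\<phi> (\<psi> r) d s)\<bar> \<noteq> \<infinity>" by auto
  qed
  then show ?thesis by (simp add: Phi_exp_def \<phi>_def)
qed

lemma dist_le_diam: "ereal (dist (x::'a) y) \<le> mm_diam \<mu>"
  unfolding mm_diam_def by (rule SUP_upper2[of x], simp, rule SUP_upper2[of y], auto)

text \<open>Replacing \<open>s\<close> by \<open>l s\<close> multiplies the two terms of the exponent by \<open>b\<close> and \<open>G b\<^sup>2\<close>,
  where \<open>b\<close> is small for large \<open>l\<close>: this makes the constants in front of them irrelevant.\<close>
lemma rescale:
  assumes "e > 0"
  obtains l b where "l \<ge> 1" "0 < b"
    "\<And>s. 0 < s \<Longrightarrow> \<rho> s / \<rho> (l * s) \<le> e" "\<And>s. 0 < s \<Longrightarrow> b \<le> \<rho> s / \<rho> (l * s)"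
    "\<And>s t. 0 < s \<Longrightarrow> 0 \<le> t \<Longrightarrow> ereal (l * s) < mm_diam \<mu> \<Longrightarrow> t / \<psi> (l * s) \<le> G * (\<rho> s / \<rho> (l * s))\<^sup>2 * (t / \<psi> s)"
proof -
  obtain d where d: "0 < d" "d < 1" "\<And>r. 0 < r \<Longrightarrow> \<rho> (d * r) \<le> e * \<rho> r" using rho.ratio_small[OF assms] by blast
  define l where "l = 1 / d"
  have l: "1 \<le> l" "d * l = 1" using d by (auto simp: l_def)
  define b where "b = inverse (K\<rho> * l powr \<gamma>')"
  have b: "0 < b" using rho.K_pos l by (simp add: b_def)
  show thesis
  proof (rule that[OF l(1) b])
    fix s :: real assume s: "0 < s"
    have ls: "0 < l * s" "s \<le> l * s" using s l by (auto simp: mult_le_cancel_right1)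
    have pos: "0 < \<rho> s" "0 < \<rho> (l * s)" "0 < \<psi> s" "0 < \<psi> (l * s)" using s ls rho.pos psi.pos by auto
    have "d * (l * s) = s" using l by (simp only: mult.assoc[symmetric] mult_1_left)
    then have "\<rho> s \<le> e * \<rho> (l * s)" using d(3)[OF ls(1)] by (simp only:)
    then show "\<rho> s / \<rho> (l * s) \<le> e" using pos by (simp add: divide_le_eq)
    have "\<rho> (l * s) \<le> K\<rho> * (l * s / s) powr \<gamma>' * \<rho> s" using s ls by (intro rho.ratio_le) auto
    then show "b \<le> \<rho> s / \<rho> (l * s)" using pos rho.K_pos l s by (simp add: b_def field_simps)
    fix t :: real assume t: "0 \<le> t" and dm: "ereal (l * s) < mm_diam \<mu>"
    have "(\<rho> (l * s) / \<rho> s)\<^sup>2 \<le> G * (\<psi> (l * s) / \<psi> s)" by (rule gain[OF s ls(2) dm])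
    then have "\<psi> s / \<psi> (l * s) \<le> G * (\<rho> s / \<rho> (l * s))\<^sup>2" using pos by (simp add: field_simps)
    then have "\<psi> s / \<psi> (l * s) * (t / \<psi> s) \<le> G * (\<rho> s / \<rho> (l * s))\<^sup>2 * (t / \<psi> s)" using t pos by (intro mult_right_mono) auto
    then show "t / \<psi> (l * s) \<le> G * (\<rho> s / \<rho> (l * s))\<^sup>2 * (t / \<psi> s)" using pos by simp
  qed
qed

text \<open>A nearly optimal radius s for S is enlarged to l s. The distance term loses a factor Q,
  the time term a factor of order \<open>Q\<^sup>2\<close>, so a small Q makes c' outweigh a. If l s
  reaches the diameter, d is at most l s and S itself is bounded.\<close>

lemma exponent_upper:
  assumes a: "a > 0" and c: "c' > 0"
  obtains c2 A where "c2 > 0" "A \<ge> 0"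
    "\<And>r d. 0 < r \<Longrightarrow> ereal r < mm_diam \<mu> \<Longrightarrow> 0 \<le> d \<Longrightarrow> ereal d \<le> mm_diam \<mu> \<Longrightarrow>
      S (\<psi> r) d \<le> A \<or> (\<exists>s>0. ereal s < mm_diam \<mu> \<and> a * (\<psi> r / \<psi> s) - c' * (\<rho> d / \<rho> s) \<le> A - c2 * S (\<psi> r) d)"
proof -
  have "c' / (a * G) > 0" using a c G by simp
  from rescale[OF this] obtain l b where l: "l \<ge> 1" and b: "0 < b"
    and up: "\<And>s. 0 < s \<Longrightarrow> \<rho> s / \<rho> (l * s) \<le> c' / (a * G)" and low: "\<And>s. 0 < s \<Longrightarrow> b \<le> \<rho> s / \<rho> (l * s)"
    and psi': "\<And>s t. 0 < s \<Longrightarrow> 0 \<le> t \<Longrightarrow> ereal (l * s) < mm_diam \<mu> \<Longrightarrow> t / \<psi> (l * s) \<le> G * (\<rho> s / \<rho> (l * s))\<^sup>2 * (t / \<psi> s)"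
    by blast
  define c2 where "c2 = c' * b"
  \<comment> \<open>The first entry bounds S when l s is not below the diameter; c2 absorbs the loss
    of 1 in choosing s.\<close>
  define A where "A = max (K\<rho> * l powr \<gamma>' + 1) c2"
  have c2: "c2 > 0" using c b by (simp add: c2_def)
  show thesis
  proof (rule that[OF c2])
    show "0 \<le> A" using c2 by (simp add: A_def)
    fix r d :: real assume r: "0 < r" "ereal r < mm_diam \<mu>" and d: "0 \<le> d" "ereal d \<le> mm_diam \<mu>"
    have p: "0 < \<psi> r" using r by (intro psi.pos)
    show "S (\<psi> r) d \<le> A \<or> (\<exists>s>0. ereal s < mm_diam \<mu> \<and> a * (\<psi> r / \<psi> s) - c' * (\<rho> d / \<rho> s) \<le> A - c2 * S (\<psi> r) d)"
    proof (cases "S (\<psi> r) d \<le> A")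
      case False
      then have S1: "1 < S (\<psi> r) d" using rho.K_pos l by (smt (verit) A_def max.cobounded1 powr_ge_zero mult_nonneg_nonneg)
      have "S (\<psi> r) d - 1 < (SUP s\<in>{0<..}. \<phi> (\<psi> r) d s)" by (simp add: S_def)
      then obtain s where s: "0 < s" "S (\<psi> r) d - 1 < \<phi> (\<psi> r) d s"
        using phi_bdd[OF r d(1)] by (subst (asm) less_cSUP_iff) auto
      have ph: "0 < \<phi> (\<psi> r) d s" using s S1 by simp
      have ls: "0 < l * s" using s l by simp
      have ld: "ereal (l * s) < mm_diam \<mu>"
      proof (rule ccontr)
        assume "\<not> ereal (l * s) < mm_diam \<mu>"
        then have "ereal d \<le> ereal (l * s)" using d(2) by (meson not_less order_trans)
        then have "\<rho> d / \<rho> s \<le> K\<rho> * l powr \<gamma>'" using rho_ratio_bound[OF d(1) _ s(1) l] by simp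
        moreover have "\<phi> (\<psi> r) d s \<le> \<rho> d / \<rho> s" using p psi.pos[OF s(1)] by (simp add: \<phi>_def)
        ultimately have "S (\<psi> r) d \<le> A" using s(2) by (simp add: A_def)
        with False show False by simp
      qed
      define Q where "Q = \<rho> s / \<rho> (l * s)"
      have Q: "b \<le> Q" "0 < Q" "Q \<le> c' / (a * G)" using low[OF s(1)] up[OF s(1)] b by (auto simp: Q_def)
      have t0: "0 \<le> \<psi> r / \<psi> s" using p psi.pos[OF s(1)] by simp
      have "a * (\<psi> r / \<psi> (l * s)) \<le> a * (G * Q\<^sup>2 * (\<psi> r / \<psi> s))"
        using psi'[OF s(1) _ ld, of "\<psi> r"] p a by (intro mult_left_mono) (auto simp: Q_def)
      also have "\<dots> = (a * G * Q) * (Q * (\<psi> r / \<psi> s))" by (simp add: power2_eq_square)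
      also have "\<dots> \<le> c' * (Q * (\<psi> r / \<psi> s))"
        using Q a G mult_nonneg_nonneg[of Q, OF _ t0] by (intro mult_right_mono) (auto simp: field_simps)
      finally have 1: "a * (\<psi> r / \<psi> (l * s)) \<le> c' * Q * (\<psi> r / \<psi> s)" by (simp only: mult.assoc)
      have 2: "\<rho> d / \<rho> (l * s) = Q * (\<rho> d / \<rho> s)" using rho.pos[OF s(1)] by (simp add: Q_def)
      have "a * (\<psi> r / \<psi> (l * s)) - c' * (\<rho> d / \<rho> (l * s)) \<le> - (c' * Q) * \<phi> (\<psi> r) d s"
        using 1 unfolding 2 \<phi>_def by (simp add: algebra_simps)
      also have "\<dots> \<le> - c2 * \<phi> (\<psi> r) d s"
        using Q c ph by (intro mult_right_mono) (auto simp: c2_def)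
      also have "\<dots> \<le> A - c2 * S (\<psi> r) d"
      proof -
        have "c2 * (S (\<psi> r) d - 1) \<le> c2 * \<phi> (\<psi> r) d s" using s(2) c2 by (intro mult_left_mono) auto
        then show ?thesis by (simp add: A_def algebra_simps)
      qed
      finally show ?thesis using ls ld by blast
    qed simp
  qed
qed

text \<open>e is the first dyadic fraction of d for which about \<open>\<rho> d / \<rho> e\<close>
  steps, each lasting a multiple of \<open>\<psi> e\<close>, fit into the time
  \<open>\<psi> r\<close>. At 2 e they do not fit, which makes the time term there at most a
  multiple of the distance term; after rescaling the exponent is at least a multiple of
  \<open>\<rho> d / \<rho> e\<close>. The variable d' allows for moving both endpoints
  slightly.\<close>

lemma exponent_lower:
  assumes A: "A > 0"
  obtains B where "B > 0"
    "\<And>r d. 0 < r \<Longrightarrow> ereal r < mm_diam \<mu> \<Longrightarrow> 0 < d \<Longrightarrow> ereal d \<le> mm_diam \<mu> \<Longrightarrow>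
      \<exists>e>0. e \<le> d \<and> A * (\<psi> e * (\<rho> d / \<rho> e)) \<le> \<psi> r \<and>
        (\<forall>d'\<ge>0. \<rho> d / 2 \<le> \<rho> d' \<longrightarrow> \<rho> d / \<rho> e \<le> B * (1 + S (\<psi> r) d'))"
proof -
  \<comment> \<open>This bound on Q brings the time term down to Q X / 4, while a distance term of
    at least Q X / 2 survives the passage from d to d'.\<close>
  have "1 / (4 * G * A) > 0" using A G by simp
  from rescale[OF this] obtain l b where l: "l \<ge> 1" and b: "0 < b"
    and up: "\<And>s. 0 < s \<Longrightarrow> \<rho> s / \<rho> (l * s) \<le> 1 / (4 * G * A)" and low: "\<And>s. 0 < s \<Longrightarrow> b \<le> \<rho> s / \<rho> (l * s)"
    and psi': "\<And>s t. 0 < s \<Longrightarrow> 0 \<le> t \<Longrightarrow> ereal (l * s) < mm_diam \<mu> \<Longrightarrow> t / \<psi> (l * s) \<le> G * (\<rho> s / \<rho> (l * s))\<^sup>2 * (t / \<psi> s)"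
    by blast
  define D where "D = K\<rho> * 2 powr \<gamma>'"
  have D: "D > 0" using rho.K_pos by (simp add: D_def)
  define B where "B = 1 + D * (K\<rho> * l powr \<gamma>') + D * (4 / b)"
  have Bp: "0 \<le> D * (K\<rho> * l powr \<gamma>')" "0 \<le> D * (4 / b)" using D rho.K_pos b by auto
  then have B: "B > 0" by (simp add: B_def)
  show thesis
  proof (rule that[OF B])
    fix r d :: real assume r: "0 < r" "ereal r < mm_diam \<mu>" and d: "0 < d" "ereal d \<le> mm_diam \<mu>"
    have p: "0 < \<psi> r" using r by (intro psi.pos)
    define E where "E n = d / 2 ^ n" for n :: nat
    have E: "0 < E n" "E n \<le> d" for n using d by (auto simp: E_def divide_le_eq mult_le_cancel_left1)
    \<comment> \<open>Half of d is strictly below the diameter even if d attains it, as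
      \<open>gain\<close> requires.\<close>
    define R0 where "R0 = d / 2"
    have R0: "0 < R0" using d by (simp add: R0_def)
    have R0d: "ereal R0 < mm_diam \<mu>"
    proof -
      have "ereal R0 < ereal d" using d by (simp add: R0_def)
      also note d(2)
      finally show ?thesis .
    qed
    \<comment> \<open>By \<open>gain\<close> the condition on e \<le> R0 follows from
      \<open>Z * \<rho> e \<le> \<psi> r\<close>, so small dyadic fractions satisfy it and the
      search ends.\<close>
    define Z where "Z = A * \<rho> d * G * \<psi> R0 / (\<rho> R0)\<^sup>2"
    have pos: "0 < \<rho> d" "0 < \<rho> R0" "0 < \<psi> R0" using d R0 rho.pos psi.pos by auto
    have Z: "0 < Z" unfolding Z_def using A pos G by simp
    obtain u where u: "0 < u" "\<rho> u < \<psi> r / Z" using rho.small[of "\<psi> r / Z"] p Z by auto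
    obtain n0 :: nat where n0: "d / min u R0 < 2 ^ n0" using real_arch_pow[of 2] by auto
    have "0 < min u R0" using u R0 by simp
    then have "d < 2 ^ n0 * min u R0" using n0 by (simp only: divide_less_eq if_True)
    then have "E n0 < min u R0" unfolding E_def
      by (subst pos_divide_less_eq) (simp_all only: mult.commute zero_less_power zero_less_numeral)
    then have En0: "E n0 \<le> u" "E n0 \<le> R0" by auto
    have "A * (\<psi> (E n0) * (\<rho> d / \<rho> (E n0))) \<le> \<psi> r"
    proof -
      have e: "0 < \<rho> (E n0)" "0 < \<psi> (E n0)" using E rho.pos psi.pos by auto
      have "(\<rho> R0 / \<rho> (E n0))\<^sup>2 \<le> G * (\<psi> R0 / \<psi> (E n0))" by (rule gain[OF E(1) En0(2) R0d])
      then have "\<psi> (E n0) \<le> G * \<psi> R0 * (\<rho> (E n0))\<^sup>2 / (\<rho> R0)\<^sup>2" using e pos by (simp add: power_divide field_simps)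
      then have "A * (\<psi> (E n0) * (\<rho> d / \<rho> (E n0))) \<le> A * ((G * \<psi> R0 * (\<rho> (E n0))\<^sup>2 / (\<rho> R0)\<^sup>2) * (\<rho> d / \<rho> (E n0)))"
        using A e pos by (intro mult_left_mono mult_right_mono) auto
      also have "\<dots> = Z * \<rho> (E n0)" using e by (simp add: Z_def power2_eq_square)
      also have "\<dots> \<le> Z * \<rho> u" using rho.mono[of "E n0" u] E(1)[of n0] En0 Z by (intro mult_left_mono) auto
      also have "\<dots> \<le> \<psi> r" using u Z by (simp add: field_simps)
      finally show ?thesis .
    qed
    then have ex: "\<exists>n. A * (\<psi> (E n) * (\<rho> d / \<rho> (E n))) \<le> \<psi> r" by blast
    define n where "n = (LEAST n. A * (\<psi> (E n) * (\<rho> d / \<rho> (E n))) \<le> \<psi> r)"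
    have n: "A * (\<psi> (E n) * (\<rho> d / \<rho> (E n))) \<le> \<psi> r" unfolding n_def by (rule LeastI_ex[OF ex])
    have main: "\<rho> d / \<rho> (E n) \<le> B * (1 + S (\<psi> r) d')" if d': "0 \<le> d'" "\<rho> d / 2 \<le> \<rho> d'" for d'
    proof -
      have S0: "0 \<le> S (\<psi> r) d'" by (rule S_nonneg[OF r d'(1)])
      show ?thesis
      proof (cases n)
        case 0
        then have "\<rho> d / \<rho> (E n) = 1" using pos by (simp add: E_def)
        also have "\<dots> \<le> B * (1 + S (\<psi> r) d')"
        proof -
          have "1 * 1 \<le> B * (1 + S (\<psi> r) d')" using Bp S0 by (intro mult_mono) (auto simp: B_def)
          then show ?thesis by simp
        qed
        finally show ?thesis .
      next
        case (Suc m)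
        define s where "s = E m"
        have s: "0 < s" "s = 2 * E n" using E Suc by (auto simp: s_def E_def)
        have "m < n" using Suc by simp
        \<comment> \<open>The preceding dyadic radius violates the condition, by minimality of
          n.\<close>
        from not_less_Least[OF this[unfolded n_def]] have big: "\<psi> r < A * (\<psi> s * (\<rho> d / \<rho> s))" by (simp add: s_def)
        have ps: "0 < \<rho> s" "0 < \<psi> s" using s(1) rho.pos psi.pos by auto
        have "\<rho> s / \<rho> (E n) \<le> K\<rho> * 2 powr \<gamma>'" using s E(1)[of n] by (intro rho_ratio_bound) auto
        then have En: "\<rho> d / \<rho> (E n) \<le> D * (\<rho> d / \<rho> s)"
        proof -
          assume a: "\<rho> s / \<rho> (E n) \<le> K\<rho> * 2 powr \<gamma>'"
          have "\<rho> d / \<rho> (E n) = (\<rho> s / \<rho> (E n)) * (\<rho> d / \<rho> s)" using ps by simp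
          also have "\<dots> \<le> D * (\<rho> d / \<rho> s)" using a ps pos by (intro mult_right_mono) (auto simp: D_def)
          finally show ?thesis .
        qed
        show ?thesis
        proof (cases "ereal (l * s) < mm_diam \<mu>")
          case False
          then have "ereal d \<le> ereal (l * s)" using d(2) by (meson not_less order_trans)
          then have "\<rho> d / \<rho> s \<le> K\<rho> * l powr \<gamma>'" using d s l by (intro rho_ratio_bound) auto
          then have "D * (\<rho> d / \<rho> s) \<le> D * (K\<rho> * l powr \<gamma>')" using D by (intro mult_left_mono) auto
          also have "\<dots> \<le> B" using Bp by (simp add: B_def)
          also have "\<dots> \<le> B * (1 + S (\<psi> r) d')" using B S0 by (simp add: mult_le_cancel_left1)
          finally show ?thesis using En by linarith
        next
          case True
          define Q where "Q = \<rho> s / \<rho> (l * s)"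
          have Q: "b \<le> Q" "0 < Q" "Q \<le> 1 / (4 * G * A)" using low[OF s(1)] up[OF s(1)] b by (auto simp: Q_def)
          have ls: "0 < l * s" using l s by simp
          define X where "X = \<rho> d / \<rho> s"
          have X: "0 < X" using pos ps by (simp add: X_def)
          have "\<psi> r / \<psi> s \<le> A * X" using big ps by (simp add: X_def field_simps)
          then have "\<psi> r / \<psi> (l * s) \<le> G * Q\<^sup>2 * (A * X)"
            using psi'[OF s(1) _ True, of "\<psi> r"] p G Q by (smt (verit) Q_def mult_left_mono mult_nonneg_nonneg zero_le_power2)
          also have "\<dots> = (G * A * Q) * (Q * X)" by (simp add: power2_eq_square)
          also have "\<dots> \<le> (1/4) * (Q * X)" using Q X G A by (intro mult_right_mono) (auto simp: field_simps)
          finally have 1: "\<psi> r / \<psi> (l * s) \<le> Q * X / 4" by simp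
          have "\<rho> d' / \<rho> (l * s) \<ge> (\<rho> d / 2) / \<rho> (l * s)" using d' rho.pos[OF ls] by (intro divide_right_mono) auto
          moreover have "(\<rho> d / 2) / \<rho> (l * s) = Q * X / 2" using ps by (simp add: Q_def X_def)
          ultimately have "Q * X / 4 \<le> \<phi> (\<psi> r) d' (l * s)" using 1 unfolding \<phi>_def by linarith
          also have "\<dots> \<le> S (\<psi> r) d'" by (rule phi_le_S[OF r d'(1) ls])
          finally have "Q * X \<le> 4 * S (\<psi> r) d'" by simp
          moreover have "b * X \<le> Q * X" using Q X by (intro mult_right_mono) auto
          ultimately have "X \<le> (4 / b) * S (\<psi> r) d'" using b by (simp add: field_simps)
          then have "D * X \<le> D * (4 / b) * S (\<psi> r) d'" using D unfolding mult.assoc by (intro mult_left_mono) auto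
          also have "\<dots> \<le> B * S (\<psi> r) d'" using Bp S0 by (intro mult_right_mono) (auto simp: B_def)
          also have "\<dots> \<le> B * (1 + S (\<psi> r) d')" using B by simp
          finally show ?thesis using En by (simp add: X_def)
        qed
      qed
    qed
    show "\<exists>e>0. e \<le> d \<and> A * (\<psi> e * (\<rho> d / \<rho> e)) \<le> \<psi> r \<and>
        (\<forall>d'\<ge>0. \<rho> d / 2 \<le> \<rho> d' \<longrightarrow> \<rho> d / \<rho> e \<le> B * (1 + S (\<psi> r) d'))"
      using E[of n] n main by (intro exI[of _ "E n"]) auto
  qed
qed

section \<open>Off-diagonal bounds for the semigroup\<close>

text \<open>\<open>harnack_average\<close> leaves the mean of the later \<open>P f\<close> over a
  ball about z; symmetry moves P onto the indicator of that ball, which is bounded by b where f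
  lives.\<close>

lemma semigroup_upper_raw:
  assumes r: "0 < r" "ereal r < mm_diam \<mu>" and f: "f \<in> L2 \<mu>" "\<And>y. 0 \<le> f y" "\<And>y. y \<notin> ball w (c * r) \<Longrightarrow> f y = 0"
    and b: "AE y in \<mu>. y \<in> ball w (c * r) \<longrightarrow> P ((1 + C4 - C2) * \<psi> r) (indicat_real (ball z (c * r))) y \<le> b"
  shows "AE y in \<mu>. y \<in> ball z (c * r) \<longrightarrow> P (\<psi> r) f y \<le> C * b / V \<mu> z (c * r) * (\<integral>y. f y \<partial>\<mu>)"
proof -
  have p: "0 < \<psi> r" using r by (intro psi.pos)
  let ?t = "(1 + C4 - C2) * \<psi> r" and ?I = "indicat_real (ball z (c * r))"
  have t_eq: "\<psi> r + (C4 - C2) * \<psi> r = ?t" by (simp add: algebra_simps)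
  have t: "0 < ?t" using C4_le_1 params p by simp
  have IL: "?I \<in> L2 \<mu>" by (intro indicator_L2) auto
  have cr: "0 < c * r" using r params by simp
  have fint: "integrable \<mu> f" by (rule L2_bounded_support_integrable[OF f(1), of "ball w (c * r)"]) (use f(3) in auto)
  have "ip (P ?t f) ?I = ip f (P ?t ?I)" by (rule P_symmetric[OF f(1) IL t])
  also have "\<dots> \<le> (\<integral>y. b * f y \<partial>\<mu>)"
    unfolding l2inner_def
  proof (rule integral_mono_AE)
    show "integrable \<mu> (\<lambda>y. b * f y)" using fint by simp
    show "integrable \<mu> (\<lambda>y. f y * P ?t ?I y)" using f IL t by (intro L2_integrable_mult P_L2) auto
    show "AE y in \<mu>. f y * P ?t ?I y \<le> b * f y"
      using b
    proof eventually_elim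
      case (elim y)
      show ?case
      proof (cases "y \<in> ball w (c * r)")
        case True
        then show ?thesis using elim f(2)[of y] by (simp add: mult.commute[of b] mult_left_mono)
      qed (use f(3) in simp)
    qed
  qed
  finally have "ip (P ?t f) ?I \<le> b * (\<integral>y. f y \<partial>\<mu>)" by simp
  then have "C / V \<mu> z (c * r) * ip (P ?t f) ?I \<le> C * b / V \<mu> z (c * r) * (\<integral>y. f y \<partial>\<mu>)"
    using mult_left_mono[of "ip (P ?t f) ?I" "b * (\<integral>y. f y \<partial>\<mu>)" "C / V \<mu> z (c * r)"] params V_pos[OF cr, of z] by simp
  moreover have "C2 * \<psi> r \<le> \<psi> r" using C4_le_1 params p by simp
  note harnack_average[OF r f(1,2) this, of z, unfolded t_eq]
  ultimately show ?thesis by (auto elim!: eventually_mono)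
qed

lemma semigroup_upper:
  obtains Cu cu where "Cu > 0" "cu > 0"
    "\<And>r z w f. 0 < r \<Longrightarrow> ereal r < mm_diam \<mu> \<Longrightarrow> f \<in> L2 \<mu> \<Longrightarrow> (\<And>y. 0 \<le> f y) \<Longrightarrow> (\<And>y. y \<notin> ball w (c * r) \<Longrightarrow> f y = 0) \<Longrightarrow>
      AE y in \<mu>. y \<in> ball z (c * r) \<longrightarrow>
        P (\<psi> r) f y \<le> Cu / V \<mu> z (c * r) * exp (- cu * S (\<psi> r) (max 0 (dist z w - 2 * (c * r)))) * (\<integral>y. f y \<partial>\<mu>)"
proof -
  \<comment> \<open>The factor 2 comes from the time \<open>?t \<le> 2 * \<psi> r\<close>, the added
    1 makes the coefficient positive, and lam1 / \<kappa> is the decay rate when the step count is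
    about \<open>\<rho> d / (\<kappa> * \<rho> s)\<close>.\<close>
  obtain c2 A where c2: "c2 > 0" and A: "A \<ge> 0" and ex:
    "\<And>r d. 0 < r \<Longrightarrow> ereal r < mm_diam \<mu> \<Longrightarrow> 0 \<le> d \<Longrightarrow> ereal d \<le> mm_diam \<mu> \<Longrightarrow>
      S (\<psi> r) d \<le> A \<or> (\<exists>s>0. ereal s < mm_diam \<mu> \<and> (2 * kap1 + 1) * (\<psi> r / \<psi> s) - (lam1 / \<kappa>) * (\<rho> d / \<rho> s) \<le> A - c2 * S (\<psi> r) d)"
    using exponent_upper[of "2 * kap1 + 1" "lam1 / \<kappa>"] kappa1 lambda1 kappa by auto
  define Cu where "Cu = C * exp (kap1 + lam1 + A + c2 * A)"
  have Cu: "Cu > 0" using params by (simp add: Cu_def)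
  show thesis
  proof (rule that[OF Cu c2])
    fix r z w f assume r: "0 < r" "ereal r < mm_diam \<mu>" and f: "f \<in> L2 \<mu>" "\<And>y. 0 \<le> f y" "\<And>y. y \<notin> ball w (c * r) \<Longrightarrow> f y = 0"
    have p: "0 < \<psi> r" using r by (intro psi.pos)
    \<comment> \<open>A lower bound for the distance between points of the two balls.\<close>
    define d where "d = max 0 (dist z w - 2 * (c * r))"
    have cr: "0 < c * r" using r params by simp
    have "ereal d \<le> ereal (dist z w)" using cr by (simp add: d_def)
    also have "\<dots> \<le> mm_diam \<mu>" by (rule dist_le_diam)
    finally have dd: "0 \<le> d" "ereal d \<le> mm_diam \<mu>" by (auto simp: d_def)
    let ?I = "indicat_real (ball z (c * r))" and ?t = "(1 + C4 - C2) * \<psi> r"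
    have t: "0 < ?t" "?t \<le> 2 * \<psi> r" using params p C4_le_1 by (auto intro: mult_right_mono)
    have bI: "bounded (ball z (c * r))" "ball z (c * r) \<in> sets borel" by auto
    define b where "b = exp (kap1 + lam1 + A + c2 * A - c2 * S (\<psi> r) d)"
    have "AE y in \<mu>. y \<in> ball w (c * r) \<longrightarrow> P ?t ?I y \<le> b"
      using ex[OF r dd]
    proof
      assume "S (\<psi> r) d \<le> A"
      then have "c2 * S (\<psi> r) d \<le> c2 * A" using c2 by (intro mult_left_mono) auto
      then have one: "1 \<le> b" using kappa1 lambda1 A by (simp add: b_def)
      from P_indicator_bounds[OF bI t(1)] show ?thesis by eventually_elim (use one in auto)
    next
      assume "\<exists>s>0. ereal s < mm_diam \<mu> \<and> (2 * kap1 + 1) * (\<psi> r / \<psi> s) - (lam1 / \<kappa>) * (\<rho> d / \<rho> s) \<le> A - c2 * S (\<psi> r) d"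
      then obtain s where s: "0 < s" "ereal s < mm_diam \<mu>"
        "(2 * kap1 + 1) * (\<psi> r / \<psi> s) - (lam1 / \<kappa>) * (\<rho> d / \<rho> s) \<le> A - c2 * S (\<psi> r) d" by blast
      have ps: "0 < \<psi> s" "0 < \<rho> s" using s psi.pos rho.pos by auto
      \<comment> \<open>By \<open>nbh_lower\<close>, so few steps of size s cannot cover the
        distance d. For j = 0 the trivial bound 1 is enough.\<close>
      define j where "j = nat \<lfloor>\<rho> d / (\<kappa> * \<rho> s)\<rfloor>"
      have j0: "0 \<le> \<rho> d / (\<kappa> * \<rho> s)" using rho_nonneg[OF dd(1)] ps kappa by simp
      have j: "real j \<le> \<rho> d / (\<kappa> * \<rho> s)" "\<rho> d / (\<kappa> * \<rho> s) - 1 \<le> real j"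
      proof -
        have "real j = of_int \<lfloor>\<rho> d / (\<kappa> * \<rho> s)\<rfloor>" using j0 by (simp add: j_def)
        then show "real j \<le> \<rho> d / (\<kappa> * \<rho> s)" "\<rho> d / (\<kappa> * \<rho> s) - 1 \<le> real j" by linarith+
      qed
      have ble: "exp (kap1 * (1 + ?t / \<psi> s) - lam1 * real j) \<le> b"
      proof -
        have "?t / \<psi> s \<le> 2 * (\<psi> r / \<psi> s)" using t ps by (simp add: divide_right_mono)
        then have "kap1 * (?t / \<psi> s) \<le> kap1 * (2 * (\<psi> r / \<psi> s))" using kappa1 by (rule mult_left_mono)
        also have "\<dots> \<le> (2 * kap1 + 1) * (\<psi> r / \<psi> s)" using p ps by (simp add: algebra_simps)
        finally have 1: "kap1 * (?t / \<psi> s) \<le> (2 * kap1 + 1) * (\<psi> r / \<psi> s)" .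
        have "lam1 * (\<rho> d / (\<kappa> * \<rho> s) - 1) \<le> lam1 * real j" using lambda1 j by (intro mult_left_mono) auto
        then have "(lam1 / \<kappa>) * (\<rho> d / \<rho> s) - lam1 \<le> lam1 * real j" by (simp add: algebra_simps)
        moreover have "0 \<le> c2 * A" using c2 A by simp
        ultimately have "kap1 * (1 + ?t / \<psi> s) - lam1 * real j \<le> kap1 + lam1 + A + c2 * A - c2 * S (\<psi> r) d"
          using 1 s(3) unfolding distrib_left mult_1_right by linarith
        then show ?thesis by (simp add: b_def)
      qed
      show ?thesis
      proof (cases "j = 0")
        case True
        have "0 \<le> kap1 * (1 + ?t / \<psi> s)" using divide_nonneg_nonneg[OF less_imp_le[OF t(1)] less_imp_le[OF ps(1)]]
          
          by (rule mult_nonneg_nonneg[OF kappa1 add_nonneg_nonneg[OF zero_le_one]])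
        then have "1 \<le> exp (kap1 * (1 + ?t / \<psi> s) - lam1 * real j)" using True by (simp only: one_le_exp_iff of_nat_0 mult_zero_right diff_zero)
        then have one: "1 \<le> b" using ble by (rule order_trans)
        from P_indicator_bounds[OF bI t(1)] show ?thesis by eventually_elim (use one in auto)
      next
        case False
        have sep: "y \<notin> nbh s (ball z (c * r)) j" if y: "y \<in> ball w (c * r)" for y
        proof
          assume "y \<in> nbh s (ball z (c * r)) j"
          then obtain a where a: "a \<in> ball z (c * r)" "y \<in> nbh s {a} j" using nbh_Union[of s "ball z (c * r)" j] by blast
          have "\<rho> (dist a y) \<le> \<kappa> * real j * \<rho> s" using a(2) False s(1) by (intro nbh_lower) auto
          also have "\<dots> \<le> \<rho> d" using j(1) kappa ps by (simp add: field_simps)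
          finally have "\<rho> (dist a y) \<le> \<rho> d" .
          then have "dist a y \<le> d" using rho.le_iff[of "dist a y" d] dd by simp
          moreover have "0 < d"
          proof (rule ccontr)
            assume "\<not> 0 < d"
            then have "d = 0" using dd by simp
            then have "real j \<le> 0" using j(1) rho.at_0 by simp
            with False show False by simp
          qed
          moreover have "dist z w \<le> dist z a + dist a y + dist y w"
            using dist_triangle[of z w a] dist_triangle[of a w y] by simp
          ultimately show False using a(1) y by (simp add: d_def dist_commute split: if_splits)
        qed
        from tail[OF bI s(1,2) t(1), of j] show ?thesis
        proof eventually_elim
          case (elim y)
          then show ?case using sep ble by (auto intro: order_trans)
        qed
      qed
    qed
    from semigroup_upper_raw[OF r f this]
    have "AE y in \<mu>. y \<in> ball z (c * r) \<longrightarrow> P (\<psi> r) f y \<le> C * b / V \<mu> z (c * r) * (\<integral>y. f y \<partial>\<mu>)" .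
    moreover have "C * b = Cu * exp (- c2 * S (\<psi> r) d)" by (simp add: b_def Cu_def exp_add[symmetric])
    then have "C * b / V \<mu> z (c * r) = Cu / V \<mu> z (c * r) * exp (- c2 * S (\<psi> r) d)" by simp
    ultimately show "AE y in \<mu>. y \<in> ball z (c * r) \<longrightarrow>
        P (\<psi> r) f y \<le> Cu / V \<mu> z (c * r) * exp (- c2 * S (\<psi> r) (max 0 (dist z w - 2 * (c * r)))) * (\<integral>y. f y \<partial>\<mu>)"
      by (simp only: d_def)
  qed
qed

text \<open>At each vertex the flow is restarted from a constant on a ball of radius q s / 2, and
  \<open>ndl\<close> spreads it over radius q s; since 2 e \<le> q s, this contains the half-size
  ball about the next vertex. The constant \<open>el\<close> is k divided by two doubling costs:
  shrinking the ball and moving its centre.\<close>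

lemma chain_lower:
  assumes s: "0 < s" "ereal s < mm_diam \<mu>" and e: "0 < e" "2 * e \<le> q * s"
    and f: "f \<in> L2 \<mu>" "\<And>y. 0 \<le> f y" "\<And>y. y \<notin> ball x (q * s / 2) \<Longrightarrow> f y = 0"
    and z: "z \<in> nbh e {x} (Suc j)"
  defines "el \<equiv> k / ((Cv * (2 / q) powr \<alpha>) * (Cv * 2 powr \<alpha>))"
  shows "AE y in \<mu>. y \<in> ball z (q * s / 2) \<longrightarrow> el ^ Suc j / V \<mu> z s * (\<integral>y. f y \<partial>\<mu>) \<le> P (real (Suc j) * \<psi> s) f y"
  using z
proof (induction j arbitrary: z)
  case 0
  have p: "0 < \<psi> s" using s by (intro psi.pos)
  have qs: "0 < q * s" using q s by simp
  have xz: "dist x z < e" using 0 by simp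
  have I0: "0 \<le> (\<integral>y. f y \<partial>\<mu>)" using f by (intro Bochner_Integration.integral_nonneg) auto
  have "AE y in \<mu>. y \<in> ball x (q * s) \<longrightarrow> k / V \<mu> x s * (\<integral>y. f y \<partial>\<mu>) \<le> P (\<psi> s) f y"
    by (rule ndl[OF s f(1,2)]) (use f(3) qs in auto)
  moreover have "ball z (q * s / 2) \<subseteq> ball x (q * s)"
  proof
    fix y assume "y \<in> ball z (q * s / 2)"
    then show "y \<in> ball x (q * s)" using dist_triangle[of x y z] xz e by simp
  qed
  moreover have "el ^ Suc 0 / V \<mu> z s * (\<integral>y. f y \<partial>\<mu>) \<le> k / V \<mu> x s * (\<integral>y. f y \<partial>\<mu>)"
  proof (rule mult_right_mono[OF _ I0])
    have q1: "1 \<le> (2 / q) powr \<alpha>" using q alpha by (intro ge_one_powr_ge_zero) auto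
    have c1: "1 \<le> Cv * (2 / q) powr \<alpha>" using mult_mono[of 1 Cv 1 "(2/q) powr \<alpha>"] Cv q1 by simp
    have "dist x z \<le> s" using xz e mult_right_mono[of q 1 s] q s by linarith
    then have "V \<mu> x s \<le> Cv * ((s + dist x z) / s) powr \<alpha> * V \<mu> z s" using s by (intro doubling_shift) auto
    also have "\<dots> \<le> Cv * 2 powr \<alpha> * V \<mu> z s"
      using \<open>dist x z \<le> s\<close> s Cv alpha V_pos[OF s(1), of z]
      by (intro mult_right_mono mult_left_mono powr_mono2) (auto simp: field_simps)
    finally have vx: "V \<mu> x s \<le> Cv * 2 powr \<alpha> * V \<mu> z s" .
    have "el \<le> k / (Cv * 2 powr \<alpha>)"
      unfolding el_def using c1 Cv k mult_right_mono[OF c1, of "Cv * 2 powr \<alpha>"] by (intro divide_left_mono) auto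
    then have "el * V \<mu> x s \<le> (k / (Cv * 2 powr \<alpha>)) * (Cv * 2 powr \<alpha> * V \<mu> z s)"
      using vx k Cv V_pos[OF s(1), of x] by (intro mult_mono) auto
    also have "\<dots> = k * V \<mu> z s" using Cv by simp
    finally show "el ^ Suc 0 / V \<mu> z s \<le> k / V \<mu> x s" using V_pos[OF s(1), of x] V_pos[OF s(1), of z] by (simp add: field_simps)
  qed
  ultimately show ?case by (auto elim!: eventually_mono)
next
  case (Suc j)
  have p: "0 < \<psi> s" using s by (intro psi.pos)
  have qs: "0 < q * s" using q s by simp
  have I0: "0 \<le> (\<integral>y. f y \<partial>\<mu>)" using f by (intro Bochner_Integration.integral_nonneg) auto
  obtain a where a: "a \<in> nbh e {x} (Suc j)" "dist a z < e"
    using Suc.prems unfolding nbh.simps(2)[of e "{x}" "Suc j"] by (auto simp del: nbh.simps)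
  let ?t = "real (Suc j) * \<psi> s"
  have t: "0 < ?t" using p by simp
  let ?B = "ball a (q * s / 2)"
  define L where "L = el ^ Suc j / V \<mu> a s * (\<integral>y. f y \<partial>\<mu>)"
  have el0: "0 < el" unfolding el_def using k Cv q by simp
  have L0: "0 \<le> L" unfolding L_def using el0 I0 V_pos[OF s(1), of a] by simp
  have IH: "AE y in \<mu>. y \<in> ?B \<longrightarrow> L \<le> P ?t f y" using Suc.IH[OF a(1)] by (simp add: L_def)
  let ?g = "\<lambda>y. L * indicat_real ?B y"
  have BL: "indicat_real ?B \<in> L2 \<mu>" by (intro indicator_L2) auto
  have gL: "?g \<in> L2 \<mu>" by (intro L2_scale BL)
  have PL: "P ?t f \<in> L2 \<mu>" using f t by (intro P_L2) auto
  have Pf0: "AE y in \<mu>. 0 \<le> P ?t f y" using f by (intro P_nonneg t) auto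
  have mono: "AE y in \<mu>. P (\<psi> s) ?g y \<le> P (\<psi> s) (P ?t f) y"
    by (rule P_mono[OF gL PL _ p]) (use IH Pf0 in eventually_elim, auto simp: indicator_def)
  have semi: "AE y in \<mu>. P (\<psi> s) (P ?t f) y = P (\<psi> s + ?t) f y" by (rule P_semigroup[OF f(1) p t])
  have "AE y in \<mu>. y \<in> ball a (q * s) \<longrightarrow> k / V \<mu> a s * (\<integral>y. ?g y \<partial>\<mu>) \<le> P (\<psi> s) ?g y"
    by (rule ndl[OF s gL]) (use L0 qs in \<open>auto simp: indicator_def\<close>)
  moreover have "(\<integral>y. ?g y \<partial>\<mu>) = L * V \<mu> a (q * s / 2)" by (simp add: V_def)
  ultimately have g: "AE y in \<mu>. y \<in> ball a (q * s) \<longrightarrow> k / V \<mu> a s * (L * V \<mu> a (q * s / 2)) \<le> P (\<psi> s) ?g y"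
    by (simp only:)
  from mono semi g have 1: "AE y in \<mu>. y \<in> ball a (q * s) \<longrightarrow> k / V \<mu> a s * (L * V \<mu> a (q * s / 2)) \<le> P (\<psi> s + ?t) f y"
  proof eventually_elim
    case (elim y)
    show ?case using elim(3) order_trans[OF _ elim(1)[unfolded elim(2)]] by blast
  qed
  have sub: "ball z (q * s / 2) \<subseteq> ball a (q * s)"
  proof
    fix y assume "y \<in> ball z (q * s / 2)"
    then show "y \<in> ball a (q * s)" using dist_triangle[of a y z] a(2) e by simp
  qed
  have 2: "el ^ Suc (Suc j) / V \<mu> z s * (\<integral>y. f y \<partial>\<mu>) \<le> k / V \<mu> a s * (L * V \<mu> a (q * s / 2))"
  proof -
    define D where "D = Cv * (2 / q) powr \<alpha>"
    define H where "H = Cv * 2 powr \<alpha>"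
    have DH: "0 < D" "0 < H" using Cv q by (auto simp: D_def H_def)
    have el: "el = k / (D * H)" by (simp add: el_def D_def H_def)
    have Va: "0 < V \<mu> a s" "0 < V \<mu> z s" using s by (auto intro: V_pos)
    have "dist a z \<le> s" using a e mult_right_mono[of q 1 s] q s by linarith
    then have "V \<mu> a s \<le> Cv * ((s + dist a z) / s) powr \<alpha> * V \<mu> z s" using s by (intro doubling_shift) auto
    also have "\<dots> \<le> H * V \<mu> z s"
      unfolding H_def using \<open>dist a z \<le> s\<close> s Cv alpha Va
      by (intro mult_right_mono mult_left_mono powr_mono2) (auto simp: field_simps)
    finally have v1: "V \<mu> a s \<le> H * V \<mu> z s" .
    have "V \<mu> a s \<le> Cv * (s / (q * s / 2)) powr \<alpha> * V \<mu> a (q * s / 2)"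
      using q s mult_right_mono[of q 1 s] by (intro doubling) auto
    then have v2: "V \<mu> a s \<le> D * V \<mu> a (q * s / 2)" using s by (simp add: D_def)
    have "el / V \<mu> z s \<le> k / (D * V \<mu> a s)" unfolding el using v1 DH Va k by (simp add: field_simps)
    then have "(el / V \<mu> z s) * (el ^ Suc j * (\<integral>y. f y \<partial>\<mu>)) \<le> (k / (D * V \<mu> a s)) * (el ^ Suc j * (\<integral>y. f y \<partial>\<mu>))"
      using el0 I0 by (intro mult_right_mono) auto
    also have "\<dots> = (k / V \<mu> a s) * (L * (V \<mu> a s / D))" using Va DH by (simp add: L_def)
    also have "\<dots> \<le> (k / V \<mu> a s) * (L * V \<mu> a (q * s / 2))"
      using v2 DH L0 k Va by (intro mult_left_mono) (auto simp: field_simps)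
    finally show ?thesis by (simp add: mult.assoc mult.left_commute)
  qed
  have "\<psi> s + ?t = real (Suc (Suc j)) * \<psi> s" by (simp add: algebra_simps)
  with 1 sub 2 show ?case by (auto elim!: eventually_mono simp del: power_Suc of_nat_Suc)
qed

text \<open>Pairs closer than q r / 2 are covered by \<open>ndl\<close>. Otherwise N equal time
  steps follow a chain; \<open>exponent_lower\<close> makes the steps short enough for their
  duration and bounds N by a multiple of 1 + S, so that \<open>el ^ N\<close> has the required
  exponential form. The bound b is uniform over a small box because the kernel is later estimated
  box by box.\<close>

lemma semigroup_lower:
  obtains Cl cl where "Cl > 0" "cl > 0"
    "\<And>r x y. 0 < r \<Longrightarrow> ereal r < mm_diam \<mu> \<Longrightarrow> \<exists>p>0. \<exists>b>0.
      (\<forall>x' y'. x' \<in> ball x p \<longrightarrow> y' \<in> ball y p \<longrightarrow> Cl / V \<mu> x' r * exp (- cl * S (\<psi> r) (dist x' y')) \<le> b) \<and>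
      (\<forall>f. f \<in> L2 \<mu> \<longrightarrow> (\<forall>z. 0 \<le> f z) \<longrightarrow> (\<forall>z. z \<notin> ball y p \<longrightarrow> f z = 0) \<longrightarrow>
        (AE z in \<mu>. z \<in> ball x p \<longrightarrow> b * (\<integral>z. f z \<partial>\<mu>) \<le> P (\<psi> r) f z))"
proof -
  define el' where "el' = k / ((Cv * (2 / q) powr \<alpha>) * (Cv * 2 powr \<alpha>))"
  \<comment> \<open>Below k for the near pairs, below 1 so that its logarithm is negative.\<close>
  define el where "el = min (min el' k) (1/2)"
  have el': "0 < el'" unfolding el'_def using k Cv q by simp
  have el: "0 < el" "el \<le> el'" "el \<le> k" "el < 1" using el' k by (auto simp: el_def)
  \<comment> \<open>3 \<kappa> bounds the number of steps in units of
    \<open>\<rho> d / \<rho> e\<close>; the other factor bounds \<psi>(2 e / q) by a multiple of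
    \<psi>(e), which ensures 2 e \<le> q s.\<close>
  define A where "A = 3 * \<kappa> * (K * (2 / q) powr \<beta>')"
  have A: "A > 0" using kappa psi.K_pos q by (simp add: A_def)
  obtain B where B: "B > 0" and sel: "\<And>r d. 0 < r \<Longrightarrow> ereal r < mm_diam \<mu> \<Longrightarrow> 0 < d \<Longrightarrow> ereal d \<le> mm_diam \<mu> \<Longrightarrow>
      \<exists>e>0. e \<le> d \<and> A * (\<psi> e * (\<rho> d / \<rho> e)) \<le> \<psi> r \<and>
        (\<forall>d'\<ge>0. \<rho> d / 2 \<le> \<rho> d' \<longrightarrow> \<rho> d / \<rho> e \<le> B * (1 + S (\<psi> r) d'))"
    using exponent_lower[OF A] by blast
  define H where "H = Cv * 2 powr \<alpha>"
  have H: "0 < H" using Cv by (simp add: H_def)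
  define cl where "cl = - ln el * (3 * \<kappa> * B)"
  have lnel: "ln el < 0" using el by simp
  have cl: "cl > 0" unfolding cl_def using lnel kappa B by (intro mult_pos_pos) auto
  define Cl where "Cl = min el (exp (- cl)) / H"
  have Cl: "Cl > 0" using el H by (simp add: Cl_def)
  have vol: "V \<mu> x r \<le> H * V \<mu> x' r" if "0 < r" "x' \<in> ball x p" "p \<le> r" for x x' r p
  proof -
    have d: "dist x x' \<le> r" using that by simp
    have "V \<mu> x r \<le> Cv * ((r + dist x x') / r) powr \<alpha> * V \<mu> x' r" using that by (intro doubling_shift) auto
    also have "\<dots> \<le> H * V \<mu> x' r"
      unfolding H_def using d that(1) Cv alpha V_pos[OF that(1), of x']
      by (intro mult_right_mono mult_left_mono powr_mono2) (auto simp: field_simps)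
    finally show ?thesis .
  qed
  show thesis
  proof (rule that[OF Cl cl])
    fix r and x y :: 'a assume r: "0 < r" "ereal r < mm_diam \<mu>"
    have pr: "0 < \<psi> r" using r by (intro psi.pos)
    have qr: "0 < q * r" "q * r \<le> r" using q r mult_right_mono[of q 1 r] by auto
    have Vx: "0 < V \<mu> x r" using r by (intro V_pos)
    show "\<exists>p>0. \<exists>b>0.
      (\<forall>x' y'. x' \<in> ball x p \<longrightarrow> y' \<in> ball y p \<longrightarrow> Cl / V \<mu> x' r * exp (- cl * S (\<psi> r) (dist x' y')) \<le> b) \<and>
      (\<forall>f. f \<in> L2 \<mu> \<longrightarrow> (\<forall>z. 0 \<le> f z) \<longrightarrow> (\<forall>z. z \<notin> ball y p \<longrightarrow> f z = 0) \<longrightarrow>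
        (AE z in \<mu>. z \<in> ball x p \<longrightarrow> b * (\<integral>z. f z \<partial>\<mu>) \<le> P (\<psi> r) f z))"
    proof (cases "dist x y < q * r / 2")
      case True
      let ?p = "q * r / 2" and ?b = "k / V \<mu> x r"
      have sub: "ball y ?p \<subseteq> ball x (q * r)"
      proof
        fix z assume "z \<in> ball y ?p"
        then show "z \<in> ball x (q * r)" using dist_triangle[of x z y] True by simp
      qed
      show ?thesis
      proof (rule exI[of _ ?p], intro conjI exI[of _ ?b] allI impI)
        fix x' y' assume x': "x' \<in> ball x ?p"
        have pos: "0 < V \<mu> x' r" using r by (intro V_pos)
        have "exp (- cl * S (\<psi> r) (dist x' y')) \<le> 1" using cl S_nonneg[OF r, of "dist x' y'"] by simp
        then have "Cl / V \<mu> x' r * exp (- cl * S (\<psi> r) (dist x' y')) \<le> Cl / V \<mu> x' r * 1"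
          using Cl pos by (intro mult_left_mono) auto
        also have "\<dots> \<le> (k / H) / V \<mu> x' r"
          unfolding Cl_def mult_1_right using el H pos by (intro divide_right_mono) auto
        also have "\<dots> \<le> k / V \<mu> x r"
        proof -
          have "q * r / 2 \<le> r" using qr by linarith
          from vol[OF r(1) x' this] show ?thesis using pos Vx H k by (simp add: field_simps)
        qed
        finally show "Cl / V \<mu> x' r * exp (- cl * S (\<psi> r) (dist x' y')) \<le> ?b" .
      next
        fix f :: "'a \<Rightarrow> real" assume f: "f \<in> L2 \<mu>" "\<forall>z. 0 \<le> f z" "\<forall>z. z \<notin> ball y ?p \<longrightarrow> f z = 0"
        have "AE z in \<mu>. z \<in> ball x (q * r) \<longrightarrow> k / V \<mu> x r * (\<integral>z. f z \<partial>\<mu>) \<le> P (\<psi> r) f z"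
          by (rule ndl[OF r f(1)]) (use f sub in blast)+
        then show "AE z in \<mu>. z \<in> ball x ?p \<longrightarrow> ?b * (\<integral>z. f z \<partial>\<mu>) \<le> P (\<psi> r) f z"
          by eventually_elim (use qr in auto)
      qed (use qr k Vx in auto)
    next
      case False
      define d where "d = dist x y"
      have d: "0 < d" "ereal d \<le> mm_diam \<mu>" using False qr dist_le_diam[of x y] by (auto simp: d_def)
      obtain e where e: "0 < e" "e \<le> d" "A * (\<psi> e * (\<rho> d / \<rho> e)) \<le> \<psi> r"
        and eN: "\<And>d'. 0 \<le> d' \<Longrightarrow> \<rho> d / 2 \<le> \<rho> d' \<Longrightarrow> \<rho> d / \<rho> e \<le> B * (1 + S (\<psi> r) d')"
        using sel[OF r d] by blast
      have pe: "0 < \<rho> e" "0 < \<psi> e" "0 < \<rho> d" using e d rho.pos psi.pos by auto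
      have one: "1 \<le> \<rho> d / \<rho> e" using rho.mono[of e d] e pe by simp
      define N where "N = nat \<lceil>\<kappa> * (\<rho> d / \<rho> e + 1)\<rceil>"
      have N: "\<kappa> * (\<rho> d / \<rho> e + 1) \<le> real N" "real N \<le> 3 * \<kappa> * (\<rho> d / \<rho> e)"
      proof -
        have "0 \<le> \<kappa> * (\<rho> d / \<rho> e + 1)" using kappa pe by simp
        then have "real N = of_int \<lceil>\<kappa> * (\<rho> d / \<rho> e + 1)\<rceil>" by (simp add: N_def)
        then have n: "\<kappa> * (\<rho> d / \<rho> e + 1) \<le> real N" "real N \<le> \<kappa> * (\<rho> d / \<rho> e + 1) + 1" by linarith+
        then show "\<kappa> * (\<rho> d / \<rho> e + 1) \<le> real N" by simp
        have "\<kappa> * 1 \<le> \<kappa> * (\<rho> d / \<rho> e)" using one kappa by (intro mult_left_mono) auto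
        then show "real N \<le> 3 * \<kappa> * (\<rho> d / \<rho> e)" using n(2) kappa unfolding distrib_left mult.assoc mult_1_right by linarith
      qed
      have "1 * 2 \<le> \<kappa> * (\<rho> d / \<rho> e + 1)" using kappa one by (intro mult_mono) auto
      then have N1: "1 \<le> real N" using N(1) by simp
      then obtain j where j: "N = Suc j" by (cases N) auto
      define t where "t = \<psi> r / real N"
      have t: "0 < t" "t \<le> \<psi> r" using pr N1 by (auto simp: t_def divide_le_eq mult_le_cancel_left1)
      \<comment> \<open>The radius whose time scale is exactly one of the N time steps.\<close>
      define s where "s = scale_inv \<psi> t"
      have s: "0 < s" "\<psi> s = t" using psi.inv_pos[OF t(1)] by (auto simp: s_def)
      have sr: "s \<le> r" using psi.le_iff[of s r] s t r by simp
      have sd: "ereal s < mm_diam \<mu>" using ereal_less_diam_mono[OF r(2) sr] .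
      have es: "2 * e \<le> q * s"
      proof -
        have "\<psi> (2 / q * e) \<le> K * (2 / q * e / e) powr \<beta>' * \<psi> e"
          using q e by (intro psi.ratio_le) (auto simp: field_simps)
        then have "\<psi> (2 / q * e) \<le> K * (2 / q) powr \<beta>' * \<psi> e" using e by simp
        then have "real N * \<psi> (2 / q * e) \<le> (3 * \<kappa> * (\<rho> d / \<rho> e)) * (K * (2 / q) powr \<beta>' * \<psi> e)"
          using N(2) kappa pe psi.pos[of "2 / q * e"] q e by (intro mult_mono) auto
        also have "\<dots> = A * (\<psi> e * (\<rho> d / \<rho> e))" by (simp add: A_def)
        also have "\<dots> \<le> \<psi> r" by (rule e(3))
        finally have "\<psi> (2 / q * e) \<le> \<psi> s" using N1 unfolding s(2) t_def by (simp add: field_simps)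
        then have "2 / q * e \<le> s" using psi.le_iff[of "2 / q * e" s] q e s by simp
        then show ?thesis using q by (simp add: field_simps)
      qed
      \<comment> \<open>Continuity of \<rho> keeps \<rho> of the distance above half of
        \<open>\<rho> d\<close> when both endpoints move by less than p, which is what
        \<open>eN\<close> asks for.\<close>
      have "isCont \<rho> d"
        using rho.cont d by (intro continuous_on_interior[of "{0..}"]) (auto simp: interior_real_atLeast)
      then have "\<forall>\<^sub>F u in at d. \<rho> d / 2 < \<rho> u" using pe by (intro order_tendstoD(1)[of \<rho> "\<rho> d"]) (auto simp: isCont_def)
      then obtain \<epsilon> where \<epsilon>: "0 < \<epsilon>" "\<And>u. u \<noteq> d \<Longrightarrow> dist u d < \<epsilon> \<Longrightarrow> \<rho> d / 2 < \<rho> u" by (auto simp: eventually_at)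
      define p where "p = min (q * s / 2) (\<epsilon> / 2)"
      have qs: "0 < q * s" "q * s \<le> s" using q s mult_right_mono[of q 1 s] by auto
      have p: "0 < p" "p \<le> q * s / 2" "p \<le> \<epsilon> / 2" "p \<le> r" using qs \<epsilon> sr by (auto simp: p_def)
      define b where "b = el ^ N / V \<mu> x r"
      have b: "0 < b" using el Vx by (simp add: b_def)
      have "x \<in> nbh e {y} N" using N(1) e by (intro nbh_upper) (auto simp: d_def dist_commute)
      then have xN: "x \<in> nbh e {y} (Suc j)" by (simp only: j)
      show ?thesis
      proof (rule exI[of _ p], intro conjI exI[of _ b] allI impI p(1) b)
        fix x' y' assume xy: "x' \<in> ball x p" "y' \<in> ball y p"
        have pos: "0 < V \<mu> x' r" using r by (intro V_pos)
        have "\<bar>dist x' y' - d\<bar> < \<epsilon>"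
        proof -
          have "dist x' y' \<le> dist x' x + dist x y + dist y y'" using dist_triangle[of x' y' x] dist_triangle[of x y' y] by simp
          moreover have "dist x y \<le> dist x x' + dist x' y' + dist y' y" using dist_triangle[of x y x'] dist_triangle[of x' y y'] by simp
          ultimately show ?thesis using xy p by (simp add: d_def dist_commute)
        qed
        then have "\<rho> d / 2 \<le> \<rho> (dist x' y')" using \<epsilon>(2)[of "dist x' y'"] pe by (cases "dist x' y' = d") (auto simp: dist_real_def intro: less_imp_le)
        then have "\<rho> d / \<rho> e \<le> B * (1 + S (\<psi> r) (dist x' y'))" by (intro eN) auto
        then have "3 * \<kappa> * (\<rho> d / \<rho> e) \<le> 3 * \<kappa> * (B * (1 + S (\<psi> r) (dist x' y')))" using kappa by (intro mult_left_mono) auto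
        then have "real N \<le> 3 * \<kappa> * B * (1 + S (\<psi> r) (dist x' y'))" using N(2) by (simp add: mult.assoc)
        then have "ln el * (3 * \<kappa> * B * (1 + S (\<psi> r) (dist x' y'))) \<le> ln el * real N" using lnel by (intro mult_left_mono_neg) auto
        then have "- cl * (1 + S (\<psi> r) (dist x' y')) \<le> real N * ln el" by (simp add: cl_def mult.commute mult.left_commute mult.assoc)
        then have "exp (- cl * (1 + S (\<psi> r) (dist x' y'))) \<le> exp (real N * ln el)" by simp
        also have "\<dots> = el ^ N" using el(1) by (simp only: exp_of_nat_mult exp_ln[of el])
        finally have e1: "exp (- cl) * exp (- cl * S (\<psi> r) (dist x' y')) \<le> el ^ N" by (simp add: exp_add[symmetric] algebra_simps)
        have "Cl / V \<mu> x' r * exp (- cl * S (\<psi> r) (dist x' y')) \<le> (exp (- cl) / H) / V \<mu> x' r * exp (- cl * S (\<psi> r) (dist x' y'))"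
          unfolding Cl_def using H pos by (intro mult_right_mono divide_right_mono) auto
        also have "\<dots> = (exp (- cl) * exp (- cl * S (\<psi> r) (dist x' y'))) / (H * V \<mu> x' r)" by simp
        also have "\<dots> \<le> el ^ N / (H * V \<mu> x' r)" using e1 H pos by (intro divide_right_mono) auto
        also have "\<dots> \<le> b" unfolding b_def using vol[OF r(1) xy(1) p(4)] Vx H pos el by (intro divide_left_mono) auto
        finally show "Cl / V \<mu> x' r * exp (- cl * S (\<psi> r) (dist x' y')) \<le> b" .
      next
        fix f :: "'a \<Rightarrow> real" assume f: "f \<in> L2 \<mu>" "\<forall>z. 0 \<le> f z" "\<forall>z. z \<notin> ball y p \<longrightarrow> f z = 0"
        have I0: "0 \<le> (\<integral>z. f z \<partial>\<mu>)" using f by (intro Bochner_Integration.integral_nonneg) auto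
        have "AE z in \<mu>. z \<in> ball x (q * s / 2) \<longrightarrow> el' ^ Suc j / V \<mu> x s * (\<integral>z. f z \<partial>\<mu>) \<le> P (real (Suc j) * \<psi> s) f z"
          unfolding el'_def by (rule chain_lower[OF s(1) sd e(1) es f(1) _ _ xN]) (use f p in auto)
        moreover have "real (Suc j) * \<psi> s = \<psi> r" unfolding s(2) t_def j[symmetric] using N1 by simp
        moreover have "b * (\<integral>z. f z \<partial>\<mu>) \<le> el' ^ Suc j / V \<mu> x s * (\<integral>z. f z \<partial>\<mu>)"
        proof (rule mult_right_mono[OF _ I0])
          have "el ^ N \<le> el' ^ Suc j" unfolding j using el by (intro power_mono) auto
          moreover have "V \<mu> x s \<le> V \<mu> x r" using sr by (rule V_mono)
          ultimately show "b \<le> el' ^ Suc j / V \<mu> x s" unfolding b_def using V_pos[OF s(1), of x] el el'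
            by (intro frac_le) auto
        qed
        ultimately show "AE z in \<mu>. z \<in> ball x p \<longrightarrow> b * (\<integral>z. f z \<partial>\<mu>) \<le> P (\<psi> r) f z"
          using p(2) by (auto elim!: eventually_mono)
      qed
    qed
  qed
qed

end

section \<open>Kernels of positive operators\<close>

lemma semiring_rectangles:
  "semiring_of_sets (space M1 \<times> space M2) {A \<times> B | A B. A \<in> sets M1 \<and> B \<in> sets M2}"
proof (unfold_locales)
  show "{A \<times> B | A B. A \<in> sets M1 \<and> B \<in> sets M2} \<subseteq> Pow (space M1 \<times> space M2)"
    using sets.space_closed[of M1] sets.space_closed[of M2] by blast
  show "{} \<in> {A \<times> B | A B. A \<in> sets M1 \<and> B \<in> sets M2}" by blast
next
  fix a b assume "a \<in> {A \<times> B | A B. A \<in> sets M1 \<and> B \<in> sets M2}" "b \<in> {A \<times> B | A B. A \<in> sets M1 \<and> B \<in> sets M2}"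
  then obtain A B A' B' where s: "A \<in> sets M1" "B \<in> sets M2" "A' \<in> sets M1" "B' \<in> sets M2" "a = A \<times> B" "b = A' \<times> B'"
    by blast
  have "a \<inter> b = (A \<inter> A') \<times> (B \<inter> B')" using s by auto
  then show "a \<inter> b \<in> {A \<times> B | A B. A \<in> sets M1 \<and> B \<in> sets M2}" using s by blast
  let ?C = "{(A - A') \<times> B, (A \<inter> A') \<times> (B - B')}"
  show "\<exists>C\<subseteq>{A \<times> B | A B. A \<in> sets M1 \<and> B \<in> sets M2}. finite C \<and> disjoint C \<and> a - b = \<Union> C"
  proof (intro exI[of _ ?C] conjI)
    show "?C \<subseteq> {A \<times> B | A B. A \<in> sets M1 \<and> B \<in> sets M2}" using s by blast
    show "disjoint ?C" by (auto simp: disjoint_def)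
    show "a - b = \<Union> ?C" using s by auto
  qed simp
qed

text \<open>Here \<tau> is only finitely additive, and each law holds off a null set that depends on
  the sets involved. A kernel is a version that works for all sets at once; domination by m2
  supplies countable additivity.\<close>

locale set_function_kernel =
  m1: finite_measure m1 + m2: finite_measure m2
  for m1 :: "'a measure" and m2 :: "'b measure" +
  fixes \<tau> :: "'b set \<Rightarrow> 'a \<Rightarrow> real"
  assumes tau_measurable [measurable]: "\<And>B. B \<in> sets m2 \<Longrightarrow> \<tau> B \<in> borel_measurable m1"
    and tau_bounds: "\<And>B. B \<in> sets m2 \<Longrightarrow> AE x in m1. 0 \<le> \<tau> B x \<and> \<tau> B x \<le> measure m2 B"
    and tau_union: "\<And>B D. B \<in> sets m2 \<Longrightarrow> D \<in> sets m2 \<Longrightarrow> B \<inter> D = {} \<Longrightarrow> AE x in m1. \<tau> (B \<union> D) x = \<tau> B x + \<tau> D x"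
begin

lemma tau_finite_union:
  assumes "finite J" "\<And>n. B n \<in> sets m2" "disjoint_family_on B J"
  shows "AE x in m1. \<tau> (\<Union>n\<in>J. B n) x = (\<Sum>n\<in>J. \<tau> (B n) x)"
  using assms(1,3)
proof (induction J rule: finite_induct)
  case empty
  have "AE x in m1. 0 \<le> \<tau> {} x \<and> \<tau> {} x \<le> measure m2 {}" by (intro tau_bounds) auto
  then show ?case by eventually_elim auto
next
  case (insert i J)
  have "disjoint_family_on B J" using insert.prems by (auto simp: disjoint_family_on_def)
  from insert.IH[OF this] have 1: "AE x in m1. \<tau> (\<Union>n\<in>J. B n) x = (\<Sum>n\<in>J. \<tau> (B n) x)" .
  have "B i \<inter> (\<Union>n\<in>J. B n) = {}" using insert.prems insert.hyps by (auto simp: disjoint_family_on_def)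
  then have "AE x in m1. \<tau> (B i \<union> (\<Union>n\<in>J. B n)) x = \<tau> (B i) x + \<tau> (\<Union>n\<in>J. B n) x"
    using assms(2) insert.hyps by (intro tau_union) auto
  with 1 show ?case
  proof eventually_elim
    case (elim x)
    then show ?case using insert.hyps by simp
  qed
qed

text \<open>The bounds for the single set that remains after removing the disjoint pieces, rewritten
  by additivity.\<close>

lemma tau_difference:
  assumes J: "finite J" and B: "\<And>n. B n \<in> sets m2" "disjoint_family_on B J" and D: "D \<in> sets m2" "(\<Union>n\<in>J. B n) \<subseteq> D"
  shows "AE x in m1. 0 \<le> \<tau> D x - (\<Sum>n\<in>J. \<tau> (B n) x) \<and> \<tau> D x - (\<Sum>n\<in>J. \<tau> (B n) x) \<le> measure m2 D - (\<Sum>n\<in>J. measure m2 (B n))"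
proof -
  let ?U = "\<Union>n\<in>J. B n"
  have U: "?U \<in> sets m2" using J B by auto
  have "(D - ?U) \<union> ?U = D" using D by auto
  moreover have "AE x in m1. \<tau> ((D - ?U) \<union> ?U) x = \<tau> (D - ?U) x + \<tau> ?U x" using U D by (intro tau_union) auto
  ultimately have 1: "AE x in m1. \<tau> D x = \<tau> (D - ?U) x + \<tau> ?U x" by simp
  have 2: "AE x in m1. 0 \<le> \<tau> (D - ?U) x \<and> \<tau> (D - ?U) x \<le> measure m2 (D - ?U)" using U D by (intro tau_bounds) auto
  have "measure m2 (D - ?U) = measure m2 D - measure m2 ?U" using U D by (intro m2.finite_measure_Diff)
  also have "measure m2 ?U = (\<Sum>n\<in>J. measure m2 (B n))" using J B by (intro m2.finite_measure_finite_Union) auto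
  finally have 3: "measure m2 (D - ?U) = measure m2 D - (\<Sum>n\<in>J. measure m2 (B n))" .
  from 1 2 tau_finite_union[OF J B] show ?thesis by eventually_elim (use 3 in auto)
qed

text \<open>The sections of a countable partition of a rectangle are countable partitions, so their
  \<open>m2\<close>-measures control the remainders of the series pointwise.\<close>
lemma tau_sums:
  assumes AB: "\<And>n::nat. A n \<in> sets m1" "\<And>n. B n \<in> sets m2" "A' \<in> sets m1" "B' \<in> sets m2"
    and dis: "disjoint_family (\<lambda>n. A n \<times> B n)" and un: "(\<Union>n. A n \<times> B n) = A' \<times> B'"
  shows "AE x in m1. (\<lambda>n. indicator (A n) x * \<tau> (B n) x) sums (indicator A' x * \<tau> B' x)"
proof -
  have "AE x in m1. \<forall>J\<in>{J. finite J \<and> disjoint_family_on B J \<and> (\<Union>n\<in>J. B n) \<subseteq> B'}.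
     0 \<le> \<tau> B' x - (\<Sum>n\<in>J. \<tau> (B n) x) \<and> \<tau> B' x - (\<Sum>n\<in>J. \<tau> (B n) x) \<le> measure m2 B' - (\<Sum>n\<in>J. measure m2 (B n))"
  proof (subst AE_ball_countable)
    \<comment> \<open>There are only countably many finite index sets, so one null set serves for
      all of them.\<close>
    have "countable {J :: nat set. finite J}" by (rule countable_Collect_finite)
    then show "countable {J. finite J \<and> disjoint_family_on B J \<and> (\<Union>n\<in>J. B n) \<subseteq> B'}" by (rule countable_subset[rotated]) auto
  qed (intro ballI tau_difference; use AB in auto)
  moreover have "AE x in m1. 0 \<le> \<tau> {} x \<and> \<tau> {} x \<le> measure m2 {}" by (intro tau_bounds) auto
  ultimately show ?thesis
  proof eventually_elim
    case (elim x)
    have mem: "(x \<in> A n \<and> y \<in> B n) \<Longrightarrow> x \<in> A' \<and> y \<in> B'" for n y using un by blast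
    show ?case
    proof (cases "x \<in> A'")
      case False
      have "indicator (A n) x * \<tau> (B n) x = 0" for n
      proof (cases "x \<in> A n")
        case True
        then have "B n = {}" using mem False by blast
        then show ?thesis using elim(2) by simp
      qed simp
      then show ?thesis using False by (simp only: indicator_simps mult_zero_left sums_zero not_False_eq_True)
    next
      case True
      \<comment> \<open>The section at x of the n-th rectangle; these sections partition B'.\<close>
      let ?s = "\<lambda>n. if x \<in> A n then B n else {}"
      have disj: "disjoint_family ?s"
        using dis by (fastforce simp: disjoint_family_on_def)
      have "(\<Union>n. ?s n) = B'" using un True by (fastforce split: if_splits)
      moreover have "(\<lambda>n. measure m2 (?s n)) sums measure m2 (\<Union>n. ?s n)"
        using AB disj by (intro m2.finite_measure_UNION) auto
      ultimately have sm: "(\<lambda>N. \<Sum>n<N. measure m2 (?s n)) \<longlonglongrightarrow> measure m2 B'" by (simp add: sums_def)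
      have sm: "(\<lambda>N. measure m2 B' - (\<Sum>n<N. measure m2 (?s n))) \<longlonglongrightarrow> 0"
        using tendsto_diff[OF tendsto_const[of "measure m2 B'"] sm] by simp
      have bnd: "0 \<le> \<tau> B' x - (\<Sum>n<N. indicator (A n) x * \<tau> (B n) x) \<and>
        \<tau> B' x - (\<Sum>n<N. indicator (A n) x * \<tau> (B n) x) \<le> measure m2 B' - (\<Sum>n<N. measure m2 (?s n))" for N
      proof -
        let ?J = "{n\<in>{..<N}. x \<in> A n}"
        have "disjoint_family_on B ?J" using disj by (fastforce simp: disjoint_family_on_def split: if_splits)
        moreover have "(\<Union>n\<in>?J. B n) \<subseteq> B'" using mem by blast
        ultimately have "?J \<in> {J. finite J \<and> disjoint_family_on B J \<and> (\<Union>n\<in>J. B n) \<subseteq> B'}" by simp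
        note b = bspec[OF elim(1) this]
        have "(\<Sum>n\<in>?J. \<tau> (B n) x) = (\<Sum>n<N. indicator (A n) x * \<tau> (B n) x)"
          by (intro sum.mono_neutral_cong_left) (auto simp: indicator_def)
        moreover have "(\<Sum>n\<in>?J. measure m2 (B n)) = (\<Sum>n<N. measure m2 (?s n))"
          by (intro sum.mono_neutral_cong_left) auto
        ultimately show ?thesis using b by simp
      qed
      have "(\<lambda>N. \<tau> B' x - (\<Sum>n<N. indicator (A n) x * \<tau> (B n) x)) \<longlonglongrightarrow> 0"
        by (rule tendsto_sandwich[OF _ _ tendsto_const sm]) (use bnd in auto)
      from tendsto_diff[OF tendsto_const[of "\<tau> B' x"] this]
      show ?thesis using True by (simp add: sums_def)
    qed
  qed
qed

lemma product_extension:
  obtains N where "sets N = sets (m1 \<Otimes>\<^sub>M m2)"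
    "\<And>A B. A \<in> sets m1 \<Longrightarrow> B \<in> sets m2 \<Longrightarrow> emeasure N (A \<times> B) = (\<integral>\<^sup>+x. ennreal (indicator A x * \<tau> B x) \<partial>m1)"
proof -
  define \<nu> where "\<nu> = (\<lambda>(A, B). \<integral>\<^sup>+x. ennreal (indicator A x * \<tau> B x) \<partial>m1)"
  define I where "I = {(A, B). A \<in> sets m1 \<and> B \<in> sets m2}"
  let ?G = "\<lambda>(A, B). A \<times> B" and ?\<Omega> = "space m1 \<times> space m2"
  define N where "N = extend_measure ?\<Omega> I ?G \<nu>"
  have GI: "?G ` I = {A \<times> B | A B. A \<in> sets m1 \<and> B \<in> sets m2}" by (force simp: I_def)
  have tau0: "AE x in m1. \<tau> {} x = 0"
    using tau_bounds[OF sets.empty_sets] by eventually_elim auto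
  have null: "\<nu> (A, B) = 0" if "(A, B) \<in> I" "A \<times> B = {}" for A B
  proof -
    have "AE x in m1. ennreal (indicator A x * \<tau> B x) = 0" using tau0 that by (auto elim!: eventually_mono)
    then have "(\<integral>\<^sup>+x. ennreal (indicator A x * \<tau> B x) \<partial>m1) = (\<integral>\<^sup>+x. 0 \<partial>m1)" by (rule nn_integral_cong_AE)
    then show ?thesis by (simp add: \<nu>_def)
  qed
  show thesis
  proof (rule that[of N])
    have "sets N = sigma_sets ?\<Omega> (?G ` I)"
      unfolding N_def using sets.space_closed by (intro sets_extend_measure) (auto simp: I_def dest!: sets.sets_into_space)
    then show "sets N = sets (m1 \<Otimes>\<^sub>M m2)" by (simp only: GI sets_pair_measure)
    fix A B assume A: "A \<in> sets m1" and B: "B \<in> sets m2"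
    have "emeasure N (?G (A, B)) = \<nu> (A, B)"
    proof (rule extend_measure_caratheodory[OF N_def])
      show "(A, B) \<in> I" using A B by (simp add: I_def)
      show "semiring_of_sets ?\<Omega> (?G ` I)" unfolding GI by (rule semiring_rectangles)
      show "\<nu> i = 0" if "i \<in> I" "?G i = {}" for i using null that by (cases i) auto
      \<comment> \<open>Sides are determined by a nonempty rectangle only; empty ones all have value
        0 by \<open>null\<close>.\<close>
      show "\<nu> i = \<nu> j" if "i \<in> I" "j \<in> I" "?G i = ?G j" for i j
      proof (cases "?G i = {}")
        case True
        then show ?thesis using null that by (cases i, cases j) auto
      next
        case False
        then show ?thesis using that by (cases i, cases j) (auto simp: times_eq_iff)
      qed
      fix D :: "nat \<Rightarrow> 'a set \<times> 'b set" and j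
      assume D: "D \<in> UNIV \<rightarrow> I" "j \<in> I" "disjoint_family (?G \<circ> D)" "(\<Union>i. ?G (D i)) = ?G j"
      define A where "A n = fst (D n)" for n
      define B where "B n = snd (D n)" for n
      have Dn: "D n = (A n, B n)" for n by (simp add: A_def B_def)
      obtain A' B' where j: "j = (A', B')" by (cases j)
      have AB: "A n \<in> sets m1" "B n \<in> sets m2" for n 
      proof -
        have "D n \<in> I" using D(1) by blast
        then show "A n \<in> sets m1" "B n \<in> sets m2" by (auto simp: I_def Dn)
      qed
      have AB': "A' \<in> sets m1" "B' \<in> sets m2" using D(2) j by (auto simp: I_def)
      have [measurable]: "A n \<in> sets m1" "B n \<in> sets m2" "A' \<in> sets m1" "B' \<in> sets m2" for n using AB AB' by auto
      have "AE x in m1. (\<lambda>n. indicator (A n) x * \<tau> (B n) x) sums (indicator A' x * \<tau> B' x)"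
        using D(3,4) by (intro tau_sums AB AB') (auto simp: Dn j comp_def)
      moreover have "AE x in m1. \<forall>n. 0 \<le> \<tau> (B n) x" using tau_bounds[OF AB(2)] by (subst AE_all_countable) (auto elim!: eventually_mono)
      ultimately have "AE x in m1. (\<Sum>n. ennreal (indicator (A n) x * \<tau> (B n) x)) = ennreal (indicator A' x * \<tau> B' x)"
        by eventually_elim (auto intro!: suminf_ennreal_eq)
      then have "(\<integral>\<^sup>+x. (\<Sum>n. ennreal (indicator (A n) x * \<tau> (B n) x)) \<partial>m1) = \<nu> j"
        unfolding \<nu>_def j prod.case by (rule nn_integral_cong_AE)
      also have "(\<integral>\<^sup>+x. (\<Sum>n. ennreal (indicator (A n) x * \<tau> (B n) x)) \<partial>m1) = (\<Sum>n. \<nu> (D n))"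
        unfolding \<nu>_def Dn prod.case by (intro nn_integral_suminf) measurable
      finally show "(\<Sum>n. \<nu> (D n)) = \<nu> j" .
    qed auto
    then show "emeasure N (A \<times> B) = (\<integral>\<^sup>+x. ennreal (indicator A x * \<tau> B x) \<partial>m1)" by (simp add: \<nu>_def)
  qed
qed

text \<open>The complementary set function, m2 minus \<tau>, satisfies the same laws. The two
  product measures add up to that of m1 and m2, first on rectangles and then everywhere, so both are
  absolutely continuous and the density of the first is at most 1.\<close>

lemma kernel:
  obtains g where "g \<in> borel_measurable (m1 \<Otimes>\<^sub>M m2)" "\<And>z. 0 \<le> g z" "\<And>z. g z \<le> (1::real)"
    "\<And>B. B \<in> sets m2 \<Longrightarrow> AE x in m1. ennreal (\<tau> B x) = (\<integral>\<^sup>+y. ennreal (g (x, y) * indicator B y) \<partial>m2)"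
proof -
  interpret pair_sigma_finite m1 m2 by unfold_locales
  interpret M: finite_measure "m1 \<Otimes>\<^sub>M m2"
  proof
    show "emeasure (m1 \<Otimes>\<^sub>M m2) (space (m1 \<Otimes>\<^sub>M m2)) \<noteq> \<infinity>"
      using m1.emeasure_finite m2.emeasure_finite
      by (simp add: space_pair_measure m2.emeasure_pair_measure_Times ennreal_mult_eq_top_iff)
  qed
  let ?M = "m1 \<Otimes>\<^sub>M m2"
  interpret co: set_function_kernel m1 m2 "\<lambda>B x. measure m2 B - \<tau> B x"
  proof
    fix B assume B: "B \<in> sets m2"
    then show "(\<lambda>x. measure m2 B - \<tau> B x) \<in> borel_measurable m1" by measurable
    show "AE x in m1. 0 \<le> measure m2 B - \<tau> B x \<and> measure m2 B - \<tau> B x \<le> measure m2 B"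
      using tau_bounds[OF B] by (auto elim!: eventually_mono)
    fix D assume D: "D \<in> sets m2" "B \<inter> D = {}"
    from tau_union[OF B D] show "AE x in m1. measure m2 (B \<union> D) - \<tau> (B \<union> D) x = measure m2 B - \<tau> B x + (measure m2 D - \<tau> D x)"
      using m2.finite_measure_Union[OF B D] by (auto elim!: eventually_mono)
  qed
  obtain N where N: "sets N = sets ?M" "\<And>A B. A \<in> sets m1 \<Longrightarrow> B \<in> sets m2 \<Longrightarrow> emeasure N (A \<times> B) = (\<integral>\<^sup>+x. ennreal (indicator A x * \<tau> B x) \<partial>m1)"
    using product_extension by blast
  obtain N' where N': "sets N' = sets ?M" "\<And>A B. A \<in> sets m1 \<Longrightarrow> B \<in> sets m2 \<Longrightarrow> emeasure N' (A \<times> B) = (\<integral>\<^sup>+x. ennreal (indicator A x * (measure m2 B - \<tau> B x)) \<partial>m1)"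
    using co.product_extension by blast
  have rect: "emeasure N (A \<times> B) + emeasure N' (A \<times> B) = emeasure ?M (A \<times> B)" if A: "A \<in> sets m1" and B: "B \<in> sets m2" for A B
  proof -
    have [measurable]: "A \<in> sets m1" "B \<in> sets m2" using A B by auto
    have "emeasure N (A \<times> B) + emeasure N' (A \<times> B) = (\<integral>\<^sup>+x. ennreal (indicator A x * \<tau> B x) + ennreal (indicator A x * (measure m2 B - \<tau> B x)) \<partial>m1)"
      unfolding N(2)[OF A B] N'(2)[OF A B] by (intro nn_integral_add[symmetric]) measurable
    also have "\<dots> = (\<integral>\<^sup>+x. emeasure m2 B * indicator A x \<partial>m1)"
    proof (rule nn_integral_cong_AE)
      show "AE x in m1. ennreal (indicator A x * \<tau> B x) + ennreal (indicator A x * (measure m2 B - \<tau> B x)) = emeasure m2 B * indicator A x"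
        using tau_bounds[OF B] by eventually_elim (auto simp: indicator_def m2.emeasure_eq_measure ennreal_plus[symmetric] simp del: ennreal_plus)
    qed
    also have "\<dots> = emeasure m2 B * emeasure m1 A" using A by (rule nn_integral_cmult_indicator)
    also have "\<dots> = emeasure ?M (A \<times> B)" using A B by (simp add: m2.emeasure_pair_measure_Times mult.commute)
    finally show ?thesis .
  qed
  have sp: "space N = space ?M" "space N' = space ?M" using N(1) N'(1) by (auto dest: sets_eq_imp_space_eq)
  have spr: "space m1 \<times> space m2 = space ?M" by (simp add: space_pair_measure)
  have tot: "emeasure N (space ?M) + emeasure N' (space ?M) = emeasure ?M (space ?M)"
    using rect[of "space m1" "space m2"] by (simp add: spr)
  have ltop: "emeasure ?M (space ?M) < \<infinity>" using M.emeasure_finite by (simp add: less_top[symmetric])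
  have fin: "emeasure N (space ?M) < \<infinity>" "emeasure N' (space ?M) < \<infinity>"
    using ltop[folded tot] by auto
  interpret N: finite_measure N by standard (use fin sp in auto)
  interpret N': finite_measure N' by standard (use fin sp in auto)
  have sum: "emeasure N X + emeasure N' X = emeasure ?M X" if "X \<in> sets ?M" for X
  proof -
    have "X \<in> sigma_sets (space m1 \<times> space m2) {A \<times> B | A B. A \<in> sets m1 \<and> B \<in> sets m2}" using that by (simp add: sets_pair_measure)
    with Int_stable_pair_measure_generator pair_measure_closed show ?thesis
    proof (induction rule: sigma_sets_induct_disjoint)
      case (basic A)
      then show ?case using rect by blast
    next
      case (compl A)
      then have A: "A \<in> sets ?M" by (simp add: sets_pair_measure)
      have "measure N A + measure N' A = measure ?M A" "measure N (space ?M) + measure N' (space ?M) = measure ?M (space ?M)"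
        using compl(2) tot by (auto simp: N.emeasure_eq_measure N'.emeasure_eq_measure M.emeasure_eq_measure ennreal_plus[symmetric] simp del: ennreal_plus)
      then have "measure N (space ?M - A) + measure N' (space ?M - A) = measure ?M (space ?M - A)"
        using A N.finite_measure_compl[of A] N'.finite_measure_compl[of A] M.finite_measure_compl[of A]
        by (simp add: N(1) N'(1) sp)
      then show ?case
        unfolding spr N.emeasure_eq_measure N'.emeasure_eq_measure M.emeasure_eq_measure
        by (simp only: ennreal_plus[symmetric] measure_nonneg)
    next
      case (union A)
      have A: "range A \<subseteq> sets ?M" using union by (auto simp: sets_pair_measure)
      have "(\<Sum>i. emeasure ?M (A i)) = (\<Sum>i. emeasure N (A i) + emeasure N' (A i))" using union by simp
      also have "\<dots> = (\<Sum>i. emeasure N (A i)) + (\<Sum>i. emeasure N' (A i))" by (intro suminf_add[symmetric]) auto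
      finally show ?case using A union N(1) N'(1) by (simp add: suminf_emeasure)
    qed simp
  qed
  have "absolutely_continuous ?M N" "absolutely_continuous ?M N'"
    unfolding absolutely_continuous_def null_sets_def using sum N(1) N'(1) by (auto; metis add_eq_0_iff_both_eq_0)+
  then obtain h h' where h [measurable]: "h \<in> borel_measurable ?M" "density ?M h = N" and h' [measurable]: "h' \<in> borel_measurable ?M" "density ?M h' = N'"
    using P.Radon_Nikodym N(1) N'(1) by meson
  have "AE z in ?M. h z + h' z = 1"
  proof (rule M.density_unique_finite_measure)
    fix A assume A: "A \<in> sets ?M"
    have "(\<integral>\<^sup>+z. (h z + h' z) * indicator A z \<partial>?M) = (\<integral>\<^sup>+z. h z * indicator A z + h' z * indicator A z \<partial>?M)" by (simp add: distrib_right)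
    also have "\<dots> = emeasure (density ?M h) A + emeasure (density ?M h') A" using A h(1) h'(1) by (simp add: nn_integral_add emeasure_density)
    also have "\<dots> = emeasure ?M A" using sum[OF A] by (simp add: h h')
    finally show "(\<integral>\<^sup>+z. (h z + h' z) * indicator A z \<partial>?M) = (\<integral>\<^sup>+z. 1 * indicator A z \<partial>?M)" using A by simp
  qed (use h(1) h'(1) in auto)
  then have h1: "AE z in ?M. h z \<le> 1" 
  proof eventually_elim
    case (elim z)
    have "h z \<le> h z + h' z" by simp
    with elim show ?case by simp
  qed
  define g where "g z = enn2real (min 1 (h z))" for z
  have eg: "ennreal (g z) = min 1 (h z)" for z unfolding g_def by (rule ennreal_enn2real) (simp add: min_less_iff_disj)
  have g_m [measurable]: "g \<in> borel_measurable ?M" unfolding g_def using h(1) by measurable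
  show thesis
  proof (rule that[OF g_m])
    show "0 \<le> g z" "g z \<le> 1" for z
    proof -
      show "0 \<le> g z" by (simp add: g_def)
      have "ennreal (g z) \<le> ennreal 1" unfolding eg by simp
      then show "g z \<le> 1" by (simp only: ennreal_le_iff zero_le_one)
    qed
    fix B assume B [measurable]: "B \<in> sets m2"
    show "AE x in m1. ennreal (\<tau> B x) = (\<integral>\<^sup>+y. ennreal (g (x, y) * indicator B y) \<partial>m2)"
    proof (rule m1.density_unique_finite_measure)
      fix A assume A [measurable]: "A \<in> sets m1"
      have "(\<integral>\<^sup>+x. ennreal (\<tau> B x) * indicator A x \<partial>m1) = emeasure N (A \<times> B)"
        unfolding N(2)[OF A B] by (intro nn_integral_cong) (auto simp: indicator_def)
      also have "\<dots> = (\<integral>\<^sup>+z. h z * indicator (A \<times> B) z \<partial>?M)" using A B h(1) by (simp add: h(2)[symmetric] emeasure_density)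
      also have "\<dots> = (\<integral>\<^sup>+z. ennreal (g z) * indicator (A \<times> B) z \<partial>?M)"
        by (rule nn_integral_cong_AE) (use h1 in eventually_elim, auto simp: eg min_def)
      also have "\<dots> = (\<integral>\<^sup>+x. \<integral>\<^sup>+y. ennreal (g (x, y)) * indicator (A \<times> B) (x, y) \<partial>m2 \<partial>m1)"
        using A B by (subst m2.nn_integral_fst[symmetric]) auto
      also have "\<dots> = (\<integral>\<^sup>+x. (\<integral>\<^sup>+y. ennreal (g (x, y) * indicator B y) \<partial>m2) * indicator A x \<partial>m1)"
        by (intro nn_integral_cong) (auto simp: indicator_def intro!: nn_integral_cong)
      finally show "(\<integral>\<^sup>+x. ennreal (\<tau> B x) * indicator A x \<partial>m1) = \<dots>" .
    qed measurable
  qed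
qed

end

text \<open>Both densities induce measures that agree on rectangles. Boundedness of q' makes one of
  them finite, which is enough for the measures and then for the densities to agree.\<close>

lemma rectangle_integrals_determine:
  fixes q q' :: "'a \<times> 'b \<Rightarrow> real"
  assumes "finite_measure m1" "finite_measure m2"
    and q [measurable]: "q \<in> borel_measurable (m1 \<Otimes>\<^sub>M m2)" "\<And>z. 0 \<le> q z"
    and q' [measurable]: "q' \<in> borel_measurable (m1 \<Otimes>\<^sub>M m2)" "\<And>z. 0 \<le> q' z" "\<And>z. q' z \<le> K"
    and eq: "\<And>B. B \<in> sets m2 \<Longrightarrow> AE x in m1. (\<integral>\<^sup>+y. ennreal (q (x, y) * indicator B y) \<partial>m2) = (\<integral>\<^sup>+y. ennreal (q' (x, y) * indicator B y) \<partial>m2)"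
  shows "AE z in m1 \<Otimes>\<^sub>M m2. q z = q' z"
proof -
  interpret m1: finite_measure m1 by fact
  interpret m2: finite_measure m2 by fact
  let ?M = "m1 \<Otimes>\<^sub>M m2" and ?R = "{A \<times> B | A B. A \<in> sets m1 \<and> B \<in> sets m2}" and ?\<Omega> = "space m1 \<times> space m2"
  have em: "emeasure (density ?M (\<lambda>z. ennreal (f z))) (A \<times> B) = (\<integral>\<^sup>+x. (\<integral>\<^sup>+y. ennreal (f (x, y) * indicator B y) \<partial>m2) * indicator A x \<partial>m1)"
    if f [measurable]: "f \<in> borel_measurable ?M" and A [measurable]: "A \<in> sets m1" and B [measurable]: "B \<in> sets m2" for f :: "'a \<times> 'b \<Rightarrow> real" and A B
  proof -
    have "emeasure (density ?M (\<lambda>z. ennreal (f z))) (A \<times> B) = (\<integral>\<^sup>+z. ennreal (f z) * indicator (A \<times> B) z \<partial>?M)"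
      by (rule emeasure_density) auto
    also have "\<dots> = (\<integral>\<^sup>+x. \<integral>\<^sup>+y. ennreal (f (x, y)) * indicator (A \<times> B) (x, y) \<partial>m2 \<partial>m1)"
      by (subst m2.nn_integral_fst[symmetric]) auto
    also have "\<dots> = (\<integral>\<^sup>+x. (\<integral>\<^sup>+y. ennreal (f (x, y) * indicator B y) \<partial>m2) * indicator A x \<partial>m1)"
      by (intro nn_integral_cong) (auto simp: indicator_def intro!: nn_integral_cong)
    finally show ?thesis .
  qed
  have rect: "emeasure (density ?M (\<lambda>z. ennreal (q z))) X = emeasure (density ?M (\<lambda>z. ennreal (q' z))) X" if "X \<in> ?R" for X
  proof -
    obtain A B where X: "X = A \<times> B" "A \<in> sets m1" "B \<in> sets m2" using \<open>X \<in> ?R\<close> by blast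
    show ?thesis unfolding X(1) em[OF q(1) X(2,3)] em[OF q'(1) X(2,3)]
      by (rule nn_integral_cong_AE) (use eq[OF X(3)] in eventually_elim, simp)
  qed
  have fin: "(\<integral>\<^sup>+z. ennreal (q' z) \<partial>?M) \<noteq> \<infinity>"
  proof -
    have "(\<integral>\<^sup>+z. ennreal (q' z) \<partial>?M) \<le> (\<integral>\<^sup>+z. ennreal K \<partial>?M)" using q'(3) by (intro nn_integral_mono ennreal_leI)
    also have "\<dots> = ennreal K * (emeasure m1 (space m1) * emeasure m2 (space m2))"
      by (simp add: space_pair_measure m2.emeasure_pair_measure_Times)
    also have "\<dots> < \<infinity>" using m1.emeasure_finite m2.emeasure_finite by (simp add: ennreal_mult_eq_top_iff less_top[symmetric])
    finally show ?thesis by simp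
  qed
  have "density ?M (\<lambda>z. ennreal (q' z)) = density ?M (\<lambda>z. ennreal (q z))"
  proof (rule measure_eqI_generator_eq[OF Int_stable_pair_measure_generator pair_measure_closed rect[symmetric], where A = "\<lambda>i. ?\<Omega>"])
    show "emeasure (density ?M (\<lambda>z. ennreal (q' z))) ?\<Omega> \<noteq> \<infinity>" for i :: nat
      using fin by (simp add: emeasure_density space_pair_measure[symmetric] nn_integral_set_ennreal[symmetric] cong: nn_integral_cong_simp)
    show "range (\<lambda>i::nat. ?\<Omega>) \<subseteq> ?R" by blast
  qed (auto simp: sets_pair_measure)
  then have "AE z in ?M. ennreal (q' z) = ennreal (q z)"
    by (subst (asm) finite_density_unique) (use fin in auto)
  then show ?thesis using q(2) q'(2) by (auto elim!: eventually_mono)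
qed

section \<open>Measurability of the distance and of ball volumes\<close>

context proper_mm_space
begin

text \<open>Openness alone does not place a set in the product sigma-algebra; countably many
  rectangles with rational radii and centres in a dense set do.\<close>

lemma dist_less_sets: "{z :: 'a \<times> 'a. dist (fst z) (snd z) < R} \<in> sets (\<mu> \<Otimes>\<^sub>M \<mu>)"
proof -
  obtain D :: "'a set" where D: "countable D" "\<And>x e. e > 0 \<Longrightarrow> \<exists>d\<in>D. dist x d < e"
    using proper_countable_dense[where 'a='a] by metis
  have "{z :: 'a \<times> 'a. dist (fst z) (snd z) < R} = (\<Union>p\<in>D \<times> \<rat>. ball (fst p) (snd p) \<times> ball (fst p) (R - snd p))"
  proof (intro equalityI subsetI)
    fix z :: "'a \<times> 'a" assume "z \<in> {z. dist (fst z) (snd z) < R}"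
    then obtain x y where z: "z = (x, y)" "dist x y < R" by (cases z) auto
    define e where "e = (R - dist x y) / 2"
    have e: "e > 0" using z by (simp add: e_def)
    obtain d where d: "d \<in> D" "dist x d < e" using D(2)[OF e] by blast
    obtain h where h: "h \<in> \<rat>" "dist x d < h" "h < e" using Rats_dense_in_real[OF d(2)] by blast
    have "dist d y \<le> dist x d + dist x y" using dist_triangle[of d y x] by (simp add: dist_commute)
    then have "dist d y < R - h" using h d z by (simp add: e_def field_simps)
    then have "z \<in> ball d h \<times> ball d (R - h)" using z h by (simp add: dist_commute)
    then show "z \<in> (\<Union>p\<in>D \<times> \<rat>. ball (fst p) (snd p) \<times> ball (fst p) (R - snd p))" using d h by force
  next
    fix z assume "z \<in> (\<Union>p\<in>D \<times> \<rat>. ball (fst p) (snd p) \<times> ball (fst p) (R - snd p))"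
    then obtain d h where "dist d (fst z) < h" "dist d (snd z) < R - h" by auto
    then show "z \<in> {z. dist (fst z) (snd z) < R}" using dist_triangle[of "fst z" "snd z" d] by (simp add: dist_commute)
  qed
  also have "\<dots> \<in> sets (\<mu> \<Otimes>\<^sub>M \<mu>)"
    using D(1) countable_rat by (intro sets.countable_UN' countable_SIGMA) auto
  finally show ?thesis .
qed

lemma dist_measurable: "(\<lambda>z :: 'a \<times> 'a. dist (fst z) (snd z)) \<in> borel_measurable (\<mu> \<Otimes>\<^sub>M \<mu>)"
  unfolding borel_measurable_iff_less using dist_less_sets by (simp add: space_pair_measure)

lemma V_measurable: "(\<lambda>x. V \<mu> x R) \<in> borel_measurable \<mu>"
proof -
  have "(\<lambda>x. emeasure \<mu> (Pair x -` {z :: 'a \<times> 'a. dist (fst z) (snd z) < R})) \<in> borel_measurable \<mu>"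
    by (rule measurable_emeasure_Pair[OF dist_less_sets])
  moreover have "Pair x -` {z :: 'a \<times> 'a. dist (fst z) (snd z) < R} = ball x R" for x by (auto simp: ball_def)
  ultimately have "(\<lambda>x. enn2real (emeasure \<mu> (ball x R))) \<in> borel_measurable \<mu>" by simp
  then show ?thesis by (simp add: V_def measure_def)
qed

end

section \<open>Existence and local bounds of the heat kernel at a fixed time\<close>

context heat
begin

text \<open>Restricted to nonnegative f with extended integrals, so that monotone limits can be
  taken without integrability; signed f are split into positive and negative parts at the
  end.\<close>

definition is_kernel :: "real \<Rightarrow> ('a \<times> 'a \<Rightarrow> real) \<Rightarrow> bool" where
  "is_kernel s q \<longleftrightarrow> q \<in> borel_measurable (\<mu> \<Otimes>\<^sub>M \<mu>) \<and> (\<forall>z. 0 \<le> q z) \<and>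
     (\<forall>f\<in>L2 \<mu>. (\<forall>x. 0 \<le> f x) \<longrightarrow> (AE x in \<mu>. ennreal (P s f x) = (\<integral>\<^sup>+y. ennreal (q (x, y) * f y) \<partial>\<mu>)))"

text \<open>Convergence in norm makes the infimum of the squared differences vanish almost
  everywhere; since the images increase, this already gives convergence of the whole
  sequence.\<close>

lemma P_monotone_convergence:
  assumes U: "\<And>i. U i \<in> L2 \<mu>" "\<And>i x. 0 \<le> U i x" and u: "u \<in> L2 \<mu>" and inc: "incseq U" and lim: "\<And>x. (\<lambda>i. U i x) \<longlonglongrightarrow> u x" and s: "0 < s"
  shows "AE x in \<mu>. (\<lambda>i. P s (U i) x) \<longlonglongrightarrow> P s u x"
proof -
  have le: "U i x \<le> u x" for i x using incseq_le[OF _ lim, of x i] inc by (auto simp: incseq_def le_fun_def)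
  define d where "d i x = P s u x - P s (U i) x" for i x
  have dL: "d i \<in> L2 \<mu>" for i unfolding d_def using U u s by (intro L2_diff P_L2) auto
  have [measurable]: "d i \<in> borel_measurable \<mu>" "U i \<in> borel_measurable \<mu>" "u \<in> borel_measurable \<mu>" for i
    using dL U u by (auto intro: L2_measurable)
  have "(\<lambda>i. \<integral>x. (u x - U i x)\<^sup>2 \<partial>\<mu>) \<longlonglongrightarrow> (\<integral>x. 0 \<partial>\<mu>)"
  proof (rule integral_dominated_convergence[where w = "\<lambda>x. (u x)\<^sup>2"])
    show "AE x in \<mu>. (\<lambda>i. (u x - U i x)\<^sup>2) \<longlonglongrightarrow> 0"
    proof (rule AE_I2)
      fix x show "(\<lambda>i. (u x - U i x)\<^sup>2) \<longlonglongrightarrow> 0"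
        using tendsto_power[OF tendsto_diff[OF tendsto_const lim], of "u x" x 2] by simp
    qed
    show "AE x in \<mu>. norm ((u x - U i x)\<^sup>2) \<le> (u x)\<^sup>2" for i
    proof (rule AE_I2)
      fix x have "0 \<le> u x - U i x" "u x - U i x \<le> u x" using le[of i x] U(2)[of i x] by auto
      then show "norm ((u x - U i x)\<^sup>2) \<le> (u x)\<^sup>2" by (simp add: power_mono)
    qed
  qed (use u in \<open>auto intro: L2_integrable_square\<close>)
  then have to0: "(\<lambda>i. \<integral>x. (u x - U i x)\<^sup>2 \<partial>\<mu>) \<longlonglongrightarrow> 0" by simp
  have dle: "(\<integral>x. (d i x)\<^sup>2 \<partial>\<mu>) \<le> (\<integral>x. (u x - U i x)\<^sup>2 \<partial>\<mu>)" for i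
  proof -
    have L: "(\<lambda>x. u x - U i x) \<in> L2 \<mu>" "P s (\<lambda>x. u x - U i x) \<in> L2 \<mu>" using U u s by (auto intro!: L2_diff P_L2)
    have "nrm (P s (\<lambda>x. u x - U i x)) \<le> nrm (\<lambda>x. u x - U i x)" by (rule P_contraction[OF L(1) s])
    then have "ip (P s (\<lambda>x. u x - U i x)) (P s (\<lambda>x. u x - U i x)) \<le> ip (\<lambda>x. u x - U i x) (\<lambda>x. u x - U i x)" by (simp add: l2norm_def)
    moreover have "ip (P s (\<lambda>x. u x - U i x)) (P s (\<lambda>x. u x - U i x)) = ip (d i) (d i)"
      using P_diff[OF u U(1) s, of i] L2_measurable[OF L(2)] by (intro l2inner_AE_cong) (auto simp: d_def)
    ultimately show ?thesis by (simp add: l2inner_def power2_eq_square)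
  qed
  have "(\<lambda>i. \<integral>x. (d i x)\<^sup>2 \<partial>\<mu>) \<longlonglongrightarrow> 0"
    by (rule tendsto_sandwich[OF _ _ tendsto_const to0]) (use dle in \<open>auto intro!: always_eventually Bochner_Integration.integral_nonneg\<close>)
  then have dn: "(\<lambda>i. ennreal (\<integral>x. (d i x)\<^sup>2 \<partial>\<mu>)) \<longlonglongrightarrow> 0" using tendsto_ennrealI by fastforce
  let ?e = "\<lambda>x. INF i. ennreal ((d i x)\<^sup>2)"
  have "(\<integral>\<^sup>+x. ?e x \<partial>\<mu>) \<le> 0"
  proof (rule tendsto_lowerbound[OF dn])
    show "\<forall>\<^sub>F i in sequentially. (\<integral>\<^sup>+x. ?e x \<partial>\<mu>) \<le> ennreal (\<integral>x. (d i x)\<^sup>2 \<partial>\<mu>)"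
    proof (rule always_eventually, rule allI)
      fix i
      have "(\<integral>\<^sup>+x. ?e x \<partial>\<mu>) \<le> (\<integral>\<^sup>+x. ennreal ((d i x)\<^sup>2) \<partial>\<mu>)" by (intro nn_integral_mono INF_lower) auto
      also have "\<dots> = ennreal (\<integral>x. (d i x)\<^sup>2 \<partial>\<mu>)" using L2_integrable_square[OF dL] by (intro nn_integral_eq_integral) auto
      finally show "(\<integral>\<^sup>+x. ?e x \<partial>\<mu>) \<le> ennreal (\<integral>x. (d i x)\<^sup>2 \<partial>\<mu>)" .
    qed
  qed simp
  then have "(\<integral>\<^sup>+x. ?e x \<partial>\<mu>) = 0" by simp
  then have e0: "AE x in \<mu>. ?e x = 0" by (subst (asm) nn_integral_0_iff_AE) auto
  have m1: "AE x in \<mu>. \<forall>i. P s (U i) x \<le> P s (U (Suc i)) x"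
    using inc U s by (subst AE_all_countable) (auto intro!: P_mono simp: incseq_Suc_iff le_fun_def)
  have m2: "AE x in \<mu>. \<forall>i. P s (U i) x \<le> P s u x"
    using le U u s by (subst AE_all_countable) (auto intro!: P_mono)
  from e0 m1 m2 show ?thesis
  proof eventually_elim
    case (elim x)
    show ?case
    proof (rule increasing_LIMSEQ)
      fix e :: real assume e: "0 < e"
      have "?e x < ennreal (e\<^sup>2)" using elim(1) e by simp
      then obtain i where "ennreal ((d i x)\<^sup>2) < ennreal (e\<^sup>2)" by (auto simp: INF_less_iff)
      then have "(d i x)\<^sup>2 < e\<^sup>2" by (simp add: ennreal_less_iff)
      then have "d i x < e" using e by (rule power_less_imp_less_base[OF _ less_imp_le])
      then show "\<exists>i. P s u x \<le> P s (U i) x + e" by (intro exI[of _ i]) (simp add: d_def)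
    qed (use elim in auto)
  qed
qed

end

context heat_kernel_setting
begin

text \<open>For arbitrary s a radius with C2 \<psi>(r) \<le> s is chosen, and the average in
  \<open>harnack_average\<close> is bounded by the total mass. Doubling replaces the centre of the
  ball by the running point, which makes the bound a function of that point alone.\<close>

lemma local_bound:
  assumes s: "0 < s"
  obtains \<kappa>' where "\<kappa>' \<in> borel_measurable \<mu>" "\<And>x. 0 < \<kappa>' x"
    "\<And>f. f \<in> L2 \<mu> \<Longrightarrow> integrable \<mu> f \<Longrightarrow> (\<And>x. 0 \<le> f x) \<Longrightarrow> AE x in \<mu>. P s f x \<le> \<kappa>' x * (\<integral>y. f y \<partial>\<mu>)"
proof -
  obtain r1 where r1: "0 < r1" "\<psi> r1 < s / C2" using psi.small[of "s / C2"] s params by auto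
  obtain r2 where r2: "0 < ereal r2" "ereal r2 < mm_diam \<mu>" using ereal_dense2[OF diam_pos] by auto
  define r where "r = min r1 r2"
  have r: "0 < r" "ereal r < mm_diam \<mu>" using r1 r2 ereal_less_diam_mono[OF r2(2), of r] by (auto simp: r_def)
  have "\<psi> r \<le> \<psi> r1" using r by (intro psi.mono) (auto simp: r_def)
  then have "\<psi> r < s / C2" using r1(2) by simp
  then have \<sigma>: "0 \<le> s - C2 * \<psi> r" using params by (simp add: field_simps)
  have p: "0 < \<psi> r" using r by (intro psi.pos)
  have cr: "0 < c * r" using r params by simp
  define \<kappa>' where "\<kappa>' x = C * (Cv * 2 powr \<alpha>) / V \<mu> x (c * r)" for x
  show thesis
  proof (rule that[of \<kappa>'])
    show "\<kappa>' \<in> borel_measurable \<mu>" unfolding \<kappa>'_def using V_measurable by (intro borel_measurable_divide borel_measurable_const) auto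
    show "0 < \<kappa>' x" for x using params Cv V_pos[OF cr, of x] by (simp add: \<kappa>'_def)
    fix f assume f: "f \<in> L2 \<mu>" "integrable \<mu> f" "\<And>x. 0 \<le> f x"
    let ?I = "\<integral>y. f y \<partial>\<mu>"
    have I0: "0 \<le> ?I" using f(3) by (intro Bochner_Integration.integral_nonneg) auto
    have "AE y in \<mu>. y \<in> UNIV \<longrightarrow> P s f y \<le> \<kappa>' y * ?I"
    proof (rule AE_local)
      fix z :: 'a
      let ?t = "s + (C4 - C2) * \<psi> r" and ?B = "indicat_real (ball z (c * r))"
      have t: "0 < ?t" using s params p by (intro add_pos_nonneg) auto
      have ip: "ip (P ?t f) ?B \<le> ?I" using f ball_finite by (intro ip_P_indicator_le t) auto
      have "C2 * \<psi> r \<le> s" using \<sigma> by simp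
      from harnack_average[OF r f(1,3) this, of z]
      have "AE y in \<mu>. y \<in> ball z (c * r) \<longrightarrow> P s f y \<le> \<kappa>' y * ?I"
      proof eventually_elim
        case (elim y)
        show ?case
        proof
          assume y: "y \<in> ball z (c * r)"
          have Vp: "0 < V \<mu> y (c * r)" "0 < V \<mu> z (c * r)" using cr by (auto intro: V_pos)
          have d: "dist y z \<le> c * r" using y by (simp add: dist_commute)
          have "V \<mu> y (c * r) \<le> Cv * ((c * r + dist y z) / (c * r)) powr \<alpha> * V \<mu> z (c * r)" using cr by (intro doubling_shift) auto
          also have "\<dots> \<le> Cv * 2 powr \<alpha> * V \<mu> z (c * r)"
            using d cr Cv alpha Vp by (intro mult_right_mono mult_left_mono powr_mono2) (auto simp: field_simps)
          finally have "C / V \<mu> z (c * r) \<le> \<kappa>' y" using Vp params by (simp add: \<kappa>'_def field_simps)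
          then have "C / V \<mu> z (c * r) * ?I \<le> \<kappa>' y * ?I" using I0 by (rule mult_right_mono)
          moreover have "C / V \<mu> z (c * r) * ip (P ?t f) ?B \<le> C / V \<mu> z (c * r) * ?I"
            using ip Vp params by (intro mult_left_mono) auto
          ultimately show "P s f y \<le> \<kappa>' y * ?I" using elim y by simp
        qed
      qed
      then show "\<exists>e>0. AE y in \<mu>. y \<in> ball z e \<longrightarrow> P s f y \<le> \<kappa>' y * ?I" using cr by blast
    qed
    then show "AE x in \<mu>. P s f x \<le> \<kappa>' x * ?I" by simp
  qed
qed

text \<open>The measure may be infinite, so a positive integrable weight w makes it finite, and
  dividing by the local bound gives \<tau> B \<le> m(B). The kernel identity for indicators extends
  to all nonnegative functions of the form w u by induction on u.\<close>

lemma kernel_exists: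
  assumes s: "0 < s"
  obtains q where "is_kernel s q"
proof -
  obtain \<kappa>' where k: "\<kappa>' \<in> borel_measurable \<mu>" "\<And>x. 0 < \<kappa>' x"
    "\<And>f. f \<in> L2 \<mu> \<Longrightarrow> integrable \<mu> f \<Longrightarrow> (\<And>x. 0 \<le> f x) \<Longrightarrow> AE x in \<mu>. P s f x \<le> \<kappa>' x * (\<integral>y. f y \<partial>\<mu>)"
    using local_bound[OF s] by blast
  obtain w :: "'a \<Rightarrow> real" where w: "w \<in> borel_measurable \<mu>" "\<And>x. 0 < w x" "\<And>x. w x \<le> 1" "integrable \<mu> w"
    using obtain_positive_integrable_function by blast
  note [measurable] = w(1) k(1)
  have w0: "0 \<le> w x" for x using w(2)[of x] by simp
  define m where "m = density \<mu> (\<lambda>x. ennreal (w x))"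
  have sets_m [simp, measurable_cong]: "sets m = sets \<mu>" by (simp add: m_def)
  have space_m [simp]: "space m = UNIV" by (simp add: m_def)
  have em: "emeasure m B = ennreal (\<integral>y. w y * indicator B y \<partial>\<mu>)" if B [measurable]: "B \<in> sets \<mu>" for B
  proof -
    have "emeasure m B = (\<integral>\<^sup>+y. ennreal (w y * indicator B y) \<partial>\<mu>)"
      unfolding m_def by (subst emeasure_density[OF _ B]) (auto intro!: nn_integral_cong simp: indicator_def)
    also have "\<dots> = ennreal (\<integral>y. w y * indicator B y \<partial>\<mu>)"
      using B w w0 by (intro nn_integral_eq_integral integrable_real_mult_indicator) auto
    finally show ?thesis .
  qed
  interpret m: finite_measure m by standard (simp add: em)
  have wL: "(\<lambda>y. w y * indicat_real B y) \<in> L2 \<mu>" if [measurable]: "B \<in> sets \<mu>" for B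
  proof (rule L2_bound)
    \<comment> \<open>w \<le> 1 gives w \<le> sqrt w, whose square w is integrable.\<close>
    show "(\<lambda>y. sqrt (w y)) \<in> L2 \<mu>" using w w0 by (simp add: L2_def)
    show "\<bar>w x * indicat_real B x\<bar> \<le> \<bar>sqrt (w x)\<bar>" for x
      using w0[of x] w(3)[of x] by (auto simp: indicator_def intro!: real_le_rsqrt simp: power2_eq_square mult_left_le)
  qed measurable
  define \<tau> where "\<tau> B x = P s (\<lambda>y. w y * indicat_real B y) x / \<kappa>' x" for B x
  have AEm: "(AE x in m. Q x) \<longleftrightarrow> (AE x in \<mu>. Q x)" for Q
    unfolding m_def using w(2) by (subst AE_density) auto
  interpret set_function_kernel m m \<tau>
  proof
    fix B assume B: "B \<in> sets m"
    then have B' [measurable]: "B \<in> sets \<mu>" by simp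
    note L = wL[OF B']
    have mB: "measure m B = (\<integral>y. w y * indicator B y \<partial>\<mu>)" unfolding measure_def em[OF B'] using w0 by (intro enn2real_ennreal Bochner_Integration.integral_nonneg) auto
    have "P s (\<lambda>y. w y * indicat_real B y) \<in> borel_measurable \<mu>" using L s by (intro P_measurable) auto
    then have "(\<lambda>x. P s (\<lambda>y. w y * indicat_real B y) x / \<kappa>' x) \<in> borel_measurable \<mu>" by measurable
    then show "\<tau> B \<in> borel_measurable m" unfolding \<tau>_def by (simp cong: measurable_cong_sets)
    have "AE x in \<mu>. 0 \<le> P s (\<lambda>y. w y * indicat_real B y) x" using w0 by (intro P_nonneg[OF L _ s]) auto
    moreover have "AE x in \<mu>. P s (\<lambda>y. w y * indicat_real B y) x \<le> \<kappa>' x * (\<integral>y. w y * indicator B y \<partial>\<mu>)"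
      using w w0 B by (intro k(3)[OF L] integrable_real_mult_indicator) auto
    ultimately have "AE x in \<mu>. 0 \<le> \<tau> B x \<and> \<tau> B x \<le> measure m B"
      by eventually_elim (use k(2) in \<open>auto simp: \<tau>_def mB divide_simps mult.commute less_imp_le\<close>)
    then show "AE x in m. 0 \<le> \<tau> B x \<and> \<tau> B x \<le> measure m B" by (simp only: AEm)
    fix D assume D: "D \<in> sets m" "B \<inter> D = {}"
    have "(\<lambda>y. w y * indicat_real (B \<union> D) y) = (\<lambda>y. w y * indicat_real B y + w y * indicat_real D y)"
      using D(2) by (auto simp: indicator_def fun_eq_iff)
    moreover have "AE x in \<mu>. P s (\<lambda>y. w y * indicat_real B y + w y * indicat_real D y) x = P s (\<lambda>y. w y * indicat_real B y) x + P s (\<lambda>y. w y * indicat_real D y) x"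
      using D by (intro P_add[OF L wL s]) simp
    ultimately have "AE x in \<mu>. \<tau> (B \<union> D) x = \<tau> B x + \<tau> D x" by (auto simp: \<tau>_def add_divide_distrib elim!: eventually_mono)
    then show "AE x in m. \<tau> (B \<union> D) x = \<tau> B x + \<tau> D x" by (simp only: AEm)
  qed
  obtain g where g: "g \<in> borel_measurable (m \<Otimes>\<^sub>M m)" "\<And>z. 0 \<le> g z" "\<And>z. g z \<le> (1::real)"
    "\<And>B. B \<in> sets m \<Longrightarrow> AE x in m. ennreal (\<tau> B x) = (\<integral>\<^sup>+y. ennreal (g (x, y) * indicator B y) \<partial>m)"
    using kernel by blast
  have g_m [measurable]: "g \<in> borel_measurable (\<mu> \<Otimes>\<^sub>M \<mu>)" using g(1) by (simp cong: measurable_cong_sets)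
  \<comment> \<open>Undoes the normalisation of \<tau>; the weight w is already contained in the
    measure m.\<close>
  define q where "q z = \<kappa>' (fst z) * g z" for z
  have q0: "0 \<le> q z" for z using k(2)[of "fst z"] g(2)[of z] by (simp add: q_def)
  have q_m [measurable]: "q \<in> borel_measurable (\<mu> \<Otimes>\<^sub>M \<mu>)" unfolding q_def by measurable
  have main: "(\<lambda>y. w y * u y) \<in> L2 \<mu> \<longrightarrow> (AE x in \<mu>. ennreal (P s (\<lambda>y. w y * u y) x) = (\<integral>\<^sup>+y. ennreal (q (x, y) * (w y * u y)) \<partial>\<mu>))"
    if u: "u \<in> borel_measurable \<mu>" "\<And>x. 0 \<le> u x" for u
    using u
  proof (induction u rule: borel_measurable_induct_real)
    case (set B)
    note [measurable] = set
    from g(4)[of B] set have "AE x in \<mu>. ennreal (\<tau> B x) = (\<integral>\<^sup>+y. ennreal (g (x, y) * indicator B y) \<partial>m)" by (simp add: AEm)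
    then show ?case
    proof (intro impI, eventually_elim)
      case (elim x)
      have "P s (\<lambda>y. w y * indicat_real B y) x = \<kappa>' x * \<tau> B x" using k(2)[of x] by (simp add: \<tau>_def)
      then have "ennreal (P s (\<lambda>y. w y * indicat_real B y) x) = ennreal (\<kappa>' x) * ennreal (\<tau> B x)" using k(2)[of x] by (simp add: ennreal_mult')
      also have "\<dots> = ennreal (\<kappa>' x) * (\<integral>\<^sup>+y. ennreal (w y) * ennreal (g (x, y) * indicator B y) \<partial>\<mu>)"
        unfolding elim m_def by (subst nn_integral_density) auto
      also have "\<dots> = (\<integral>\<^sup>+y. ennreal (\<kappa>' x) * (ennreal (w y) * ennreal (g (x, y) * indicator B y)) \<partial>\<mu>)"
        by (rule nn_integral_cmult[symmetric]) measurable
      also have "\<dots> = (\<integral>\<^sup>+y. ennreal (q (x, y) * (w y * indicator B y)) \<partial>\<mu>)"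
        using less_imp_le[OF k(2)[of x]] w0 g(2) by (intro nn_integral_cong) (auto simp: ennreal_mult[symmetric] q_def mult_ac)
      finally show ?case .
    qed
  next
    case (mult u a)
    show ?case
    proof
      assume L: "(\<lambda>y. w y * (a * u y)) \<in> L2 \<mu>"
      show "AE x in \<mu>. ennreal (P s (\<lambda>y. w y * (a * u y)) x) = (\<integral>\<^sup>+y. ennreal (q (x, y) * (w y * (a * u y))) \<partial>\<mu>)"
      proof (cases "a = 0")
        case True
        have "AE x in \<mu>. P s (\<lambda>x. 0 * (0::real)) x = 0 * P s (\<lambda>x. 0) x" by (rule P_scale[OF L2_zero s])
        then show ?thesis using True by (auto elim!: eventually_mono)
      next
        case False
        have "(\<lambda>y. (1 / a) * (w y * (a * u y))) \<in> L2 \<mu>" using L by (rule L2_scale)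
        then have uL: "(\<lambda>y. w y * u y) \<in> L2 \<mu>" using False by simp
        have "(\<lambda>y. a * (w y * u y)) = (\<lambda>y. w y * (a * u y))" by (simp add: fun_eq_iff)
        with P_scale[OF uL s, of a] have 1: "AE x in \<mu>. P s (\<lambda>y. w y * (a * u y)) x = a * P s (\<lambda>y. w y * u y) x" by simp
        have 2: "AE x in \<mu>. ennreal (P s (\<lambda>y. w y * u y) x) = (\<integral>\<^sup>+y. ennreal (q (x, y) * (w y * u y)) \<partial>\<mu>)" using mult uL by blast
        note [measurable] = mult(2)
        from 1 2 show ?thesis
        proof eventually_elim
          case (elim x)
          have "ennreal (P s (\<lambda>y. w y * (a * u y)) x) = ennreal a * ennreal (P s (\<lambda>y. w y * u y) x)" using elim(1) mult(1) by (simp add: ennreal_mult')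
          also have "\<dots> = (\<integral>\<^sup>+y. ennreal a * ennreal (q (x, y) * (w y * u y)) \<partial>\<mu>)" unfolding elim(2) by (rule nn_integral_cmult[symmetric]) measurable
          also have "\<dots> = (\<integral>\<^sup>+y. ennreal (q (x, y) * (w y * (a * u y))) \<partial>\<mu>)"
            using mult(1) by (intro nn_integral_cong) (simp add: ennreal_mult'[symmetric] mult_ac)
          finally show ?case .
        qed
      qed
    qed
  next
    case (add u v)
    show ?case
    proof
      assume L: "(\<lambda>y. w y * (v y + u y)) \<in> L2 \<mu>"
      note [measurable] = add(1,3)
      have uv: "(\<lambda>y. w y * u y) \<in> L2 \<mu>" "(\<lambda>y. w y * v y) \<in> L2 \<mu>"
        using add(2,4) w0 by (auto intro!: L2_bound[OF L] simp: abs_mult mult_left_mono)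
      have 1: "AE x in \<mu>. P s (\<lambda>y. w y * v y + w y * u y) x = P s (\<lambda>y. w y * v y) x + P s (\<lambda>y. w y * u y) x" by (rule P_add[OF uv(2,1) s])
      have 2: "AE x in \<mu>. ennreal (P s (\<lambda>y. w y * u y) x) = (\<integral>\<^sup>+y. ennreal (q (x, y) * (w y * u y)) \<partial>\<mu>)" using add uv by blast
      have 3: "AE x in \<mu>. ennreal (P s (\<lambda>y. w y * v y) x) = (\<integral>\<^sup>+y. ennreal (q (x, y) * (w y * v y)) \<partial>\<mu>)" using add uv by blast
      have 4: "AE x in \<mu>. 0 \<le> P s (\<lambda>y. w y * u y) x" using add w0 by (intro P_nonneg[OF uv(1) _ s]) auto
      have 5: "AE x in \<mu>. 0 \<le> P s (\<lambda>y. w y * v y) x" using add w0 by (intro P_nonneg[OF uv(2) _ s]) auto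
      from 1 2 3 4 5 show "AE x in \<mu>. ennreal (P s (\<lambda>y. w y * (v y + u y)) x) = (\<integral>\<^sup>+y. ennreal (q (x, y) * (w y * (v y + u y))) \<partial>\<mu>)"
      proof eventually_elim
        case (elim x)
        have "ennreal (P s (\<lambda>y. w y * (v y + u y)) x) = ennreal (P s (\<lambda>y. w y * v y) x) + ennreal (P s (\<lambda>y. w y * u y) x)"
          using elim(1,4,5) by (simp add: distrib_left)
        also have "\<dots> = (\<integral>\<^sup>+y. ennreal (q (x, y) * (w y * v y)) + ennreal (q (x, y) * (w y * u y)) \<partial>\<mu>)"
          unfolding elim(2,3) by (rule nn_integral_add[symmetric]) measurable
        also have "\<dots> = (\<integral>\<^sup>+y. ennreal (q (x, y) * (w y * (v y + u y))) \<partial>\<mu>)"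
          using add w0 q0 by (intro nn_integral_cong) (simp add: distrib_left)
        finally show ?case .
      qed
    qed
  next
    case (seq U)
    show ?case
    proof
      assume L: "(\<lambda>y. w y * u y) \<in> L2 \<mu>"
      note [measurable] = seq.hyps(1)
      have U0: "0 \<le> w y * U i y" for i y using seq.hyps(2) w0 by simp
      have Ule: "U i y \<le> u y" for i y using incseq_le[OF _ seq.hyps(4), of y i] seq.hyps(3) by (auto simp: incseq_def le_fun_def)
      have UL: "(\<lambda>y. w y * U i y) \<in> L2 \<mu>" for i
      proof (rule L2_bound[OF L])
        show "\<bar>w y * U i y\<bar> \<le> \<bar>w y * u y\<bar>" for y
          using mult_left_mono[OF Ule[of i y] w0[of y]] U0[of y i] by linarith
      qed measurable
      have inc: "incseq (\<lambda>i y. w y * U i y)" using seq.hyps(3) w0 by (auto simp: incseq_def le_fun_def intro!: mult_left_mono)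
      have lim: "(\<lambda>i. w y * U i y) \<longlonglongrightarrow> w y * u y" for y using seq.hyps(4)[of y] by (intro tendsto_mult_left) simp
      have 1: "AE x in \<mu>. (\<lambda>i. P s (\<lambda>y. w y * U i y) x) \<longlonglongrightarrow> P s (\<lambda>y. w y * u y) x"
        by (rule P_monotone_convergence[OF UL U0 L inc lim s])
      have 2: "AE x in \<mu>. \<forall>i. ennreal (P s (\<lambda>y. w y * U i y) x) = (\<integral>\<^sup>+y. ennreal (q (x, y) * (w y * U i y)) \<partial>\<mu>)"
        using seq.IH UL by (subst AE_all_countable) blast
      from 1 2 show "AE x in \<mu>. ennreal (P s (\<lambda>y. w y * u y) x) = (\<integral>\<^sup>+y. ennreal (q (x, y) * (w y * u y)) \<partial>\<mu>)"
      proof eventually_elim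
        case (elim x)
        have "(\<lambda>i. \<integral>\<^sup>+y. ennreal (q (x, y) * (w y * U i y)) \<partial>\<mu>) \<longlonglongrightarrow> (\<integral>\<^sup>+y. ennreal (q (x, y) * (w y * u y)) \<partial>\<mu>)"
        proof (rule nn_integral_LIMSEQ)
          show "incseq (\<lambda>i y. ennreal (q (x, y) * (w y * U i y)))"
            using seq.hyps(3) w0 q0 by (auto simp: incseq_def le_fun_def intro!: ennreal_leI mult_left_mono)
          show "(\<lambda>y. ennreal (q (x, y) * (w y * U i y))) \<in> borel_measurable \<mu>" for i by measurable
          show "(\<lambda>i. ennreal (q (x, y) * (w y * U i y))) \<longlonglongrightarrow> ennreal (q (x, y) * (w y * u y))" for y
            by (intro tendsto_ennrealI tendsto_mult_left lim)
        qed
        moreover have "(\<lambda>i. ennreal (P s (\<lambda>y. w y * U i y) x)) \<longlonglongrightarrow> ennreal (P s (\<lambda>y. w y * u y) x)"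
          by (intro tendsto_ennrealI elim(1))
        ultimately show ?case unfolding spec[OF elim(2)] by (meson LIMSEQ_unique)
      qed
    qed
  qed
  have "is_kernel s q"
    unfolding is_kernel_def
  proof (intro conjI allI ballI impI q_m q0)
    fix f assume f: "f \<in> L2 \<mu>" "\<forall>x. 0 \<le> f x"
    have [measurable]: "f \<in> borel_measurable \<mu>" using f by (intro L2_measurable)
    have "w y * (f y / w y) = f y" for y using w(2)[of y] by simp
    with main[of "\<lambda>y. f y / w y", unfolded this] f w0 show "AE x in \<mu>. ennreal (P s f x) = (\<integral>\<^sup>+y. ennreal (q (x, y) * f y) \<partial>\<mu>)" by simp
  qed
  then show thesis by (rule that)
qed

text \<open>The operator bounds make (P 1_D - a m2(D)) / (b - a) a set function between 0 and m2(D).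
  Its kernel g lies in [0,1], so a + (b - a) g lies in [a,b], and it agrees with q on the box
  because both have the same integrals.\<close>

lemma kernel_box:
  assumes s: "0 < s" and q: "is_kernel s q" and A: "bounded A" "A \<in> sets borel" and B: "bounded B" "B \<in> sets borel"
    and ab: "0 \<le> a" "a < b"
    and bounds: "\<And>f. f \<in> L2 \<mu> \<Longrightarrow> (\<And>y. 0 \<le> f y) \<Longrightarrow> (\<And>y. y \<notin> B \<Longrightarrow> f y = 0) \<Longrightarrow>
      AE x in \<mu>. x \<in> A \<longrightarrow> a * (\<integral>y. f y \<partial>\<mu>) \<le> P s f x \<and> P s f x \<le> b * (\<integral>y. f y \<partial>\<mu>)"
  shows "AE z in \<mu> \<Otimes>\<^sub>M \<mu>. z \<in> A \<times> B \<longrightarrow> a \<le> q z \<and> q z \<le> b"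
proof -
  have [measurable]: "A \<in> sets \<mu>" "B \<in> sets \<mu>" using A B by auto
  have q_m [measurable]: "q \<in> borel_measurable (\<mu> \<Otimes>\<^sub>M \<mu>)" and q0: "\<And>z. 0 \<le> q z" using q by (auto simp: is_kernel_def)
  define m1 where "m1 = density \<mu> (indicator A :: 'a \<Rightarrow> ennreal)"
  define m2 where "m2 = density \<mu> (indicator B :: 'a \<Rightarrow> ennreal)"
  have sets_m [simp, measurable_cong]: "sets m1 = sets \<mu>" "sets m2 = sets \<mu>" by (auto simp: m1_def m2_def)
  have em: "emeasure m1 D = emeasure \<mu> (A \<inter> D)" "emeasure m2 D = emeasure \<mu> (B \<inter> D)" if "D \<in> sets \<mu>" for D
    using that by (auto simp: m1_def m2_def emeasure_density nn_integral_set_ennreal[symmetric] indicator_inter_arith[symmetric])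
  have fin: "emeasure \<mu> (A \<inter> D) < \<infinity>" "emeasure \<mu> (B \<inter> D) < \<infinity>" for D
    by (rule bounded_finite, simp add: bounded_Int A B)+
  interpret m1: finite_measure m1 by standard (use em[of UNIV] fin[of UNIV] in \<open>simp add: m1_def\<close>)
  interpret m2: finite_measure m2 by standard (use em[of UNIV] fin[of UNIV] in \<open>simp add: m2_def\<close>)
  have AEm: "(AE x in m1. Q x) \<longleftrightarrow> (AE x in \<mu>. x \<in> A \<longrightarrow> Q x)" for Q
    unfolding m1_def by (subst AE_density) (auto simp: indicator_def split: if_splits)
  let ?I = "\<lambda>D. indicat_real (B \<inter> D)"
  have IL: "?I D \<in> L2 \<mu>" if "D \<in> sets \<mu>" for D using B that by (intro indicator_L2 bounded_Int) auto
  have int: "(\<integral>y. ?I D y \<partial>\<mu>) = measure m2 D" if "D \<in> sets \<mu>" for D using that by (simp add: measure_def em)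
  define \<tau> where "\<tau> D x = (P s (?I D) x - a * measure m2 D) / (b - a)" for D x
  interpret set_function_kernel m1 m2 \<tau>
  proof
    fix D assume D: "D \<in> sets m2"
    then have D': "D \<in> sets \<mu>" by simp
    have "P s (?I D) \<in> borel_measurable \<mu>" using IL[OF D'] s by (intro P_measurable) auto
    then have "(\<lambda>x. (P s (?I D) x - a * measure m2 D) / (b - a)) \<in> borel_measurable \<mu>" by measurable
    then show "\<tau> D \<in> borel_measurable m1" unfolding \<tau>_def by (simp cong: measurable_cong_sets)
    have "AE x in \<mu>. x \<in> A \<longrightarrow> a * measure m2 D \<le> P s (?I D) x \<and> P s (?I D) x \<le> b * measure m2 D"
      using bounds[OF IL[OF D']] unfolding int[OF D'] by (auto simp: indicator_def)
    then have "AE x in \<mu>. x \<in> A \<longrightarrow> 0 \<le> \<tau> D x \<and> \<tau> D x \<le> measure m2 D"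
      by eventually_elim (use ab in \<open>auto simp: \<tau>_def divide_simps algebra_simps\<close>)
    then show "AE x in m1. 0 \<le> \<tau> D x \<and> \<tau> D x \<le> measure m2 D" by (simp only: AEm)
    fix D2 assume D2: "D2 \<in> sets m2" "D \<inter> D2 = {}"
    have "?I (D \<union> D2) = (\<lambda>y. ?I D y + ?I D2 y)" using D2 by (auto simp: indicator_def fun_eq_iff)
    moreover have "AE x in \<mu>. P s (\<lambda>y. ?I D y + ?I D2 y) x = P s (?I D) x + P s (?I D2) x"
      using D2 by (intro P_add[OF IL[OF D'] IL s]) simp
    moreover have "measure m2 (D \<union> D2) = measure m2 D + measure m2 D2" using D D2 by (intro m2.finite_measure_Union)
    ultimately have "AE x in \<mu>. \<tau> (D \<union> D2) x = \<tau> D x + \<tau> D2 x"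
      by (auto simp: \<tau>_def algebra_simps add_divide_distrib diff_divide_distrib elim!: eventually_mono)
    then show "AE x in m1. \<tau> (D \<union> D2) x = \<tau> D x + \<tau> D2 x" by (auto simp: AEm elim!: eventually_mono)
  qed
  obtain g where g: "g \<in> borel_measurable (m1 \<Otimes>\<^sub>M m2)" "\<And>z. 0 \<le> g z" "\<And>z. g z \<le> (1::real)"
    "\<And>D. D \<in> sets m2 \<Longrightarrow> AE x in m1. ennreal (\<tau> D x) = (\<integral>\<^sup>+y. ennreal (g (x, y) * indicator D y) \<partial>m2)"
    using kernel by blast
  note [measurable] = g(1)
  define q' where "q' z = a + (b - a) * g z" for z
  have q'a: "a \<le> q' z" for z using g(2)[of z] ab by (simp add: q'_def)
  have q'b: "q' z \<le> b" for z
    using mult_left_mono[OF g(3)[of z] diff_ge_0_iff_ge[THEN iffD2, OF less_imp_le[OF ab(2)]]] by (simp add: q'_def algebra_simps)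
  have "AE z in m1 \<Otimes>\<^sub>M m2. q z = q' z"
  proof (rule rectangle_integrals_determine[OF m1.finite_measure_axioms m2.finite_measure_axioms _ q0 _ _ q'b])
    show "q \<in> borel_measurable (m1 \<Otimes>\<^sub>M m2)" using q_m by (simp cong: measurable_cong_sets)
    show "q' \<in> borel_measurable (m1 \<Otimes>\<^sub>M m2)" unfolding q'_def by measurable
    show "0 \<le> q' z" for z using q'a[of z] ab by simp
    fix D assume D: "D \<in> sets m2"
    then have D' [measurable]: "D \<in> sets \<mu>" by simp
    have 1: "AE x in \<mu>. ennreal (P s (?I D) x) = (\<integral>\<^sup>+y. ennreal (q (x, y) * ?I D y) \<partial>\<mu>)"
      using q IL[OF D'] by (auto simp: is_kernel_def)
    have 2: "AE x in \<mu>. x \<in> A \<longrightarrow> ennreal (\<tau> D x) = (\<integral>\<^sup>+y. ennreal (g (x, y) * indicator D y) \<partial>m2)"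
      using g(4)[OF D] by (simp only: AEm)
    have 3: "AE x in \<mu>. x \<in> A \<longrightarrow> 0 \<le> \<tau> D x" using tau_bounds[OF D] unfolding AEm by eventually_elim auto
    from 1 2 3 have "AE x in \<mu>. x \<in> A \<longrightarrow> (\<integral>\<^sup>+y. ennreal (q (x, y) * indicator D y) \<partial>m2) = (\<integral>\<^sup>+y. ennreal (q' (x, y) * indicator D y) \<partial>m2)"
    proof eventually_elim
      case (elim x)
      show ?case
      proof
        assume x: "x \<in> A"
        have "(\<integral>\<^sup>+y. ennreal (q (x, y) * indicator D y) \<partial>m2) = (\<integral>\<^sup>+y. indicator B y * ennreal (q (x, y) * indicator D y) \<partial>\<mu>)"
          unfolding m2_def by (subst nn_integral_density) auto
        also have "\<dots> = (\<integral>\<^sup>+y. ennreal (q (x, y) * ?I D y) \<partial>\<mu>)" by (intro nn_integral_cong) (auto simp: indicator_def)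
        also have "\<dots> = ennreal (P s (?I D) x)" using elim(1) by simp
        also have "P s (?I D) x = a * measure m2 D + (b - a) * \<tau> D x" using ab by (simp add: \<tau>_def)
        also have "ennreal \<dots> = ennreal a * emeasure m2 D + ennreal (b - a) * ennreal (\<tau> D x)"
          using ab elim(3) x by (simp add: m2.emeasure_eq_measure ennreal_mult)
        also have "\<dots> = (\<integral>\<^sup>+y. ennreal a * indicator D y \<partial>m2) + (\<integral>\<^sup>+y. ennreal (b - a) * ennreal (g (x, y) * indicator D y) \<partial>m2)"
        proof -
          have "(\<lambda>y. g (x, y)) \<in> borel_measurable m2"
            by (rule measurable_compose[OF measurable_Pair1' g(1)]) (simp add: m1_def)
          then have "(\<lambda>y. ennreal (g (x, y) * indicator D y)) \<in> borel_measurable m2" using D by measurable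
          from nn_integral_cmult[OF this] show ?thesis using elim(2) x D by (simp add: nn_integral_cmult_indicator)
        qed
        also have "\<dots> = (\<integral>\<^sup>+y. ennreal a * indicator D y + ennreal (b - a) * ennreal (g (x, y) * indicator D y) \<partial>m2)"
        proof (rule nn_integral_add[symmetric])
          have "(\<lambda>y. g (x, y)) \<in> borel_measurable m2"
            by (rule measurable_compose[OF measurable_Pair1' g(1)]) (simp add: m1_def)
          then show "(\<lambda>y. ennreal (b - a) * ennreal (g (x, y) * indicator D y)) \<in> borel_measurable m2" using D by measurable
        qed (use D in measurable)
        also have "\<dots> = (\<integral>\<^sup>+y. ennreal (q' (x, y) * indicator D y) \<partial>m2)"
          using ab g(2) by (intro nn_integral_cong) (auto simp: indicator_def q'_def ennreal_mult)
        finally show "(\<integral>\<^sup>+y. ennreal (q (x, y) * indicator D y) \<partial>m2) = \<dots>" .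
      qed
    qed
    then show "AE x in m1. (\<integral>\<^sup>+y. ennreal (q (x, y) * indicator D y) \<partial>m2) = (\<integral>\<^sup>+y. ennreal (q' (x, y) * indicator D y) \<partial>m2)"
      by (simp only: AEm)
  qed
  then have "AE z in m1 \<Otimes>\<^sub>M m2. a \<le> q z \<and> q z \<le> b" by eventually_elim (use q'a q'b in auto)
  moreover have eq: "m1 \<Otimes>\<^sub>M m2 = density (\<mu> \<Otimes>\<^sub>M \<mu>) (\<lambda>(x, y). indicator A x * indicator B y)"
    unfolding m1_def m2_def
    by (rule pair_measure_density) (use m2.sigma_finite_measure_axioms in \<open>auto simp: m2_def intro: sigma_finite_measure_axioms\<close>)
  ultimately have "AE z in density (\<mu> \<Otimes>\<^sub>M \<mu>) (\<lambda>(x, y). indicator A x * indicator B y). a \<le> q z \<and> q z \<le> b" by (simp only:)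
  then have "AE z in \<mu> \<Otimes>\<^sub>M \<mu>. (0::ennreal) < (case z of (x, y) \<Rightarrow> indicator A x * indicator B y) \<longrightarrow> a \<le> q z \<and> q z \<le> b"
    by (subst (asm) AE_density) auto
  then show ?thesis by eventually_elim (auto simp: indicator_def)
qed

end

section \<open>Pointwise heat kernel bounds\<close>

lemma (in proper_mm_space) AE_local_product:
  assumes "\<And>x y. \<exists>p>0. AE z in \<mu> \<Otimes>\<^sub>M \<mu>. z \<in> ball x p \<times> ball y p \<longrightarrow> Q z"
  shows "AE z in \<mu> \<Otimes>\<^sub>M \<mu>. Q z"
proof -
  obtain D :: "'a set" where D: "countable D" "\<And>x e. e > 0 \<Longrightarrow> \<exists>d\<in>D. dist x d < e"
    using proper_countable_dense[where 'a='a] by metis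
  let ?G = "{p \<in> D \<times> D \<times> \<rat>. AE z in \<mu> \<Otimes>\<^sub>M \<mu>. z \<in> ball (fst p) (snd (snd p)) \<times> ball (fst (snd p)) (snd (snd p)) \<longrightarrow> Q z}"
  have "countable ?G" using D(1) countable_rat by (intro countable_subset[of ?G "D \<times> D \<times> \<rat>"] countable_SIGMA) auto
  then have "AE z in \<mu> \<Otimes>\<^sub>M \<mu>. \<forall>p\<in>?G. z \<in> ball (fst p) (snd (snd p)) \<times> ball (fst (snd p)) (snd (snd p)) \<longrightarrow> Q z"
    by (subst AE_ball_countable) auto
  then show ?thesis
  proof eventually_elim
    case (elim z)
    obtain x y where z: "z = (x, y)" by (cases z)
    obtain p where p: "p > 0" "AE z in \<mu> \<Otimes>\<^sub>M \<mu>. z \<in> ball x p \<times> ball y p \<longrightarrow> Q z" using assms by blast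
    obtain h where h: "h \<in> \<rat>" "0 < h" "h < p / 2" using Rats_dense_in_real[of 0 "p / 2"] p by auto
    obtain d e where de: "d \<in> D" "dist x d < h" "e \<in> D" "dist y e < h" using D(2)[OF h(2)] by metis
    have sub: "ball d h \<subseteq> ball x p" "ball e h \<subseteq> ball y p"
    proof (auto)
      fix u assume "dist d u < h"
      then show "dist x u < p" using dist_triangle[of x u d] de h by simp
    next
      fix u assume "dist e u < h"
      then show "dist y u < p" using dist_triangle[of y u e] de h by simp
    qed
    have "AE z in \<mu> \<Otimes>\<^sub>M \<mu>. z \<in> ball d h \<times> ball e h \<longrightarrow> Q z"
      using p(2) by eventually_elim (use sub in blast)
    then have "(d, e, h) \<in> ?G" using de h by simp
    from bspec[OF elim this] show ?case using de by (simp add: z dist_commute)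
  qed
qed

context scale_comparison
begin

lemma S_mono:
  assumes "0 < r" "ereal r < mm_diam \<mu>" "0 \<le> d" "d \<le> d'"
  shows "S (\<psi> r) d \<le> S (\<psi> r) d'"
  unfolding S_def
proof (rule cSUP_mono)
  show "bdd_above (\<phi> (\<psi> r) d' ` {0<..})" using assms by (intro phi_bdd) auto
  fix s :: real assume "s \<in> {0<..}"
  then show "\<exists>s'\<in>{0<..}. \<phi> (\<psi> r) d s \<le> \<phi> (\<psi> r) d' s'"
    using assms rho.mono[of d d'] rho.pos[of s] by (intro bexI[of _ s]) (auto simp: \<phi>_def divide_right_mono)
qed auto

text \<open>With c' = 1/D in \<open>exponent_upper\<close>, the bound \<rho>(d) \<le> D \<rho>(d0)
  turns the weighted distance term for d into at most the one for d0. The upper estimate for the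
  exponent at d is thereby compared with S at d0.\<close>

lemma S_doubling:
  obtains A B where "A \<ge> 0" "B > 0"
    "\<And>r d d0. 0 < r \<Longrightarrow> ereal r < mm_diam \<mu> \<Longrightarrow> 0 \<le> d \<Longrightarrow> ereal d \<le> mm_diam \<mu> \<Longrightarrow> d \<le> 2 * d0 \<Longrightarrow>
      S (\<psi> r) d \<le> A + B * S (\<psi> r) d0"
proof -
  define D where "D = K\<rho> * 2 powr \<gamma>'"
  have D: "D > 0" using rho.K_pos by (simp add: D_def)
  obtain c2 A where c2: "c2 > 0" and A: "A \<ge> 0" and ex:
    "\<And>r d. 0 < r \<Longrightarrow> ereal r < mm_diam \<mu> \<Longrightarrow> 0 \<le> d \<Longrightarrow> ereal d \<le> mm_diam \<mu> \<Longrightarrow>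
      S (\<psi> r) d \<le> A \<or> (\<exists>s>0. ereal s < mm_diam \<mu> \<and> 1 * (\<psi> r / \<psi> s) - (1 / D) * (\<rho> d / \<rho> s) \<le> A - c2 * S (\<psi> r) d)"
    using exponent_upper[of 1 "1 / D"] D by auto
  have B: "0 < 1 / c2" using c2 by simp
  have A': "0 \<le> A + A / c2" using A c2 by simp
  show thesis
  proof (rule that[OF A' B])
    fix r d d0 assume r: "0 < r" "ereal r < mm_diam \<mu>" and d: "0 \<le> d" "ereal d \<le> mm_diam \<mu>" "d \<le> 2 * d0"
    have d0: "0 \<le> d0" using d by simp
    have S0: "0 \<le> S (\<psi> r) d0" using S_nonneg[OF r d0] .
    show "S (\<psi> r) d \<le> A + A / c2 + 1 / c2 * S (\<psi> r) d0"
      using ex[OF r d(1,2)]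
    proof
      assume "S (\<psi> r) d \<le> A"
      moreover have "0 \<le> A / c2 + 1 / c2 * S (\<psi> r) d0" using S0 A c2 by simp
      ultimately show ?thesis by linarith
    next
      assume "\<exists>s>0. ereal s < mm_diam \<mu> \<and> 1 * (\<psi> r / \<psi> s) - (1 / D) * (\<rho> d / \<rho> s) \<le> A - c2 * S (\<psi> r) d"
      then obtain s where s: "0 < s" "\<psi> r / \<psi> s - (1 / D) * (\<rho> d / \<rho> s) \<le> A - c2 * S (\<psi> r) d" by auto
      have "\<rho> d \<le> D * \<rho> d0"
      proof (cases "d0 = 0")
        case True
        then show ?thesis using d rho.at_0 by simp
      next
        case False
        then have "\<rho> d / \<rho> d0 \<le> D" unfolding D_def using d d0 by (intro rho_ratio_bound) auto
        then show ?thesis using rho.pos[of d0] False d0 by (simp add: divide_le_eq)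
      qed
      then have "(1 / D) * (\<rho> d / \<rho> s) \<le> \<rho> d0 / \<rho> s" using D rho.pos[OF s(1)] by (simp add: field_simps)
      moreover have "\<phi> (\<psi> r) d0 s \<le> S (\<psi> r) d0" by (rule phi_le_S[OF r d0 s(1)])
      ultimately have "c2 * S (\<psi> r) d \<le> A + S (\<psi> r) d0" using s(2) by (simp add: \<phi>_def)
      then have "S (\<psi> r) d \<le> A / c2 + 1 / c2 * S (\<psi> r) d0" using c2 by (simp add: field_simps)
      then show ?thesis using A by simp
    qed
  qed
qed

text \<open>The operator bound involves the distance between two balls; it has to be replaced by the
  distance of the points themselves, at the price of constants.\<close>

lemma kernel_upper:
  obtains Cu cu where "Cu > 0" "cu > 0"
    "\<And>r q. 0 < r \<Longrightarrow> ereal r < mm_diam \<mu> \<Longrightarrow> is_kernel (\<psi> r) q \<Longrightarrow>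
      AE z in \<mu> \<Otimes>\<^sub>M \<mu>. q z \<le> Cu / V \<mu> (fst z) r * exp (- cu * S (\<psi> r) (dist (fst z) (snd z)))"
proof -
  obtain C0 c0 where C0: "C0 > 0" and c0: "c0 > 0" and up:
    "\<And>r z w f. 0 < r \<Longrightarrow> ereal r < mm_diam \<mu> \<Longrightarrow> f \<in> L2 \<mu> \<Longrightarrow> (\<And>y. 0 \<le> f y) \<Longrightarrow> (\<And>y. y \<notin> ball w (c * r) \<Longrightarrow> f y = 0) \<Longrightarrow>
      AE y in \<mu>. y \<in> ball z (c * r) \<longrightarrow>
        P (\<psi> r) f y \<le> C0 / V \<mu> z (c * r) * exp (- c0 * S (\<psi> r) (max 0 (dist z w - 2 * (c * r)))) * (\<integral>y. f y \<partial>\<mu>)"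
    using semigroup_upper by blast
  obtain A B where A: "A \<ge> 0" and B: "B > 0" and dbl:
    "\<And>r d d0. 0 < r \<Longrightarrow> ereal r < mm_diam \<mu> \<Longrightarrow> 0 \<le> d \<Longrightarrow> ereal d \<le> mm_diam \<mu> \<Longrightarrow> d \<le> 2 * d0 \<Longrightarrow>
      S (\<psi> r) d \<le> A + B * S (\<psi> r) d0"
    using S_doubling by blast
  define B0 where "B0 = K\<rho> * 8 powr \<gamma>' + (K\<rho> * 8 powr \<gamma>')\<^sup>2 * G"
  have B0: "0 \<le> B0" using rho.K_pos G by (simp add: B0_def)
  define cu where "cu = c0 / B"
  have cu: "cu > 0" using c0 B by (simp add: cu_def)
  define H where "H = Cv * (2 / c) powr \<alpha>"
  have H: "H > 0" using Cv params by (simp add: H_def)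
  define Cu where "Cu = C0 * H * exp (cu * (A + B0))"
  have Cu: "Cu > 0" using C0 H by (simp add: Cu_def)
  show thesis
  proof (rule that[OF Cu cu])
    fix r q assume r: "0 < r" "ereal r < mm_diam \<mu>" and q: "is_kernel (\<psi> r) q"
    have p: "0 < \<psi> r" using r by (intro psi.pos)
    have cr: "0 < c * r" "c * r \<le> r" using r params mult_right_mono[of c 1 r] by auto
    show "AE z in \<mu> \<Otimes>\<^sub>M \<mu>. q z \<le> Cu / V \<mu> (fst z) r * exp (- cu * S (\<psi> r) (dist (fst z) (snd z)))"
    proof (rule AE_local_product)
      fix x y :: 'a
      define d0 where "d0 = max 0 (dist x y - 2 * (c * r))"
      have d0: "0 \<le> d0" by (simp add: d0_def)
      define b where "b = C0 / V \<mu> x (c * r) * exp (- c0 * S (\<psi> r) d0)"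
      have b: "0 < b" using C0 V_pos[OF cr(1), of x] by (simp add: b_def)
      have box: "AE z in \<mu> \<Otimes>\<^sub>M \<mu>. z \<in> ball x (c * r) \<times> ball y (c * r) \<longrightarrow> 0 \<le> q z \<and> q z \<le> b"
      proof (rule kernel_box[OF p q _ _ _ _ order_refl b])
        fix f assume f: "f \<in> L2 \<mu>" "\<And>u. 0 \<le> f u" "\<And>u. u \<notin> ball y (c * r) \<Longrightarrow> f u = 0"
        have 1: "AE u in \<mu>. 0 \<le> P (\<psi> r) f u" using f by (intro P_nonneg[OF f(1) _ p]) auto
        have 2: "AE u in \<mu>. u \<in> ball x (c * r) \<longrightarrow> P (\<psi> r) f u \<le> b * (\<integral>u. f u \<partial>\<mu>)"
          unfolding b_def d0_def by (rule up[OF r f])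
        from 1 2 show "AE u in \<mu>. u \<in> ball x (c * r) \<longrightarrow> 0 * (\<integral>u. f u \<partial>\<mu>) \<le> P (\<psi> r) f u \<and> P (\<psi> r) f u \<le> b * (\<integral>u. f u \<partial>\<mu>)"
          by eventually_elim simp
      qed auto
      have bound: "b \<le> Cu / V \<mu> x' r * exp (- cu * S (\<psi> r) (dist x' y'))" if x': "x' \<in> ball x (c * r)" and y': "y' \<in> ball y (c * r)" for x' y'
      proof -
        define d where "d = dist x' y'"
        have d: "0 \<le> d" "ereal d \<le> mm_diam \<mu>" using dist_le_diam[of x' y'] by (auto simp: d_def)
        have dx: "d \<le> dist x y + 2 * (c * r)"
          using x' y' dist_triangle[of x' y' x] dist_triangle[of x y' y] by (simp add: d_def dist_commute)
        have S0: "0 \<le> S (\<psi> r) d0" by (rule S_nonneg[OF r d0])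
        \<comment> \<open>Up to 8 r the exponent is bounded by \<open>S_le\<close>. Beyond that, the
          ball radii cost at most half of d, so d \<le> 2 d0 and \<open>S_doubling\<close>
          applies.\<close>
        have "S (\<psi> r) d \<le> A + B0 + B * S (\<psi> r) d0"
        proof (cases "d \<le> 8 * r")
          case True
          then have "S (\<psi> r) d \<le> B0" unfolding B0_def using r d by (intro S_le) auto
          moreover have "0 \<le> B * S (\<psi> r) d0" using B S0 by simp
          ultimately show ?thesis using A by linarith
        next
          case False
          then have "d \<le> 2 * d0" using dx cr by (simp add: d0_def)
          then show ?thesis using dbl[OF r d] B0 by (smt (verit))
        qed
        then have "cu * S (\<psi> r) d \<le> cu * (A + B0 + B * S (\<psi> r) d0)" using cu by (intro mult_left_mono) auto
        moreover have "cu * (B * S (\<psi> r) d0) = c0 * S (\<psi> r) d0" using B by (simp add: cu_def)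
        ultimately have "- c0 * S (\<psi> r) d0 \<le> cu * (A + B0) + - cu * S (\<psi> r) d" unfolding distrib_left by linarith
        then have e: "exp (- c0 * S (\<psi> r) d0) \<le> exp (cu * (A + B0)) * exp (- cu * S (\<psi> r) d)" by (simp only: exp_add[symmetric] exp_le_cancel_iff)
        have Vp: "0 < V \<mu> x' r" "0 < V \<mu> x (c * r)" using r cr by (auto intro: V_pos)
        have dd: "dist x' x \<le> r" using x' cr by (simp add: dist_commute)
        have "V \<mu> x' r \<le> Cv * ((r + dist x' x) / (c * r)) powr \<alpha> * V \<mu> x (c * r)" using cr by (intro doubling_shift) (auto intro: order_trans)
        also have "\<dots> \<le> H * V \<mu> x (c * r)"
          unfolding H_def using dd r cr params Cv alpha Vp
          by (intro mult_right_mono mult_left_mono powr_mono2) (auto simp: field_simps)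
        finally have "C0 / V \<mu> x (c * r) \<le> C0 * H / V \<mu> x' r" using Vp C0 by (simp add: field_simps)
        then have "b \<le> (C0 * H / V \<mu> x' r) * (exp (cu * (A + B0)) * exp (- cu * S (\<psi> r) d))"
          unfolding b_def using e C0 H Vp by (intro mult_mono) auto
        also have "\<dots> = Cu / V \<mu> x' r * exp (- cu * S (\<psi> r) d)" by (simp add: Cu_def)
        finally show ?thesis by (simp add: d_def)
      qed
      have "AE z in \<mu> \<Otimes>\<^sub>M \<mu>. z \<in> ball x (c * r) \<times> ball y (c * r) \<longrightarrow>
        q z \<le> Cu / V \<mu> (fst z) r * exp (- cu * S (\<psi> r) (dist (fst z) (snd z)))"
        using box
      proof eventually_elim
        case (elim z)
        show ?case
        proof
          assume z: "z \<in> ball x (c * r) \<times> ball y (c * r)"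
          then have "b \<le> Cu / V \<mu> (fst z) r * exp (- cu * S (\<psi> r) (dist (fst z) (snd z)))" by (intro bound) auto
          with elim z show "q z \<le> Cu / V \<mu> (fst z) r * exp (- cu * S (\<psi> r) (dist (fst z) (snd z)))" by linarith
        qed
      qed
      then show "\<exists>p>0. AE z in \<mu> \<Otimes>\<^sub>M \<mu>. z \<in> ball x p \<times> ball y p \<longrightarrow>
        q z \<le> Cu / V \<mu> (fst z) r * exp (- cu * S (\<psi> r) (dist (fst z) (snd z)))"
        using cr by blast
    qed
  qed
qed

lemma kernel_lower:
  obtains Cl cl where "Cl > 0" "cl > 0"
    "\<And>r q. 0 < r \<Longrightarrow> ereal r < mm_diam \<mu> \<Longrightarrow> is_kernel (\<psi> r) q \<Longrightarrow>
      AE z in \<mu> \<Otimes>\<^sub>M \<mu>. Cl / V \<mu> (fst z) r * exp (- cl * S (\<psi> r) (dist (fst z) (snd z))) \<le> q z"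
proof -
  obtain Cl cl where Cl: "Cl > 0" and cl: "cl > 0" and low:
    "\<And>r x y. 0 < r \<Longrightarrow> ereal r < mm_diam \<mu> \<Longrightarrow> \<exists>p>0. \<exists>b>0.
      (\<forall>x' y'. x' \<in> ball x p \<longrightarrow> y' \<in> ball y p \<longrightarrow> Cl / V \<mu> x' r * exp (- cl * S (\<psi> r) (dist x' y')) \<le> b) \<and>
      (\<forall>f. f \<in> L2 \<mu> \<longrightarrow> (\<forall>z. 0 \<le> f z) \<longrightarrow> (\<forall>z. z \<notin> ball y p \<longrightarrow> f z = 0) \<longrightarrow>
        (AE z in \<mu>. z \<in> ball x p \<longrightarrow> b * (\<integral>z. f z \<partial>\<mu>) \<le> P (\<psi> r) f z))"
    by (rule semigroup_lower) (rule that)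
  \<comment> \<open>\<open>kernel_box\<close> identifies kernels only between two finite bounds, so
    the lower estimate needs some upper one as well.\<close>
  obtain C0 c0 where "C0 > 0" "c0 > 0" and up:
    "\<And>r z w f. 0 < r \<Longrightarrow> ereal r < mm_diam \<mu> \<Longrightarrow> f \<in> L2 \<mu> \<Longrightarrow> (\<And>y. 0 \<le> f y) \<Longrightarrow> (\<And>y. y \<notin> ball w (c * r) \<Longrightarrow> f y = 0) \<Longrightarrow>
      AE y in \<mu>. y \<in> ball z (c * r) \<longrightarrow>
        P (\<psi> r) f y \<le> C0 / V \<mu> z (c * r) * exp (- c0 * S (\<psi> r) (max 0 (dist z w - 2 * (c * r)))) * (\<integral>y. f y \<partial>\<mu>)"
    using semigroup_upper by blast
  show thesis
  proof (rule that[OF Cl cl])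
    fix r q assume r: "0 < r" "ereal r < mm_diam \<mu>" and q: "is_kernel (\<psi> r) q"
    have pr: "0 < \<psi> r" using r by (intro psi.pos)
    have cr: "0 < c * r" using r params by simp
    show "AE z in \<mu> \<Otimes>\<^sub>M \<mu>. Cl / V \<mu> (fst z) r * exp (- cl * S (\<psi> r) (dist (fst z) (snd z))) \<le> q z"
    proof (rule AE_local_product)
      fix x y :: 'a
      obtain p b where p: "p > 0" and b: "b > 0"
        and bl: "\<And>x' y'. x' \<in> ball x p \<Longrightarrow> y' \<in> ball y p \<Longrightarrow> Cl / V \<mu> x' r * exp (- cl * S (\<psi> r) (dist x' y')) \<le> b"
        and op: "\<And>f. f \<in> L2 \<mu> \<Longrightarrow> (\<forall>z. 0 \<le> f z) \<Longrightarrow> (\<forall>z. z \<notin> ball y p \<longrightarrow> f z = 0) \<Longrightarrow>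
          AE z in \<mu>. z \<in> ball x p \<longrightarrow> b * (\<integral>z. f z \<partial>\<mu>) \<le> P (\<psi> r) f z"
        using low[OF r, of x y] by blast
      define p' where "p' = min p (c * r)"
      have p': "0 < p'" "p' \<le> p" "p' \<le> c * r" using p cr by (auto simp: p'_def)
      have sub: "ball u p' \<subseteq> ball u p" "ball u p' \<subseteq> ball u (c * r)" for u :: 'a using p' by auto
      define U where "U = C0 / V \<mu> x (c * r) * exp (- c0 * S (\<psi> r) (max 0 (dist x y - 2 * (c * r))))"
      have bU: "b < max b U + 1" by simp
      have "AE z in \<mu> \<Otimes>\<^sub>M \<mu>. z \<in> ball x p' \<times> ball y p' \<longrightarrow> b \<le> q z \<and> q z \<le> max b U + 1"
      proof (rule kernel_box[OF pr q _ _ _ _ less_imp_le[OF b] bU])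
        fix f assume f: "f \<in> L2 \<mu>" "\<And>u. 0 \<le> f u" "\<And>u. u \<notin> ball y p' \<Longrightarrow> f u = 0"
        have I0: "0 \<le> (\<integral>u. f u \<partial>\<mu>)" using f by (intro Bochner_Integration.integral_nonneg) auto
        have f1: "f u = 0" if "u \<notin> ball y p" for u using f(3)[of u] sub(1)[of y] that by blast
        have f2: "f u = 0" if "u \<notin> ball y (c * r)" for u using f(3)[of u] sub(2)[of y] that by blast
        have 1: "AE u in \<mu>. u \<in> ball x p \<longrightarrow> b * (\<integral>u. f u \<partial>\<mu>) \<le> P (\<psi> r) f u"
          by (rule op[OF f(1)]) (use f(2) f1 in auto)
        have 2: "AE u in \<mu>. u \<in> ball x (c * r) \<longrightarrow> P (\<psi> r) f u \<le> U * (\<integral>u. f u \<partial>\<mu>)"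
          unfolding U_def by (rule up[OF r f(1,2) f2])
        have le: "U * (\<integral>u. f u \<partial>\<mu>) \<le> (max b U + 1) * (\<integral>u. f u \<partial>\<mu>)" using I0 by (intro mult_right_mono) auto
        from 1 2 show "AE u in \<mu>. u \<in> ball x p' \<longrightarrow> b * (\<integral>u. f u \<partial>\<mu>) \<le> P (\<psi> r) f u \<and> P (\<psi> r) f u \<le> (max b U + 1) * (\<integral>u. f u \<partial>\<mu>)"
        proof eventually_elim
          case (elim u)
          then show ?case using sub[of x] le by (meson order_trans subsetD)
        qed
      qed auto
      then have "AE z in \<mu> \<Otimes>\<^sub>M \<mu>. z \<in> ball x p' \<times> ball y p' \<longrightarrow> Cl / V \<mu> (fst z) r * exp (- cl * S (\<psi> r) (dist (fst z) (snd z))) \<le> q z"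
      proof eventually_elim
        case (elim z)
        show ?case
        proof
          assume z: "z \<in> ball x p' \<times> ball y p'"
          have "Cl / V \<mu> (fst z) r * exp (- cl * S (\<psi> r) (dist (fst z) (snd z))) \<le> b"
            by (rule bl) (use z p'(2) in auto)
          with elim z show "Cl / V \<mu> (fst z) r * exp (- cl * S (\<psi> r) (dist (fst z) (snd z))) \<le> q z" by linarith
        qed
      qed
      then show "\<exists>p>0. AE z in \<mu> \<Otimes>\<^sub>M \<mu>. z \<in> ball x p \<times> ball y p \<longrightarrow>
        Cl / V \<mu> (fst z) r * exp (- cl * S (\<psi> r) (dist (fst z) (snd z))) \<le> q z"
        using p' by blast
    qed
  qed
qed

text \<open>S is monotone in the distance, hence Borel, although it is an uncountable
  supremum.\<close>

lemma kernel_bound_measurable: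
  assumes "0 < r" "ereal r < mm_diam \<mu>"
  shows "(\<lambda>z. a / V \<mu> (fst z) r * exp (- b * S (\<psi> r) (dist (fst z) (snd z)))) \<in> borel_measurable (\<mu> \<Otimes>\<^sub>M \<mu>)"
proof -
  have "mono (\<lambda>d. S (\<psi> r) (max 0 d))" using S_mono[OF assms] by (intro monoI) auto
  then have "(\<lambda>d. S (\<psi> r) (max 0 d)) \<in> borel_measurable borel" by (rule borel_measurable_mono)
  from measurable_compose[OF dist_measurable this]
  have [measurable]: "(\<lambda>z :: 'a \<times> 'a. S (\<psi> r) (dist (fst z) (snd z))) \<in> borel_measurable (\<mu> \<Otimes>\<^sub>M \<mu>)" by simp
  have [measurable]: "(\<lambda>z :: 'a \<times> 'a. V \<mu> (fst z) r) \<in> borel_measurable (\<mu> \<Otimes>\<^sub>M \<mu>)"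
    by (rule measurable_compose[OF measurable_fst V_measurable])
  show ?thesis by measurable
qed

text \<open>The two-sided bounds hold almost everywhere for any kernel, and truncating it between them
  makes them hold everywhere.\<close>
lemma pointwise_heat_kernel_bounds:
  "\<exists>p. heat_kernel \<mu> P p \<and> (\<exists>C c1 c2. C \<ge> 1 \<and> c1 > 0 \<and> c2 > 0 \<and>
      (\<forall>x y t. 0 < t \<and> ereal t < phi_bar \<psi> (mm_diam \<mu>) \<longrightarrow>
         inverse C / V \<mu> x (scale_inv \<psi> t) * exp_neg c1 (Phi_exp \<rho> \<psi> t (dist x y)) \<le> p t x y \<and>
         p t x y \<le> C / V \<mu> x (scale_inv \<psi> t) * exp_neg c2 (Phi_exp \<rho> \<psi> t (dist x y))))"
proof -
  interpret pair_sigma_finite \<mu> \<mu> by unfold_locales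
  obtain Cu cu where Cu: "Cu > 0" and cu: "cu > 0" and up:
    "\<And>r q. 0 < r \<Longrightarrow> ereal r < mm_diam \<mu> \<Longrightarrow> is_kernel (\<psi> r) q \<Longrightarrow>
      AE z in \<mu> \<Otimes>\<^sub>M \<mu>. q z \<le> Cu / V \<mu> (fst z) r * exp (- cu * S (\<psi> r) (dist (fst z) (snd z)))"
    using kernel_upper by blast
  obtain Cl cl where Cl: "Cl > 0" and cl: "cl > 0" and low:
    "\<And>r q. 0 < r \<Longrightarrow> ereal r < mm_diam \<mu> \<Longrightarrow> is_kernel (\<psi> r) q \<Longrightarrow>
      AE z in \<mu> \<Otimes>\<^sub>M \<mu>. Cl / V \<mu> (fst z) r * exp (- cl * S (\<psi> r) (dist (fst z) (snd z))) \<le> q z"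
    using kernel_lower by blast
  define C' where "C' = max 1 (max Cu (inverse Cl))"
  have C': "C' \<ge> 1" "Cu \<le> C'" "inverse Cl \<le> C'" by (auto simp: C'_def)
  have iC': "inverse C' \<le> Cl" using C' Cl by (metis inverse_inverse_eq inverse_le_iff_le inverse_positive_iff_positive less_le_trans zero_less_one)
  have iC1: "inverse C' \<le> C'" using C'(1) by (simp add: inverse_le_1_iff order_trans[of _ 1])
  \<comment> \<open>The minimum guarantees that the lower envelope L stays below the upper envelope
    U, so that truncating between them is consistent.\<close>
  define c2 where "c2 = min cu cl"
  have c2: "c2 > 0" "c2 \<le> cu" "c2 \<le> cl" using cu cl by (auto simp: c2_def)
  define L where "L r z = inverse C' / V \<mu> (fst z) r * exp (- cl * S (\<psi> r) (dist (fst z) (snd z)))" for r and z :: "'a \<times> 'a"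
  define U where "U r z = C' / V \<mu> (fst z) r * exp (- c2 * S (\<psi> r) (dist (fst z) (snd z)))" for r and z :: "'a \<times> 'a"
  have LU: "0 \<le> L r z" "L r z \<le> U r z"
    and L_le: "L r z \<le> Cl / V \<mu> (fst z) r * exp (- cl * S (\<psi> r) (dist (fst z) (snd z)))"
    and U_ge: "Cu / V \<mu> (fst z) r * exp (- cu * S (\<psi> r) (dist (fst z) (snd z))) \<le> U r z"
    if r: "0 < r" "ereal r < mm_diam \<mu>" for r z
  proof -
    have Vp: "0 < V \<mu> (fst z) r" using r by (intro V_pos)
    have S0: "0 \<le> S (\<psi> r) (dist (fst z) (snd z))" using S_nonneg[OF r] by simp
    show "0 \<le> L r z" using Vp C' by (simp add: L_def)
    show "L r z \<le> U r z"
      unfolding L_def U_def using Vp S0 C' iC1 c2 by (intro mult_mono divide_right_mono) (auto intro: mult_right_mono)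
    show "L r z \<le> Cl / V \<mu> (fst z) r * exp (- cl * S (\<psi> r) (dist (fst z) (snd z)))"
      unfolding L_def using Vp iC' by (intro mult_right_mono divide_right_mono) auto
    show "Cu / V \<mu> (fst z) r * exp (- cu * S (\<psi> r) (dist (fst z) (snd z))) \<le> U r z"
      unfolding U_def using Vp S0 C' c2 Cu by (intro mult_mono divide_right_mono) (auto intro: mult_right_mono)
  qed
  define Q where "Q t = (SOME q. is_kernel t q)" for t
  have Q: "is_kernel t (Q t)" if t: "0 < t" for t
  proof -
    obtain q where "is_kernel t q" using kernel_exists[OF t] .
    then show ?thesis unfolding Q_def by (rule someI[where P = "is_kernel t"])
  qed
  define p where "p t x y = (if 0 < t \<and> ereal t < phi_bar \<psi> (mm_diam \<mu>)
    then max (L (scale_inv \<psi> t) (x, y)) (min (U (scale_inv \<psi> t) (x, y)) (Q t (x, y))) else Q t (x, y))" for t x y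
  have inv: "0 < scale_inv \<psi> t" "ereal (scale_inv \<psi> t) < mm_diam \<mu>" "\<psi> (scale_inv \<psi> t) = t"
    if "0 < t" "ereal t < phi_bar \<psi> (mm_diam \<mu>)" for t
    using psi.inv_pos[OF that(1)] psi.phi_bar_inv[OF that] diam_pos by auto
  have pm: "(\<lambda>(x, y). p t x y) \<in> borel_measurable (\<mu> \<Otimes>\<^sub>M \<mu>)" if t: "0 < t" for t
  proof -
    have [measurable]: "Q t \<in> borel_measurable (\<mu> \<Otimes>\<^sub>M \<mu>)" using Q[OF t] by (simp add: is_kernel_def)
    show ?thesis
    proof (cases "ereal t < phi_bar \<psi> (mm_diam \<mu>)")
      case True
      let ?r = "scale_inv \<psi> t"
      have [measurable]: "L ?r \<in> borel_measurable (\<mu> \<Otimes>\<^sub>M \<mu>)" "U ?r \<in> borel_measurable (\<mu> \<Otimes>\<^sub>M \<mu>)"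
        unfolding L_def U_def by (rule kernel_bound_measurable[OF inv(1,2)[OF t True]])+
      have "(\<lambda>(x, y). p t x y) = (\<lambda>z. max (L ?r z) (min (U ?r z) (Q t z)))" using t True by (auto simp: p_def)
      then show ?thesis by simp
    next
      case False
      then have "(\<lambda>(x, y). p t x y) = Q t" by (auto simp: p_def)
      then show ?thesis by simp
    qed
  qed
  have p0: "0 \<le> p t x y" if t: "0 < t" for t x y
    using Q[OF t] LU(1)[OF inv(1,2)[OF t]] by (auto simp: p_def is_kernel_def le_max_iff_disj)
  have pQ: "AE z in \<mu> \<Otimes>\<^sub>M \<mu>. p t (fst z) (snd z) = Q t z" if t: "0 < t" for t
  proof (cases "ereal t < phi_bar \<psi> (mm_diam \<mu>)")
    case True
    let ?r = "scale_inv \<psi> t"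
    note r = inv[OF t True]
    have k: "is_kernel (\<psi> ?r) (Q t)" using Q[OF t] r(3) by simp
    from up[OF r(1,2) k] low[OF r(1,2) k] show ?thesis
    proof eventually_elim
      case (elim z)
      have "L ?r z \<le> Q t z" "Q t z \<le> U ?r z" using elim L_le[OF r(1,2), of z] U_ge[OF r(1,2), of z] by linarith+
      then show ?case by (simp add: p_def)
    qed
  qed (simp add: p_def)
  have "heat_kernel \<mu> P p"
    unfolding heat_kernel_def
  proof (intro allI impI conjI ballI)
    fix t :: real assume t: "0 < t"
    show "(\<lambda>(x, y). p t x y) \<in> borel_measurable (\<mu> \<Otimes>\<^sub>M \<mu>)" by (rule pm[OF t])
    have px [measurable]: "(\<lambda>y. p t x y) \<in> borel_measurable \<mu>" for x
      using measurable_compose[OF measurable_Pair1' pm[OF t], of x] by simp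
    \<comment> \<open>By Fubini, for almost every x the truncated kernel and the original one agree
      for almost every y, so they define the same integrals.\<close>
    have eq: "AE x in \<mu>. AE y in \<mu>. p t x y = Q t (x, y)" using AE_pair[OF pQ[OF t]] by simp
    have pos: "AE x in \<mu>. has_bochner_integral \<mu> (\<lambda>y. p t x y * f y) (P t f x)"
      if f: "f \<in> L2 \<mu>" "\<And>x. 0 \<le> f x" for f
    proof -
      have [measurable]: "f \<in> borel_measurable \<mu>" using f by (intro L2_measurable)
      have 1: "AE x in \<mu>. ennreal (P t f x) = (\<integral>\<^sup>+y. ennreal (Q t (x, y) * f y) \<partial>\<mu>)" using Q[OF t] f by (auto simp: is_kernel_def)
      have 2: "AE x in \<mu>. 0 \<le> P t f x" using f by (intro P_nonneg[OF f(1) _ t]) auto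
      from 1 2 eq show ?thesis
      proof eventually_elim
        case (elim x)
        have "(\<integral>\<^sup>+y. ennreal (p t x y * f y) \<partial>\<mu>) = (\<integral>\<^sup>+y. ennreal (Q t (x, y) * f y) \<partial>\<mu>)"
          by (rule nn_integral_cong_AE) (use elim(3) in eventually_elim, simp)
        then show ?case using elim(1,2) p0[OF t] f(2) by (intro has_bochner_integral_nn_integral) auto
      qed
    qed
    fix f assume f: "f \<in> L2 \<mu>"
    define f1 where "f1 x = max 0 (f x)" for x
    define f2 where "f2 x = max 0 (- f x)" for x
    have [measurable]: "f \<in> borel_measurable \<mu>" using f by (intro L2_measurable)
    have fL: "f1 \<in> L2 \<mu>" "f2 \<in> L2 \<mu>" unfolding f1_def f2_def by (auto intro!: L2_bound[OF f])
    have f12: "f = (\<lambda>x. f1 x - f2 x)" by (auto simp: f1_def f2_def fun_eq_iff max_def)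
    have 1: "AE x in \<mu>. has_bochner_integral \<mu> (\<lambda>y. p t x y * f1 y) (P t f1 x)" by (rule pos[OF fL(1)]) (simp add: f1_def)
    have 2: "AE x in \<mu>. has_bochner_integral \<mu> (\<lambda>y. p t x y * f2 y) (P t f2 x)" by (rule pos[OF fL(2)]) (simp add: f2_def)
    have 3: "AE x in \<mu>. P t f x = P t f1 x - P t f2 x" using P_diff[OF fL t] by (simp only: f12[symmetric])
    from 1 2 3 show "AE x in \<mu>. integrable \<mu> (\<lambda>y. p t x y * f y) \<and> P t f x = (\<integral>y. p t x y * f y \<partial>\<mu>)"
    proof eventually_elim
      case (elim x)
      have "(\<lambda>y. p t x y * f y) = (\<lambda>y. p t x y * f1 y - p t x y * f2 y)"
        by (subst f12) (simp add: right_diff_distrib fun_eq_iff)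
      with has_bochner_integral_diff[OF elim(1,2)]
      have "has_bochner_integral \<mu> (\<lambda>y. p t x y * f y) (P t f x)" unfolding elim(3) by simp
      then show ?case by (simp add: has_bochner_integral_iff)
    qed
  qed
  moreover have "inverse C' / V \<mu> x (scale_inv \<psi> t) * exp_neg cl (Phi_exp \<rho> \<psi> t (dist x y)) \<le> p t x y \<and>
      p t x y \<le> C' / V \<mu> x (scale_inv \<psi> t) * exp_neg c2 (Phi_exp \<rho> \<psi> t (dist x y))"
    if t: "0 < t" "ereal t < phi_bar \<psi> (mm_diam \<mu>)" for x y t
  proof -
    let ?r = "scale_inv \<psi> t"
    note r = inv[OF t]
    have "Phi_exp \<rho> \<psi> t (dist x y) = ereal (S (\<psi> ?r) (dist x y))"
      using Phi_exp_eq[OF r(1,2), of "dist x y"] unfolding r(3) by simp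
    then have "inverse C' / V \<mu> x ?r * exp_neg cl (Phi_exp \<rho> \<psi> t (dist x y)) = L ?r (x, y)"
      "C' / V \<mu> x ?r * exp_neg c2 (Phi_exp \<rho> \<psi> t (dist x y)) = U ?r (x, y)"
      by (simp_all add: exp_neg_def L_def U_def)
    then show ?thesis using t LU(2)[OF r(1,2), of "(x, y)"] by (simp add: p_def)
  qed
  ultimately show ?thesis using C'(1) cl c2(1) by blast
qed

end

theorem theorem1p1:
  fixes \<mu> :: "'a::heine_borel measure"
    and \<rho> \<psi> :: "real \<Rightarrow> real"
    and E :: "('a \<Rightarrow> real) \<Rightarrow> ('a \<Rightarrow> real) \<Rightarrow> real"
    and F :: "('a \<Rightarrow> real) set"
    and P :: "real \<Rightarrow> ('a \<Rightarrow> real) \<Rightarrow> ('a \<Rightarrow> real)"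
  assumes "mm_space \<mu>" and "VD \<mu>" and "RVD \<mu>"
    and "\<exists>C \<beta>1 \<beta>2. scale_function_with \<rho> C \<beta>1 \<beta>2 \<and> \<beta>1 \<ge> 1"
    and "chain_condition \<rho> TYPE('a)"
    and "regular_dirichlet_form \<mu> E F" and "strongly_local E F"
    and "scale_function \<psi>" and "PHI \<mu> E F \<psi>"
    and "heat_semigroup \<mu> E F P"
  shows "\<exists>p. heat_kernel \<mu> P p \<and>
    (\<exists>C c1 c2. C \<ge> 1 \<and> c1 > 0 \<and> c2 > 0 \<and>
      (\<forall>x y t. 0 < t \<and> ereal t < phi_bar \<psi> (mm_diam \<mu>) \<longrightarrow>
         inverse C / V \<mu> x (scale_inv \<psi> t) * exp_neg c1 (Phi_exp \<rho> \<psi> t (dist x y)) \<le> p t x y \<and>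
         p t x y \<le> C / V \<mu> x (scale_inv \<psi> t) * exp_neg c2 (Phi_exp \<rho> \<psi> t (dist x y))))"
proof -
  obtain K\<rho> \<gamma> \<gamma>' where rho: "scale_function_with \<rho> K\<rho> \<gamma> \<gamma>'" using assms(4) by blast
  obtain K \<beta> \<beta>' where psi: "scale_function_with \<psi> K \<beta> \<beta>'" using assms(8) unfolding scale_function_def by blast
  obtain Cv \<alpha> where Cv: "Cv \<ge> 1" "\<alpha> > 0" "\<And>x r R. 0 < r \<Longrightarrow> r < R \<Longrightarrow> V \<mu> x R / V \<mu> x r \<le> Cv * (R / r) powr \<alpha>"
    using assms(2) unfolding VD_def by blast
  obtain \<kappa> where kappa: "\<kappa> \<ge> 1"
    "\<And>e (x::'a) z j. e > 0 \<Longrightarrow> j \<ge> 1 \<Longrightarrow> z \<in> nbh e {x} j \<Longrightarrow> \<rho> (dist x z) \<le> \<kappa> * real j * \<rho> e"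
    "\<And>e (x::'a) z j. e > 0 \<Longrightarrow> \<kappa> * (\<rho> (dist x z) / \<rho> e + 1) \<le> real j \<Longrightarrow> z \<in> nbh e {x} j"
    using chain_condition_nbh[OF rho assms(5)] by blast
  obtain C1 C2 C3 C4 C c where C: "0 < C1" "C1 < C2" "C2 < C3" "C3 < C4" "C \<ge> 1" "0 < c" "c < 1"
    and phi: "\<And>t x u. 0 < t \<and> ereal t < ereal (min (inverse C4) 1) * phi_bar \<psi> (mm_diam \<mu>) \<and>
        (\<forall>s y. u s y \<ge> 0) \<and> caloric \<mu> E F u t (ball x (scale_inv \<psi> t)) \<Longrightarrow>
        (SUP s\<in>{C1 * t<..C2 * t}. esssup_on \<mu> (ball x (c * scale_inv \<psi> t)) (u s))
          \<le> ereal C * (INF s\<in>{C3 * t<..C4 * t}. essinf_on \<mu> (ball x (c * scale_inv \<psi> t)) (u s))"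
    using assms(9) unfolding PHI_def by blast
  have form: "dirichlet_form \<mu> E F" using assms(6) by (simp add: regular_dirichlet_form_def)
  interpret heat_kernel_setting \<mu> E F P \<psi> K \<beta> \<beta>' C1 C2 C3 C4 C c \<rho> K\<rho> \<gamma> \<gamma>' \<kappa> Cv \<alpha>
    by unfold_locales (use assms form C phi psi rho kappa Cv in \<open>assumption | blast\<close>)+
  \<comment> \<open>The scale comparison and the near-diagonal bound are consequences of the setting
    just interpreted; fixing their constants provides the parameters of the last one.\<close>
  obtain G where G: "G \<ge> 1" "\<And>e R. 0 < e \<Longrightarrow> e \<le> R \<Longrightarrow> ereal R < mm_diam \<mu> \<Longrightarrow> (\<rho> R / \<rho> e)\<^sup>2 \<le> G * (\<psi> R / \<psi> e)"
    using scale_gain by blast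
  obtain q k where q: "0 < q" "q < 1" "0 < k" and ndl:
    "\<And>x r f. 0 < r \<Longrightarrow> ereal r < mm_diam \<mu> \<Longrightarrow> f \<in> L2 \<mu> \<Longrightarrow> (\<And>y. 0 \<le> f y) \<Longrightarrow> (\<And>y. y \<notin> ball x (q * r) \<Longrightarrow> f y = 0) \<Longrightarrow>
       AE y in \<mu>. y \<in> ball x (q * r) \<longrightarrow> k / V \<mu> x r * (\<integral>z. f z \<partial>\<mu>) \<le> P (\<psi> r) f y"
    using near_diagonal by blast
  interpret scale_comparison \<mu> E F P \<psi> K \<beta> \<beta>' C1 C2 C3 C4 C c \<rho> K\<rho> \<gamma> \<gamma>' \<kappa> Cv \<alpha> G q k
    by unfold_locales (use G q ndl in \<open>assumption | blast\<close>)+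
  show ?thesis by (rule pointwise_heat_kernel_bounds)
qed

end
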